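(* Let $M$ be a compact smooth $n$-manifold, $e\in\mathbb{R}$ and $q\in(1,\infty)$. Let $\Lambda=\{(U_\alpha,\varphi_\alpha,\psi_\alpha)\}_{1\le\alpha\le N}$ and $\Upsilon=\{(\tilde U_\beta,\tilde\varphi_\beta,\tilde\psi_\beta)\}_{1\le\beta\le\tilde N}$ be two augmented total trivialization atlases for the trivial bundle $M\times\mathbb{R}\to M$. Let $\mathcal{W}$ be any vector subspace of $W^{e,q}(M;\Upsilon)$ whose elements are regular distributions (for example $\mathcal{W}=C^\infty(M)$). 1. If $e$ is not a noninteger less than $-1$, then $\mathcal{W}$ is a subspace of $W^{e,q}(M;\Lambda)$ as well, and the norms $\|\cdot\|_{W^{e,q}(M;\Lambda)}$ and $\|\cdot\|_{W^{e,q}(M;\Upsilon)}$ are equivalent on $\mathcal{W}$. 2. If $e$ is a noninteger less than $-1$, assume further that the total trivialization atlases corresponding to $\Lambda$ and $\Upsilon$ are GL compatible (GLC). Then $\mathcal{W}$ is a subspace of $W^{e,q}(M;\Lambda)$ as well, and the norms $\|\cdot\|_{W^{e,q}(M;\Lambda)}$ and $\|\cdot\|_{W^{e,q}(M;\Upsilon)}$ are equivalent on $\mathcal{W}$.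
   Context: Manifolds are smooth, Hausdorff and second countable. For the trivial bundle $M\times\mathbb{R}$ an augmented total trivialization atlas is a finite collection $\{(U_\alpha,\varphi_\alpha,\psi_\alpha)\}_{1\le\alpha\le N}$ where $\{(U_\alpha,\varphi_\alpha)\}$ is a smooth atlas of $M$ and $\{\psi_\alpha\}$ is a smooth nonnegative partition of unity with $\mathrm{supp}\,\psi_\alpha\subseteq U_\alpha$ (the fibre trivializations are the identity). Euclidean spaces. Let $\Omega\subseteq\mathbb{R}^n$ be nonempty open, $1<p<\infty$. For $k\in\mathbb{N}_0$, $\|u\|_{W^{k,p}(\Omega)}=\sum_{|\nu|\le k}\|\partial^\nu u\|_{L^p(\Omega)}$; for $s=k+\theta$, $\theta\in(0,1)$, $\|u\|_{W^{s,p}(\Omega)}=\|u\|_{W^{k,p}(\Omega)}+\sum_{|\nu|=k}\big(\iint_{\Omega\times\Omega}\frac{|\partial^\nu u(x)-\partial^\nu u(y)|^p}{|x-y|^{n+\theta p}}dx\,dy\big)^{1/p}$; $W^{s,p}(\Omega)$ is the set of $u\in L^p(\Omega)$ with finite norm. For $s\ge0$, $W^{s,p}_0(\Omega)$ is the closure of $C_c^\infty(\Omega)$ in $W^{s,p}(\Omega)$. For $s<0$, $W^{s,p}(\Omega)=(W_0^{-s,p'}(\Omega))^*$, $1/p+1/p'=1$, viewed as a subspace of $D'(\Omega)$ by restriction to $C_c^\infty(\Omega)$. Distributions on $M$. Let $\mathcal{D}$ be the (1-)density bundle of $M$ (compactly supported continuous sections of $\mathcal{D}$ can be integrated over $M$).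 $D'(M)$ is the topological dual of the space of smooth sections of $\mathrm{Hom}(M\times\mathbb{R},\mathcal{D})\cong\mathcal{D}$ with its usual Fréchet topology. A distribution $u$ is regular if it is given by $\eta\mapsto\int_M f\eta$ for some function $f$ on $M$ (for which this is well defined and continuous). For $u\in D'(M)$ and a chart $(U_\alpha,\varphi_\alpha=(x^i))$, the local representation $H_\alpha(u)\in D'(\varphi_\alpha(U_\alpha))$ is $\xi\mapsto\langle u,(\xi\circ\varphi_\alpha)|dx^1\wedge\cdots\wedge dx^n|\rangle$; if $u$ is regular given by $f$, then $H_\alpha(u)=f\circ\varphi_\alpha^{-1}$. Sobolev spaces. $W^{e,q}(M;\Lambda)=\{u\in D'(M):\|u\|_{W^{e,q}(M;\Lambda)}:=\sum_{\alpha=1}^N\|H_\alpha(\psi_\alpha u)\|_{W^{e,q}(\varphi_\alpha(U_\alpha))}<\infty\}$; for regular $u$ the summands are $\|(\psi_\alpha u)\circ\varphi_\alpha^{-1}\|_{W^{e,q}(\varphi_\alpha(U_\alpha))}$. GL compatibility. A smooth atlas is GGL (generalized geometrically Lipschitz) if the image of each coordinate domain under its coordinate map is either $\mathbb{R}^n$ or a nonempty bounded open set with Lipschitz boundary. Two atlases $\{(U_\alpha,\varphi_\alpha)\}$, $\{(\tilde U_\beta,\tilde\varphi_\beta)\}$ are GL compatible (GLC) if each is GGL and whenever $U_\alpha\cap\tilde U_\beta\ne\emptyset$, each of $\varphi_\alpha(U_\alpha\cap\tilde U_\beta)$ and $\tilde\varphi_\beta(U_\alpha\cap\tilde U_\beta)$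 is a nonempty bounded open set with Lipschitz boundary or all of $\mathbb{R}^n$. Total trivialization atlases are GLC if their underlying smooth atlases are. Two norms are equivalent if each is bounded by a constant times the other, the constants possibly depending on $n,e,q$ and the charts and partitions of unity. *)

theory Defs
  imports "HOL-Analysis.Analysis"
begin

section \<open>Partial derivatives, smooth functions, test functions\<close>

definition partial :: "'n \<Rightarrow> (real^'n::finite \<Rightarrow> 'b::real_normed_vector) \<Rightarrow> real^'n \<Rightarrow> 'b"
  where "partial i f = (\<lambda>x. frechet_derivative f (at x) (axis i 1))"

definition partials :: "'n list \<Rightarrow> (real^'n::finite \<Rightarrow> 'b::real_normed_vector) \<Rightarrow> real^'n \<Rightarrow> 'b"
  where "partials is f = foldr partial is f"

text \<open>Meant for open \<open>S\<close>: all iterated partial derivatives exist and are differentiable.\<close>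
definition smooth_on :: "(real^'n::finite) set \<Rightarrow> (real^'n \<Rightarrow> 'b::real_normed_vector) \<Rightarrow> bool"
  where "smooth_on S f \<longleftrightarrow> (\<forall>is. \<forall>x\<in>S. partials is f differentiable (at x))"

definition mi_order :: "('n::finite \<Rightarrow> nat) \<Rightarrow> nat"
  where "mi_order \<nu> = (\<Sum>i\<in>UNIV. \<nu> i)"

text \<open>The sums over multi-indices below range over finite sets.\<close>
lemma finite_mi_order_le: "finite {\<nu> :: 'n::finite \<Rightarrow> nat. mi_order \<nu> \<le> k}"
proof (rule finite_subset)
  show "{\<nu> :: 'n \<Rightarrow> nat. mi_order \<nu> \<le> k} \<subseteq> Pi\<^sub>E UNIV (\<lambda>_. {..k})"
  proof
    fix \<nu> :: "'n \<Rightarrow> nat" assume "\<nu> \<in> {\<nu>. mi_order \<nu> \<le> k}"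
    then have le: "(\<Sum>i\<in>UNIV. \<nu> i) \<le> k" by (simp add: mi_order_def)
    have "\<nu> i \<le> (\<Sum>i\<in>UNIV. \<nu> i)" for i by (rule member_le_sum) auto
    then show "\<nu> \<in> Pi\<^sub>E UNIV (\<lambda>_. {..k})" using le by (auto intro: order_trans)
  qed
  show "finite (Pi\<^sub>E (UNIV :: 'n set) (\<lambda>_. {..k}))" by (simp add: finite_PiE)
qed

text \<open>
  The derivative of multi-index \<open>\<nu>\<close>. The index type carries no order, so an enumeration of the
  differentiations is chosen; it is applied only to smooth functions, where partial derivatives
  commute.
\<close>
definition mi_deriv :: "('n \<Rightarrow> nat) \<Rightarrow> (real^'n::finite \<Rightarrow> real) \<Rightarrow> real^'n \<Rightarrow> real"
  where "mi_deriv \<nu> f = partials (SOME is. \<forall>i. count_list is i = \<nu> i) f"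

definition test_functions :: "(real^'n::finite) set \<Rightarrow> (real^'n \<Rightarrow> real) set"
  where "test_functions \<Omega> = {\<xi>. smooth_on UNIV \<xi> \<and>
    compact (closure {x. \<xi> x \<noteq> 0}) \<and> closure {x. \<xi> x \<noteq> 0} \<subseteq> \<Omega>}"

section \<open>Sobolev spaces on open subsets of Euclidean space\<close>

definition ennreal_root :: "real \<Rightarrow> ennreal \<Rightarrow> ennreal"
  where "ennreal_root p I = (if I = \<infinity> then \<infinity> else ennreal (enn2real I powr (1 / p)))"

definition Lp_norm :: "(real^'n::finite) set \<Rightarrow> real \<Rightarrow> (real^'n \<Rightarrow> real) \<Rightarrow> ennreal"
  where "Lp_norm \<Omega> p f = ennreal_root p (\<integral>\<^sup>+ x. ennreal (\<bar>f x\<bar> powr p) \<partial>lebesgue_on \<Omega>)"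

definition gagliardo_seminorm ::
    "(real^'n::finite) set \<Rightarrow> real \<Rightarrow> real \<Rightarrow> (real^'n \<Rightarrow> real) \<Rightarrow> ennreal"
  where "gagliardo_seminorm \<Omega> \<theta> p f = ennreal_root p
    (\<integral>\<^sup>+ (x, y). ennreal (\<bar>f x - f y\<bar> powr p / norm (x - y) powr (real CARD('n) + \<theta> * p))
      \<partial>(lebesgue_on \<Omega> \<Otimes>\<^sub>M lebesgue_on \<Omega>))"

definition locally_integrable :: "(real^'n::finite) set \<Rightarrow> (real^'n \<Rightarrow> real) \<Rightarrow> bool"
  where "locally_integrable \<Omega> f \<longleftrightarrow>
    (\<forall>K. compact K \<and> K \<subseteq> \<Omega> \<longrightarrow> integrable (lebesgue_on K) f)"

definition is_weak_deriv ::
    "(real^'n::finite) set \<Rightarrow> ('n \<Rightarrow> nat) \<Rightarrow> (real^'n \<Rightarrow> real) \<Rightarrow> (real^'n \<Rightarrow> real) \<Rightarrow> bool"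
  where "is_weak_deriv \<Omega> \<nu> f g \<longleftrightarrow> locally_integrable \<Omega> f \<and> locally_integrable \<Omega> g \<and>
    (\<forall>\<xi>\<in>test_functions \<Omega>. (LINT x|lebesgue_on \<Omega>. f x * mi_deriv \<nu> \<xi> x)
        = (- 1) ^ mi_order \<nu> * (LINT x|lebesgue_on \<Omega>. g x * \<xi> x))"

text \<open>
  The norm of \<open>W\<^sup>s\<^sup>,\<^sup>p(\<Omega>)\<close> for \<open>s \<ge> 0\<close> on functions, with value \<open>\<infinity>\<close> off the space. Weak derivatives
  are unique up to null sets, so each infimum is the norm of the weak derivative, or \<open>\<infinity>\<close> if there
  is none. For \<open>\<nu> = 0\<close> the summand is the \<open>L\<^sup>p\<close> norm of \<open>f\<close> itself.
\<close>
definition sobolev_fun_norm ::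
    "(real^'n::finite) set \<Rightarrow> real \<Rightarrow> real \<Rightarrow> (real^'n \<Rightarrow> real) \<Rightarrow> ennreal"
  where "sobolev_fun_norm \<Omega> s p f = (let k = nat \<lfloor>s\<rfloor>; \<theta> = frac s in
    (\<Sum>\<nu> | mi_order \<nu> \<le> k. Inf {Lp_norm \<Omega> p g | g. is_weak_deriv \<Omega> \<nu> f g}) +
    (if \<theta> = 0 then 0
     else (\<Sum>\<nu> | mi_order \<nu> = k. Inf {gagliardo_seminorm \<Omega> \<theta> p g | g. is_weak_deriv \<Omega> \<nu> f g})))"

text \<open>\<open>W\<^sub>0\<^sup>s\<^sup>,\<^sup>p(\<Omega>)\<close>, as a set of functions that are not identified almost everywhere.\<close>
definition sobolev_zero ::
    "(real^'n::finite) set \<Rightarrow> real \<Rightarrow> real \<Rightarrow> (real^'n \<Rightarrow> real) set"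
  where "sobolev_zero \<Omega> s p = {f. sobolev_fun_norm \<Omega> s p f < \<infinity> \<and>
    (\<forall>\<epsilon>>0. \<exists>\<xi>\<in>test_functions \<Omega>. sobolev_fun_norm \<Omega> s p (\<lambda>x. f x - \<xi> x) < ennreal \<epsilon>)}"

definition linear_functional_on :: "('a \<Rightarrow> real) set \<Rightarrow> (('a \<Rightarrow> real) \<Rightarrow> real) \<Rightarrow> bool"
  where "linear_functional_on V F \<longleftrightarrow>
    (\<forall>f\<in>V. \<forall>g\<in>V. F (\<lambda>x. f x + g x) = F f + F g) \<and>
    (\<forall>a. \<forall>f\<in>V. F (\<lambda>x. a * f x) = a * F f)"

definition sobolev_dual_norm ::
    "(real^'n::finite) set \<Rightarrow> real \<Rightarrow> real \<Rightarrow> ((real^'n \<Rightarrow> real) \<Rightarrow> real) \<Rightarrow> ennreal"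
  where "sobolev_dual_norm \<Omega> s p F =
    (SUP f\<in>{f \<in> sobolev_zero \<Omega> s p. sobolev_fun_norm \<Omega> s p f \<le> 1}. ennreal \<bar>F f\<bar>)"

text \<open>
  The norm of \<open>W\<^sup>s\<^sup>,\<^sup>p(\<Omega>)\<close>, \<open>s\<close> real, on distributions, with value \<open>\<infinity>\<close> off the space. For \<open>s \<ge> 0\<close>,
  \<open>T\<close> must be given by a function \<open>f\<close> (unique up to null sets). For \<open>s < 0\<close>, \<open>T\<close> must be the
  restriction to the test functions of a bounded linear functional \<open>F\<close> on \<open>W\<^sub>0\<^sup>-\<^sup>s\<^sup>,\<^sup>p\<^sup>'(\<Omega>)\<close> with
  \<open>p' = p / (p - 1)\<close>; \<open>F\<close> is unique there by density.
\<close>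
definition sobolev_norm ::
    "(real^'n::finite) set \<Rightarrow> real \<Rightarrow> real \<Rightarrow> ((real^'n \<Rightarrow> real) \<Rightarrow> real) \<Rightarrow> ennreal"
  where "sobolev_norm \<Omega> s p T =
    (if s \<ge> 0
     then Inf {sobolev_fun_norm \<Omega> s p f | f. locally_integrable \<Omega> f \<and>
            (\<forall>\<xi>\<in>test_functions \<Omega>. T \<xi> = (LINT x|lebesgue_on \<Omega>. f x * \<xi> x))}
     else Inf {sobolev_dual_norm \<Omega> (- s) (p / (p - 1)) F | F.
            linear_functional_on (sobolev_zero \<Omega> (- s) (p / (p - 1))) F \<and>
            (\<forall>\<xi>\<in>test_functions \<Omega>. F \<xi> = T \<xi>)})"

section \<open>Smooth manifolds\<close>

text \<open>A coordinate domain with a map; values of the map off the domain are irrelevant.\<close>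
type_synonym ('m, 'n) chart = "'m set \<times> ('m \<Rightarrow> real^'n)"

definition chart_image :: "('m, 'n::finite) chart \<Rightarrow> (real^'n) set"
  where "chart_image c = snd c ` fst c"

definition chart_inv :: "('m, 'n::finite) chart \<Rightarrow> real^'n \<Rightarrow> 'm"
  where "chart_inv c = inv_into (fst c) (snd c)"

definition is_chart :: "'m topology \<Rightarrow> ('m, 'n::finite) chart \<Rightarrow> bool"
  where "is_chart M c \<longleftrightarrow> openin M (fst c) \<and> fst c \<noteq> {} \<and> open (chart_image c) \<and>
    homeomorphic_map (subtopology M (fst c)) (top_of_set (chart_image c)) (snd c)"

definition transition :: "('m, 'n::finite) chart \<Rightarrow> ('m, 'n) chart \<Rightarrow> real^'n \<Rightarrow> real^'n"
  where "transition c d = (\<lambda>y. snd d (chart_inv c y))"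

definition smoothly_compatible :: "('m, 'n::finite) chart \<Rightarrow> ('m, 'n) chart \<Rightarrow> bool"
  where "smoothly_compatible c d \<longleftrightarrow>
    smooth_on (snd c ` (fst c \<inter> fst d)) (transition c d) \<and>
    smooth_on (snd d ` (fst c \<inter> fst d)) (transition d c)"

text \<open>\<open>A\<close> is the smooth structure, a maximal atlas; the dimension is \<open>CARD('n)\<close>.\<close>
definition smooth_manifold :: "'m topology \<Rightarrow> ('m, 'n::finite) chart set \<Rightarrow> bool"
  where "smooth_manifold M A \<longleftrightarrow> Hausdorff_space M \<and> second_countable M \<and>
    (\<forall>c\<in>A. is_chart M c) \<and> (\<Union>c\<in>A. fst c) = topspace M \<and>
    (\<forall>c\<in>A. \<forall>d\<in>A. smoothly_compatible c d) \<and>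
    (\<forall>c. is_chart M c \<and> (\<forall>d\<in>A. smoothly_compatible c d) \<longrightarrow> c \<in> A)"

definition smooth_function :: "('m, 'n::finite) chart set \<Rightarrow> ('m \<Rightarrow> real) \<Rightarrow> bool"
  where "smooth_function A f \<longleftrightarrow> (\<forall>c\<in>A. smooth_on (chart_image c) (\<lambda>y. f (chart_inv c y)))"

text \<open>
  An augmented total trivialization atlas of the trivial line bundle: the fibre trivializations are
  the identity and are not recorded. The position in the list is the index.
\<close>
type_synonym ('m, 'n) aug_atlas = "(('m, 'n) chart \<times> ('m \<Rightarrow> real)) list"

definition augmented_atlas ::
    "'m topology \<Rightarrow> ('m, 'n::finite) chart set \<Rightarrow> ('m, 'n) aug_atlas \<Rightarrow> bool"
  where "augmented_atlas M A \<Lambda> \<longleftrightarrow>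
    fst ` set \<Lambda> \<subseteq> A \<and> (\<Union>(c, \<psi>)\<in>set \<Lambda>. fst c) = topspace M \<and>
    (\<forall>(c, \<psi>)\<in>set \<Lambda>. smooth_function A \<psi> \<and> (\<forall>x\<in>topspace M. \<psi> x \<ge> 0) \<and>
       M closure_of {x \<in> topspace M. \<psi> x \<noteq> 0} \<subseteq> fst c) \<and>
    (\<forall>x\<in>topspace M. (\<Sum>(c, \<psi>)\<leftarrow>\<Lambda>. \<psi> x) = 1)"

section \<open>Densities and distributions on a manifold\<close>

definition jacobian_factor ::
    "('m, 'n::finite) chart \<Rightarrow> ('m, 'n) chart \<Rightarrow> 'm \<Rightarrow> real"
  where "jacobian_factor c d x =
    \<bar>det (matrix (frechet_derivative (transition c d) (at (snd c x))))\<bar>"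

text \<open>
  The fibre of the density bundle over \<open>x\<close>: a density \<open>w\<close> is recorded by its coefficients \<open>w c\<close>
  with respect to \<open>|dx\<^sup>1 \<and> \<dots> \<and> dx\<^sup>n|\<close> in the charts \<open>c\<close> around \<open>x\<close>, extended by \<open>0\<close> to all other \<open>c\<close>.
\<close>
definition density_fibre :: "('m, 'n::finite) chart set \<Rightarrow> 'm \<Rightarrow> (('m, 'n) chart \<Rightarrow> real) set"
  where "density_fibre A x = {w. (\<forall>c. c \<notin> A \<or> x \<notin> fst c \<longrightarrow> w c = 0) \<and>
    (\<forall>c\<in>A. \<forall>d\<in>A. x \<in> fst c \<inter> fst d \<longrightarrow> w c = jacobian_factor c d x * w d)}"

text \<open>
  A section of the density bundle is written as one function of pairs \<open>(x, c)\<close>, so that the vector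
  space operations are pointwise.
\<close>
type_synonym ('m, 'n) density = "'m \<times> ('m, 'n) chart \<Rightarrow> real"

definition smooth_densities :: "('m, 'n::finite) chart set \<Rightarrow> ('m, 'n) density set"
  where "smooth_densities A = {\<eta>. (\<forall>x. (\<lambda>c. \<eta> (x, c)) \<in> density_fibre A x) \<and>
    (\<forall>c\<in>A. smooth_on (chart_image c) (\<lambda>y. \<eta> (chart_inv c y, c)))}"

definition scale_density :: "('m \<Rightarrow> real) \<Rightarrow> ('m, 'n) density \<Rightarrow> ('m, 'n) density"
  where "scale_density f \<eta> = (\<lambda>(x, c). f x * \<eta> (x, c))"

text \<open>The density \<open>(\<xi> \<circ> \<phi>) |dx\<^sup>1 \<and> \<dots> \<and> dx\<^sup>n|\<close> of the chart \<open>d = (U, \<phi>)\<close>, extended by zero off \<open>U\<close>.\<close>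
definition coord_density ::
    "('m, 'n::finite) chart set \<Rightarrow> ('m, 'n) chart \<Rightarrow> (real^'n \<Rightarrow> real) \<Rightarrow> ('m, 'n) density"
  where "coord_density A d \<xi> = (\<lambda>(x, c).
    if c \<in> A \<and> x \<in> fst c \<inter> fst d then \<xi> (snd d x) * jacobian_factor c d x else 0)"

text \<open>The value does not depend on the atlas and the partition of unity.\<close>
definition has_density_integral ::
    "'m topology \<Rightarrow> ('m, 'n::finite) chart set \<Rightarrow> ('m, 'n) density \<Rightarrow> real \<Rightarrow> bool"
  where "has_density_integral M A \<omega> I \<longleftrightarrow> (\<exists>\<Lambda>. augmented_atlas M A \<Lambda> \<and>
    (\<forall>(c, \<psi>)\<in>set \<Lambda>. integrable (lebesgue_on (chart_image c))
       (\<lambda>y. \<psi> (chart_inv c y) * \<omega> (chart_inv c y, c))) \<and>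
    I = (\<Sum>(c, \<psi>)\<leftarrow>\<Lambda>. LINT y|lebesgue_on (chart_image c).
           \<psi> (chart_inv c y) * \<omega> (chart_inv c y, c)))"

definition density_seminorm ::
    "('m, 'n::finite) chart \<Rightarrow> (real^'n) set \<Rightarrow> ('n \<Rightarrow> nat) \<Rightarrow> ('m, 'n) density \<Rightarrow> real"
  where "density_seminorm c K \<nu> \<eta> =
    (SUP y\<in>K. \<bar>mi_deriv \<nu> (\<lambda>y. \<eta> (chart_inv c y, c)) y\<bar>)"

text \<open>The Frechet topology of the space of smooth densities, generated by all seminorm balls.\<close>
definition density_topology ::
    "('m, 'n::finite) chart set \<Rightarrow> ('m, 'n) density topology"
  where "density_topology A = topology_generated_by
    {{\<eta> \<in> smooth_densities A. density_seminorm c K \<nu> (\<lambda>z. \<eta> z - \<eta>\<^sub>0 z) < r} | c K \<nu> \<eta>\<^sub>0 r.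
       c \<in> A \<and> compact K \<and> K \<noteq> {} \<and> K \<subseteq> chart_image c \<and> \<eta>\<^sub>0 \<in> smooth_densities A \<and> 0 < r}"

type_synonym ('m, 'n) functional = "('m, 'n) density \<Rightarrow> real"

text \<open>Functionals are extended by \<open>0\<close> off the smooth densities, so that equality is extensional.\<close>
definition distributions :: "('m, 'n::finite) chart set \<Rightarrow> ('m, 'n) functional set"
  where "distributions A = {u. (\<forall>\<eta>. \<eta> \<notin> smooth_densities A \<longrightarrow> u \<eta> = 0) \<and>
    linear_functional_on (smooth_densities A) u \<and>
    continuous_map (density_topology A) euclideanreal u}"

definition regular_distributions ::
    "'m topology \<Rightarrow> ('m, 'n::finite) chart set \<Rightarrow> ('m, 'n) functional set"
  where "regular_distributions M A = {u \<in> distributions A.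
    \<exists>f. \<forall>\<eta>\<in>smooth_densities A. has_density_integral M A (scale_density f \<eta>) (u \<eta>)}"

definition mult_distr ::
    "('m, 'n::finite) chart set \<Rightarrow> ('m \<Rightarrow> real) \<Rightarrow> ('m, 'n) functional \<Rightarrow> ('m, 'n) functional"
  where "mult_distr A \<psi> u =
    (\<lambda>\<eta>. if \<eta> \<in> smooth_densities A then u (scale_density \<psi> \<eta>) else 0)"

text \<open>The local representation \<open>H\<^sub>\<alpha>(u)\<close> in the chart \<open>c\<close>, to be applied to test functions on its image.\<close>
definition local_rep ::
    "('m, 'n::finite) chart set \<Rightarrow> ('m, 'n) chart \<Rightarrow> ('m, 'n) functional \<Rightarrow>
      (real^'n \<Rightarrow> real) \<Rightarrow> real"
  where "local_rep A c u = (\<lambda>\<xi>. u (coord_density A c \<xi>))"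

section \<open>Sobolev spaces on a manifold\<close>

definition msobolev_norm ::
    "('m, 'n::finite) chart set \<Rightarrow> ('m, 'n) aug_atlas \<Rightarrow> real \<Rightarrow> real \<Rightarrow>
      ('m, 'n) functional \<Rightarrow> ennreal"
  where "msobolev_norm A \<Lambda> e q u =
    (\<Sum>(c, \<psi>)\<leftarrow>\<Lambda>. sobolev_norm (chart_image c) e q (local_rep A c (mult_distr A \<psi> u)))"

definition msobolev_space ::
    "('m, 'n::finite) chart set \<Rightarrow> ('m, 'n) aug_atlas \<Rightarrow> real \<Rightarrow> real \<Rightarrow>
      ('m, 'n) functional set"
  where "msobolev_space A \<Lambda> e q = {u \<in> distributions A. msobolev_norm A \<Lambda> e q u < \<infinity>}"

definition vector_subspace :: "('a \<Rightarrow> real) set \<Rightarrow> ('a \<Rightarrow> real) set \<Rightarrow> bool"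
  where "vector_subspace W V \<longleftrightarrow> W \<subseteq> V \<and> (\<lambda>_. 0) \<in> W \<and>
    (\<forall>u\<in>W. \<forall>v\<in>W. (\<lambda>x. u x + v x) \<in> W) \<and> (\<forall>a. \<forall>u\<in>W. (\<lambda>x. a * u x) \<in> W)"

section \<open>Geometrically Lipschitz atlases\<close>

text \<open>
  Near each boundary point, after a rotation of the coordinates with last axis along \<open>v\<close>, the set is
  the strict epigraph of a Lipschitz function \<open>g\<close> on the hyperplane orthogonal to \<open>v\<close>.
\<close>
definition lipschitz_boundary :: "(real^'n::finite) set \<Rightarrow> bool"
  where "lipschitz_boundary \<Omega> \<longleftrightarrow> (\<forall>x\<in>frontier \<Omega>. \<exists>r>0. \<exists>v g L.
    norm v = 1 \<and> L-lipschitz_on {z. z \<bullet> v = 0} g \<and>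
    \<Omega> \<inter> ball x r = {y \<in> ball x r. g (y - (y \<bullet> v) *\<^sub>R v) < y \<bullet> v})"

definition gl_set :: "(real^'n::finite) set \<Rightarrow> bool"
  where "gl_set \<Omega> \<longleftrightarrow> \<Omega> = UNIV \<or>
    (\<Omega> \<noteq> {} \<and> bounded \<Omega> \<and> open \<Omega> \<and> lipschitz_boundary \<Omega>)"

definition GGL :: "('m, 'n::finite) aug_atlas \<Rightarrow> bool"
  where "GGL \<Lambda> \<longleftrightarrow> (\<forall>(c, \<psi>)\<in>set \<Lambda>. gl_set (chart_image c))"

definition GL_compatible :: "('m, 'n::finite) aug_atlas \<Rightarrow> ('m, 'n) aug_atlas \<Rightarrow> bool"
  where "GL_compatible \<Lambda> \<Upsilon> \<longleftrightarrow> GGL \<Lambda> \<and> GGL \<Upsilon> \<and>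
    (\<forall>(c, \<psi>)\<in>set \<Lambda>. \<forall>(d, \<rho>)\<in>set \<Upsilon>. fst c \<inter> fst d \<noteq> {} \<longrightarrow>
       gl_set (snd c ` (fst c \<inter> fst d)) \<and> gl_set (snd d ` (fst c \<inter> fst d)))"

end

theory Submission
  imports Defs "HOL-Combinatorics.Permutations" "HOL-Probability.Probability_Measure"
begin

text \<open>
  Let \<open>u\<close> be a distribution. Since the functions \<open>\<rho>\<close> of \<open>\<Upsilon>\<close> sum to one, for each function \<open>\<psi>\<close> of
  \<open>\<Lambda>\<close> the distribution \<open>\<psi>u\<close> is the sum of the \<open>\<rho>\<psi>u\<close>. In coordinates this says that the local
  representation \<open>T\<close> of \<open>\<psi>u\<close> in a chart \<open>c\<close> is expressed by the local representations \<open>S d\<close> of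
  \<open>\<rho>u\<close> in the charts \<open>d\<close>: \<open>T(\<xi>)\<close> is the sum of \<open>S d (a d \<cdot> (\<xi> \<circ> \<tau> d))\<close>, where \<open>\<tau> d\<close> is the
  transition map from \<open>d\<close> to \<open>c\<close> and \<open>a d\<close> is a smooth function with compact support in the
  coordinate image of the overlap (\<open>distribution_partition\<close>, \<open>localized_coord_density\<close>). Hence the
  norm with respect to \<open>\<Lambda>\<close> is bounded by that with respect to \<open>\<Upsilon>\<close> as soon as each operator
  \<open>P f = a \<cdot> (f \<circ> \<tau>)\<close> acts boundedly (\<open>sobolev_norm_sum_pullback\<close>), and the two atlases may be
  exchanged.

  The heart of the matter is that \<open>P\<close> is bounded on \<open>W\<^sup>s\<^sup>,\<^sup>p\<close> for all \<open>s \<ge> 0\<close> and \<open>p > 1\<close>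
  (\<open>sobolev_fun_norm_pullback\<close>). For \<open>e < 0\<close> the bound for distributions is dual to it. For
  \<open>e \<ge> 0\<close> the functional \<open>S\<close> is integration against a function \<open>g\<close>, and then \<open>\<xi> \<mapsto> S (P \<xi>)\<close> is
  integration against the adjoint of \<open>P\<close> applied to \<open>g\<close>; the adjoint is again a pullback times a
  test function, now along the inverse of \<open>\<tau>\<close>.

  The compact support of \<open>a\<close> makes the bound for \<open>P\<close> uniform: on it the derivatives of \<open>\<tau>\<close> and the
  inverse of the Jacobian are bounded, and \<open>P f\<close> is extended by zero and estimated on the whole
  space. By the weak chain rule (\<open>wd_pullback\<close>) each weak derivative of \<open>P f\<close> is a sum of terms
  \<open>b \<cdot> (g \<circ> \<tau>)\<close> with a test function \<open>b\<close> and a weak derivative \<open>g\<close> of \<open>f\<close>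
  (\<open>pullback_weak_derivatives\<close>). The change of variables bounds their \<open>L\<^sup>p\<close> norms. For a
  fractional part \<open>\<theta>\<close> of \<open>s\<close> the Gagliardo integral of \<open>h = b \<cdot> (g \<circ> \<tau>)\<close> is split at a distance
  \<open>\<delta>\<close> of the two points (\<open>gagliardo_energy_pullback\<close>). The far part is bounded by the \<open>L\<^sup>p\<close> norm
  of \<open>h\<close>. In the near part the segment between the points stays in a compact subset of the
  overlap, which gives Lipschitz bounds for \<open>\<tau>\<close> and \<open>b\<close>: the difference of \<open>g \<circ> \<tau>\<close> leads back to
  the Gagliardo integral of \<open>g\<close>, and the difference of \<open>b\<close> gains a power of the distance that
  makes the kernel integrable. This settles the terms in which \<open>g\<close> is a derivative of top order,
  the only ones whose Gagliardo integral the norm of \<open>f\<close> controls. A term in which \<open>g\<close> has lower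
  order has a weak gradient in \<open>L\<^sup>p\<close>, and this bounds its Gagliardo integral
  (\<open>gagliardo_energy_le_weak_gradient\<close>).
\<close>

section \<open>Change of variables\<close>

text \<open>
  \<open>has_measure_differentiable_image\<close> speaks of coordinates indexed by a well-ordered finite type.
  Numbering the coordinates arbitrarily carries it over to every finite index type: a copy of the
  index type is ordered by such a numbering, and the renaming of coordinates preserves Lebesgue
  measure and determinants.
\<close>
typedef 'a ranked = "UNIV :: 'a set" ..

definition rank_of :: "'a::finite ranked \<Rightarrow> nat"
  where "rank_of x = (SOME f :: 'a \<Rightarrow> nat. inj f) (Rep_ranked x)"

lemma inj_rank_of: "inj (rank_of :: 'a::finite ranked \<Rightarrow> nat)"
proof -
  have "\<exists>f :: 'a \<Rightarrow> nat. inj f"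
    using finite_imp_inj_to_nat_seg[of "UNIV :: 'a set"] by auto
  then have "inj (SOME f :: 'a \<Rightarrow> nat. inj f)" by (rule someI_ex)
  then show ?thesis
    by (intro injI) (auto simp: rank_of_def Rep_ranked_inject dest: injD)
qed

instantiation ranked :: (finite) wellorder
begin

definition less_eq_ranked :: "'a ranked \<Rightarrow> 'a ranked \<Rightarrow> bool"
  where "x \<le> y \<longleftrightarrow> rank_of x \<le> rank_of y"

definition less_ranked :: "'a ranked \<Rightarrow> 'a ranked \<Rightarrow> bool"
  where "x < y \<longleftrightarrow> rank_of x < rank_of y"

instance
proof
  fix x y z :: "'a ranked" and P
  show "x < y \<longleftrightarrow> x \<le> y \<and> \<not> y \<le> x" "x \<le> x" "x \<le> y \<Longrightarrow> y \<le> z \<Longrightarrow> x \<le> z"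
    "x \<le> y \<or> y \<le> x"
    by (auto simp: less_eq_ranked_def less_ranked_def)
  show "x = y" if "x \<le> y" "y \<le> x"
    by (rule injD[OF inj_rank_of]) (use that in \<open>simp add: less_eq_ranked_def\<close>)
  show "P x" if "\<And>x. (\<And>y. y < x \<Longrightarrow> P y) \<Longrightarrow> P x"
  proof (induction x rule: measure_induct_rule[of rank_of])
    case (less x)
    show ?case by (rule that, rule less) (simp add: less_ranked_def)
  qed
qed

end

instance ranked :: (finite) finite
proof
  have "(UNIV :: 'a ranked set) = Abs_ranked ` UNIV"
    by (metis Abs_ranked_cases surj_def)
  then show "finite (UNIV :: 'a ranked set)"
    by (metis finite finite_imageI)
qed

lemma bij_Rep_ranked: "bij Rep_ranked"
  by (rule bijI'[OF Rep_ranked_inject]) (metis Abs_ranked_inverse UNIV_I)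

lemma ranked_all: "(\<forall>i. P (Rep_ranked i) i) \<longleftrightarrow> (\<forall>j. P j (Abs_ranked j))"
  by (metis Abs_ranked_inverse Rep_ranked_inverse UNIV_I)

definition to_ranked :: "real^'n \<Rightarrow> real^('n::finite ranked)"
  where "to_ranked x = (\<chi> i. x $ Rep_ranked i)"

definition of_ranked :: "real^('n::finite ranked) \<Rightarrow> real^'n"
  where "of_ranked x = (\<chi> i. x $ Abs_ranked i)"

lemma of_to_ranked [simp]: "of_ranked (to_ranked x) = x"
  by (simp add: of_ranked_def to_ranked_def Abs_ranked_inverse)

lemma to_of_ranked [simp]: "to_ranked (of_ranked x) = x"
  by (simp add: of_ranked_def to_ranked_def Rep_ranked_inverse)

lemma bounded_linear_to_ranked: "bounded_linear to_ranked"
  by (rule linear_conv_bounded_linear[THEN iffD1]) (auto intro!: linearI simp: to_ranked_def vec_eq_iff)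

lemma bounded_linear_of_ranked: "bounded_linear of_ranked"
  by (rule linear_conv_bounded_linear[THEN iffD1]) (auto intro!: linearI simp: of_ranked_def vec_eq_iff)

text \<open>
  Conjugation with the renaming is a sign preserving bijection between the permutations of the two
  index types, so that the two Leibniz sums agree term by term.
\<close>
lemma det_reindex_ranked:
  fixes A :: "real^'n::finite^'n"
  shows "det (\<chi> i j. A $ Rep_ranked i $ Rep_ranked j) = det A"
proof -
  let ?m = "map_permutation UNIV (Abs_ranked :: 'n \<Rightarrow> 'n ranked)"
  have inj: "inj (Abs_ranked :: 'n \<Rightarrow> 'n ranked)" and surj: "surj (Abs_ranked :: 'n \<Rightarrow> 'n ranked)"
    by (metis Abs_ranked_inverse UNIV_I injI, metis Abs_ranked_cases surj_def)
  have m: "?m p (Abs_ranked i) = Abs_ranked (p i)" for p i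
    using inj surj by (simp add: map_permutation_def restrict_id_def)
  have mq: "?m (Rep_ranked \<circ> q \<circ> Abs_ranked) = q" for q :: "'n ranked \<Rightarrow> 'n ranked"
  proof
    fix x show "?m (Rep_ranked \<circ> q \<circ> Abs_ranked) x = q x"
      using m[of "Rep_ranked \<circ> q \<circ> Abs_ranked" "Rep_ranked x"] by (simp add: Rep_ranked_inverse)
  qed
  have "bij_betw ?m {p. p permutes UNIV} {q. q permutes UNIV}"
  proof (rule bij_betwI')
    fix p p' :: "'n \<Rightarrow> 'n"
    show "(?m p = ?m p') = (p = p')"
    proof
      assume eq: "?m p = ?m p'"
      have "p i = p' i" for i
        using m[of p i] m[of p' i] inj eq by (simp add: inj_eq)
      then show "p = p'" by blast
    qed simp
    show "p \<in> {p. p permutes UNIV} \<Longrightarrow> ?m p \<in> {q. q permutes UNIV}"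
      using map_permutation_permutes[of Abs_ranked UNIV UNIV p] inj surj by (simp add: bij_betw_def)
  next
    fix q :: "'n ranked \<Rightarrow> 'n ranked" assume q: "q \<in> {q. q permutes UNIV}"
    then have "bij q" by (simp add: permutes_bij)
    then have "bij (Rep_ranked \<circ> q \<circ> Abs_ranked)"
      using bij_Rep_ranked inj surj by (intro bij_comp) (auto simp: bij_def)
    then show "\<exists>p\<in>{p. p permutes UNIV}. q = ?m p"
      using mq[of q] by (metis (mono_tags) bij_imp_permutes iso_tuple_UNIV_I mem_Collect_eq)
  qed
  then have "det (\<chi> i j. A $ Rep_ranked i $ Rep_ranked j) =
      (\<Sum>p | p permutes UNIV. of_int (sign (?m p)) * (\<Prod>i\<in>UNIV. A $ Rep_ranked i $ Rep_ranked (?m p i)))"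
    unfolding det_def by (subst sum.reindex_bij_betw[symmetric]) auto
  also have "\<dots> = (\<Sum>p | p permutes UNIV. of_int (sign p) * (\<Prod>i\<in>UNIV. A $ i $ p i))"
  proof (rule sum.cong[OF refl])
    fix p :: "'n \<Rightarrow> 'n" assume "p \<in> {p. p permutes UNIV}"
    then have s: "sign (?m p) = sign p" using inj by (intro sign_map_permutation) auto
    have "(\<Prod>i\<in>UNIV. A $ Rep_ranked i $ Rep_ranked (?m p i)) = (\<Prod>i\<in>UNIV. A $ i $ p i)"
    proof (rule prod.reindex_bij_witness[of _ Abs_ranked Rep_ranked])
      fix i :: "'n ranked"
      have "?m p i = Abs_ranked (p (Rep_ranked i))"
        using m[of p "Rep_ranked i"] by (simp add: Rep_ranked_inverse)
      then show "A $ Rep_ranked i $ p (Rep_ranked i) = A $ Rep_ranked i $ Rep_ranked (?m p i)"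
        by (simp add: Abs_ranked_inverse)
    qed (auto simp: Abs_ranked_inverse Rep_ranked_inverse)
    with s show "of_int (sign (?m p)) * (\<Prod>i\<in>UNIV. A $ Rep_ranked i $ Rep_ranked (?m p i)) =
      of_int (sign p) * (\<Prod>i\<in>UNIV. A $ i $ p i)" by simp
  qed
  finally show ?thesis by (simp add: det_def)
qed

lemma prod_Basis_cart: "(\<Prod>b\<in>(Basis :: (real^'n::finite) set). f b) = (\<Prod>i\<in>UNIV. f (axis i 1))"
proof -
  have B: "(Basis :: (real^'n) set) = range (\<lambda>i. axis i 1)" by (auto simp: Basis_vec_def)
  have "inj (\<lambda>i :: 'n. axis i (1::real))" by (auto simp: inj_def axis_eq_axis)
  then show ?thesis unfolding B by (subst prod.reindex) auto
qed

text \<open>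
  Both measures give a box the product of its side lengths, and renaming the coordinates permutes
  the factors.
\<close>
lemma distr_to_ranked: "distr lborel borel (to_ranked :: real^'n::finite \<Rightarrow> _) = lborel"
proof (rule lborel_eqI[symmetric])
  have meas: "(to_ranked :: real^'n \<Rightarrow> _) \<in> borel_measurable borel"
    using bounded_linear_to_ranked by (intro borel_measurable_continuous_onI linear_continuous_on)
  fix l u :: "real^'n ranked"
  assume lu: "\<And>b. b \<in> Basis \<Longrightarrow> l \<bullet> b \<le> u \<bullet> b"
  then have le: "l $ i \<le> u $ i" for i
    using lu[of "axis i 1"] by (simp add: axis_in_Basis_iff inner_axis)
  have "to_ranked -` box l u = box (of_ranked l) (of_ranked u)"
    unfolding set_eq_iff mem_box_cart vimage_eq to_ranked_def of_ranked_def vec_lambda_beta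
    by (intro allI ranked_all)
  then have "emeasure (distr lborel borel (to_ranked :: real^'n \<Rightarrow> _)) (box l u)
      = emeasure lborel (box (of_ranked l) (of_ranked u))"
    using meas by (simp add: emeasure_distr)
  also have "\<dots> = (\<Prod>b\<in>Basis. (of_ranked u - of_ranked l) \<bullet> b)"
    by (subst emeasure_lborel_box) (auto simp: Basis_vec_def inner_axis of_ranked_def le)
  also have "(\<Prod>b\<in>Basis. (of_ranked u - of_ranked l) \<bullet> b) = (\<Prod>b\<in>Basis. (u - l) \<bullet> b)"
    unfolding prod_Basis_cart inner_axis
    by (rule prod.reindex_bij_witness[of _ Rep_ranked Abs_ranked])
      (auto simp: Abs_ranked_inverse Rep_ranked_inverse of_ranked_def)
  finally show "emeasure (distr lborel borel (to_ranked :: real^'n \<Rightarrow> _)) (box l u) = (\<Prod>b\<in>Basis. (u - l) \<bullet> b)" .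
qed simp

lemma measurable_to_ranked [measurable]: "to_ranked \<in> borel_measurable borel"
  using bounded_linear_to_ranked by (intro borel_measurable_continuous_onI linear_continuous_on)

lemma measurable_of_ranked [measurable]: "of_ranked \<in> borel_measurable borel"
  using bounded_linear_of_ranked by (intro borel_measurable_continuous_onI linear_continuous_on)

lemma nn_integral_to_ranked:
  assumes "F \<in> borel_measurable borel"
  shows "(\<integral>\<^sup>+x. F (to_ranked x) \<partial>lborel) = (\<integral>\<^sup>+z. F z \<partial>lborel)"
  using nn_integral_distr[of to_ranked lborel borel F] assms unfolding distr_to_ranked by simp

lemma measurable_if_continuous_open:
  fixes g :: "'a::topological_space \<Rightarrow> 'b::real_normed_vector"
  assumes "open V" "continuous_on V g"
  shows "(\<lambda>x. if x \<in> V then g x else 0) \<in> borel_measurable borel"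
proof -
  have "(\<lambda>x. indicator V x *\<^sub>R g x) \<in> borel_measurable borel"
    using assms by (intro borel_measurable_continuous_on_indicator) auto
  moreover have "(\<lambda>x. indicator V x *\<^sub>R g x) = (\<lambda>x. if x \<in> V then g x else 0)"
    by (auto simp: indicator_def)
  ultimately show ?thesis by simp
qed

text \<open>
  \<open>has_measure_differentiable_image\<close> asserts that the image has finite measure \<open>m\<close> if and only if
  the Jacobian has integral \<open>m\<close>. So the two sides are finite together, and equal in this case.
\<close>
lemma emeasure_image_wellorder:
  fixes g :: "real^'m::{finite,wellorder} \<Rightarrow> real^'m::_"
  assumes S: "S \<in> sets borel" and gS: "g ` S \<in> sets borel"
    and der: "\<And>x. x \<in> S \<Longrightarrow> (g has_derivative g' x) (at x)" and inj: "inj_on g S"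
    and J: "(\<lambda>x. indicator S x * \<bar>det (matrix (g' x))\<bar>) \<in> borel_measurable borel"
  shows "emeasure lborel (g ` S) = (\<integral>\<^sup>+x. ennreal (indicator S x * \<bar>det (matrix (g' x))\<bar>) \<partial>lborel)"
proof -
  let ?J = "\<lambda>x. indicator S x * \<bar>det (matrix (g' x))\<bar>"
  have S': "S \<in> sets lebesgue" using S by auto
  have der': "\<And>x. x \<in> S \<Longrightarrow> (g has_derivative g' x) (at x within S)"
    using der has_derivative_at_withinI by blast
  have iff: "g ` S \<in> lmeasurable \<and> measure lebesgue (g ` S) = m
     \<longleftrightarrow> ((\<lambda>x. \<bar>det (matrix (g' x))\<bar>) has_integral m) S" for m
    by (rule has_measure_differentiable_image[OF S' der' inj])
  have hi: "((\<lambda>x. \<bar>det (matrix (g' x))\<bar>) has_integral m) S \<longleftrightarrow> (?J has_integral m) UNIV" for m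
  proof -
    have "?J = (\<lambda>x. if x \<in> S then \<bar>det (matrix (g' x))\<bar> else 0)" by auto
    then show ?thesis by (simp only: has_integral_restrict_UNIV)
  qed
  have em: "emeasure lborel (g ` S) = emeasure lebesgue (g ` S)" using gS by simp
  show ?thesis
  proof (cases "(\<integral>\<^sup>+x. ennreal (?J x) \<partial>lborel) < \<infinity>")
    case True
    then have "integrable lborel ?J"
      using J by (intro integrableI_bounded) (auto simp: abs_mult)
    then have *: "(?J has_integral (LINT x|lborel. ?J x)) UNIV"
      using has_integral_integral_lborel by blast
    have "g ` S \<in> lmeasurable" "measure lebesgue (g ` S) = (LINT x|lborel. ?J x)"
      using iff hi * by blast+
    then have "emeasure lebesgue (g ` S) = ennreal (LINT x|lborel. ?J x)"
      by (metis emeasure_eq_ennreal_measure fmeasurableD2 infinity_ennreal_def)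
    also have "\<dots> = (\<integral>\<^sup>+x. ennreal (?J x) \<partial>lborel)"
      using \<open>integrable lborel ?J\<close> by (intro nn_integral_eq_integral[symmetric]) auto
    finally show ?thesis using em by simp
  next
    case False
    have "\<not> g ` S \<in> lmeasurable"
    proof
      assume "g ` S \<in> lmeasurable"
      then have "(?J has_integral (measure lebesgue (g ` S))) UNIV" using iff hi by blast
      then have "(\<integral>\<^sup>+x. ennreal (?J x) \<partial>lborel) = ennreal (measure lebesgue (g ` S))"
        using J by (intro nn_integral_has_integral_lborel) auto
      with False show False by simp
    qed
    then have "emeasure lebesgue (g ` S) = \<infinity>"
      using gS fmeasurableI[of "g ` S" lebesgue] by (cases "emeasure lebesgue (g ` S) < \<infinity>") (auto simp: less_top[symmetric])
    with False em show ?thesis by (simp add: less_top[symmetric])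
  qed
qed

lemma emeasure_differentiable_image:
  fixes g :: "real^'n::finite \<Rightarrow> real^'n"
  assumes S: "S \<in> sets borel" and gS: "g ` S \<in> sets borel"
    and der: "\<And>x. x \<in> S \<Longrightarrow> (g has_derivative g' x) (at x)" and inj: "inj_on g S"
    and J: "(\<lambda>x. indicator S x * \<bar>det (matrix (g' x))\<bar>) \<in> borel_measurable borel"
  shows "emeasure lborel (g ` S) = (\<integral>\<^sup>+x. ennreal (indicator S x * \<bar>det (matrix (g' x))\<bar>) \<partial>lborel)"
proof -
  define G where "G = to_ranked \<circ> g \<circ> of_ranked"
  define G' where "G' x = to_ranked \<circ> g' (of_ranked x) \<circ> of_ranked" for x
  let ?S = "of_ranked -` S"
  have inj_to: "inj (to_ranked :: real^'n \<Rightarrow> _)" by (metis injI of_to_ranked)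
  have GS: "G ` ?S = of_ranked -` (g ` S)"
  proof safe
    fix x y assume "of_ranked x = g y" "y \<in> S"
    then have "x = G (to_ranked y)" "to_ranked y \<in> ?S"
      by (metis G_def comp_apply of_to_ranked to_of_ranked, simp)
    then show "x \<in> G ` ?S" by blast
  qed (auto simp: G_def)
  have det: "det (matrix (G' x)) = det (matrix (g' (of_ranked x)))" for x
  proof -
    have ax: "of_ranked (axis j 1) = (axis (Rep_ranked j) 1 :: real^'n)" for j
      by (auto simp: of_ranked_def axis_def vec_eq_iff Abs_ranked_inverse Rep_ranked_inverse)
    have "matrix (G' x) = (\<chi> i j. matrix (g' (of_ranked x)) $ Rep_ranked i $ Rep_ranked j)"
      by (simp add: matrix_def G'_def to_ranked_def vec_eq_iff ax)
    then show ?thesis by (simp add: det_reindex_ranked)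
  qed
  have "emeasure lborel (G ` ?S) = (\<integral>\<^sup>+x. ennreal (indicator ?S x * \<bar>det (matrix (G' x))\<bar>) \<partial>lborel)"
  proof (rule emeasure_image_wellorder)
    show "?S \<in> sets borel" using measurable_sets[OF measurable_of_ranked S] by simp
    show "G ` ?S \<in> sets borel" unfolding GS using measurable_sets[OF measurable_of_ranked gS] by simp
    show "(G has_derivative G' x) (at x)" if "x \<in> ?S" for x
    proof -
      have "(g has_derivative g' (of_ranked x)) (at (of_ranked x))" using der that by auto
      then show ?thesis unfolding G_def G'_def
        by (intro diff_chain_at bounded_linear_imp_has_derivative bounded_linear_to_ranked bounded_linear_of_ranked)
    qed
    show "inj_on G ?S"
    proof (rule inj_onI)
      fix x y assume "x \<in> ?S" "y \<in> ?S" "G x = G y"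
      then have "of_ranked x = of_ranked y"
        using inj inj_to by (auto simp: inj_on_def G_def)
      then show "x = y" by (metis to_of_ranked)
    qed
    have "(\<lambda>x. indicator S (of_ranked x) * \<bar>det (matrix (g' (of_ranked x)))\<bar>) \<in> borel_measurable borel"
      using measurable_compose[OF measurable_of_ranked J] .
    then show "(\<lambda>x. indicator ?S x * \<bar>det (matrix (G' x))\<bar>) \<in> borel_measurable borel"
      by (simp add: det indicator_def)
  qed
  also have "\<dots> = (\<integral>\<^sup>+x. ennreal (indicator S (of_ranked x) * \<bar>det (matrix (g' (of_ranked x)))\<bar>) \<partial>lborel)"
    by (simp add: det indicator_def)
  also have "\<dots> = (\<integral>\<^sup>+x. ennreal (indicator S x * \<bar>det (matrix (g' x))\<bar>) \<partial>lborel)"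
    by (subst nn_integral_to_ranked[symmetric])
      (auto intro!: measurable_compose[OF _ measurable_ennreal] measurable_compose[OF measurable_of_ranked J])
  also have "emeasure lborel (G ` ?S) = emeasure lborel (g ` S)"
  proof -
    have "emeasure lborel (G ` ?S) = emeasure (distr lborel borel to_ranked) (of_ranked -` (g ` S))"
      unfolding distr_to_ranked GS ..
    also have "\<dots> = emeasure lborel (g ` S)"
      using measurable_sets[OF measurable_of_ranked gS]
      by (subst emeasure_distr) (auto simp: vimage_def)
    finally show ?thesis .
  qed
  finally show ?thesis .
qed

text \<open>
  The change of variables as an equality of measures. On a Borel set \<open>B\<close> it is the formula for the
  measure of the image of \<open>V \<inter> g -` B\<close>, which is \<open>V' \<inter> B\<close>. The value of the map off \<open>V\<close> is set to
  \<open>0\<close> in order to have a Borel map on the whole space; the density vanishes there.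
\<close>
lemma distr_density_jacobian:
  fixes g h :: "real^'n::finite \<Rightarrow> real^'n"
  assumes V: "open V" and V': "open V'" and gV: "g ` V = V'"
    and h: "continuous_on V' h" and hg: "\<And>x. x \<in> V \<Longrightarrow> h (g x) = x"
    and der: "\<And>x. x \<in> V \<Longrightarrow> (g has_derivative g' x) (at x)"
    and J: "continuous_on V (\<lambda>x. det (matrix (g' x)))"
  shows "distr (density lborel (\<lambda>x. ennreal (indicator V x * \<bar>det (matrix (g' x))\<bar>))) borel
      (\<lambda>x. if x \<in> V then g x else 0) = density lborel (indicator V')"
    (is "distr ?N borel ?g = _")
proof (rule measure_eqI)
  have cg: "continuous_on V g"
    using der by (meson continuous_at_imp_continuous_on has_derivative_continuous)
  have g [measurable]: "?g \<in> borel_measurable borel" by (rule measurable_if_continuous_open[OF V cg])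
  have [measurable]: "V \<in> sets borel" "V' \<in> sets borel" using V V' by auto
  have J' [measurable]: "(\<lambda>x. indicator V x * \<bar>det (matrix (g' x))\<bar>) \<in> borel_measurable borel"
    using borel_measurable_continuous_on_indicator[of V "\<lambda>x. \<bar>det (matrix (g' x))\<bar>"] V J
    by (simp add: continuous_on_rabs)
  fix B assume "B \<in> sets (distr ?N borel ?g)"
  then have B [measurable]: "B \<in> sets borel" by simp
  let ?S = "V \<inter> ?g -` B"
  have S [measurable]: "?S \<in> sets borel" using measurable_sets[OF g B] by auto
  have gS: "g ` ?S = V' \<inter> B" unfolding gV[symmetric] by auto
  have "emeasure (distr ?N borel ?g) B = emeasure ?N (?g -` B)"
    by (subst emeasure_distr) auto
  also have "\<dots> = (\<integral>\<^sup>+x. ennreal (indicator V x * \<bar>det (matrix (g' x))\<bar>) * indicator (?g -` B) x \<partial>lborel)"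
    using measurable_sets[OF g B] by (subst emeasure_density) auto
  also have "\<dots> = (\<integral>\<^sup>+x. ennreal (indicator ?S x * \<bar>det (matrix (g' x))\<bar>) \<partial>lborel)"
    by (intro nn_integral_cong) (auto simp: indicator_def)
  also have "\<dots> = emeasure lborel (g ` ?S)"
  proof (rule emeasure_differentiable_image[symmetric])
    show "g ` ?S \<in> sets borel" unfolding gS by auto
    show "inj_on g ?S" by (rule inj_on_inverseI[of _ h]) (use hg in auto)
    have "(\<lambda>x. indicator ?S x * (indicator V x * \<bar>det (matrix (g' x))\<bar>)) \<in> borel_measurable borel"
      by (rule borel_measurable_times[OF borel_measurable_indicator J']) (use S in auto)
    moreover have "(\<lambda>x. indicator ?S x * (indicator V x * \<bar>det (matrix (g' x))\<bar>)) =
       (\<lambda>x. indicator ?S x * \<bar>det (matrix (g' x))\<bar>)" by (auto simp: indicator_def)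
    ultimately show "(\<lambda>x. indicator ?S x * \<bar>det (matrix (g' x))\<bar>) \<in> borel_measurable borel" by simp
  qed (use S der in auto)
  also have "\<dots> = emeasure (density lborel (indicator V')) B"
    unfolding gS by (subst emeasure_density) (auto simp: indicator_inter_arith[symmetric])
  finally show "emeasure (distr ?N borel ?g) B = emeasure (density lborel (indicator V')) B" .
qed simp

section \<open>Calculus of smooth functions\<close>

text \<open>
  All iterated partial derivatives up to order \<open>k\<close> exist and are differentiable. Smoothness is a
  property of all orders at once; the recursion, which takes the innermost derivative first,
  permits proofs of the product and chain rules by induction on \<open>k\<close>.
\<close>
primrec Ck :: "nat \<Rightarrow> (real^'n::finite) set \<Rightarrow> (real^'n \<Rightarrow> 'b::real_normed_vector) \<Rightarrow> bool"
  where
    "Ck 0 S f = (\<forall>x\<in>S. f differentiable (at x))"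
  | "Ck (Suc k) S f = ((\<forall>x\<in>S. f differentiable (at x)) \<and> (\<forall>i. Ck k S (partial i f)))"

lemma partials_Nil [simp]: "partials [] f = f"
  and partials_Cons: "partials (i # is) f = partial i (partials is f)"
  and partials_append: "partials (is @ js) f = partials is (partials js f)"
  by (simp_all add: partials_def)

lemma Ck_iff_partials:
  "Ck k S f \<longleftrightarrow> (\<forall>is. length is \<le> k \<longrightarrow> (\<forall>x\<in>S. partials is f differentiable (at x)))"
proof (induction k arbitrary: f)
  case (Suc k)
  have split: "(\<forall>is. length is \<le> Suc k \<longrightarrow> P is) \<longleftrightarrow> P [] \<and> (\<forall>i is. length is \<le> k \<longrightarrow> P (is @ [i]))"
    for P :: "'a list \<Rightarrow> bool"
  proof
    assume *: "P [] \<and> (\<forall>i is. length is \<le> k \<longrightarrow> P (is @ [i]))"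
    show "\<forall>is. length is \<le> Suc k \<longrightarrow> P is"
    proof (intro allI impI)
      fix js :: "'a list" assume "length js \<le> Suc k"
      then show "P js" using * by (cases js rule: rev_cases) auto
    qed
  qed auto
  show ?case
    unfolding split Ck.simps Suc.IH by (auto simp: partials_append partials_Cons)
qed simp

lemma smooth_on_iff_Ck: "smooth_on S f \<longleftrightarrow> (\<forall>k. Ck k S f)"
  by (auto simp: smooth_on_def Ck_iff_partials)

lemma Ck_differentiable: "Ck k S f \<Longrightarrow> x \<in> S \<Longrightarrow> f differentiable (at x)"
  by (cases k) auto

lemma Ck_mono: "Ck (Suc k) S f \<Longrightarrow> Ck k S f"
  unfolding Ck_iff_partials by auto

lemma smooth_on_differentiable: "smooth_on S f \<Longrightarrow> x \<in> S \<Longrightarrow> f differentiable (at x)"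
  by (auto simp: smooth_on_iff_Ck intro: Ck_differentiable)

lemma smooth_on_continuous_on: "smooth_on S f \<Longrightarrow> continuous_on S f"
  by (meson continuous_at_imp_continuous_on differentiable_imp_continuous_within smooth_on_differentiable)

lemma smooth_on_partial: "smooth_on S f \<Longrightarrow> smooth_on S (partial i f)"
  by (metis Ck.simps(2) smooth_on_iff_Ck)

lemma smooth_on_subset: "smooth_on T f \<Longrightarrow> S \<subseteq> T \<Longrightarrow> smooth_on S f"
  by (auto simp: smooth_on_def)

lemma smooth_on_local: "(\<And>x. x \<in> S \<Longrightarrow> \<exists>T. x \<in> T \<and> smooth_on T f) \<Longrightarrow> smooth_on S f"
  by (force simp: smooth_on_def)

lemma partial_eq: "(f has_derivative f') (at x) \<Longrightarrow> partial i f x = f' (axis i 1)"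
  unfolding partial_def by (metis frechet_derivative_at)

lemma partial_cong_open:
  assumes "open S" "x \<in> S" "f differentiable (at x)" "\<And>y. y \<in> S \<Longrightarrow> f y = g y"
  shows "partial i f x = partial i g x"
  unfolding partial_def using frechet_derivative_transform_within_open[OF assms(3,1,2,4)] by simp

lemma differentiable_cong_open:
  assumes "open S" "x \<in> S" "f differentiable (at x)" "\<And>y. y \<in> S \<Longrightarrow> f y = g y"
  shows "g differentiable (at x)"
proof -
  obtain D where "(f has_derivative D) (at x)" using assms(3) by (auto simp: differentiable_def)
  from has_derivative_transform_within_open[OF this assms(1,2,4)]
  show ?thesis by (auto simp: differentiable_def)
qed

lemma Ck_cong_open:
  assumes "open S" "Ck k S f" "\<And>x. x \<in> S \<Longrightarrow> f x = g x"
  shows "Ck k S g"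
  using assms(2,3)
proof (induction k arbitrary: f g)
  case 0
  then show ?case
    using differentiable_cong_open[OF assms(1), of _ f g] by simp
next
  case (Suc k)
  have d: "g differentiable (at x)" if "x \<in> S" for x
    using differentiable_cong_open[OF assms(1), of _ f g] Suc.prems that by simp
  have "Ck k S (partial i g)" for i
  proof (rule Suc.IH)
    show "Ck k S (partial i f)" using Suc.prems by simp
    show "partial i f x = partial i g x" if "x \<in> S" for x
      by (rule partial_cong_open[OF assms(1) that]) (use Suc.prems that in auto)
  qed
  with d show ?case by simp
qed

lemma smooth_on_cong_open:
  "open S \<Longrightarrow> smooth_on S f \<Longrightarrow> (\<And>x. x \<in> S \<Longrightarrow> f x = g x) \<Longrightarrow> smooth_on S g"
  unfolding smooth_on_iff_Ck by (blast intro: Ck_cong_open)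

lemma partial_const [simp]: "partial i (\<lambda>x. c) = (\<lambda>x. 0)"
  by (rule ext, subst partial_eq[OF has_derivative_const]) auto

lemma partial_add:
  "f differentiable (at x) \<Longrightarrow> g differentiable (at x) \<Longrightarrow>
    partial i (\<lambda>x. f x + g x) x = partial i f x + partial i g x"
  by (subst partial_eq[OF has_derivative_add]) (auto simp: frechet_derivative_works partial_def)

lemma partial_mult:
  fixes f g :: "real^'n::finite \<Rightarrow> real"
  shows "f differentiable (at x) \<Longrightarrow> g differentiable (at x) \<Longrightarrow>
    partial i (\<lambda>x. f x * g x) x = f x * partial i g x + partial i f x * g x"
  by (subst partial_eq[OF has_derivative_mult]) (auto simp: frechet_derivative_works partial_def)

lemma partial_nth:
  fixes f :: "real^'n::finite \<Rightarrow> real^'m::finite"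
  shows "f differentiable (at x) \<Longrightarrow> partial i (\<lambda>x. f x $ j) x = partial i f x $ j"
  by (subst partial_eq[OF bounded_linear.has_derivative[OF bounded_linear_vec_nth]])
    (auto simp: frechet_derivative_works partial_def)

lemma differentiable_nth:
  fixes f :: "real^'n::finite \<Rightarrow> real^'m::finite"
  shows "f differentiable (at x) \<Longrightarrow> (\<lambda>x. f x $ j) differentiable (at x)"
  unfolding differentiable_def by (blast intro: bounded_linear.has_derivative[OF bounded_linear_vec_nth])

lemma differentiable_vec:
  fixes f :: "real^'n::finite \<Rightarrow> real^'m::finite"
  assumes "\<And>j. (\<lambda>x. f x $ j) differentiable (at x)"
  shows "f differentiable (at x)"
proof -
  define F where "F h = (\<chi> j. frechet_derivative (\<lambda>x. f x $ j) (at x) h)" for h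
  have "((\<lambda>y. f y \<bullet> b) has_derivative (\<lambda>h. F h \<bullet> b)) (at x)" if "b \<in> range (\<lambda>j. axis j 1)" for b
    using assms that by (auto simp: inner_axis F_def frechet_derivative_works)
  moreover have "(Basis :: (real^'m) set) \<subseteq> range (\<lambda>j. axis j 1)" by (auto simp: Basis_vec_def)
  ultimately have "(f has_derivative F) (at x)"
    by (subst has_derivative_componentwise_within) blast
  then show ?thesis by (rule differentiableI)
qed

lemma has_derivative_eq_partials:
  assumes "f differentiable (at x)"
  shows "frechet_derivative f (at x) v = (\<Sum>j\<in>UNIV. (v $ j) *\<^sub>R partial j f x)"
proof -
  have l: "linear (frechet_derivative f (at x))"
    using assms by (simp add: linear_frechet_derivative)
  have "v = (\<Sum>j\<in>UNIV. (v $ j) *\<^sub>R axis j 1)"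
    by (auto simp: vec_eq_iff axis_def if_distrib cong: if_cong)
  then have "frechet_derivative f (at x) v = frechet_derivative f (at x) (\<Sum>j\<in>UNIV. (v $ j) *\<^sub>R axis j 1)"
    by simp
  then show ?thesis
    by (simp add: linear_sum[OF l] linear_cmul[OF l] partial_def)
qed

lemma partial_compose:
  fixes \<tau> :: "real^'n::finite \<Rightarrow> real^'m::finite" and f :: "real^'m \<Rightarrow> real"
  assumes "f differentiable (at (\<tau> y))" "\<tau> differentiable (at y)"
  shows "partial i (\<lambda>y. f (\<tau> y)) y = (\<Sum>j\<in>UNIV. partial j f (\<tau> y) * partial i (\<lambda>y. \<tau> y $ j) y)"
proof -
  have "((\<lambda>y. f (\<tau> y)) has_derivative (\<lambda>h. frechet_derivative f (at (\<tau> y)) (frechet_derivative \<tau> (at y) h))) (at y)"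
    using has_derivative_compose[of \<tau> "frechet_derivative \<tau> (at y)" y UNIV f] assms
    by (simp add: frechet_derivative_works)
  then have "partial i (\<lambda>y. f (\<tau> y)) y = frechet_derivative f (at (\<tau> y)) (partial i \<tau> y)"
    by (subst partial_eq) (auto simp: partial_def)
  then show ?thesis
    using assms by (simp add: has_derivative_eq_partials partial_nth mult.commute)
qed

lemma Ck_const: "Ck k S (\<lambda>x. c)"
  by (induction k arbitrary: c) auto

lemma Ck_add:
  "open S \<Longrightarrow> Ck k S f \<Longrightarrow> Ck k S g \<Longrightarrow> Ck k S (\<lambda>x. f x + g x)"
proof (induction k arbitrary: f g)
  case (Suc k)
  have "Ck k S (partial i (\<lambda>x. f x + g x))" for i
    by (rule Ck_cong_open[OF \<open>open S\<close> Suc.IH[of "partial i f" "partial i g"]])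
      (use Suc.prems in \<open>auto simp: partial_add\<close>)
  then show ?case using Suc.prems by auto
qed auto

lemma Ck_mult:
  fixes f g :: "real^'n::finite \<Rightarrow> real"
  shows "open S \<Longrightarrow> Ck k S f \<Longrightarrow> Ck k S g \<Longrightarrow> Ck k S (\<lambda>x. f x * g x)"
proof (induction k arbitrary: f g)
  case (Suc k)
  note mono = Ck_mono[OF Suc.prems(2)] Ck_mono[OF Suc.prems(3)]
  have "Ck k S (partial i (\<lambda>x. f x * g x))" for i
    by (rule Ck_cong_open[OF \<open>open S\<close> Ck_add[OF \<open>open S\<close> Suc.IH[of f "partial i g"] Suc.IH[of "partial i f" g]]])
      (use Suc.prems mono in \<open>auto simp: partial_mult\<close>)
  then show ?case using Suc.prems by auto
qed auto

lemma Ck_sum: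
  assumes "open S" "finite J" "\<And>j. j \<in> J \<Longrightarrow> Ck k S (f j)"
  shows "Ck k S (\<lambda>x. \<Sum>j\<in>J. f j x)"
  using assms(2,3)
proof (induction J rule: finite_induct)
  case (insert j J)
  then have "Ck k S (\<lambda>x. f j x + (\<Sum>j\<in>J. f j x))" using assms(1) by (intro Ck_add) auto
  then show ?case using insert by simp
qed (simp add: Ck_const)

text \<open>
  The partial derivatives of the composition are sums of products of \<open>partial j f \<circ> \<tau>\<close>, to which
  the induction hypothesis applies, and derivatives of the components of \<open>\<tau>\<close>.
\<close>
lemma Ck_compose:
  fixes \<tau> :: "real^'n::finite \<Rightarrow> real^'m::finite" and f :: "real^'m \<Rightarrow> real"
  assumes "open S" "open T" "\<tau> ` S \<subseteq> T"
  shows "Ck k T f \<Longrightarrow> (\<And>j. Ck k S (\<lambda>y. \<tau> y $ j)) \<Longrightarrow> Ck k S (\<lambda>y. f (\<tau> y))"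
proof (induction k arbitrary: f)
  case 0
  have "(f \<circ> \<tau>) differentiable (at y)" if "y \<in> S" for y
    using 0 that assms(3) by (intro differentiable_chain_at differentiable_vec) auto
  then show ?case by (simp add: o_def)
next
  case (Suc k)
  have d\<tau>: "\<tau> differentiable (at y)" if "y \<in> S" for y
    using Suc.prems(2) that by (intro differentiable_vec) auto
  have df: "f differentiable (at (\<tau> y))" if "y \<in> S" for y
    using Suc.prems(1) that assms(3) by auto
  have "(f \<circ> \<tau>) differentiable (at y)" if "y \<in> S" for y
    using that d\<tau> df by (intro differentiable_chain_at) auto
  moreover have "Ck k S (partial i (\<lambda>y. f (\<tau> y)))" for i
  proof (rule Ck_cong_open[OF \<open>open S\<close> Ck_sum[OF \<open>open S\<close> finite Ck_mult[OF \<open>open S\<close>]]])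
    show "Ck k S (\<lambda>y. partial j f (\<tau> y))" for j
      by (rule Suc.IH) (use Suc.prems(1) Ck_mono[OF Suc.prems(2)] in simp_all)
    show "Ck k S (partial i (\<lambda>y. \<tau> y $ j))" for j using Suc.prems by auto
    show "(\<Sum>j\<in>UNIV. partial j f (\<tau> x) * partial i (\<lambda>y. \<tau> y $ j) x) = partial i (\<lambda>y. f (\<tau> y)) x"
      if "x \<in> S" for x using df d\<tau> that by (intro partial_compose[symmetric])
  qed
  ultimately show ?case by (simp add: o_def)
qed

lemma Ck_vec:
  fixes f :: "real^'n::finite \<Rightarrow> real^'m::finite"
  assumes "open S"
  shows "Ck k S f \<longleftrightarrow> (\<forall>j. Ck k S (\<lambda>x. f x $ j))"
proof (induction k arbitrary: f)
  case 0
  show ?case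
    unfolding Ck.simps using differentiable_vec differentiable_nth by blast
next
  case (Suc k)
  have diff: "(\<forall>x\<in>S. f differentiable (at x)) \<longleftrightarrow> (\<forall>j. \<forall>x\<in>S. (\<lambda>x. f x $ j) differentiable (at x))"
    using differentiable_vec differentiable_nth by blast
  have "Ck k S (\<lambda>x. partial i f x $ j) \<longleftrightarrow> Ck k S (partial i (\<lambda>x. f x $ j))"
    if "\<forall>x\<in>S. f differentiable (at x)" for i j
    by (intro iffI; erule Ck_cong_open[OF assms]) (use that in \<open>simp_all add: partial_nth\<close>)
  then have "(\<forall>i. Ck k S (partial i f)) \<longleftrightarrow> (\<forall>j i. Ck k S (partial i (\<lambda>x. f x $ j)))"
    if "\<forall>x\<in>S. f differentiable (at x)"
    using that by (simp add: Suc.IH) blast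
  with diff show ?case by auto
qed

text \<open>
  The derivatives of \<open>1 / g\<close> are polynomials in \<open>1 / g\<close> and the derivatives of \<open>g\<close>.
\<close>
lemma Ck_inverse:
  fixes g :: "real^'n::finite \<Rightarrow> real"
  assumes "open S" "\<And>x. x \<in> S \<Longrightarrow> g x \<noteq> 0"
  shows "Ck k S g \<Longrightarrow> Ck k S (\<lambda>x. inverse (g x))"
proof (induction k)
  case 0
  then show ?case using assms by (auto intro: differentiable_inverse)
next
  case (Suc k)
  have "Ck k S (partial i (\<lambda>x. inverse (g x)))" for i
  proof (rule Ck_cong_open[OF \<open>open S\<close> Ck_mult[OF \<open>open S\<close> Ck_const[of k S "-1"] Ck_mult[OF \<open>open S\<close> Ck_mult[OF \<open>open S\<close>]]]])
    show "Ck k S (\<lambda>x. inverse (g x))" "Ck k S (partial i g)" "Ck k S (\<lambda>x. inverse (g x))"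
      using Suc Ck_mono[OF Suc.prems] by auto
    show "- 1 * (inverse (g x) * partial i g x * inverse (g x)) = partial i (\<lambda>x. inverse (g x)) x" if "x \<in> S" for x
      by (subst partial_eq[OF Deriv.has_derivative_inverse]) 
       (use assms that Suc.prems in \<open>auto simp: frechet_derivative_works partial_def\<close>)
  qed
  then show ?case using Suc.prems assms by (auto intro: differentiable_inverse)
qed

lemma smooth_on_const: "smooth_on S (\<lambda>x. c)"
  by (simp add: smooth_on_iff_Ck Ck_const)

lemma smooth_on_add: "open S \<Longrightarrow> smooth_on S f \<Longrightarrow> smooth_on S g \<Longrightarrow> smooth_on S (\<lambda>x. f x + g x)"
  by (simp add: smooth_on_iff_Ck Ck_add)

lemma smooth_on_mult:
  fixes f g :: "real^'n::finite \<Rightarrow> real"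
  shows "open S \<Longrightarrow> smooth_on S f \<Longrightarrow> smooth_on S g \<Longrightarrow> smooth_on S (\<lambda>x. f x * g x)"
  by (simp add: smooth_on_iff_Ck Ck_mult)

lemma smooth_on_diff:
  fixes f g :: "real^'n::finite \<Rightarrow> real"
  assumes "open S" "smooth_on S f" "smooth_on S g" shows "smooth_on S (\<lambda>x. f x - g x)"
  using smooth_on_add[OF assms(1,2) smooth_on_mult[OF assms(1) smooth_on_const[of S "-1"] assms(3)]] by simp

lemma smooth_on_sum:
  "open S \<Longrightarrow> finite J \<Longrightarrow> (\<And>j. j \<in> J \<Longrightarrow> smooth_on S (f j)) \<Longrightarrow> smooth_on S (\<lambda>x. \<Sum>j\<in>J. f j x)"
  by (simp add: smooth_on_iff_Ck Ck_sum)

lemma smooth_on_prod: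
  fixes f :: "'j \<Rightarrow> real^'n::finite \<Rightarrow> real"
  assumes "open S" "finite J" "\<And>j. j \<in> J \<Longrightarrow> smooth_on S (f j)"
  shows "smooth_on S (\<lambda>x. \<Prod>j\<in>J. f j x)"
  using assms(2,3)
proof (induction J rule: finite_induct)
  case (insert j J)
  then have "smooth_on S (\<lambda>x. f j x * (\<Prod>j\<in>J. f j x))" using assms(1) by (intro smooth_on_mult) auto
  then show ?case using insert by simp
qed (simp add: smooth_on_const)

lemma smooth_on_vec:
  fixes f :: "real^'n::finite \<Rightarrow> real^'m::finite"
  shows "open S \<Longrightarrow> smooth_on S f \<longleftrightarrow> (\<forall>j. smooth_on S (\<lambda>x. f x $ j))"
  by (auto simp: smooth_on_iff_Ck Ck_vec)

lemma smooth_on_compose: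
  fixes \<tau> :: "real^'n::finite \<Rightarrow> real^'m::finite" and f :: "real^'m \<Rightarrow> real"
  assumes "open S" "open T" "\<tau> ` S \<subseteq> T" "smooth_on T f" "smooth_on S \<tau>"
  shows "smooth_on S (\<lambda>y. f (\<tau> y))"
  using assms(4,5) Ck_compose[OF assms(1-3)] by (auto simp: smooth_on_iff_Ck Ck_vec[OF assms(1)])

lemma smooth_on_inverse:
  fixes g :: "real^'n::finite \<Rightarrow> real"
  shows "open S \<Longrightarrow> (\<And>x. x \<in> S \<Longrightarrow> g x \<noteq> 0) \<Longrightarrow> smooth_on S g \<Longrightarrow> smooth_on S (\<lambda>x. inverse (g x))"
  by (simp add: smooth_on_iff_Ck Ck_inverse)

lemma smooth_on_nth: "smooth_on S (\<lambda>x :: real^'n::finite. x $ i)"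
proof -
  have "((\<lambda>x. x $ i) has_derivative (\<lambda>x. x $ i)) (at x)" for x :: "real^'n"
    by (intro bounded_linear_imp_has_derivative bounded_linear_vec_nth)
  then have "partial j (\<lambda>x. x $ i) = (\<lambda>x. axis j 1 $ i)" and "(\<lambda>x. x $ i) differentiable (at x)"
    for x :: "real^'n" and j
    using partial_eq unfolding differentiable_def by blast+
  then have "Ck k S (\<lambda>x. x $ i)" for k by (cases k) (auto simp: Ck_const)
  then show ?thesis by (simp add: smooth_on_iff_Ck)
qed

text \<open>
  Near each point the sign of \<open>g\<close> is constant.
\<close>
lemma smooth_on_abs:
  fixes g :: "real^'n::finite \<Rightarrow> real"
  assumes S: "open S" and nz: "\<And>x. x \<in> S \<Longrightarrow> g x \<noteq> 0" and g: "smooth_on S g"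
  shows "smooth_on S (\<lambda>x. \<bar>g x\<bar>)"
proof (rule smooth_on_local)
  fix x assume x: "x \<in> S"
  define T where "T = S \<inter> (\<lambda>y. g x * g y) -` {0<..}"
  have "open T" unfolding T_def
    by (intro continuous_open_preimage continuous_intros smooth_on_continuous_on g S open_greaterThan)
  moreover have "x \<in> T" using x nz[of x] by (auto simp: T_def zero_less_mult_iff)
  moreover have "smooth_on T (\<lambda>y. sgn (g x) * g y)"
    using \<open>open T\<close> g by (intro smooth_on_mult smooth_on_const) (auto simp: T_def intro: smooth_on_subset)
  moreover have "sgn (g x) * g y = \<bar>g y\<bar>" if "y \<in> T" for y
    using that by (auto simp: T_def sgn_if zero_less_mult_iff)
  ultimately show "\<exists>T. x \<in> T \<and> smooth_on T (\<lambda>x. \<bar>g x\<bar>)"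
    by (blast intro: smooth_on_cong_open)
qed

lemma smooth_on_det_derivative:
  fixes \<tau> :: "real^'n::finite \<Rightarrow> real^'n"
  assumes S: "open S" and \<tau>: "smooth_on S \<tau>"
  shows "smooth_on S (\<lambda>y. det (matrix (frechet_derivative \<tau> (at y))))"
proof -
  have "smooth_on S (\<lambda>y. matrix (frechet_derivative \<tau> (at y)) $ i $ j)" for i j
  proof (rule smooth_on_cong_open[OF S])
    show "smooth_on S (partial j (\<lambda>y. \<tau> y $ i))"
      using \<tau> S by (intro smooth_on_partial) (simp add: smooth_on_vec)
    show "partial j (\<lambda>y. \<tau> y $ i) x = matrix (frechet_derivative \<tau> (at x)) $ i $ j" if "x \<in> S" for x
      using smooth_on_differentiable[OF \<tau> that] by (subst partial_nth) (auto simp: partial_def matrix_def)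
  qed
  then show ?thesis
    unfolding det_def
    by (intro smooth_on_sum smooth_on_mult smooth_on_const smooth_on_prod S) auto
qed

section \<open>Test functions\<close>

text \<open>
  For \<open>m = 0\<close> this is the classical function that vanishes to infinite order at \<open>0\<close>. Division by
  the powers \<open>t ^ m\<close> makes the family closed under differentiation (\<open>DERIV_flat\<close>), so that
  smoothness follows by an induction over all \<open>m\<close> simultaneously.
\<close>
definition flat :: "nat \<Rightarrow> real \<Rightarrow> real"
  where "flat m t = (if t > 0 then exp (- 1 / t) / t ^ m else 0)"

lemma flat_nonneg: "flat m t \<ge> 0" and flat_pos: "t > 0 \<Longrightarrow> flat m t > 0" and flat_zero: "t \<le> 0 \<Longrightarrow> flat m t = 0"
  by (auto simp: flat_def)

lemma DERIV_flat: "(flat m has_real_derivative flat (m + 2) t - real m * flat (m + 1) t) (at t)"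
proof (cases t "0 :: real" rule: linorder_cases)
  case less
  then have "((\<lambda>t. 0) has_real_derivative flat (m + 2) t - real m * flat (m + 1) t) (at t)"
    by (simp add: flat_def)
  then show ?thesis
    by (rule has_field_derivative_transform_within_open[where S = "{..<0}"]) (use less in \<open>auto simp: flat_def\<close>)
next
  case greater
  have "((\<lambda>t. exp (- 1 / t) / t ^ m) has_real_derivative
      (exp (- 1 / t) * (1 / t\<^sup>2) * t ^ m - exp (- 1 / t) * (real m * t ^ (m - 1))) / (t ^ m * t ^ m)) (at t)"
    using greater by (auto intro!: derivative_eq_intros simp: power2_eq_square)
  also have "(exp (- 1 / t) * (1 / t\<^sup>2) * t ^ m - exp (- 1 / t) * (real m * t ^ (m - 1))) / (t ^ m * t ^ m)
      = flat (m + 2) t - real m * flat (m + 1) t"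
    using greater by (cases m) (auto simp: flat_def field_simps power2_eq_square)
  finally show ?thesis
    by (rule has_field_derivative_transform_within_open[where S = "{0<..}"]) (use greater in \<open>auto simp: flat_def\<close>)
next
  case equal
  have "((\<lambda>h. (inverse h) ^ (m + 1) / exp (inverse h)) \<longlongrightarrow> 0) (at_right (0::real))"
    using filterlim_compose[OF tendsto_power_div_exp_0[of "m + 1"] filterlim_inverse_at_top_right] .
  then have "((\<lambda>h. flat m h / h) \<longlongrightarrow> 0) (at_right 0)"
    by (rule Lim_transform_eventually)
      (auto simp: eventually_at_filter flat_def exp_minus field_simps)
  moreover have "((\<lambda>h. flat m h / h) \<longlongrightarrow> 0) (at_left 0)"
    by (rule Lim_transform_eventually[OF tendsto_const]) (auto simp: eventually_at_filter flat_def)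
  ultimately have "((\<lambda>h. flat m h / h) \<longlongrightarrow> 0) (at 0)"
    by (simp add: filterlim_split_at)
  then show ?thesis using equal
    by (simp add: has_field_derivative_iff flat_def)
qed

lemma smooth_on_flat:
  assumes "open S" "smooth_on S u" shows "smooth_on S (\<lambda>x. flat m (u x))"
proof -
  have d: "((\<lambda>x. flat m (u x)) has_derivative
      (\<lambda>h. (flat (m + 2) (u x) - real m * flat (m + 1) (u x)) * frechet_derivative u (at x) h)) (at x)"
    if "x \<in> S" for x m
  proof -
    have "(u has_derivative frechet_derivative u (at x)) (at x)"
      using smooth_on_differentiable[OF assms(2) that] by (simp add: frechet_derivative_works)
    from has_derivative_compose[OF this DERIV_flat[THEN has_field_derivative_imp_has_derivative]]
    show ?thesis by simp
  qed
  have "Ck k S (\<lambda>x. flat m (u x))" for k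
  proof (induction k arbitrary: m)
    case 0
    then show ?case using d unfolding Ck.simps differentiable_def by blast
  next
    case (Suc k)
    have "Ck k S (partial i (\<lambda>x. flat m (u x)))" for i
    proof (rule Ck_cong_open[OF assms(1)])
      show "Ck k S (\<lambda>x. (flat (m + 2) (u x) + (- real m) * flat (m + 1) (u x)) * partial i u x)"
        using assms Suc smooth_on_partial[OF assms(2)]
        by (intro Ck_mult Ck_add Ck_const Suc) (auto simp: smooth_on_iff_Ck)
      show "(flat (m + 2) (u x) + (- real m) * flat (m + 1) (u x)) * partial i u x = partial i (\<lambda>x. flat m (u x)) x"
        if "x \<in> S" for x
        by (subst partial_eq[OF d[OF that]]) (simp add: partial_def)
    qed
    then show ?case using d unfolding Ck.simps differentiable_def by blast
  qed
  then show ?thesis by (simp add: smooth_on_iff_Ck)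
qed

text \<open>
  Smoothness has to be checked only on a neighbourhood of a compact set off which \<open>f\<close> vanishes.
\<close>
lemma test_functionsI:
  assumes "open W" "smooth_on W f" "compact C" "C \<subseteq> W" "C \<subseteq> \<Omega>" "\<And>x. x \<notin> C \<Longrightarrow> f x = 0"
  shows "f \<in> test_functions \<Omega>"
proof -
  have "smooth_on UNIV f"
  proof (rule smooth_on_local)
    fix x
    show "\<exists>T. x \<in> T \<and> smooth_on T f"
    proof (cases "x \<in> C")
      case False
      have "open (- C)" using assms(3) by (simp add: compact_imp_closed open_Compl)
      then have "smooth_on (- C) f"
        by (rule smooth_on_cong_open[OF _ smooth_on_const[of _ 0]]) (use assms(6) in auto)
      with False show ?thesis by blast
    qed (use assms in blast)
  qed
  moreover have "closure {x. f x \<noteq> 0} \<subseteq> C"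
    using assms(3,6) by (intro closure_minimal) (auto simp: compact_imp_closed)
  moreover have "compact (closure {x. f x \<noteq> 0})"
    using compact_Int_closed[OF assms(3) closed_closure] calculation(2) by (metis inf.absorb_iff2)
  ultimately show ?thesis using assms(5) unfolding test_functions_def by blast
qed

lemma test_functions_support:
  assumes "f \<in> test_functions \<Omega>"
  shows "\<exists>C. compact C \<and> C \<subseteq> \<Omega> \<and> (\<forall>x. x \<notin> C \<longrightarrow> f x = 0)"
proof (intro exI conjI)
  show "compact (closure {x. f x \<noteq> 0})" "closure {x. f x \<noteq> 0} \<subseteq> \<Omega>"
    using assms by (auto simp: test_functions_def)
  show "\<forall>x. x \<notin> closure {x. f x \<noteq> 0} \<longrightarrow> f x = 0"
    using closure_subset[of "{x. f x \<noteq> 0}"] by blast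
qed

lemma test_functions_smooth: "f \<in> test_functions \<Omega> \<Longrightarrow> smooth_on UNIV f"
  by (simp add: test_functions_def)

lemma test_functions_zero: "f \<in> test_functions \<Omega> \<Longrightarrow> x \<notin> \<Omega> \<Longrightarrow> f x = 0"
  using test_functions_support[of f \<Omega>] by blast

lemma test_functions_mono: "f \<in> test_functions V \<Longrightarrow> V \<subseteq> \<Omega> \<Longrightarrow> f \<in> test_functions \<Omega>"
  by (auto simp: test_functions_def)

lemma test_functions_continuous: "f \<in> test_functions \<Omega> \<Longrightarrow> continuous_on S f"
  by (meson continuous_on_subset smooth_on_continuous_on subset_UNIV test_functions_smooth)

lemma test_functions_measurable: "f \<in> test_functions \<Omega> \<Longrightarrow> f \<in> borel_measurable borel"
  by (intro borel_measurable_continuous_onI test_functions_continuous)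

lemma test_functions_bounded:
  assumes "f \<in> test_functions \<Omega>" obtains B where "B > 0" "\<And>x. \<bar>f x\<bar> \<le> B"
proof -
  obtain C where C: "compact C" "\<And>x. x \<notin> C \<Longrightarrow> f x = 0" using test_functions_support[OF assms] by blast
  have "compact (f ` C)" using C(1) test_functions_continuous[OF assms] by (rule compact_continuous_image[rotated])
  then obtain B where "B > 0" "\<And>y. y \<in> f ` C \<Longrightarrow> \<bar>y\<bar> \<le> B"
    using bounded_pos[of "f ` C"] compact_imp_bounded by auto
  then show thesis using C(2) by (intro that[of B]) (metis abs_zero imageI less_eq_real_def)+
qed

lemma test_functions_mult_smooth:
  assumes "a \<in> test_functions V" "open V" "smooth_on V g"
  shows "(\<lambda>x. a x * g x) \<in> test_functions V"
proof -
  obtain C where C: "compact C" "C \<subseteq> V" "\<And>x. x \<notin> C \<Longrightarrow> a x = 0" using test_functions_support[OF assms(1)] by blast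
  show ?thesis
    by (rule test_functionsI[OF assms(2) smooth_on_mult C(1,2,2)])
      (use assms C(3) in \<open>auto dest: test_functions_smooth intro: smooth_on_subset\<close>)
qed

lemma test_functions_mult:
  "a \<in> test_functions \<Omega> \<Longrightarrow> smooth_on UNIV g \<Longrightarrow> (\<lambda>x. a x * g x) \<in> test_functions \<Omega>"
proof -
  assume a: "a \<in> test_functions \<Omega>" and g: "smooth_on UNIV g"
  obtain C where C: "compact C" "C \<subseteq> \<Omega>" "\<And>x. x \<notin> C \<Longrightarrow> a x = 0" using test_functions_support[OF a] by blast
  show ?thesis
    by (rule test_functionsI[OF open_UNIV smooth_on_mult C(1) _ C(2)])
      (use a g C(3) in \<open>auto dest: test_functions_smooth\<close>)
qed

lemma test_functions_cmult: "a \<in> test_functions \<Omega> \<Longrightarrow> (\<lambda>x. c * a x) \<in> test_functions \<Omega>"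
  using test_functions_mult[of a \<Omega> "\<lambda>x. c"] by (simp add: smooth_on_const mult.commute)

lemma test_functions_add:
  assumes "a \<in> test_functions \<Omega>" "b \<in> test_functions \<Omega>" shows "(\<lambda>x. a x + b x) \<in> test_functions \<Omega>"
proof -
  obtain C where C: "compact C" "C \<subseteq> \<Omega>" "\<And>x. x \<notin> C \<Longrightarrow> a x = 0" using test_functions_support[OF assms(1)] by blast
  obtain D where D: "compact D" "D \<subseteq> \<Omega>" "\<And>x. x \<notin> D \<Longrightarrow> b x = 0" using test_functions_support[OF assms(2)] by blast
  show ?thesis
    by (rule test_functionsI[OF open_UNIV smooth_on_add compact_Un[OF C(1) D(1)]])
      (use assms C D in \<open>auto dest: test_functions_smooth\<close>)
qed

lemma test_functions_0: "(\<lambda>x. 0) \<in> test_functions \<Omega>"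
  by (rule test_functionsI[of UNIV _ "{}"]) (auto simp: smooth_on_const)

lemma test_functions_sum:
  "finite J \<Longrightarrow> (\<And>j. j \<in> J \<Longrightarrow> f j \<in> test_functions \<Omega>) \<Longrightarrow> (\<lambda>x. \<Sum>j\<in>J. f j x) \<in> test_functions \<Omega>"
  by (induction J rule: finite_induct) (auto simp: test_functions_0 intro: test_functions_add)

lemma test_functions_partial:
  assumes "a \<in> test_functions \<Omega>" shows "partial i a \<in> test_functions \<Omega>"
proof -
  obtain C where C: "compact C" "C \<subseteq> \<Omega>" "\<And>x. x \<notin> C \<Longrightarrow> a x = 0" using test_functions_support[OF assms] by blast
  have "partial i a x = 0" if "x \<notin> C" for x
  proof -
    have "open (- C)" using C(1) by (simp add: compact_imp_closed open_Compl)
    from partial_cong_open[OF this, of x "\<lambda>x. 0" a i] that C(3) show ?thesis by auto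
  qed
  then show ?thesis
    by (intro test_functionsI[OF open_UNIV smooth_on_partial C(1) _ C(2)])
      (use assms in \<open>auto dest: test_functions_smooth\<close>)
qed

lemma test_functions_partials: "a \<in> test_functions \<Omega> \<Longrightarrow> partials is a \<in> test_functions \<Omega>"
  by (induction "is") (auto simp: partials_Cons intro: test_functions_partial)

text \<open>
  The extension by zero is smooth because the support is the compact image of the support of \<open>a\<close>
  under the inverse of \<open>\<sigma>\<close>.
\<close>
lemma test_functions_compose:
  fixes \<sigma> :: "real^'n::finite \<Rightarrow> real^'n"
  assumes "a \<in> test_functions V" "open V" "open V'" "\<sigma> ` V' \<subseteq> V" "smooth_on V' \<sigma>"
    and "continuous_on V \<tau>" "\<tau> ` V \<subseteq> V'" "\<And>z. z \<in> V' \<Longrightarrow> \<tau> (\<sigma> z) = z"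
  shows "(\<lambda>z. if z \<in> V' then a (\<sigma> z) else 0) \<in> test_functions V'"
proof -
  obtain C where C: "compact C" "C \<subseteq> V" "\<And>x. x \<notin> C \<Longrightarrow> a x = 0" using test_functions_support[OF assms(1)] by blast
  have "compact (\<tau> ` C)"
    using C assms(6) by (intro compact_continuous_image) (auto intro: continuous_on_subset)
  moreover have "\<tau> ` C \<subseteq> V'" using C assms(7) by auto
  moreover have "smooth_on V' (\<lambda>z. if z \<in> V' then a (\<sigma> z) else 0)"
    by (rule smooth_on_cong_open[OF assms(3) smooth_on_compose[OF assms(3,2,4) _ assms(5)]])
      (use assms(1) in \<open>auto dest: test_functions_smooth intro: smooth_on_subset\<close>)
  ultimately show ?thesis
    by (intro test_functionsI[OF assms(3), of _ "\<tau> ` C"]) (use C(3) assms(8) in \<open>force+\<close>)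
qed

text \<open>
  A sum \<open>B\<close> of rescaled copies of \<open>flat\<close> is positive exactly on finitely many balls that cover \<open>K\<close>
  and whose closures lie in \<open>U\<close>. By compactness \<open>B \<ge> c > 0\<close> on \<open>K\<close>. The quotient
  \<open>flat 0 B / (flat 0 B + flat 0 (c - B))\<close> equals \<open>1\<close> where \<open>B \<ge> c\<close> and \<open>0\<close> where \<open>B = 0\<close>, and its
  denominator never vanishes.
\<close>
lemma bump_function_exists:
  fixes K :: "(real^'n::finite) set"
  assumes K: "compact K" and U: "open U" "K \<subseteq> U"
  obtains \<omega> where "\<omega> \<in> test_functions U" "\<And>x. x \<in> K \<Longrightarrow> \<omega> x = 1" "\<And>x. 0 \<le> \<omega> x" "\<And>x. \<omega> x \<le> 1"
proof (cases "K = {}")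
  case True
  then show thesis using that[OF test_functions_0] by simp
next
  case False
  have "\<exists>r>0. cball x r \<subseteq> U" if "x \<in> K" for x
    using U that open_contains_cball by blast
  then obtain r where r: "\<And>x. x \<in> K \<Longrightarrow> r x > 0" "\<And>x. x \<in> K \<Longrightarrow> cball x (r x) \<subseteq> U" by metis
  obtain D where D: "D \<subseteq> K" "finite D" "K \<subseteq> (\<Union>x\<in>D. ball x (r x))"
  proof (rule compactE_image[OF K, of K "\<lambda>x. ball x (r x)"])
    show "K \<subseteq> (\<Union>x\<in>K. ball x (r x))" using r(1) by force
  qed auto
  define B where "B y = (\<Sum>x\<in>D. flat 0 ((r x)\<^sup>2 - (\<Sum>i\<in>UNIV. (y $ i - x $ i) * (y $ i - x $ i))))" for y
  have n2: "(\<Sum>i\<in>UNIV. (y $ i - x $ i) * (y $ i - x $ i)) = (dist x y)\<^sup>2" for x y :: "real^'n"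
    by (simp add: dist_norm norm_eq_sqrt_inner inner_vec_def sum_nonneg, intro sum.cong, auto simp: algebra_simps)
  have smB: "smooth_on UNIV B"
    unfolding B_def using D(2)
    by (intro smooth_on_sum smooth_on_flat smooth_on_diff smooth_on_mult smooth_on_const smooth_on_nth) auto
  have B0: "B y \<ge> 0" for y unfolding B_def by (intro sum_nonneg flat_nonneg)
  have Bpos: "B y > 0 \<longleftrightarrow> (\<exists>x\<in>D. y \<in> ball x (r x))" for y
  proof -
    have *: "(r x)\<^sup>2 - (dist x y)\<^sup>2 > 0 \<longleftrightarrow> y \<in> ball x (r x)" if "x \<in> D" for x
    proof -
      have "r x > 0" using r(1) that D(1) by blast
      then have "(dist x y)\<^sup>2 < (r x)\<^sup>2 \<longleftrightarrow> dist x y < r x"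
        using power2_less_imp_less[of "dist x y" "r x"] power_strict_mono[of "dist x y" "r x" 2] by auto
      then show ?thesis by simp
    qed
    show ?thesis
    proof
      assume "B y > 0"
      then obtain x where "x \<in> D" "flat 0 ((r x)\<^sup>2 - (dist x y)\<^sup>2) \<noteq> 0"
        unfolding B_def n2 using sum.not_neutral_contains_not_neutral[where A = D] less_imp_neq
        by (metis (no_types, lifting))
      then have "\<not> (r x)\<^sup>2 - (dist x y)\<^sup>2 \<le> 0" using flat_zero by blast
      then show "\<exists>x\<in>D. y \<in> ball x (r x)" using * \<open>x \<in> D\<close> by (meson not_le)
    next
      assume "\<exists>x\<in>D. y \<in> ball x (r x)"
      then show "B y > 0" unfolding B_def n2
        using * D(2) by (auto intro!: sum_pos2 flat_nonneg flat_pos simp del: mem_ball)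
    qed
  qed
  obtain x0 where x0: "x0 \<in> K" "\<And>y. y \<in> K \<Longrightarrow> B x0 \<le> B y"
    using continuous_attains_inf[OF K False, of B] smooth_on_continuous_on[OF smB] continuous_on_subset by blast
  define c where "c = B x0"
  have c: "c > 0" unfolding c_def Bpos using D(3) x0(1) by blast
  define \<omega> where "\<omega> y = flat 0 (B y) * inverse (flat 0 (B y) + flat 0 (c - B y))" for y
  have den: "flat 0 (B y) + flat 0 (c - B y) > 0" for y
  proof (cases "B y > 0")
    case True then show ?thesis by (intro add_pos_nonneg flat_pos flat_nonneg)
  next
    case False then show ?thesis using c by (intro add_nonneg_pos flat_pos flat_nonneg) auto
  qed
  show thesis
  proof
    show "\<omega> \<in> test_functions U"
    proof (rule test_functionsI[of UNIV _ "\<Union>x\<in>D. cball x (r x)"])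
      show "smooth_on UNIV \<omega>" unfolding \<omega>_def
        using den by (intro smooth_on_mult smooth_on_inverse smooth_on_add smooth_on_flat smooth_on_diff smooth_on_const smB)
          (auto simp: less_le)
      show "compact (\<Union>x\<in>D. cball x (r x))" using D(2) by (intro compact_UN) auto
      show "(\<Union>x\<in>D. cball x (r x)) \<subseteq> U" using r D(1) by blast
      show "\<omega> x = 0" if "x \<notin> (\<Union>x\<in>D. cball x (r x))" for x
      proof -
        have "\<not> B x > 0" unfolding Bpos using that by auto
        then show ?thesis by (simp add: \<omega>_def flat_zero)
      qed
    qed auto
    show "\<omega> x = 1" if "x \<in> K" for x
      using x0(2)[OF that] den[of x] by (simp add: \<omega>_def c_def flat_zero)
    show "0 \<le> \<omega> x" for x using den[of x] by (simp add: \<omega>_def flat_nonneg)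
    show "\<omega> x \<le> 1" for x using den[of x] flat_nonneg[of 0 "c - B x"]
      by (simp add: \<omega>_def divide_inverse[symmetric])
  qed
qed

section \<open>Symmetry of iterated partial derivatives\<close>

lemma DERIV_along_axis:
  fixes g :: "real^'n::finite \<Rightarrow> real"
  assumes "g differentiable (at (y + t *\<^sub>R axis k 1))"
  shows "((\<lambda>t. g (y + t *\<^sub>R axis k 1)) has_real_derivative partial k g (y + t *\<^sub>R axis k 1)) (at t)"
proof -
  have "((\<lambda>t. y + t *\<^sub>R axis k 1) has_derivative (\<lambda>s. s *\<^sub>R axis k 1)) (at t)"
    by (auto intro!: derivative_eq_intros)
  from has_derivative_compose[OF this, of g "frechet_derivative g (at (y + t *\<^sub>R axis k 1))"] assms
  have "((\<lambda>t. g (y + t *\<^sub>R axis k 1)) has_derivative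
      (\<lambda>s. frechet_derivative g (at (y + t *\<^sub>R axis k 1)) (s *\<^sub>R axis k 1))) (at t)"
    by (simp add: frechet_derivative_works)
  moreover have "frechet_derivative g (at (y + t *\<^sub>R axis k 1)) (s *\<^sub>R axis k 1)
      = partial k g (y + t *\<^sub>R axis k 1) * s" for s
    using linear_cmul[OF linear_frechet_derivative[OF assms]] by (simp add: partial_def)
  ultimately show ?thesis by (simp add: has_field_derivative_def)
qed

text \<open>
  The mean value theorem is applied in direction \<open>i\<close> to the difference of two translates of \<open>f\<close>
  and then in direction \<open>j\<close> to \<open>partial i f\<close>.
\<close>
lemma second_difference_mean_value:
  fixes f :: "real^'n::finite \<Rightarrow> real"
  assumes f: "Ck 1 UNIV f" and h: "h > 0"
  obtains p where "dist p x \<le> 2 * h"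
    "f (x + h *\<^sub>R axis i 1 + h *\<^sub>R axis j 1) - f (x + h *\<^sub>R axis i 1) - f (x + h *\<^sub>R axis j 1) + f x
      = h\<^sup>2 * partial j (partial i f) p"
proof -
  define g where "g t = f ((x + h *\<^sub>R axis j 1) + t *\<^sub>R axis i 1) - f (x + t *\<^sub>R axis i 1)" for t
  have "\<exists>\<xi>. 0 < \<xi> \<and> \<xi> < h \<and> g h - g 0 = (h - 0) *
     (partial i f ((x + h *\<^sub>R axis j 1) + \<xi> *\<^sub>R axis i 1) - partial i f (x + \<xi> *\<^sub>R axis i 1))"
    unfolding g_def by (intro MVT2 h DERIV_diff DERIV_along_axis) (use f in auto)
  then obtain \<xi> where \<xi>: "0 < \<xi>" "\<xi> < h" and g: "g h - g 0 = h *
     (partial i f ((x + h *\<^sub>R axis j 1) + \<xi> *\<^sub>R axis i 1) - partial i f (x + \<xi> *\<^sub>R axis i 1))" by auto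
  have "\<exists>\<eta>. 0 < \<eta> \<and> \<eta> < h \<and> partial i f ((x + \<xi> *\<^sub>R axis i 1) + h *\<^sub>R axis j 1) - partial i f ((x + \<xi> *\<^sub>R axis i 1) + 0 *\<^sub>R axis j 1)
     = (h - 0) * partial j (partial i f) ((x + \<xi> *\<^sub>R axis i 1) + \<eta> *\<^sub>R axis j 1)"
    by (intro MVT2 h DERIV_along_axis) (use f in auto)
  then obtain \<eta> where \<eta>: "0 < \<eta>" "\<eta> < h" and g': "partial i f ((x + \<xi> *\<^sub>R axis i 1) + h *\<^sub>R axis j 1) - partial i f (x + \<xi> *\<^sub>R axis i 1)
     = h * partial j (partial i f) ((x + \<xi> *\<^sub>R axis i 1) + \<eta> *\<^sub>R axis j 1)" by auto
  show thesis
  proof (rule that[of "(x + \<xi> *\<^sub>R axis i 1) + \<eta> *\<^sub>R axis j 1"])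
    have "dist (x + \<xi> *\<^sub>R axis i 1 + \<eta> *\<^sub>R axis j 1) x \<le> norm (\<xi> *\<^sub>R (axis i 1 :: real^'n)) + norm (\<eta> *\<^sub>R (axis j 1 :: real^'n))"
      by (simp add: dist_norm add.assoc norm_triangle_ineq del: norm_scaleR)
    also have "\<dots> \<le> 2 * h" using \<xi> \<eta> by (simp add: norm_axis_1)
    finally show "dist (x + \<xi> *\<^sub>R axis i 1 + \<eta> *\<^sub>R axis j 1) x \<le> 2 * h" .
    have "f (x + h *\<^sub>R axis i 1 + h *\<^sub>R axis j 1) - f (x + h *\<^sub>R axis i 1) - f (x + h *\<^sub>R axis j 1) + f x = g h - g 0"
      by (simp add: g_def algebra_simps)
    also have "\<dots> = h\<^sup>2 * partial j (partial i f) (x + \<xi> *\<^sub>R axis i 1 + \<eta> *\<^sub>R axis j 1)"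
      using g g' by (simp add: power2_eq_square algebra_simps)
    finally show "f (x + h *\<^sub>R axis i 1 + h *\<^sub>R axis j 1) - f (x + h *\<^sub>R axis i 1) - f (x + h *\<^sub>R axis j 1) + f x
      = h\<^sup>2 * partial j (partial i f) (x + \<xi> *\<^sub>R axis i 1 + \<eta> *\<^sub>R axis j 1)" .
  qed
qed

text \<open>
  The second difference is symmetric in \<open>i\<close> and \<open>j\<close>, so the two mixed derivatives have a common
  value at points arbitrarily close to \<open>x\<close>, and they are continuous.
\<close>
lemma partial_commute:
  fixes f :: "real^'n::finite \<Rightarrow> real"
  assumes f: "smooth_on UNIV f"
  shows "partial i (partial j f) = partial j (partial i f)"
proof
  fix x
  have C1: "Ck 1 UNIV f" using f by (simp add: smooth_on_iff_Ck)
  have "\<forall>m. \<exists>p q. dist p x \<le> 2 * inverse (real (Suc m)) \<and> dist q x \<le> 2 * inverse (real (Suc m)) \<and>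
     partial j (partial i f) p = partial i (partial j f) q"
  proof
    fix m
    let ?h = "inverse (real (Suc m))"
    obtain p where p: "dist p x \<le> 2 * ?h"
      "f (x + ?h *\<^sub>R axis i 1 + ?h *\<^sub>R axis j 1) - f (x + ?h *\<^sub>R axis i 1) - f (x + ?h *\<^sub>R axis j 1) + f x
      = ?h\<^sup>2 * partial j (partial i f) p" using second_difference_mean_value[OF C1] by (metis inverse_positive_iff_positive of_nat_0_less_iff zero_less_Suc)
    obtain q where q: "dist q x \<le> 2 * ?h"
      "f (x + ?h *\<^sub>R axis j 1 + ?h *\<^sub>R axis i 1) - f (x + ?h *\<^sub>R axis j 1) - f (x + ?h *\<^sub>R axis i 1) + f x
      = ?h\<^sup>2 * partial i (partial j f) q" using second_difference_mean_value[OF C1] by (metis inverse_positive_iff_positive of_nat_0_less_iff zero_less_Suc)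
    have "?h\<^sup>2 * partial j (partial i f) p = ?h\<^sup>2 * partial i (partial j f) q"
      unfolding p(2)[symmetric] q(2)[symmetric] by (simp add: algebra_simps)
    then have "partial j (partial i f) p = partial i (partial j f) q" by simp
    with p(1) q(1) show "\<exists>p q. dist p x \<le> 2 * ?h \<and> dist q x \<le> 2 * ?h \<and>
      partial j (partial i f) p = partial i (partial j f) q" by blast
  qed
  then obtain p q where p: "\<And>m. dist (p m) x \<le> 2 * inverse (real (Suc m))"
    and q: "\<And>m. dist (q m) x \<le> 2 * inverse (real (Suc m))"
    and pq: "\<And>m. partial j (partial i f) (p m) = partial i (partial j f) (q m)" by metis
  have lim: "(\<lambda>m. 2 * inverse (real (Suc m))) \<longlonglongrightarrow> 0"
    using tendsto_mult_right_zero[OF LIMSEQ_inverse_real_of_nat] .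
  have "p \<longlonglongrightarrow> x" "q \<longlonglongrightarrow> x"
    using p q by (auto intro!: metric_tendsto_imp_tendsto[OF lim] simp: dist_real_def always_eventually)
  then have "(\<lambda>m. partial j (partial i f) (p m)) \<longlonglongrightarrow> partial j (partial i f) x"
    "(\<lambda>m. partial i (partial j f) (q m)) \<longlonglongrightarrow> partial i (partial j f) x"
    using smooth_on_continuous_on[OF smooth_on_partial[OF smooth_on_partial[OF f]]]
    by (auto simp: continuous_on_eq_continuous_at intro: isCont_tendsto_compose)
  then show "partial i (partial j f) x = partial j (partial i f) x"
    unfolding pq using LIMSEQ_unique by blast
qed

lemma smooth_on_partials: "smooth_on S f \<Longrightarrow> smooth_on S (partials is f)"
  by (induction "is") (auto simp: partials_Cons intro: smooth_on_partial)

lemma partials_cong_mset: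
  fixes f :: "real^'n::finite \<Rightarrow> real"
  assumes "smooth_on UNIV f" "mset is = mset js"
  shows "partials is f = partials js f"
  using assms(2)
proof (induction "is" arbitrary: js)
  case (Cons i "is")
  then obtain a b where js: "js = a @ i # b" by (metis list.set_intros(1) mset_eq_setD split_list)
  with Cons.prems have "mset is = mset (a @ b)" by simp
  then have "partials is f = partials (a @ b) f" by (rule Cons.IH)
  moreover have "partial i (partials a g) = partials a (partial i g)" if "smooth_on UNIV g" for g :: "real^'n \<Rightarrow> real"
    using that
  proof (induction a)
    case (Cons k a)
    then show ?case
      using partial_commute[OF smooth_on_partials[OF \<open>smooth_on UNIV g\<close>, of a], of i k] by (simp add: partials_Cons)
  qed simp
  ultimately show ?case
    by (simp add: js partials_Cons partials_append smooth_on_partials[OF assms(1)])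
qed simp

text \<open>
  By the symmetry of mixed derivatives the enumeration chosen in \<open>mi_deriv\<close> may be replaced by any
  list with the same counts. This turns multi-indices into lists, over which induction is
  possible.
\<close>
lemma mi_deriv_eq_partials:
  fixes f :: "real^'n::finite \<Rightarrow> real"
  assumes "smooth_on UNIV f"
  shows "mi_deriv (count_list is) f = partials is f"
proof -
  let ?js = "SOME js. \<forall>i. count_list js i = count_list is i"
  have "\<forall>i. count_list ?js i = count_list is i"
    by (rule someI_ex[where P = "\<lambda>js. \<forall>i. count_list js i = count_list is i"]) blast
  then have "mset ?js = mset is" by (intro multiset_eqI) (simp add: count_mset)
  then show ?thesis unfolding mi_deriv_def by (rule partials_cong_mset[OF assms])
qed

lemma multi_index_list_exists: obtains "is" where "count_list is = (\<nu> :: 'n::finite \<Rightarrow> nat)"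
proof -
  obtain "is" where "mset is = (\<Sum>i\<in>UNIV. replicate_mset (\<nu> i) i)" using ex_mset by blast
  then have "count (mset is) j = \<nu> j" for j
    by (simp add: count_sum)
  then show thesis by (intro that[of "is"]) (auto simp: count_mset)
qed

lemma mi_order_count_list: "mi_order (count_list is) = length is"
  unfolding mi_order_def by (simp add: sum_count_set)

section \<open>Locally integrable Borel functions\<close>

text \<open>
  Local integrability of Borel functions with respect to \<open>lborel\<close>. Borel measurability passes to
  compositions with continuous maps, which Lebesgue measurability does not, and Borel functions of
  two variables are accessible to Fubini's theorem. Up to null sets every locally integrable
  function is of this kind (\<open>borel_representative\<close>).
\<close>
definition loc_int :: "(real^'n::finite) set \<Rightarrow> (real^'n \<Rightarrow> real) \<Rightarrow> bool"
  where "loc_int \<Omega> f \<longleftrightarrow> f \<in> borel_measurable borel \<and>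
    (\<forall>K. compact K \<and> K \<subseteq> \<Omega> \<longrightarrow> integrable lborel (\<lambda>x. indicator K x * f x))"

lemma loc_int_measurable: "loc_int \<Omega> f \<Longrightarrow> f \<in> borel_measurable borel"
  by (simp add: loc_int_def)

lemma loc_int_mono: "loc_int \<Omega> f \<Longrightarrow> V \<subseteq> \<Omega> \<Longrightarrow> loc_int V f"
  by (auto simp: loc_int_def)

lemma loc_int_bounded_mult:
  assumes f: "loc_int \<Omega> f" and w: "w \<in> borel_measurable borel" "\<And>x. \<bar>w x\<bar> \<le> B"
    and C: "compact C" "C \<subseteq> \<Omega>" "\<And>x. x \<notin> C \<Longrightarrow> w x = 0"
  shows "integrable lborel (\<lambda>x. f x * w x)"
proof (rule Bochner_Integration.integrable_bound)
  show "integrable lborel (\<lambda>x. B * (indicator C x * f x))"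
    using f C by (auto simp: loc_int_def)
  show "(\<lambda>x. f x * w x) \<in> borel_measurable lborel"
    using w loc_int_measurable[OF f] by auto
  show "AE x in lborel. norm (f x * w x) \<le> norm (B * (indicator C x * f x))"
  proof (rule AE_I2)
    fix x
    have "\<bar>f x\<bar> * \<bar>w x\<bar> \<le> \<bar>f x\<bar> * \<bar>B\<bar>" using w(2)[of x] by (intro mult_left_mono) auto
    then show "norm (f x * w x) \<le> norm (B * (indicator C x * f x))"
      using C(3)[of x] by (cases "x \<in> C") (auto simp: abs_mult mult.commute)
  qed
qed

lemma loc_int_mult_test:
  assumes f: "loc_int \<Omega> f" and \<xi>: "\<xi> \<in> test_functions \<Omega>"
  shows "integrable lborel (\<lambda>x. f x * \<xi> x)"
proof -
  obtain B where B: "\<And>x. \<bar>\<xi> x\<bar> \<le> B" using test_functions_bounded[OF \<xi>] by metis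
  obtain C where "compact C" "C \<subseteq> \<Omega>" "\<And>x. x \<notin> C \<Longrightarrow> \<xi> x = 0" using test_functions_support[OF \<xi>] by blast
  then show ?thesis by (intro loc_int_bounded_mult[OF f test_functions_measurable[OF \<xi>] B])
qed

text \<open>
  The indicator of a compact set is dominated by a bump function.
\<close>
lemma loc_intI_test:
  assumes f: "f \<in> borel_measurable borel" and \<Omega>: "open \<Omega>"
    and int: "\<And>\<xi>. \<xi> \<in> test_functions \<Omega> \<Longrightarrow> integrable lborel (\<lambda>x. f x * \<xi> x)"
  shows "loc_int \<Omega> f"
  unfolding loc_int_def
proof (intro conjI allI impI f)
  fix K assume K: "compact K \<and> K \<subseteq> \<Omega>"
  then obtain \<xi> where \<xi>: "\<xi> \<in> test_functions \<Omega>" "\<And>x. x \<in> K \<Longrightarrow> \<xi> x = 1"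
    using bump_function_exists[of K \<Omega>] \<Omega> by metis
  show "integrable lborel (\<lambda>x. indicator K x * f x)"
  proof (rule Bochner_Integration.integrable_bound[OF int[OF \<xi>(1)]])
    show "(\<lambda>x. indicator K x * f x) \<in> borel_measurable lborel"
      using f K by (auto intro!: borel_measurable_times borel_measurable_indicator borel_compact)
  qed (auto simp: indicator_def \<xi>(2))
qed

lemma loc_int_continuous:
  assumes "open \<Omega>" "f \<in> borel_measurable borel" "continuous_on \<Omega> f"
  shows "loc_int \<Omega> f"
  unfolding loc_int_def
proof (intro conjI allI impI assms)
  fix K assume "compact K \<and> K \<subseteq> \<Omega>"
  then show "integrable lborel (\<lambda>x. indicator K x * f x)"
    using borel_integrable_compact[of K f] assms(3) by (auto simp: indicator_def intro: continuous_on_subset)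
qed

lemma loc_int_add: "loc_int \<Omega> f \<Longrightarrow> loc_int \<Omega> g \<Longrightarrow> loc_int \<Omega> (\<lambda>x. f x + g x)"
  by (auto simp: loc_int_def distrib_left)

lemma loc_int_0: "loc_int \<Omega> (\<lambda>x. 0)"
  by (auto simp: loc_int_def)

lemma loc_int_sum: "finite J \<Longrightarrow> (\<And>j. j \<in> J \<Longrightarrow> loc_int \<Omega> (f j)) \<Longrightarrow> loc_int \<Omega> (\<lambda>x. \<Sum>j\<in>J. f j x)"
  by (induction J rule: finite_induct) (auto simp: loc_int_0 intro: loc_int_add)

lemma loc_int_mult_continuous:
  assumes "loc_int \<Omega> f" "a \<in> borel_measurable borel" "continuous_on \<Omega> a"
  shows "loc_int \<Omega> (\<lambda>x. a x * f x)"
  unfolding loc_int_def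
proof (intro conjI allI impI)
  show "(\<lambda>x. a x * f x) \<in> borel_measurable borel" using assms(2) loc_int_measurable[OF assms(1)] by auto
  fix K assume K: "compact K \<and> K \<subseteq> \<Omega>"
  then have "bounded (a ` K)"
    using assms(3) by (intro compact_imp_bounded compact_continuous_image) (auto intro: continuous_on_subset)
  then obtain B where B: "B > 0" "\<And>x. x \<in> K \<Longrightarrow> \<bar>a x\<bar> \<le> B" unfolding bounded_pos by auto
  have "integrable lborel (\<lambda>x. f x * (indicator K x * a x))"
    using K B assms(2) by (intro loc_int_bounded_mult[OF assms(1), of _ B K]) (auto split: split_indicator intro!: borel_measurable_times borel_measurable_indicator borel_compact)
  then show "integrable lborel (\<lambda>x. indicator K x * (a x * f x))" by (simp add: mult_ac)
qed

lemma open_compact_exhaustion: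
  fixes U :: "(real^'n::finite) set"
  assumes "open U"
  shows "\<exists>C :: nat \<Rightarrow> (real^'n) set. (\<forall>m. compact (C m)) \<and> (\<forall>m. C m \<subseteq> U) \<and> incseq C \<and> (\<Union>m. C m) = U"
proof -
  \<comment> \<open>Points of norm at most \<open>m\<close> whose distance to the complement of \<open>U\<close> is at least
    \<open>1 / (m + 1)\<close>.\<close>
  define C where "C m = cball 0 (real m) - (\<Union>y\<in>-U. ball y (inverse (real (Suc m))))" for m
  have "C m \<subseteq> U" for m unfolding C_def by force
  moreover have "compact (C m)" for m unfolding C_def by (intro compact_diff) auto
  moreover have "incseq C"
  proof (rule incseq_SucI)
    fix m
    have "ball y (inverse (real (Suc (Suc m)))) \<subseteq> ball y (inverse (real (Suc m)))" for y :: "real^'n"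
      by (intro subset_ball le_imp_inverse_le) auto
    then show "C m \<subseteq> C (Suc m)" unfolding C_def by fastforce
  qed
  moreover have "x \<in> (\<Union>m. C m)" if x: "x \<in> U" for x
  proof -
    obtain e where e: "e > 0" "ball x e \<subseteq> U" using assms x open_contains_ball by blast
    obtain m where m: "inverse (real (Suc m)) < e" using reals_Archimedean[OF e(1)] by blast
    define k where "k = max m (nat \<lceil>norm x\<rceil>)"
    have k: "norm x \<le> real k" "inverse (real (Suc k)) < e"
    proof -
      show "norm x \<le> real k" unfolding k_def by linarith
      have "inverse (real (Suc k)) \<le> inverse (real (Suc m))" unfolding k_def by (intro le_imp_inverse_le) auto
      with m show "inverse (real (Suc k)) < e" by (rule le_less_trans[rotated])
    qed
    have "x \<notin> ball y (inverse (real (Suc k)))" if "y \<notin> U" for y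
    proof
      assume "x \<in> ball y (inverse (real (Suc k)))"
      then have "y \<in> ball x e" using k(2) by (simp add: dist_commute)
      with e(2) that show False by blast
    qed
    then have "x \<in> C k" using k(1) by (auto simp: C_def)
    then show ?thesis by blast
  qed
  ultimately show ?thesis by (intro exI[of _ C]) blast
qed

section \<open>The fundamental lemma of the calculus of variations\<close>

text \<open>
  The indicator of \<open>U\<close> is the pointwise limit of test functions with values in \<open>[0, 1]\<close>.
\<close>
lemma integral_indicator_open_eq_0:
  fixes h :: "real^'n::finite \<Rightarrow> real"
  assumes h: "integrable lborel h" and 0: "\<And>\<xi>. \<xi> \<in> test_functions UNIV \<Longrightarrow> (LINT x|lborel. h x * \<xi> x) = 0"
    and U: "open U"
  shows "(LINT x|lborel. indicator U x * h x) = 0"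
proof -
  obtain C :: "nat \<Rightarrow> (real^'n) set" where C: "\<And>m. compact (C m)" "\<And>m. C m \<subseteq> U" "incseq C" "(\<Union>m. C m) = U"
    using open_compact_exhaustion[OF U] by blast
  have "\<exists>\<xi>. \<xi> \<in> test_functions U \<and> (\<forall>x\<in>C m. \<xi> x = 1) \<and> (\<forall>x. 0 \<le> \<xi> x \<and> \<xi> x \<le> 1)" for m
    using bump_function_exists[OF C(1) U C(2)] by metis
  then obtain \<xi> where \<xi>: "\<And>m. \<xi> m \<in> test_functions U" "\<And>m x. x \<in> C m \<Longrightarrow> \<xi> m x = 1"
    "\<And>m x. 0 \<le> \<xi> m x" "\<And>m x. \<xi> m x \<le> 1" by metis
  have lim: "(\<lambda>m. LINT x|lborel. h x * \<xi> m x) \<longlonglongrightarrow> (LINT x|lborel. indicator U x * h x)"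
  proof (rule integral_dominated_convergence[where w = "\<lambda>x. \<bar>h x\<bar>"])
    show "(\<lambda>x. indicator U x * h x) \<in> borel_measurable lborel" using h U by auto
    show "(\<lambda>x. h x * \<xi> m x) \<in> borel_measurable lborel" for m
      using h test_functions_measurable[OF \<xi>(1)[of m]] by auto
    show "integrable lborel (\<lambda>x. \<bar>h x\<bar>)" using h by auto
    show "AE x in lborel. norm (h x * \<xi> m x) \<le> \<bar>h x\<bar>" for m
      using \<xi>(3,4)[of m] by (intro AE_I2) (auto simp: abs_mult mult_left_le)
    show "AE x in lborel. (\<lambda>m. h x * \<xi> m x) \<longlonglongrightarrow> indicator U x * h x"
    proof (rule AE_I2)
      fix x
      show "(\<lambda>m. h x * \<xi> m x) \<longlonglongrightarrow> indicator U x * h x"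
      proof (cases "x \<in> U")
        case True
        then obtain N where "x \<in> C N" using C(4) by blast
        then have "\<xi> m x = 1" if "m \<ge> N" for m using C(3) that \<xi>(2)[of x m] by (auto simp: incseq_def)
        then have "\<forall>\<^sub>F m in sequentially. h x * \<xi> m x = indicator U x * h x"
          using True by (auto simp: eventually_sequentially)
        then show ?thesis by (rule tendsto_eventually)
      next
        case False
        then show ?thesis using test_functions_zero[OF \<xi>(1)] by simp
      qed
    qed
  qed
  have "(LINT x|lborel. h x * \<xi> m x) = 0" for m using 0 \<xi>(1)[of m] test_functions_mono[of _ U UNIV] by auto
  with lim show ?thesis by (simp add: LIMSEQ_const_iff)
qed

text \<open>
  The positive and the negative part of \<open>h\<close> are densities of finite measures that agree on open
  sets, hence on all Borel sets; so they agree almost everywhere, and both vanish.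
\<close>
lemma AE_eq_0_if_test_integrals_0:
  fixes h :: "real^'n::finite \<Rightarrow> real"
  assumes h: "integrable lborel h" and 0: "\<And>\<xi>. \<xi> \<in> test_functions UNIV \<Longrightarrow> (LINT x|lborel. h x * \<xi> x) = 0"
  shows "AE x in lborel. h x = 0"
proof -
  have [measurable]: "h \<in> borel_measurable borel" using h by auto
  have fin: "(\<integral>\<^sup>+x. ennreal (h x) \<partial>lborel) \<noteq> \<infinity>" "(\<integral>\<^sup>+x. ennreal (- h x) \<partial>lborel) \<noteq> \<infinity>"
    using h by (auto simp: real_integrable_def)
  \<comment> \<open>\<open>ennreal\<close> cuts off at \<open>0\<close>, so these are the densities given by the positive and the negative
    part.\<close>
  have "density lborel (\<lambda>x. ennreal (h x)) = density lborel (\<lambda>x. ennreal (- h x))"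
  proof (rule measure_eqI_generator_eq[where E = "Collect open" and \<Omega> = UNIV and A = "\<lambda>_. UNIV"])
    show "Int_stable (Collect open :: (real^'n) set set)" by (auto simp: Int_stable_def)
    show "sets (density lborel (\<lambda>x. ennreal (h x))) = sigma_sets UNIV (Collect open)"
      "sets (density lborel (\<lambda>x. ennreal (- h x))) = sigma_sets UNIV (Collect open)"
      by (simp_all add: borel_def)
    show "emeasure (density lborel (\<lambda>x. ennreal (h x))) UNIV \<noteq> \<infinity>"
      using fin by (simp add: emeasure_density)
    fix U :: "(real^'n) set" assume "U \<in> Collect open"
    then have U: "open U" and [measurable]: "U \<in> sets borel" by auto
    have int: "integrable lborel (\<lambda>x. indicator U x * h x)"
      using h integrable_real_mult_indicator[of U lborel h] by (simp add: mult.commute)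
    have "(\<integral>\<^sup>+x. ennreal (indicator U x * h x) \<partial>lborel) = (\<integral>\<^sup>+x. ennreal (- (indicator U x * h x)) \<partial>lborel)"
      using integral_indicator_open_eq_0[OF h 0 U] int
      unfolding real_lebesgue_integral_def[OF int] real_integrable_def
      by (auto simp: ennreal_enn2real_if less_top[symmetric] dest!: arg_cong[where f = ennreal])
    moreover have "ennreal (indicator U x * h x) = ennreal (h x) * indicator U x"
      "ennreal (- (indicator U x * h x)) = ennreal (- h x) * indicator U x" for x
      by (auto simp: indicator_def)
    ultimately show "emeasure (density lborel (\<lambda>x. ennreal (h x))) U = emeasure (density lborel (\<lambda>x. ennreal (- h x))) U"
      by (simp add: emeasure_density)
  qed auto
  then have "AE x in lborel. ennreal (h x) = ennreal (- h x)"
    using fin by (subst (asm) finite_density_unique) auto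
  then show ?thesis
  proof (rule AE_mp, intro AE_I2 impI)
    fix x assume "ennreal (h x) = ennreal (- h x)"
    then show "h x = 0" by (cases "h x" "0::real" rule: linorder_cases) (auto simp: ennreal_neg)
  qed
qed

text \<open>
  Multiplication with bump functions that equal \<open>1\<close> on the sets of a compact exhaustion reduces
  this to integrable functions on the whole space.
\<close>
lemma AE_eq_if_test_integrals_eq:
  fixes f g :: "real^'n::finite \<Rightarrow> real"
  assumes \<Omega>: "open \<Omega>" and f: "loc_int \<Omega> f" and g: "loc_int \<Omega> g"
    and eq: "\<And>\<xi>. \<xi> \<in> test_functions \<Omega> \<Longrightarrow> (LINT x|lborel. f x * \<xi> x) = (LINT x|lborel. g x * \<xi> x)"
  shows "AE x in lborel. x \<in> \<Omega> \<longrightarrow> f x = g x"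
proof -
  obtain C :: "nat \<Rightarrow> (real^'n) set" where C: "\<And>m. compact (C m)" "\<And>m. C m \<subseteq> \<Omega>" "(\<Union>m. C m) = \<Omega>"
    using open_compact_exhaustion[OF \<Omega>] by blast
  have "AE x in lborel. x \<in> C m \<longrightarrow> f x = g x" for m
  proof -
    obtain a where a: "a \<in> test_functions \<Omega>" "\<And>x. x \<in> C m \<Longrightarrow> a x = 1"
      using bump_function_exists[OF C(1) \<Omega> C(2)] by metis
    note fa = loc_int_mult_test[OF f a(1)] and ga = loc_int_mult_test[OF g a(1)]
    have "AE x in lborel. f x * a x - g x * a x = 0"
    proof (rule AE_eq_0_if_test_integrals_0)
      show "integrable lborel (\<lambda>x. f x * a x - g x * a x)" using fa ga by auto
      fix \<xi> :: "real^'n \<Rightarrow> real" assume "\<xi> \<in> test_functions UNIV"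
      then have t: "(\<lambda>x. a x * \<xi> x) \<in> test_functions \<Omega>"
        using a(1) by (auto intro: test_functions_mult test_functions_smooth)
      have "(LINT x|lborel. (f x * a x - g x * a x) * \<xi> x) = (LINT x|lborel. f x * (a x * \<xi> x) - g x * (a x * \<xi> x))"
        by (simp add: algebra_simps)
      also have "\<dots> = 0"
        using loc_int_mult_test[OF f t] loc_int_mult_test[OF g t] eq[OF t] by simp
      finally show "(LINT x|lborel. (f x * a x - g x * a x) * \<xi> x) = 0" .
    qed
    then show ?thesis by (rule AE_mp) (use a(2) in auto)
  qed
  then have "AE x in lborel. \<forall>m. x \<in> C m \<longrightarrow> f x = g x" unfolding AE_all_countable by blast
  then show ?thesis by (rule AE_mp) (use C(3) in blast)
qed

lemma lborel_integral_translate: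
  fixes f :: "real^'n::finite \<Rightarrow> real"
  assumes "f \<in> borel_measurable borel"
  shows "(LINT x|lborel. f (v + x)) = (LINT x|lborel. f x)"
  using integral_distr[of "(+) v" lborel borel f] assms unfolding lborel_distr_plus by simp

lemma lborel_integrable_translate:
  fixes f :: "real^'n::finite \<Rightarrow> real"
  assumes "integrable lborel f"
  shows "integrable lborel (\<lambda>x. f (v + x))"
  using integrable_distr[of "(+) v" lborel borel f] assms unfolding lborel_distr_plus by simp

lemma lborel_nn_integral_translate:
  fixes f :: "real^'n::finite \<Rightarrow> ennreal"
  assumes "f \<in> borel_measurable borel"
  shows "(\<integral>\<^sup>+x. f (v + x) \<partial>lborel) = (\<integral>\<^sup>+x. f x \<partial>lborel)"
  using nn_integral_distr[of "(+) v" lborel borel f] assms unfolding lborel_distr_plus by simp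

text \<open>
  By translation invariance the difference quotients of \<open>f\<close> have integral zero. They converge
  boundedly to the derivative, with supports in one compact set.
\<close>
lemma integral_partial_eq_0:
  fixes f :: "real^'n::finite \<Rightarrow> real"
  assumes f: "f \<in> test_functions UNIV"
  shows "(LINT x|lborel. partial i f x) = 0"
proof -
  let ?t = "\<lambda>m. inverse (real (Suc m))"
  let ?d = "\<lambda>m x. (f (?t m *\<^sub>R axis i 1 + x) - f x) / ?t m"
  obtain B where B: "B > 0" "\<And>x. \<bar>partial i f x\<bar> \<le> B" using test_functions_bounded[OF test_functions_partial[OF f]] by metis
  obtain C where C: "compact C" "\<And>x. x \<notin> C \<Longrightarrow> f x = 0" using test_functions_support[OF f] by blast
  \<comment> \<open>The supports of all difference quotients with step at most \<open>1\<close> lie in \<open>C'\<close>.\<close>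
  define C' where "C' = (\<lambda>(x, s). x - s *\<^sub>R axis i 1) ` (C \<times> {0..1})"
  have C': "compact C'" unfolding C'_def
    using C(1) by (intro compact_continuous_image compact_Times) (auto intro!: continuous_intros simp: case_prod_beta)
  have diff: "f differentiable (at x)" for x
    using test_functions_smooth[OF f] smooth_on_differentiable by blast
  have lim: "(\<lambda>m. LINT x|lborel. ?d m x) \<longlonglongrightarrow> (LINT x|lborel. partial i f x)"
  proof (rule integral_dominated_convergence[where w = "\<lambda>x. B * indicator C' x"])
    show "partial i f \<in> borel_measurable lborel"
      using test_functions_measurable[OF test_functions_partial[OF f]] by simp
    show "?d m \<in> borel_measurable lborel" for m using test_functions_measurable[OF f] by auto
    show "integrable lborel (\<lambda>x. B * indicator C' x)"
      using borel_integrable_compact[OF C', of "\<lambda>x. B"] by (simp add: indicator_def if_distrib cong: if_cong)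
    show "AE x in lborel. (\<lambda>m. ?d m x) \<longlonglongrightarrow> partial i f x"
    proof (rule AE_I2)
      fix x
      have "((\<lambda>t. f (x + t *\<^sub>R axis i 1)) has_real_derivative partial i f x) (at 0)"
        using DERIV_along_axis[of f x 0 i, OF diff] by simp
      then have "((\<lambda>h. (f (x + h *\<^sub>R axis i 1) - f x) / h) \<longlongrightarrow> partial i f x) (at 0)"
        by (simp add: has_field_derivative_iff)
      then have "(\<lambda>m. (f (x + ?t m *\<^sub>R axis i 1) - f x) / ?t m) \<longlonglongrightarrow> partial i f x"
        by (rule filterlim_compose) (auto simp: filterlim_at LIMSEQ_inverse_real_of_nat simp del: of_nat_Suc)
      then show "(\<lambda>m. ?d m x) \<longlonglongrightarrow> partial i f x" by (simp add: add.commute)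
    qed
    show "AE x in lborel. norm (?d m x) \<le> B * indicator C' x" for m
    proof (rule AE_I2)
      fix x
      have t: "?t m > 0" "?t m \<le> 1" by (auto simp: field_simps)
      show "norm (?d m x) \<le> B * indicator C' x"
      proof (cases "x \<in> C'")
        case True
        have "\<exists>z>0. z < ?t m \<and> f (x + ?t m *\<^sub>R axis i 1) - f (x + 0 *\<^sub>R axis i 1) = (?t m - 0) * partial i f (x + z *\<^sub>R axis i 1)"
          by (intro MVT2 t(1) DERIV_along_axis diff)
        then obtain z where "f (?t m *\<^sub>R axis i 1 + x) - f x = ?t m * partial i f (x + z *\<^sub>R axis i 1)" by (auto simp: add.commute)
        then have "?d m x = partial i f (x + z *\<^sub>R axis i 1)" using t(1) by (simp del: of_nat_Suc)
        then show ?thesis using B(2) True by simp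
      next
        case False
        have "x + s *\<^sub>R axis i 1 \<notin> C" if "0 \<le> s" "s \<le> 1" for s
        proof
          assume "x + s *\<^sub>R axis i 1 \<in> C"
          then have "(x + s *\<^sub>R axis i 1) - s *\<^sub>R axis i 1 \<in> C'" unfolding C'_def using that by force
          with False show False by simp
        qed
        from this[of 0] this[of "?t m"] t have "f x = 0" "f (?t m *\<^sub>R axis i 1 + x) = 0"
          by (auto intro!: C(2) simp: add.commute simp del: of_nat_Suc)
        with False show ?thesis by simp
      qed
    qed
  qed
  have "integrable lborel f"
  proof -
    have "(\<lambda>x. indicator C x *\<^sub>R f x) = f" using C(2) by (intro ext) (simp split: split_indicator)
    then show ?thesis using borel_integrable_compact[OF C(1) test_functions_continuous[OF f]] by simp
  qed
  then have "(LINT x|lborel. ?d m x) = 0" for m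
    using lborel_integrable_translate[of f "?t m *\<^sub>R axis i 1"] lborel_integral_translate[of f "?t m *\<^sub>R axis i 1"] by auto
  with lim show ?thesis by (simp add: LIMSEQ_const_iff)
qed

section \<open>Weak derivatives along lists\<close>

text \<open>
  Weak derivatives along lists of directions, in terms of \<open>lborel\<close>; on Borel functions this is
  \<open>is_weak_deriv\<close> for the counts of the list (\<open>is_weak_deriv_iff_wd\<close>).
\<close>
definition wd :: "(real^'n::finite) set \<Rightarrow> 'n list \<Rightarrow> (real^'n \<Rightarrow> real) \<Rightarrow> (real^'n \<Rightarrow> real) \<Rightarrow> bool"
  where "wd \<Omega> is f g \<longleftrightarrow> loc_int \<Omega> f \<and> loc_int \<Omega> g \<and>
    (\<forall>\<xi>\<in>test_functions \<Omega>. (LINT x|lborel. f x * partials is \<xi> x) = (- 1) ^ length is * (LINT x|lborel. g x * \<xi> x))"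

lemma wd_mono: "wd \<Omega> is f g \<Longrightarrow> V \<subseteq> \<Omega> \<Longrightarrow> wd V is f g"
  by (auto simp: wd_def intro: loc_int_mono dest: test_functions_mono)

lemma wd_unique:
  assumes "open \<Omega>" "wd \<Omega> is f g" "wd \<Omega> is f g'"
  shows "AE x in lborel. x \<in> \<Omega> \<longrightarrow> g x = g' x"
  using assms by (intro AE_eq_if_test_integrals_eq) (auto simp: wd_def)

lemma wd_Nil: "loc_int \<Omega> f \<Longrightarrow> wd \<Omega> [] f f"
  by (simp add: wd_def)

text \<open>
  Test with the derivatives of test functions:
  \<open>partials (is @ [j]) \<xi> = partials is (partial j \<xi>)\<close>.
\<close>
lemma wd_append_first:
  assumes "wd \<Omega> is f g" "wd \<Omega> (is @ [j]) f g'"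
  shows "wd \<Omega> [j] g g'"
proof -
  have "(LINT x|lborel. g x * partial j \<xi> x) = - (LINT x|lborel. g' x * \<xi> x)" if \<xi>: "\<xi> \<in> test_functions \<Omega>" for \<xi>
  proof -
    have "(- 1) ^ length is * (LINT x|lborel. g x * partial j \<xi> x) = (LINT x|lborel. f x * partials is (partial j \<xi>) x)"
      using assms(1) test_functions_partial[OF \<xi>] by (simp add: wd_def)
    also have "\<dots> = (- 1) ^ length is * - (LINT x|lborel. g' x * \<xi> x)"
      using assms(2) \<xi> by (simp add: wd_def partials_append partials_Cons)
    finally show ?thesis by (simp only: mult_cancel_left) auto
  qed
  then show ?thesis using assms by (simp add: wd_def partials_Cons)
qed

lemma wd_append:
  assumes "wd \<Omega> is f g" "wd \<Omega> [j] g g'"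
  shows "wd \<Omega> (is @ [j]) f g'"
  using assms by (auto simp: wd_def partials_append partials_Cons test_functions_partial)

lemma wd_0: "wd \<Omega> is (\<lambda>x. 0) (\<lambda>x. 0)"
  by (simp add: wd_def loc_int_0)

lemma wd_add:
  assumes "wd \<Omega> is f g" "wd \<Omega> is f' g'"
  shows "wd \<Omega> is (\<lambda>x. f x + f' x) (\<lambda>x. g x + g' x)"
  unfolding wd_def
proof (intro conjI ballI)
  show "loc_int \<Omega> (\<lambda>x. f x + f' x)" "loc_int \<Omega> (\<lambda>x. g x + g' x)"
    using assms by (auto simp: wd_def intro: loc_int_add)
  fix \<xi> assume \<xi>: "\<xi> \<in> test_functions \<Omega>"
  then have p: "partials is \<xi> \<in> test_functions \<Omega>" by (rule test_functions_partials)
  have i: "integrable lborel (\<lambda>x. f x * partials is \<xi> x)" "integrable lborel (\<lambda>x. f' x * partials is \<xi> x)"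
    "integrable lborel (\<lambda>x. g x * \<xi> x)" "integrable lborel (\<lambda>x. g' x * \<xi> x)"
    using assms p \<xi> by (auto simp: wd_def intro: loc_int_mult_test)
  show "(LINT x|lborel. (f x + f' x) * partials is \<xi> x) = (- 1) ^ length is * (LINT x|lborel. (g x + g' x) * \<xi> x)"
    using assms \<xi> i by (simp add: wd_def distrib_right distrib_left)
qed

section \<open>Lebesgue measurable functions and their Borel representatives\<close>

lemma AE_eq_lebesgue_measurable:
  fixes f g :: "real^'n::finite \<Rightarrow> real"
  assumes f: "f \<in> borel_measurable lebesgue" and ae: "AE x in lebesgue. f x = g x"
  shows "g \<in> borel_measurable lebesgue"
proof (rule measurableI)
  fix B :: "real set" assume B: "B \<in> sets borel"
  show "g -` B \<inter> space lebesgue \<in> sets lebesgue"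
  proof (rule completion.in_sets_AE)
    show "f -` B \<inter> space lebesgue \<in> sets lebesgue" using f B by (rule measurable_sets)
    show "AE x in lebesgue. (x \<in> f -` B \<inter> space lebesgue) = (x \<in> g -` B \<inter> space lebesgue)"
      using ae by eventually_elim auto
  qed auto
qed simp

lemma integrable_lebesgue_on_iff:
  fixes f :: "real^'n::finite \<Rightarrow> real"
  assumes "K \<in> sets lebesgue"
  shows "integrable (lebesgue_on K) f \<longleftrightarrow> integrable lebesgue (\<lambda>x. indicator K x * f x)"
  using assms by (subst integrable_restrict_space) auto

lemma locally_integrable_cong_AE:
  fixes f g :: "real^'n::finite \<Rightarrow> real"
  assumes ae: "AE x in lebesgue. x \<in> \<Omega> \<longrightarrow> f x = g x" and f: "locally_integrable \<Omega> f"
  shows "locally_integrable \<Omega> g"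
  unfolding locally_integrable_def
proof (intro allI impI)
  fix K assume K: "compact K \<and> K \<subseteq> \<Omega>"
  then have K': "K \<in> sets lebesgue" using borel_compact[of K] by simp
  have i: "integrable lebesgue (\<lambda>x. indicator K x * f x)"
    using f K integrable_lebesgue_on_iff[OF K'] by (auto simp: locally_integrable_def)
  have e: "AE x in lebesgue. indicator K x * f x = indicator K x * g x"
    using ae by eventually_elim (use K in \<open>auto simp: indicator_def\<close>)
  have "integrable lebesgue (\<lambda>x. indicator K x * g x)"
    by (rule integrable_cong_AE_imp[OF i AE_eq_lebesgue_measurable[OF borel_measurable_integrable[OF i] e] e])
  then show "integrable (lebesgue_on K) g" using integrable_lebesgue_on_iff[OF K'] by blast
qed

lemma loc_int_iff:
  fixes f :: "real^'n::finite \<Rightarrow> real"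
  assumes f: "f \<in> borel_measurable borel"
  shows "locally_integrable \<Omega> f \<longleftrightarrow> loc_int \<Omega> f"
proof -
  have "integrable (lebesgue_on K) f \<longleftrightarrow> integrable lborel (\<lambda>x. indicator K x * f x)" if "compact K" for K
  proof -
    have K: "K \<in> sets borel" using that by (rule borel_compact)
    have "(\<lambda>x. indicator K x * f x) \<in> borel_measurable lborel" using K f by auto
    with K show ?thesis by (simp add: integrable_lebesgue_on_iff integrable_completion)
  qed
  then show ?thesis using f by (auto simp: locally_integrable_def loc_int_def)
qed

lemma locally_integrable_measurable:
  fixes f :: "real^'n::finite \<Rightarrow> real"
  assumes \<Omega>: "open \<Omega>" and f: "locally_integrable \<Omega> f"
  shows "(\<lambda>x. indicator \<Omega> x * f x) \<in> borel_measurable lebesgue"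
proof -
  obtain C :: "nat \<Rightarrow> (real^'n) set" where C: "\<And>m. compact (C m)" "\<And>m. C m \<subseteq> \<Omega>" "incseq C" "(\<Union>m. C m) = \<Omega>"
    using open_compact_exhaustion[OF \<Omega>] by blast
  show ?thesis
  proof (rule borel_measurable_LIMSEQ_real)
    show "(\<lambda>x. indicator (C m) x * f x) \<in> borel_measurable lebesgue" for m
    proof -
      have "C m \<in> sets lebesgue" using borel_compact[OF C(1)] by simp
      then have "integrable lebesgue (\<lambda>x. indicator (C m) x * f x)"
        using f C(1,2) by (simp add: locally_integrable_def flip: integrable_lebesgue_on_iff)
      then show ?thesis by (rule borel_measurable_integrable)
    qed
    fix x
    show "(\<lambda>m. indicator (C m) x * f x) \<longlonglongrightarrow> indicator \<Omega> x * f x"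
    proof (cases "x \<in> \<Omega>")
      case True
      then obtain N where "x \<in> C N" using C(4) by blast
      then have "x \<in> C m" if "m \<ge> N" for m using C(3) that by (auto simp: incseq_def)
      then have "\<forall>\<^sub>F m in sequentially. indicator (C m) x * f x = indicator \<Omega> x * f x"
        using True by (intro eventually_sequentiallyI[of N]) simp
      then show ?thesis by (rule tendsto_eventually)
    next
      case False
      then have "x \<notin> C m" for m using C(2) by blast
      with False show ?thesis by simp
    qed
  qed
qed

text \<open>
  The restriction of \<open>f\<close> to \<open>\<Omega>\<close> is Lebesgue measurable as a limit along a compact exhaustion, and
  Lebesgue measurable functions are almost everywhere equal to Borel functions.
\<close>
lemma borel_representative:
  fixes f :: "real^'n::finite \<Rightarrow> real"
  assumes \<Omega>: "open \<Omega>" and f: "locally_integrable \<Omega> f"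
  shows "\<exists>f0. loc_int \<Omega> f0 \<and> (AE x in lebesgue. x \<in> \<Omega> \<longrightarrow> f x = f0 x)"
proof -
  obtain f0 where f0: "f0 \<in> borel_measurable lborel" "AE x in lborel. indicator \<Omega> x * f x = f0 x"
    using completion_ex_borel_measurable_real[OF locally_integrable_measurable[OF \<Omega> f]] by blast
  have ae: "AE x in lebesgue. x \<in> \<Omega> \<longrightarrow> f x = f0 x"
    using AE_completion[OF f0(2)] by eventually_elim (auto simp: indicator_def)
  have "loc_int \<Omega> f0"
    using locally_integrable_cong_AE[OF ae f] loc_int_iff[of f0 \<Omega>] f0(1) by simp
  with ae show ?thesis by blast
qed

lemma integral_lebesgue_on_cong_AE:
  fixes f g \<eta> :: "real^'n::finite \<Rightarrow> real"
  assumes \<Omega>: "open \<Omega>" and ae: "AE x in lebesgue. x \<in> \<Omega> \<longrightarrow> f x = g x" and f: "locally_integrable \<Omega> f"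
    and \<eta>: "\<eta> \<in> borel_measurable borel"
  shows "(LINT x|lebesgue_on \<Omega>. f x * \<eta> x) = (LINT x|lebesgue_on \<Omega>. g x * \<eta> x)"
proof -
  have \<eta>': "\<eta> \<in> borel_measurable lebesgue" by (rule measurable_completion) (simp add: \<eta>)
  have m: "(\<lambda>x. (indicator \<Omega> x * f x) * \<eta> x) \<in> borel_measurable lebesgue"
    "(\<lambda>x. (indicator \<Omega> x * g x) * \<eta> x) \<in> borel_measurable lebesgue"
    using locally_integrable_measurable[OF \<Omega> f] locally_integrable_measurable[OF \<Omega> locally_integrable_cong_AE[OF ae f]] \<eta>'
    by (auto intro!: borel_measurable_times simp del: indicator_times_eq_if)
  have "(LINT x|lebesgue. (indicator \<Omega> x * f x) * \<eta> x) = (LINT x|lebesgue. (indicator \<Omega> x * g x) * \<eta> x)"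
    by (rule integral_cong_AE[OF m]) (use ae in \<open>eventually_elim, auto simp: indicator_def\<close>)
  then show ?thesis using \<Omega> by (simp add: integral_restrict_space mult.assoc)
qed

lemma integral_lebesgue_on_borel:
  fixes f \<eta> :: "real^'n::finite \<Rightarrow> real"
  assumes \<Omega>: "open \<Omega>" and "f \<in> borel_measurable borel" and \<eta>: "\<eta> \<in> test_functions \<Omega>"
  shows "(LINT x|lebesgue_on \<Omega>. f x * \<eta> x) = (LINT x|lborel. f x * \<eta> x)"
proof -
  have "(LINT x|lebesgue_on \<Omega>. f x * \<eta> x) = (LINT x|lebesgue. indicator \<Omega> x *\<^sub>R (f x * \<eta> x))"
    using \<Omega> by (simp add: integral_restrict_space)
  also have "(\<lambda>x. indicator \<Omega> x *\<^sub>R (f x * \<eta> x)) = (\<lambda>x. f x * \<eta> x)"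
    using test_functions_zero[OF \<eta>] by (intro ext) (simp split: split_indicator)
  also have "(LINT x|lebesgue. f x * \<eta> x) = (LINT x|lborel. f x * \<eta> x)"
    using assms(2) test_functions_measurable[OF \<eta>] by (intro integral_completion) auto
  finally show ?thesis .
qed

lemma mi_deriv_test_function:
  assumes "\<xi> \<in> test_functions \<Omega>" shows "mi_deriv \<nu> \<xi> \<in> test_functions \<Omega>"
proof -
  obtain "is" where "count_list is = \<nu>" by (rule multi_index_list_exists)
  then show ?thesis
    using mi_deriv_eq_partials[OF test_functions_smooth[OF assms], of "is"] test_functions_partials[OF assms, of "is"] by simp
qed

text \<open>
  Functions are not identified almost everywhere, so both the function and its weak derivative
  have to be exchanged explicitly when passing to Borel representatives.
\<close>
lemma is_weak_deriv_cong_AE: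
  fixes f g :: "real^'n::finite \<Rightarrow> real"
  assumes \<Omega>: "open \<Omega>" and f: "AE x in lebesgue. x \<in> \<Omega> \<longrightarrow> f x = f' x" and g: "AE x in lebesgue. x \<in> \<Omega> \<longrightarrow> g x = g' x"
    and w: "is_weak_deriv \<Omega> \<nu> f g"
  shows "is_weak_deriv \<Omega> \<nu> f' g'"
  unfolding is_weak_deriv_def
proof (intro conjI ballI)
  show "locally_integrable \<Omega> f'" "locally_integrable \<Omega> g'"
    using locally_integrable_cong_AE f g w by (auto simp: is_weak_deriv_def)
  fix \<xi> assume \<xi>: "\<xi> \<in> test_functions \<Omega>"
  show "(LINT x|lebesgue_on \<Omega>. f' x * mi_deriv \<nu> \<xi> x) = (- 1) ^ mi_order \<nu> * (LINT x|lebesgue_on \<Omega>. g' x * \<xi> x)"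
    using w \<xi> integral_lebesgue_on_cong_AE[OF \<Omega> f, of "mi_deriv \<nu> \<xi>"] integral_lebesgue_on_cong_AE[OF \<Omega> g, of \<xi>]
      test_functions_measurable[OF \<xi>] test_functions_measurable[OF mi_deriv_test_function[OF \<xi>]]
    by (simp add: is_weak_deriv_def)
qed

lemma AE_eq_sym: "AE x in M. P x \<longrightarrow> f x = g x \<Longrightarrow> AE x in M. P x \<longrightarrow> g x = f x"
  by (auto elim: eventually_mono)

lemma is_weak_deriv_iff_wd:
  fixes f g :: "real^'n::finite \<Rightarrow> real"
  assumes \<Omega>: "open \<Omega>" and f: "f \<in> borel_measurable borel" and g: "g \<in> borel_measurable borel"
  shows "is_weak_deriv \<Omega> (count_list is) f g \<longleftrightarrow> wd \<Omega> is f g"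
proof -
  have "(LINT x|lebesgue_on \<Omega>. f x * mi_deriv (count_list is) \<xi> x) = (LINT x|lborel. f x * partials is \<xi> x)"
    "(LINT x|lebesgue_on \<Omega>. g x * \<xi> x) = (LINT x|lborel. g x * \<xi> x)" if "\<xi> \<in> test_functions \<Omega>" for \<xi>
    using that integral_lebesgue_on_borel[OF \<Omega> f test_functions_partials] integral_lebesgue_on_borel[OF \<Omega> g]
    by (simp_all add: mi_deriv_eq_partials[OF test_functions_smooth])
  then show ?thesis
    by (auto simp: is_weak_deriv_def wd_def loc_int_iff f g mi_order_count_list)
qed

lemma is_weak_deriv_unique:
  fixes f g :: "real^'n::finite \<Rightarrow> real"
  assumes \<Omega>: "open \<Omega>" and g: "is_weak_deriv \<Omega> \<nu> f g" and g': "is_weak_deriv \<Omega> \<nu> f g'"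
  shows "AE x in lebesgue. x \<in> \<Omega> \<longrightarrow> g x = g' x"
proof -
  obtain "is" where "is": "count_list is = \<nu>" by (rule multi_index_list_exists)
  obtain f0 where f0: "loc_int \<Omega> f0" "AE x in lebesgue. x \<in> \<Omega> \<longrightarrow> f x = f0 x"
    using borel_representative[OF \<Omega>] g by (auto simp: is_weak_deriv_def)
  obtain g0 where g0: "loc_int \<Omega> g0" "AE x in lebesgue. x \<in> \<Omega> \<longrightarrow> g x = g0 x"
    using borel_representative[OF \<Omega>] g by (auto simp: is_weak_deriv_def)
  obtain g1 where g1: "loc_int \<Omega> g1" "AE x in lebesgue. x \<in> \<Omega> \<longrightarrow> g' x = g1 x"
    using borel_representative[OF \<Omega>] g' by (auto simp: is_weak_deriv_def)
  have "wd \<Omega> is f0 g0" "wd \<Omega> is f0 g1"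
    using is_weak_deriv_cong_AE[OF \<Omega> f0(2) g0(2) g] is_weak_deriv_cong_AE[OF \<Omega> f0(2) g1(2) g'] "is"
      is_weak_deriv_iff_wd[OF \<Omega>, of f0 _ "is"] f0(1) g0(1) g1(1) by (auto dest: loc_int_measurable)
  then have "AE x in lebesgue. x \<in> \<Omega> \<longrightarrow> g0 x = g1 x" by (intro AE_completion wd_unique[OF \<Omega>])
  with g0(2) g1(2) show ?thesis by eventually_elim auto
qed

section \<open>The Sobolev norm in terms of Borel functions\<close>

lemma sigma_finite_lebesgue: "sigma_finite_measure (lebesgue :: (real^'n::finite) measure)"
proof
  show "\<exists>A::(real^'n) set set. countable A \<and> A \<subseteq> sets lebesgue \<and> \<Union> A = space lebesgue \<and> (\<forall>a\<in>A. emeasure lebesgue a \<noteq> \<infinity>)"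
  proof (intro exI[of _ "range (\<lambda>n::nat. cball 0 (real n))"] conjI ballI)
    show "\<Union> (range (\<lambda>n. cball (0::real^'n) (real n))) = space lebesgue"
      using real_arch_simple by auto
    fix a assume "a \<in> range (\<lambda>n. cball (0::real^'n) (real n))"
    then obtain n where "a = cball 0 (real n)" by blast
    then show "emeasure lebesgue a \<noteq> \<infinity>"
      using emeasure_lborel_cball_finite[of "0 :: real^'n" "real n"] by simp
  qed auto
qed

lemma sigma_finite_lebesgue_on:
  "\<Omega> \<in> sets lebesgue \<Longrightarrow> sigma_finite_measure (lebesgue_on (\<Omega> :: (real^'n::finite) set))"
  by (intro sigma_finite_measure_restrict_space sigma_finite_lebesgue) auto

lemma Lp_norm_cong_AE:
  assumes "open \<Omega>" and "AE x in lebesgue. x \<in> \<Omega> \<longrightarrow> f x = g x"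
  shows "Lp_norm \<Omega> p f = Lp_norm \<Omega> p g"
proof -
  have "AE x in lebesgue_on \<Omega>. f x = g x" using assms by (subst AE_restrict_space_iff) auto
  then have "AE x in lebesgue_on \<Omega>. ennreal (\<bar>f x\<bar> powr p) = ennreal (\<bar>g x\<bar> powr p)" by eventually_elim simp
  then show ?thesis unfolding Lp_norm_def by (intro arg_cong[where f = "ennreal_root p"] nn_integral_cong_AE)
qed

text \<open>
  A null set \<open>N\<close> in one variable affects the double integral only on the null sets \<open>N \<times> \<Omega>\<close> and
  \<open>\<Omega> \<times> N\<close>.
\<close>
lemma gagliardo_cong_AE:
  fixes f g :: "real^'n::finite \<Rightarrow> real"
  assumes \<Omega>: "open \<Omega>" and ae: "AE x in lebesgue. x \<in> \<Omega> \<longrightarrow> f x = g x"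
  shows "gagliardo_seminorm \<Omega> \<theta> p f = gagliardo_seminorm \<Omega> \<theta> p g"
proof -
  interpret sigma_finite_measure "lebesgue_on \<Omega>" using \<Omega> by (intro sigma_finite_lebesgue_on) auto
  let ?M = "lebesgue_on \<Omega>"
  have "AE x in ?M. f x = g x" using ae \<Omega> by (subst AE_restrict_space_iff) auto
  then obtain N where N: "{x \<in> space ?M. f x \<noteq> g x} \<subseteq> N" "emeasure ?M N = 0" "N \<in> sets ?M" by (elim AE_E)
  have "N \<times> space ?M \<in> null_sets (?M \<Otimes>\<^sub>M ?M)" "space ?M \<times> N \<in> null_sets (?M \<Otimes>\<^sub>M ?M)"
    using N(2,3) by (auto simp: null_sets_def emeasure_pair_measure_Times)
  then have "N \<times> space ?M \<union> space ?M \<times> N \<in> null_sets (?M \<Otimes>\<^sub>M ?M)" by auto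
  moreover have "z \<in> N \<times> space ?M \<union> space ?M \<times> N"
    if "z \<in> space (?M \<Otimes>\<^sub>M ?M)" "\<not> (f (fst z) = g (fst z) \<and> f (snd z) = g (snd z))" for z
    using that N(1) by (auto simp: space_pair_measure)
  ultimately have "AE z in ?M \<Otimes>\<^sub>M ?M. f (fst z) = g (fst z) \<and> f (snd z) = g (snd z)"
    by (intro AE_I'[of "N \<times> space ?M \<union> space ?M \<times> N"]) auto
  then have "AE z in ?M \<Otimes>\<^sub>M ?M.
      (case z of (x, y) \<Rightarrow> ennreal (\<bar>f x - f y\<bar> powr p / norm (x - y) powr (real CARD('n) + \<theta> * p))) =
      (case z of (x, y) \<Rightarrow> ennreal (\<bar>g x - g y\<bar> powr p / norm (x - y) powr (real CARD('n) + \<theta> * p)))"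
    by eventually_elim (simp add: case_prod_beta)
  then show ?thesis unfolding gagliardo_seminorm_def by (intro arg_cong[where f = "ennreal_root p"] nn_integral_cong_AE)
qed

lemma nn_integral_lebesgue_on_borel:
  fixes F :: "real^'n::finite \<Rightarrow> ennreal"
  assumes "open \<Omega>"
  shows "(\<integral>\<^sup>+x. F x \<partial>lebesgue_on \<Omega>) = (\<integral>\<^sup>+x. indicator \<Omega> x * F x \<partial>lborel)"
  using assms by (simp add: nn_integral_restrict_space nn_integral_completion mult.commute)

lemma Lp_norm_borel:
  assumes "open \<Omega>"
  shows "Lp_norm \<Omega> p f = ennreal_root p (\<integral>\<^sup>+x. indicator \<Omega> x * ennreal (\<bar>f x\<bar> powr p) \<partial>lborel)"
  unfolding Lp_norm_def using assms by (simp add: nn_integral_lebesgue_on_borel)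

lemma measurable_ident_lebesgue_on: "(\<lambda>x. x) \<in> lebesgue_on \<Omega> \<rightarrow>\<^sub>M (borel :: (real^'n::finite) measure)"
  by (intro measurable_restrict_space1 measurable_completion) simp

text \<open>
  For Borel functions the double integral over the product of Lebesgue measures is an iterated
  integral with respect to \<open>lborel\<close>.
\<close>
lemma gagliardo_borel:
  fixes f :: "real^'n::finite \<Rightarrow> real"
  assumes \<Omega>: "open \<Omega>" and f: "f \<in> borel_measurable borel"
  shows "gagliardo_seminorm \<Omega> \<theta> p f = ennreal_root p (\<integral>\<^sup>+x. indicator \<Omega> x * (\<integral>\<^sup>+y. indicator \<Omega> y *
     ennreal (\<bar>f x - f y\<bar> powr p / norm (x - y) powr (real CARD('n) + \<theta> * p)) \<partial>lborel) \<partial>lborel)"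
proof -
  interpret sigma_finite_measure "lebesgue_on \<Omega>" using \<Omega> by (intro sigma_finite_lebesgue_on) auto
  let ?F = "\<lambda>(x, y). ennreal (\<bar>f x - f y\<bar> powr p / norm (x - y) powr (real CARD('n) + \<theta> * p))"
  have [measurable]: "f \<in> borel_measurable borel" by (rule f)
  have F: "?F \<in> borel_measurable (borel \<Otimes>\<^sub>M borel)" by measurable
  have "(\<lambda>z. z) \<in> lebesgue_on \<Omega> \<Otimes>\<^sub>M lebesgue_on \<Omega> \<rightarrow>\<^sub>M borel \<Otimes>\<^sub>M (borel :: (real^'n) measure)"
    using measurable_Pair[OF measurable_compose[OF measurable_fst measurable_ident_lebesgue_on]
        measurable_compose[OF measurable_snd measurable_ident_lebesgue_on]] by simp
  from measurable_compose[OF this F]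
  have "?F \<in> borel_measurable (lebesgue_on \<Omega> \<Otimes>\<^sub>M lebesgue_on \<Omega>)" by simp
  from nn_integral_fst[OF this]
  show ?thesis unfolding gagliardo_seminorm_def using \<Omega> by (simp add: nn_integral_lebesgue_on_borel)
qed

lemma sobolev_fun_norm_cong_AE:
  assumes \<Omega>: "open \<Omega>" and ae: "AE x in lebesgue. x \<in> \<Omega> \<longrightarrow> f x = g x"
  shows "sobolev_fun_norm \<Omega> s p f = sobolev_fun_norm \<Omega> s p g"
proof -
  have "is_weak_deriv \<Omega> \<nu> f h \<longleftrightarrow> is_weak_deriv \<Omega> \<nu> g h" for \<nu> h
    using is_weak_deriv_cong_AE[OF \<Omega> ae, of h h] is_weak_deriv_cong_AE[OF \<Omega> AE_eq_sym[OF ae], of h h] by auto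
  then have "is_weak_deriv \<Omega> \<nu> f = is_weak_deriv \<Omega> \<nu> g" for \<nu> by blast
  then show ?thesis unfolding sobolev_fun_norm_def by (simp only:)
qed

text \<open>
  By uniqueness of weak derivatives each infimum in \<open>sobolev_fun_norm\<close> is taken over a single
  value.
\<close>
lemma sobolev_fun_norm_eq:
  fixes f :: "real^'n::finite \<Rightarrow> real"
  assumes \<Omega>: "open \<Omega>" and k: "k = nat \<lfloor>s\<rfloor>" and \<theta>: "\<theta> = frac s"
    and G: "\<And>\<nu>. mi_order \<nu> \<le> k \<Longrightarrow> is_weak_deriv \<Omega> \<nu> f (G \<nu>)"
  shows "sobolev_fun_norm \<Omega> s p f = (\<Sum>\<nu> | mi_order \<nu> \<le> k. Lp_norm \<Omega> p (G \<nu>)) +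
    (if \<theta> = 0 then 0 else (\<Sum>\<nu> | mi_order \<nu> = k. gagliardo_seminorm \<Omega> \<theta> p (G \<nu>)))"
proof -
  have "{Lp_norm \<Omega> p g | g. is_weak_deriv \<Omega> \<nu> f g} = {Lp_norm \<Omega> p (G \<nu>)}"
    "{gagliardo_seminorm \<Omega> \<theta> p g | g. is_weak_deriv \<Omega> \<nu> f g} = {gagliardo_seminorm \<Omega> \<theta> p (G \<nu>)}"
    if "mi_order \<nu> \<le> k" for \<nu>
    using Lp_norm_cong_AE[OF \<Omega> is_weak_deriv_unique[OF \<Omega> _ G[OF that]], of _ p]
      gagliardo_cong_AE[OF \<Omega> is_weak_deriv_unique[OF \<Omega> _ G[OF that]], of _ \<theta> p] G[OF that] by blast+
  then show ?thesis
    unfolding sobolev_fun_norm_def Let_def k[symmetric] \<theta>[symmetric] by simp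
qed

lemma sobolev_fun_norm_finite_weak_deriv:
  assumes fin: "sobolev_fun_norm \<Omega> s p f < \<infinity>" and \<nu>: "mi_order \<nu> \<le> nat \<lfloor>s\<rfloor>"
  shows "\<exists>g. is_weak_deriv \<Omega> \<nu> f g"
proof (rule ccontr)
  assume "\<not> (\<exists>g. is_weak_deriv \<Omega> \<nu> f g)"
  then have "Inf {Lp_norm \<Omega> p g | g. is_weak_deriv \<Omega> \<nu> f g} = \<infinity>" by simp
  then have "(\<Sum>\<nu> | mi_order \<nu> \<le> nat \<lfloor>s\<rfloor>. Inf {Lp_norm \<Omega> p g | g. is_weak_deriv \<Omega> \<nu> f g}) = \<infinity>"
    using \<nu> finite_mi_order_le by (subst sum.remove[of _ \<nu>]) auto
  with fin show False unfolding sobolev_fun_norm_def Let_def by simp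
qed

section \<open>The weak chain rule\<close>

definition jac :: "(real^'n::finite \<Rightarrow> real^'n) \<Rightarrow> real^'n \<Rightarrow> real"
  where "jac \<tau> y = \<bar>det (matrix (frechet_derivative \<tau> (at y)))\<bar>"

locale smooth_diffeo =
  fixes V V' :: "(real^'n::finite) set" and \<tau> \<sigma> :: "real^'n \<Rightarrow> real^'n"
  assumes open_V: "open V" and open_V': "open V'"
    and image_\<tau>: "\<tau> ` V = V'" and image_\<sigma>: "\<sigma> ` V' = V"
    and \<sigma>\<tau>: "y \<in> V \<Longrightarrow> \<sigma> (\<tau> y) = y" and \<tau>\<sigma>: "z \<in> V' \<Longrightarrow> \<tau> (\<sigma> z) = z"
    and smooth_\<tau>: "smooth_on V \<tau>" and smooth_\<sigma>: "smooth_on V' \<sigma>"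
begin

lemma inverse_diffeo: "smooth_diffeo V' V \<sigma> \<tau>"
  using smooth_diffeo_axioms by (auto simp: smooth_diffeo_def)

lemma \<tau>_mem: "y \<in> V \<Longrightarrow> \<tau> y \<in> V'" and \<sigma>_mem: "z \<in> V' \<Longrightarrow> \<sigma> z \<in> V"
  using image_\<tau> image_\<sigma> by auto

lemma has_derivative_\<tau>: "y \<in> V \<Longrightarrow> (\<tau> has_derivative frechet_derivative \<tau> (at y)) (at y)"
  using smooth_on_differentiable[OF smooth_\<tau>] by (simp add: frechet_derivative_works)

lemma det_derivative_inverse:
  assumes y: "y \<in> V"
  shows "det (matrix (frechet_derivative \<sigma> (at (\<tau> y)))) * det (matrix (frechet_derivative \<tau> (at y))) = 1"
proof -
  have d\<sigma>: "(\<sigma> has_derivative frechet_derivative \<sigma> (at (\<tau> y))) (at (\<tau> y))"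
    using smooth_on_differentiable[OF smooth_\<sigma> \<tau>_mem[OF y]] by (simp add: frechet_derivative_works)
  have "((\<lambda>y. \<sigma> (\<tau> y)) has_derivative (\<lambda>h. frechet_derivative \<sigma> (at (\<tau> y)) (frechet_derivative \<tau> (at y) h))) (at y)"
    by (rule has_derivative_compose[OF has_derivative_\<tau>[OF y] d\<sigma>])
  moreover have "((\<lambda>y. \<sigma> (\<tau> y)) has_derivative (\<lambda>h. h)) (at y)"
    by (rule has_derivative_transform_within_open[OF has_derivative_ident open_V y]) (simp add: \<sigma>\<tau>)
  ultimately have "(\<lambda>h. frechet_derivative \<sigma> (at (\<tau> y)) (frechet_derivative \<tau> (at y) h)) = (\<lambda>h. h)"
    by (rule has_derivative_unique)
  then have "matrix (frechet_derivative \<sigma> (at (\<tau> y)) \<circ> frechet_derivative \<tau> (at y)) = matrix id"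
    by (simp add: o_def id_def)
  then have "matrix (frechet_derivative \<sigma> (at (\<tau> y))) ** matrix (frechet_derivative \<tau> (at y)) = mat 1"
    using has_derivative_linear[OF d\<sigma>] has_derivative_linear[OF has_derivative_\<tau>[OF y]]
    by (simp add: matrix_compose matrix_id_mat_1)
  then show ?thesis by (metis det_I det_mul)
qed

lemma det_derivative_nonzero: "y \<in> V \<Longrightarrow> det (matrix (frechet_derivative \<tau> (at y))) \<noteq> 0"
  using det_derivative_inverse by fastforce

lemma jac_inverse: "y \<in> V \<Longrightarrow> jac \<sigma> (\<tau> y) * jac \<tau> y = 1"
  using det_derivative_inverse by (simp add: jac_def abs_mult[symmetric])

lemma jac_pos: "y \<in> V \<Longrightarrow> jac \<tau> y > 0"
  using det_derivative_nonzero by (simp add: jac_def)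

lemma smooth_on_jac: "smooth_on V (jac \<tau>)"
  unfolding jac_def[abs_def] by (intro smooth_on_abs smooth_on_det_derivative open_V smooth_\<tau> det_derivative_nonzero)

lemma change_of_variables:
  "distr (density lborel (\<lambda>x. ennreal (indicator V x * jac \<tau> x))) borel (\<lambda>x. if x \<in> V then \<tau> x else 0)
    = density lborel (indicator V')"
  unfolding jac_def
  by (rule distr_density_jacobian[OF open_V open_V' image_\<tau> smooth_on_continuous_on[OF smooth_\<sigma>] \<sigma>\<tau> has_derivative_\<tau>
      smooth_on_continuous_on[OF smooth_on_det_derivative[OF open_V smooth_\<tau>]]])

lemma measurable_\<tau>: "(\<lambda>x. if x \<in> V then \<tau> x else 0) \<in> borel_measurable borel"
  by (rule measurable_if_continuous_open[OF open_V smooth_on_continuous_on[OF smooth_\<tau>]])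

lemma measurable_jac: "(\<lambda>x. indicator V x * jac \<tau> x) \<in> borel_measurable borel"
  using borel_measurable_continuous_on_indicator[of V "jac \<tau>"] open_V smooth_on_continuous_on[OF smooth_on_jac] by simp

lemma nn_integral_change_of_variables:
  assumes F: "F \<in> borel_measurable borel"
  shows "(\<integral>\<^sup>+x. ennreal (indicator V x * jac \<tau> x) * F (\<tau> x) \<partial>lborel) = (\<integral>\<^sup>+z. indicator V' z * F z \<partial>lborel)"
proof -
  note [measurable] = measurable_\<tau> measurable_jac F
  have [measurable]: "V' \<in> sets borel" using open_V' by auto
  have "(\<integral>\<^sup>+z. indicator V' z * F z \<partial>lborel) = (\<integral>\<^sup>+z. F z \<partial>density lborel (indicator V'))"
    by (subst nn_integral_density) auto
  also have "\<dots> = (\<integral>\<^sup>+x. ennreal (indicator V x * jac \<tau> x) * F (if x \<in> V then \<tau> x else 0) \<partial>lborel)"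
    unfolding change_of_variables[symmetric]
    by (subst nn_integral_distr, (measurable)[2], subst nn_integral_density) measurable
  also have "\<dots> = (\<integral>\<^sup>+x. ennreal (indicator V x * jac \<tau> x) * F (\<tau> x) \<partial>lborel)"
    by (intro nn_integral_cong) (simp split: split_indicator)
  finally show ?thesis by simp
qed

lemma integral_change_of_variables:
  fixes F :: "real^'n \<Rightarrow> real"
  assumes F: "F \<in> borel_measurable borel"
  shows "integrable lborel (\<lambda>x. indicator V x * jac \<tau> x * F (\<tau> x)) \<longleftrightarrow> integrable lborel (\<lambda>z. indicator V' z * F z)"
    and "(LINT x|lborel. indicator V x * jac \<tau> x * F (\<tau> x)) = (LINT z|lborel. indicator V' z * F z)"
proof -
  note [measurable] = measurable_\<tau> measurable_jac F
  have [measurable]: "V' \<in> sets borel" using open_V' by auto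
  have dens: "density lborel (indicator V') = density lborel (\<lambda>x. ennreal (indicator V' x))"
    by (intro arg_cong[where f = "density lborel"]) (auto split: split_indicator)
  have eq: "(\<lambda>x. indicator V x * jac \<tau> x * F (if x \<in> V then \<tau> x else 0)) = (\<lambda>x. indicator V x * jac \<tau> x * F (\<tau> x))"
    by (intro ext) (simp split: split_indicator)
  have nn: "AE x in lborel. 0 \<le> indicator V x * jac \<tau> x" by (simp add: jac_def)
  show "integrable lborel (\<lambda>x. indicator V x * jac \<tau> x * F (\<tau> x)) \<longleftrightarrow> integrable lborel (\<lambda>z. indicator V' z * F z)"
    using integrable_density[of F lborel "\<lambda>x. indicator V' x"]
      integrable_distr_eq[of "\<lambda>x. if x \<in> V then \<tau> x else 0" "density lborel (\<lambda>x. ennreal (indicator V x * jac \<tau> x))" borel F]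
      integrable_density[of "\<lambda>x. F (if x \<in> V then \<tau> x else 0)" lborel "\<lambda>x. indicator V x * jac \<tau> x"] nn
    unfolding change_of_variables dens by (simp add: eq)
  show "(LINT x|lborel. indicator V x * jac \<tau> x * F (\<tau> x)) = (LINT z|lborel. indicator V' z * F z)"
    using integral_density[of F lborel "\<lambda>x. indicator V' x"]
      integral_distr[of "\<lambda>x. if x \<in> V then \<tau> x else 0" "density lborel (\<lambda>x. ennreal (indicator V x * jac \<tau> x))" borel F]
      integral_density[of "\<lambda>x. F (if x \<in> V then \<tau> x else 0)" lborel "\<lambda>x. indicator V x * jac \<tau> x"] nn
    unfolding change_of_variables dens by (simp add: eq)
qed

text \<open>
  The adjoint of \<open>f \<mapsto> f \<circ> \<tau>\<close> with respect to integration (\<open>pullback_integral\<close>).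
\<close>
definition push :: "(real^'n \<Rightarrow> real) \<Rightarrow> real^'n \<Rightarrow> real"
  where "push b z = (if z \<in> V' then b (\<sigma> z) else 0) * jac \<sigma> z"

lemma push_test:
  assumes "b \<in> test_functions V" shows "push b \<in> test_functions V'"
proof -
  have "(\<lambda>z. if z \<in> V' then b (\<sigma> z) else 0) \<in> test_functions V'"
    by (rule test_functions_compose[OF assms open_V open_V' _ smooth_\<sigma> smooth_on_continuous_on[OF smooth_\<tau>]])
      (auto simp: \<tau>_mem \<sigma>_mem \<tau>\<sigma>)
  from test_functions_mult_smooth[OF this open_V' smooth_diffeo.smooth_on_jac[OF inverse_diffeo]]
  show ?thesis by (simp add: push_def[abs_def])
qed

lemma measurable_pullback:
  assumes a: "a \<in> borel_measurable borel" "\<And>y. y \<notin> V \<Longrightarrow> a y = (0::real)" and g: "g \<in> borel_measurable borel"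
  shows "(\<lambda>y. a y * g (\<tau> y)) \<in> borel_measurable borel"
proof -
  have "(\<lambda>y. a y * g (if y \<in> V then \<tau> y else 0)) \<in> borel_measurable borel"
    using a(1) measurable_compose[OF measurable_\<tau> g] by auto
  also have "(\<lambda>y. a y * g (if y \<in> V then \<tau> y else 0)) = (\<lambda>y. a y * g (\<tau> y))"
    using a(2) by auto
  finally show ?thesis .
qed

lemma pullback_integral:
  assumes b: "b \<in> test_functions V" and g: "loc_int V' g"
  shows "integrable lborel (\<lambda>y. b y * g (\<tau> y))" (is ?I)
    and "(LINT y|lborel. b y * g (\<tau> y)) = (LINT z|lborel. g z * push b z)" (is ?E)
proof -
  interpret inv: smooth_diffeo V' V \<sigma> \<tau> by (rule inverse_diffeo)
  let ?F = "\<lambda>y. b y * g (\<tau> y)"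
  have F: "?F \<in> borel_measurable borel"
    by (rule measurable_pullback[OF test_functions_measurable[OF b] test_functions_zero[OF b] loc_int_measurable[OF g]])
  have 1: "(\<lambda>z. indicator V' z * jac \<sigma> z * ?F (\<sigma> z)) = (\<lambda>z. g z * push b z)"
    by (intro ext) (simp add: push_def \<tau>\<sigma> split: split_indicator)
  have 2: "(\<lambda>y. indicator V y * ?F y) = ?F"
    using test_functions_zero[OF b] by (intro ext) (simp split: split_indicator)
  show ?I ?E
    using inv.integral_change_of_variables[OF F] loc_int_mult_test[OF g push_test[OF b]] unfolding 1 2 by simp_all
qed

end

lemma integral_by_parts:
  assumes a: "a \<in> test_functions UNIV" and b: "b \<in> test_functions UNIV"
  shows "(LINT x|lborel. partial i a x * b x) = - (LINT x|lborel. a x * partial i b x)"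
proof -
  have ab: "(\<lambda>x. a x * b x) \<in> test_functions UNIV" by (rule test_functions_mult[OF a test_functions_smooth[OF b]])
  have int: "integrable lborel (\<lambda>x. u x * v x)" if "u \<in> test_functions UNIV" "v \<in> test_functions UNIV" for u v :: "real^'a \<Rightarrow> real"
    using that by (intro loc_int_mult_test[of UNIV] loc_int_continuous) (auto intro: test_functions_measurable test_functions_continuous)
  have "partial i (\<lambda>x. a x * b x) = (\<lambda>x. a x * partial i b x + partial i a x * b x)"
    by (intro ext partial_mult) (use a b in \<open>auto dest!: test_functions_smooth intro: smooth_on_differentiable\<close>)
  then have "(LINT x|lborel. a x * partial i b x + partial i a x * b x) = 0"
    using integral_partial_eq_0[OF ab, of i] by simp
  then show ?thesis
    using int[OF a test_functions_partial[OF b]] int[OF test_functions_partial[OF a] b] by simp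
qed

lemma loc_int_test: "open \<Omega> \<Longrightarrow> a \<in> test_functions \<Omega>' \<Longrightarrow> loc_int \<Omega> a"
  by (intro loc_int_continuous) (auto intro: test_functions_measurable test_functions_continuous)

context smooth_diffeo
begin

lemma smooth_on_\<tau>_partial: "smooth_on V (partial i (\<lambda>y. \<tau> y $ j))"
  using smooth_\<tau> open_V by (intro smooth_on_partial) (simp add: smooth_on_vec)

text \<open>
  This is the transformation rule for the divergence of a vector density. A direct computation
  would have to differentiate the Jacobian. Instead both sides are integrated against a test
  function \<open>\<phi>\<close>: after the change of variables, integration by parts on \<open>V\<close>, the classical chain
  rule for \<open>\<phi> \<circ> \<tau>\<close>, the change of variables back and integration by parts on \<open>V'\<close> transform one
  into the other.
\<close>
lemma push_partial:
  assumes \<eta>: "\<eta> \<in> test_functions V"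
  shows "AE z in lborel. z \<in> V' \<longrightarrow>
    push (partial i \<eta>) z = (\<Sum>j\<in>UNIV. partial j (push (\<lambda>y. \<eta> y * partial i (\<lambda>y. \<tau> y $ j) y)) z)"
proof -
  let ?\<eta> = "\<lambda>j y. \<eta> y * partial i (\<lambda>y. \<tau> y $ j) y"
  have \<eta>j: "?\<eta> j \<in> test_functions V" for j
    by (rule test_functions_mult_smooth[OF \<eta> open_V smooth_on_\<tau>_partial])
  have U: "u \<in> test_functions UNIV" if "u \<in> test_functions S" for u :: "real^'n \<Rightarrow> real" and S
    using that by (rule test_functions_mono) simp
  have pj: "partial j (push (?\<eta> j)) \<in> test_functions V'" for j
    by (intro test_functions_partial push_test \<eta>j)
  show ?thesis
  proof (rule AE_eq_if_test_integrals_eq[OF open_V'])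
    show "loc_int V' (push (partial i \<eta>))"
      by (rule loc_int_test[OF open_V' push_test[OF test_functions_partial[OF \<eta>]]])
    show "loc_int V' (\<lambda>z. \<Sum>j\<in>UNIV. partial j (push (?\<eta> j)) z)"
      by (rule loc_int_test[OF open_V' test_functions_sum[OF finite pj]])
    fix \<phi> assume \<phi>: "\<phi> \<in> test_functions V'"
    define \<phi>' where "\<phi>' = (\<lambda>y. if y \<in> V then \<phi> (\<tau> y) else 0)"
    have \<phi>': "\<phi>' \<in> test_functions V" unfolding \<phi>'_def
      by (rule test_functions_compose[OF \<phi> open_V' open_V _ smooth_\<tau> smooth_on_continuous_on[OF smooth_\<sigma>]])
        (auto simp: \<tau>_mem \<sigma>_mem \<sigma>\<tau>)
    have d\<phi>': "partial i \<phi>' y = (\<Sum>j\<in>UNIV. partial j \<phi> (\<tau> y) * partial i (\<lambda>y. \<tau> y $ j) y)" if y: "y \<in> V" for y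
    proof -
      have "partial i \<phi>' y = partial i (\<lambda>y. \<phi> (\<tau> y)) y"
        by (rule partial_cong_open[OF open_V y])
          (use test_functions_smooth[OF \<phi>'] in \<open>auto simp: \<phi>'_def intro: smooth_on_differentiable\<close>)
      also have "\<dots> = (\<Sum>j\<in>UNIV. partial j \<phi> (\<tau> y) * partial i (\<lambda>y. \<tau> y $ j) y)"
        using test_functions_smooth[OF \<phi>] smooth_\<tau> y by (intro partial_compose) (auto intro: smooth_on_differentiable)
      finally show ?thesis .
    qed
    have l: "loc_int V' (partial j \<phi>)" for j by (rule loc_int_test[OF open_V' test_functions_partial[OF \<phi>]])
    note pb = pullback_integral[OF \<eta>j l]
    have "(LINT z|lborel. push (partial i \<eta>) z * \<phi> z) = (LINT y|lborel. partial i \<eta> y * \<phi> (\<tau> y))"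
      by (subst pullback_integral(2)[OF test_functions_partial[OF \<eta>] loc_int_test[OF open_V' \<phi>]]) (simp add: mult.commute)
    also have "\<dots> = (LINT y|lborel. partial i \<eta> y * \<phi>' y)"
      using test_functions_zero[OF test_functions_partial[OF \<eta>]] by (intro Bochner_Integration.integral_cong) (auto simp: \<phi>'_def)
    also have "\<dots> = - (LINT y|lborel. \<eta> y * partial i \<phi>' y)"
      by (rule integral_by_parts[OF U[OF \<eta>] U[OF \<phi>']])
    also have "(LINT y|lborel. \<eta> y * partial i \<phi>' y) = (LINT y|lborel. (\<Sum>j\<in>UNIV. ?\<eta> j y * partial j \<phi> (\<tau> y)))"
    proof (rule Bochner_Integration.integral_cong[OF refl])
      fix y
      show "\<eta> y * partial i \<phi>' y = (\<Sum>j\<in>UNIV. ?\<eta> j y * partial j \<phi> (\<tau> y))"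
        using d\<phi>'[of y] test_functions_zero[OF \<eta>, of y]
        by (cases "y \<in> V") (simp_all add: sum_distrib_left mult_ac)
    qed
    also have "\<dots> = (\<Sum>j\<in>UNIV. LINT z|lborel. partial j \<phi> z * push (?\<eta> j) z)"
      using pb by (subst Bochner_Integration.integral_sum) auto
    also have "- \<dots> = (\<Sum>j\<in>UNIV. LINT z|lborel. \<phi> z * partial j (push (?\<eta> j)) z)"
      by (simp add: integral_by_parts[OF U[OF \<phi>] U[OF push_test[OF \<eta>j]]] sum_negf)
    also have "\<dots> = (LINT z|lborel. (\<Sum>j\<in>UNIV. partial j (push (?\<eta> j)) z) * \<phi> z)"
    proof -
      have "integrable lborel (\<lambda>z. \<phi> z * partial j (push (?\<eta> j)) z)" for j
        by (rule loc_int_mult_test[OF loc_int_test[OF open_V' \<phi>] pj])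
      then show ?thesis by (subst Bochner_Integration.integral_sum[symmetric]) (simp_all add: sum_distrib_left mult.commute)
    qed
    finally show "(LINT z|lborel. push (partial i \<eta>) z * \<phi> z) = (LINT z|lborel. (\<Sum>j\<in>UNIV. partial j (push (?\<eta> j)) z) * \<phi> z)" .
  qed
qed

lemma loc_int_pullback:
  assumes a: "a \<in> test_functions V" and g: "loc_int V' g"
  shows "loc_int UNIV (\<lambda>y. a y * g (\<tau> y))"
proof (rule loc_intI_test)
  show "(\<lambda>y. a y * g (\<tau> y)) \<in> borel_measurable borel"
    by (rule measurable_pullback[OF test_functions_measurable[OF a] test_functions_zero[OF a] loc_int_measurable[OF g]])
  fix \<xi> :: "real^'n \<Rightarrow> real" assume "\<xi> \<in> test_functions UNIV"
  then have "(\<lambda>y. a y * \<xi> y) \<in> test_functions V" by (intro test_functions_mult a test_functions_smooth)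
  from pullback_integral(1)[OF this g]
  show "integrable lborel (\<lambda>y. a y * g (\<tau> y) * \<xi> y)" by (simp add: mult_ac)
qed auto

text \<open>
  The product and chain rule for weak derivatives. Transporting the test function to \<open>V'\<close> by
  \<open>push\<close> reduces it to \<open>push_partial\<close>, in which only smooth functions are differentiated. The
  factor \<open>a\<close> makes the pullback a function on the whole space.
\<close>
lemma wd_pullback:
  assumes a: "a \<in> test_functions V" and g: "\<And>j. wd V' [j] g (g' j)"
  shows "wd UNIV [i] (\<lambda>y. a y * g (\<tau> y))
    (\<lambda>y. partial i a y * g (\<tau> y) + (\<Sum>j\<in>UNIV. (a y * partial i (\<lambda>y. \<tau> y $ j) y) * g' j (\<tau> y)))"
  unfolding wd_def
proof (intro conjI ballI)
  have lg: "loc_int V' g" "loc_int V' (g' j)" for j using g[of j] by (auto simp: wd_def)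
  have aj: "(\<lambda>y. a y * partial i (\<lambda>y. \<tau> y $ j) y) \<in> test_functions V" for j
    by (rule test_functions_mult_smooth[OF a open_V smooth_on_\<tau>_partial])
  show "loc_int UNIV (\<lambda>y. a y * g (\<tau> y))" by (rule loc_int_pullback[OF a lg(1)])
  show "loc_int UNIV (\<lambda>y. partial i a y * g (\<tau> y) + (\<Sum>j\<in>UNIV. (a y * partial i (\<lambda>y. \<tau> y $ j) y) * g' j (\<tau> y)))"
    by (intro loc_int_add loc_int_sum loc_int_pullback test_functions_partial a aj lg) auto
  fix \<xi> :: "real^'n \<Rightarrow> real" assume \<xi>: "\<xi> \<in> test_functions UNIV"
  define \<eta> where "\<eta> = (\<lambda>y. a y * \<xi> y)"
  have \<eta>: "\<eta> \<in> test_functions V" unfolding \<eta>_def by (intro test_functions_mult a test_functions_smooth[OF \<xi>])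
  have \<eta>j: "(\<lambda>y. \<eta> y * partial i (\<lambda>y. \<tau> y $ j) y) \<in> test_functions V" for j
    by (rule test_functions_mult_smooth[OF \<eta> open_V smooth_on_\<tau>_partial])
  have a\<xi>: "(\<lambda>y. partial i a y * \<xi> y) \<in> test_functions V"
    by (intro test_functions_mult test_functions_partial a test_functions_smooth[OF \<xi>])
  have d\<eta>: "partial i \<eta> y = a y * partial i \<xi> y + partial i a y * \<xi> y" for y unfolding \<eta>_def
    using test_functions_smooth[OF a] test_functions_smooth[OF \<xi>] by (intro partial_mult) (auto intro: smooth_on_differentiable)
  note p1 = pullback_integral[OF test_functions_partial[OF \<eta>] lg(1)]
  note p2 = pullback_integral[OF \<eta>j lg(2)]
  note p3 = pullback_integral[OF a\<xi> lg(1)]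
  have pj: "partial j (push (\<lambda>y. \<eta> y * partial i (\<lambda>y. \<tau> y $ j) y)) \<in> test_functions V'" for j
    by (intro test_functions_partial push_test \<eta>j)
  have "(LINT y|lborel. partial i \<eta> y * g (\<tau> y)) = (LINT z|lborel. g z * push (partial i \<eta>) z)" by (rule p1)
  also have "\<dots> = (LINT z|lborel. (\<Sum>j\<in>UNIV. g z * partial j (push (\<lambda>y. \<eta> y * partial i (\<lambda>y. \<tau> y $ j) y)) z))"
  proof (rule integral_cong_AE)
    show "(\<lambda>z. g z * push (partial i \<eta>) z) \<in> borel_measurable lborel"
      using loc_int_mult_test[OF lg(1) push_test[OF test_functions_partial[OF \<eta>]]] by (rule borel_measurable_integrable)
    show "(\<lambda>z. \<Sum>j\<in>UNIV. g z * partial j (push (\<lambda>y. \<eta> y * partial i (\<lambda>y. \<tau> y $ j) y)) z) \<in> borel_measurable lborel"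
      by (intro borel_measurable_sum borel_measurable_integrable loc_int_mult_test[OF lg(1)] pj)
    show "AE z in lborel. g z * push (partial i \<eta>) z = (\<Sum>j\<in>UNIV. g z * partial j (push (\<lambda>y. \<eta> y * partial i (\<lambda>y. \<tau> y $ j) y)) z)"
      using push_partial[OF \<eta>, of i]
    proof eventually_elim
      case (elim z)
      then show ?case
        using test_functions_zero[OF push_test[OF test_functions_partial[OF \<eta>, of i]], of z] test_functions_zero[OF pj, of z]
        by (cases "z \<in> V'") (auto simp: sum_distrib_left)
    qed
  qed
  also have "\<dots> = (\<Sum>j\<in>UNIV. LINT z|lborel. g z * partial j (push (\<lambda>y. \<eta> y * partial i (\<lambda>y. \<tau> y $ j) y)) z)"
    by (intro Bochner_Integration.integral_sum loc_int_mult_test[OF lg(1)] pj)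
  also have "\<dots> = (\<Sum>j\<in>UNIV. - (LINT z|lborel. g' j z * push (\<lambda>y. \<eta> y * partial i (\<lambda>y. \<tau> y $ j) y) z))"
    using g push_test[OF \<eta>j] by (intro sum.cong refl) (simp add: wd_def partials_Cons)
  also have "\<dots> = - (\<Sum>j\<in>UNIV. LINT y|lborel. \<eta> y * partial i (\<lambda>y. \<tau> y $ j) y * g' j (\<tau> y))"
    by (simp add: p2 sum_negf)
  also have "\<dots> = - (LINT y|lborel. (\<Sum>j\<in>UNIV. \<eta> y * partial i (\<lambda>y. \<tau> y $ j) y * g' j (\<tau> y)))"
    by (subst Bochner_Integration.integral_sum) (auto simp: p2)
  finally have main: "(LINT y|lborel. partial i \<eta> y * g (\<tau> y)) = - (LINT y|lborel. (\<Sum>j\<in>UNIV. \<eta> y * partial i (\<lambda>y. \<tau> y $ j) y * g' j (\<tau> y)))" .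
  have "(LINT x|lborel. a x * g (\<tau> x) * partials [i] \<xi> x) =
      (LINT y|lborel. partial i \<eta> y * g (\<tau> y) - partial i a y * \<xi> y * g (\<tau> y))"
    by (intro Bochner_Integration.integral_cong refl) (simp add: d\<eta> partials_Cons algebra_simps)
  also have "\<dots> = - (LINT y|lborel. (\<Sum>j\<in>UNIV. \<eta> y * partial i (\<lambda>y. \<tau> y $ j) y * g' j (\<tau> y))) - (LINT y|lborel. partial i a y * \<xi> y * g (\<tau> y))"
    by (subst Bochner_Integration.integral_diff[OF p1(1) p3(1)]) (simp add: main)
  also have "\<dots> = - (LINT y|lborel. (\<Sum>j\<in>UNIV. \<eta> y * partial i (\<lambda>y. \<tau> y $ j) y * g' j (\<tau> y)) + partial i a y * \<xi> y * g (\<tau> y))"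
    by (subst Bochner_Integration.integral_add[OF Bochner_Integration.integrable_sum[OF p2(1)] p3(1)]) simp
  also have "(LINT y|lborel. (\<Sum>j\<in>UNIV. \<eta> y * partial i (\<lambda>y. \<tau> y $ j) y * g' j (\<tau> y)) + partial i a y * \<xi> y * g (\<tau> y))
    = (LINT y|lborel. (partial i a y * g (\<tau> y) + (\<Sum>j\<in>UNIV. a y * partial i (\<lambda>y. \<tau> y $ j) y * g' j (\<tau> y))) * \<xi> y)"
    by (intro Bochner_Integration.integral_cong refl) (simp add: \<eta>_def algebra_simps sum_distrib_left)
  finally show "(LINT x|lborel. a x * g (\<tau> x) * partials [i] \<xi> x) = (- 1) ^ length [i] *
    (LINT y|lborel. (partial i a y * g (\<tau> y) + (\<Sum>j\<in>UNIV. a y * partial i (\<lambda>y. \<tau> y $ j) y * g' j (\<tau> y))) * \<xi> y)"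
    by simp
qed

end

section \<open>Higher derivatives of a pullback\<close>

text \<open>
  The shape of the derivatives of order at most \<open>m\<close> of a pullback: \<open>G L\<close> stands for the weak
  derivative along the list \<open>L\<close>, and the coefficients are test functions on \<open>V\<close>. The estimates
  below need only this shape and no explicit formula of Faa di Bruno.
\<close>
inductive pullback_operator ::
    "(real^'n::finite) set \<Rightarrow> (real^'n \<Rightarrow> real^'n) \<Rightarrow> nat \<Rightarrow> (('n list \<Rightarrow> real^'n \<Rightarrow> real) \<Rightarrow> real^'n \<Rightarrow> real) \<Rightarrow> bool"
  for V \<tau> m where
    zero: "pullback_operator V \<tau> m (\<lambda>G y. 0)"
  | monomial: "a \<in> test_functions V \<Longrightarrow> length L \<le> m \<Longrightarrow> pullback_operator V \<tau> m (\<lambda>G y. a y * G L (\<tau> y))"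
  | add: "pullback_operator V \<tau> m H \<Longrightarrow> pullback_operator V \<tau> m H' \<Longrightarrow> pullback_operator V \<tau> m (\<lambda>G y. H G y + H' G y)"

lemma pullback_operator_sum:
  "finite J \<Longrightarrow> (\<And>j. j \<in> J \<Longrightarrow> pullback_operator V \<tau> m (H j)) \<Longrightarrow> pullback_operator V \<tau> m (\<lambda>G y. \<Sum>j\<in>J. H j G y)"
  by (induction J rule: finite_induct) (auto intro: pullback_operator.intros)

context smooth_diffeo
begin

lemma pullback_operator_partial:
  assumes "pullback_operator V \<tau> m H"
  shows "\<exists>H'. pullback_operator V \<tau> (Suc m) H' \<and>
    (\<forall>f G. (\<forall>L. length L \<le> Suc m \<longrightarrow> wd V' L f (G L)) \<longrightarrow> wd UNIV [i] (H G) (H' G))"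
  using assms
proof induction
  case zero
  show ?case by (intro exI[of _ "\<lambda>G y. 0"] conjI pullback_operator.zero) (auto intro: wd_0)
next
  case (monomial a L)
  let ?H = "\<lambda>G y. partial i a y * G L (\<tau> y) + (\<Sum>j\<in>UNIV. (a y * partial i (\<lambda>y. \<tau> y $ j) y) * G (L @ [j]) (\<tau> y))"
  show ?case
  proof (intro exI[of _ ?H] conjI allI impI)
    show "pullback_operator V \<tau> (Suc m) ?H"
      using monomial by (intro pullback_operator.add pullback_operator_sum pullback_operator.monomial
          test_functions_partial test_functions_mult_smooth open_V smooth_on_\<tau>_partial) auto
    fix f G assume "\<forall>L. length L \<le> Suc m \<longrightarrow> wd V' L f (G L)"
    then show "wd UNIV [i] (\<lambda>y. a y * G L (\<tau> y)) (?H G)"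
      using monomial by (intro wd_pullback wd_append_first[of V' L f]) auto
  qed
next
  case (add H1 H2)
  then obtain H1' H2' where "pullback_operator V \<tau> (Suc m) H1'" "pullback_operator V \<tau> (Suc m) H2'"
    "\<And>f G. (\<forall>L. length L \<le> Suc m \<longrightarrow> wd V' L f (G L)) \<Longrightarrow> wd UNIV [i] (H1 G) (H1' G)"
    "\<And>f G. (\<forall>L. length L \<le> Suc m \<longrightarrow> wd V' L f (G L)) \<Longrightarrow> wd UNIV [i] (H2 G) (H2' G)" by metis
  then show ?case by (intro exI[of _ "\<lambda>G y. H1' G y + H2' G y"]) (blast intro: pullback_operator.add wd_add)
qed

text \<open>
  The operator \<open>H\<close> is chosen before \<open>f\<close> and its derivatives \<open>G\<close>; therefore the constants in the
  estimates for \<open>H\<close> do not depend on \<open>f\<close>.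
\<close>
lemma pullback_weak_derivatives:
  assumes a: "a \<in> test_functions V"
  shows "\<exists>H. pullback_operator V \<tau> (length is) H \<and>
    (\<forall>f G. (\<forall>L. length L \<le> length is \<longrightarrow> wd V' L f (G L)) \<longrightarrow> G [] = f \<longrightarrow> wd UNIV is (\<lambda>y. a y * f (\<tau> y)) (H G))"
proof (induction "is" rule: rev_induct)
  case Nil
  have "wd UNIV [] (\<lambda>y. a y * f (\<tau> y)) (\<lambda>y. a y * f (\<tau> y))" if "wd V' [] f f" for f
    using that by (intro wd_Nil loc_int_pullback[OF a]) (simp add: wd_def)
  then show ?case
    by (intro exI[of _ "\<lambda>G y. a y * G [] (\<tau> y)"]) (auto intro!: pullback_operator.monomial a)
next
  case (snoc i "is")
  then obtain H where H: "pullback_operator V \<tau> (length is) H"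
    "\<And>f G. (\<forall>L. length L \<le> length is \<longrightarrow> wd V' L f (G L)) \<Longrightarrow> G [] = f \<Longrightarrow> wd UNIV is (\<lambda>y. a y * f (\<tau> y)) (H G)" by blast
  obtain H' where H': "pullback_operator V \<tau> (Suc (length is)) H'"
    "\<And>f G. (\<forall>L. length L \<le> Suc (length is) \<longrightarrow> wd V' L f (G L)) \<Longrightarrow> wd UNIV [i] (H G) (H' G)"
    using pullback_operator_partial[OF H(1), of i] by blast
  show ?case
  proof (intro exI[of _ H'] conjI allI impI)
    show "pullback_operator V \<tau> (length (is @ [i])) H'" using H'(1) by simp
    fix f G assume *: "\<forall>L. length L \<le> length (is @ [i]) \<longrightarrow> wd V' L f (G L)" "G [] = f"
    show "wd UNIV (is @ [i]) (\<lambda>y. a y * f (\<tau> y)) (H' G)"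
      by (rule wd_append[OF H(2) H'(2)]) (use * in auto)
  qed
qed

end

section \<open>Radial integrals and convolution estimates\<close>

lemma dyadic_scale:
  fixes u :: real assumes "1 \<le> u"
  obtains k where "2 ^ k \<le> u" "u < 2 ^ Suc k"
proof -
  define n where "n = (LEAST n. u < 2 ^ n)"
  have "\<exists>n. u < 2 ^ n" using real_arch_pow[of 2 u] by auto
  then have n: "u < 2 ^ n" unfolding n_def by (rule LeastI_ex)
  then obtain k where k: "n = Suc k" using assms by (cases n) auto
  then have "\<not> u < 2 ^ k" unfolding n_def using not_less_Least[of k "\<lambda>n. u < 2 ^ n"] by auto
  then have "2 ^ k \<le> u" by simp
  with n k that show thesis by simp
qed

lemma ennreal_le_suminf: "f k \<le> (\<Sum>k. f k)" for f :: "nat \<Rightarrow> ennreal"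
  using sum_le_suminf[of f "{k}"] by simp

lemma two_powr_power: "(2 powr a) ^ n = 2 powr (a * real n)"
  by (subst powr_realpow[symmetric]) (simp_all add: powr_powr)

lemma two_powr_combine: "(2 powr a) powr s * (2 powr a) ^ n = 2 powr (a * (s + real n))"
  by (simp add: two_powr_power powr_powr powr_add[symmetric] distrib_left)

text \<open>
  The two radial integrals that follow are compared with geometric series: on each dyadic shell
  the power of the norm is bounded by a constant, and the shell is replaced by the ball that
  contains it.
\<close>
lemma nn_integral_suminf_cball:
  fixes c :: "nat \<Rightarrow> ennreal"
  shows "(\<integral>\<^sup>+v. (\<Sum>k. c k * indicator (cball 0 (r k)) (v :: real^'n::finite)) \<partial>lborel) =
    (\<Sum>k. c k * emeasure lborel (cball (0 :: real^'n) (r k)))"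
proof -
  have cb: "cball (0 :: real^'n) (r k) \<in> sets lborel" for k by simp
  have "(\<integral>\<^sup>+v. (\<Sum>k. c k * indicator (cball 0 (r k)) (v :: real^'n)) \<partial>lborel)
      = (\<Sum>k. \<integral>\<^sup>+v. c k * indicator (cball 0 (r k)) (v :: real^'n) \<partial>lborel)"
    by (rule nn_integral_suminf) (intro borel_measurable_times_ennreal borel_measurable_const borel_measurable_indicator cb)
  also have "\<dots> = (\<Sum>k. c k * emeasure lborel (cball (0 :: real^'n) (r k)))"
    by (intro suminf_cong nn_integral_cmult_indicator cb)
  finally show ?thesis .
qed

text \<open>
  On the shell \<open>R / 2 ^ Suc k < norm v \<le> R / 2 ^ k\<close> the integrand is comparable to its value at
  \<open>R / 2 ^ k\<close>, and the contribution of the \<open>k\<close>-th ball is a multiple of the \<open>k\<close>-th power of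
  \<open>\<rho> = 2 powr (- (n + s))\<close>.
\<close>
lemma nn_integral_norm_powr_near:
  fixes s R :: real
  assumes s: "real CARD('n) + s > 0" and R: "R > 0"
  shows "(\<integral>\<^sup>+v. ennreal (indicator (ball 0 R) v * norm (v :: real^'n::finite) powr s) \<partial>lborel) < \<infinity>"
proof -
  let ?n = "CARD('n)"
  let ?r = "\<lambda>k::nat. R / 2 ^ k"
  define c where "c = 2 powr \<bar>s\<bar> * R powr s * (unit_ball_vol ?n * R ^ ?n)"
  define \<rho> where "\<rho> = 2 powr (- (real ?n + s))"
  have \<rho>: "0 < \<rho>" "\<rho> < 1" using s by (auto simp: \<rho>_def powr_less_one)
  have "indicator (ball 0 R) v * norm v powr s \<le> 2 powr \<bar>s\<bar> * (?r k) powr s"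
    if "?r (Suc k) < norm v" "norm v \<le> ?r k" for v :: "real^'n" and k
  proof -
    define \<mu> where "\<mu> = norm v / ?r k"
    have r: "?r k > 0" using R by simp
    have \<mu>: "1 / 2 \<le> \<mu>" "\<mu> \<le> 1" using that r by (auto simp: \<mu>_def field_simps)
    have "\<mu> powr s \<le> 2 powr \<bar>s\<bar>"
    proof (cases "s \<ge> 0")
      case True
      then have "\<mu> powr s \<le> 1 powr s" using \<mu> by (intro powr_mono2) auto
      also have "\<dots> \<le> 2 powr \<bar>s\<bar>" by (simp add: ge_one_powr_ge_zero)
      finally show ?thesis .
    next
      case False
      then have "\<mu> powr s \<le> (1 / 2) powr s" using \<mu> by (intro powr_mono2') auto
      also have "\<dots> = 2 powr \<bar>s\<bar>" using False by (simp add: powr_divide powr_minus_divide[symmetric])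
      finally show ?thesis .
    qed
    moreover have "norm v powr s = \<mu> powr s * (?r k) powr s"
      using r R by (simp add: \<mu>_def powr_mult[symmetric])
    ultimately have "norm v powr s \<le> 2 powr \<bar>s\<bar> * (?r k) powr s" by (simp add: mult_right_mono)
    then show ?thesis by (simp split: split_indicator)
  qed
  note shell = this
  have "ennreal (indicator (ball 0 R) v * norm v powr s)
      \<le> (\<Sum>k. ennreal (2 powr \<bar>s\<bar> * (?r k) powr s) * indicator (cball 0 (?r k)) v)" for v :: "real^'n"
  proof (cases "v = 0 \<or> norm v \<ge> R")
    case True
    then show ?thesis by (auto simp: indicator_def)
  next
    case False
    then obtain k where "2 ^ k \<le> R / norm v" "R / norm v < 2 ^ Suc k"
      using dyadic_scale[of "R / norm v"] by (auto simp: field_simps)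
    then have v: "?r (Suc k) < norm v" "norm v \<le> ?r k" using False by (auto simp: field_simps)
    have "ennreal (indicator (ball 0 R) v * norm v powr s)
        \<le> ennreal (2 powr \<bar>s\<bar> * (?r k) powr s) * indicator (cball 0 (?r k)) v"
      using shell[OF v] v by (simp add: ennreal_leI)
    also have "\<dots> \<le> (\<Sum>k. ennreal (2 powr \<bar>s\<bar> * (?r k) powr s) * indicator (cball 0 (?r k)) v)"
      by (rule ennreal_le_suminf)
    finally show ?thesis .
  qed
  then have "(\<integral>\<^sup>+v. ennreal (indicator (ball 0 R) v * norm (v :: real^'n) powr s) \<partial>lborel)
      \<le> (\<integral>\<^sup>+v. (\<Sum>k. ennreal (2 powr \<bar>s\<bar> * (?r k) powr s) * indicator (cball 0 (?r k)) (v :: real^'n)) \<partial>lborel)"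
    by (intro nn_integral_mono)
  also have "\<dots> = (\<Sum>k. ennreal (2 powr \<bar>s\<bar> * (?r k) powr s) * emeasure lborel (cball (0 :: real^'n) (?r k)))"
    by (rule nn_integral_suminf_cball)
  also have "\<dots> = (\<Sum>k. ennreal (c * \<rho> ^ k))"
  proof (rule suminf_cong)
    fix k
    have "(?r k) powr s * (?r k) ^ ?n = R powr s * R ^ ?n * \<rho> ^ k"
    proof -
      have "(?r k) powr s * (?r k) ^ ?n = R powr s * R ^ ?n * ((1 / 2 ^ k) powr s * (1 / 2 ^ k) ^ ?n)"
        by (simp add: powr_divide power_divide)
      also have "(1 / 2 ^ k) powr s * (1 / 2 ^ k) ^ ?n = \<rho> ^ k"
      proof -
        have "1 / 2 ^ k = 2 powr (- real k)" by (simp add: powr_minus powr_realpow divide_inverse)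
        then show ?thesis unfolding \<rho>_def two_powr_power by (simp add: two_powr_combine algebra_simps)
      qed
      finally show ?thesis .
    qed
    then show "ennreal (2 powr \<bar>s\<bar> * (?r k) powr s) * emeasure lborel (cball (0 :: real^'n) (?r k)) = ennreal (c * \<rho> ^ k)"
      using R by (simp add: emeasure_cball c_def ennreal_mult[symmetric] mult_ac)
  qed
  also have "\<dots> < \<infinity>"
  proof -
    have "c \<ge> 0" using R by (auto simp: c_def)
    then have "(\<Sum>k. ennreal (c * \<rho> ^ k)) \<noteq> top"
      using \<rho> by (intro ennreal_suminf_neq_top summable_mult summable_geometric) auto
    then show ?thesis by (simp add: less_top)
  qed
  finally show ?thesis .
qed

text \<open>
  As before, with the shells \<open>R * 2 ^ k \<le> norm v < R * 2 ^ Suc k\<close> and the ratio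
  \<open>\<rho> = 2 powr (n - s)\<close>.
\<close>
lemma nn_integral_norm_powr_far:
  fixes s R :: real
  assumes s: "s > real CARD('n)" and R: "R > 0"
  shows "(\<integral>\<^sup>+v. ennreal (indicator (- ball 0 R) v * norm (v :: real^'n::finite) powr (- s)) \<partial>lborel) < \<infinity>"
proof -
  let ?n = "CARD('n)"
  let ?r = "\<lambda>k::nat. R * 2 ^ k"
  define c where "c = R powr (- s) * (unit_ball_vol ?n * (2 * R) ^ ?n)"
  define \<rho> where "\<rho> = 2 powr (real ?n - s)"
  have \<rho>: "0 < \<rho>" "\<rho> < 1" using s by (auto simp: \<rho>_def powr_less_one)
  have "ennreal (indicator (- ball 0 R) v * norm v powr (- s))
      \<le> (\<Sum>k. ennreal ((?r k) powr (- s)) * indicator (cball 0 (?r (Suc k))) v)" for v :: "real^'n"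
  proof (cases "norm v < R")
    case True
    then show ?thesis by (auto simp: indicator_def)
  next
    case False
    then obtain k where "2 ^ k \<le> norm v / R" "norm v / R < 2 ^ Suc k"
      using dyadic_scale[of "norm v / R"] R by (auto simp: field_simps)
    then have v: "?r k \<le> norm v" "norm v \<le> ?r (Suc k)" using R by (auto simp: field_simps)
    have "norm v powr (- s) \<le> (?r k) powr (- s)" using v R s by (intro powr_mono2') auto
    then have "ennreal (indicator (- ball 0 R) v * norm v powr (- s))
        \<le> ennreal ((?r k) powr (- s)) * indicator (cball 0 (?r (Suc k))) v"
      using v by (auto intro!: ennreal_leI split: split_indicator)
    also have "\<dots> \<le> (\<Sum>k. ennreal ((?r k) powr (- s)) * indicator (cball 0 (?r (Suc k))) v)"
      by (rule ennreal_le_suminf)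
    finally show ?thesis .
  qed
  then have "(\<integral>\<^sup>+v. ennreal (indicator (- ball 0 R) v * norm (v :: real^'n) powr (- s)) \<partial>lborel)
      \<le> (\<integral>\<^sup>+v. (\<Sum>k. ennreal ((?r k) powr (- s)) * indicator (cball 0 (?r (Suc k))) (v :: real^'n)) \<partial>lborel)"
    by (intro nn_integral_mono)
  also have "\<dots> = (\<Sum>k. ennreal ((?r k) powr (- s)) * emeasure lborel (cball (0 :: real^'n) (?r (Suc k))))"
    by (rule nn_integral_suminf_cball)
  also have "\<dots> = (\<Sum>k. ennreal (c * \<rho> ^ k))"
  proof (rule suminf_cong)
    fix k
    have "(?r k) powr (- s) * (?r (Suc k)) ^ ?n = R powr (- s) * (2 * R) ^ ?n * \<rho> ^ k"
    proof -
      have "(?r k) powr (- s) * (?r (Suc k)) ^ ?n = R powr (- s) * (2 * R) ^ ?n * ((2 ^ k) powr (- s) * (2 ^ k) ^ ?n)"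
        by (simp add: powr_mult power_mult_distrib)
      also have "(2 ^ k) powr (- s) * (2 ^ k) ^ ?n = \<rho> ^ k"
      proof -
        have "(2 ^ k) powr (- s) * (2 ^ k) ^ ?n = (2 powr real k) powr (- s) * (2 powr real k) ^ ?n"
          by (simp add: powr_realpow)
        also have "\<dots> = 2 powr (real k * (- s + real ?n))" by (rule two_powr_combine)
        also have "\<dots> = \<rho> ^ k" unfolding \<rho>_def two_powr_power by (simp add: algebra_simps)
        finally show ?thesis .
      qed
      finally show ?thesis .
    qed
    then show "ennreal ((?r k) powr (- s)) * emeasure lborel (cball (0 :: real^'n) (?r (Suc k))) = ennreal (c * \<rho> ^ k)"
      using R by (simp add: emeasure_cball c_def ennreal_mult[symmetric] mult_ac)
  qed
  also have "\<dots> < \<infinity>"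
  proof -
    have "c \<ge> 0" using R by (auto simp: c_def)
    then have "(\<Sum>k. ennreal (c * \<rho> ^ k)) \<noteq> top"
      using \<rho> by (intro ennreal_suminf_neq_top summable_mult summable_geometric) auto
    then show ?thesis by (simp add: less_top)
  qed
  finally show ?thesis .
qed

interpretation lborel_pair: pair_sigma_finite "lborel :: (real^'n::finite) measure" "lborel :: (real^'n) measure" ..

lemma nn_integral_convolution_second:
  fixes F w :: "real^'n::finite \<Rightarrow> ennreal"
  assumes F: "F \<in> borel_measurable borel" and w: "w \<in> borel_measurable borel"
  shows "(\<integral>\<^sup>+x. \<integral>\<^sup>+y. F (x - y) * w y \<partial>lborel \<partial>lborel) = (\<integral>\<^sup>+v. F v \<partial>lborel) * (\<integral>\<^sup>+y. w y \<partial>lborel)"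
proof -
  note [measurable] = F w
  have "(\<integral>\<^sup>+x. \<integral>\<^sup>+y. F (x - y) * w y \<partial>lborel \<partial>lborel) = (\<integral>\<^sup>+y. \<integral>\<^sup>+x. F (x - y) * w y \<partial>lborel \<partial>lborel)"
    by (rule lborel_pair.Fubini'[symmetric]) measurable
  also have "\<dots> = (\<integral>\<^sup>+y. (\<integral>\<^sup>+v. F v \<partial>lborel) * w y \<partial>lborel)"
    using lborel_nn_integral_translate[OF F, of "- _"] by (simp add: nn_integral_multc)
  also have "\<dots> = (\<integral>\<^sup>+v. F v \<partial>lborel) * (\<integral>\<^sup>+y. w y \<partial>lborel)"
    by (simp add: nn_integral_cmult)
  finally show ?thesis .
qed

lemma nn_integral_convolution_first:
  fixes F w :: "real^'n::finite \<Rightarrow> ennreal"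
  assumes F: "F \<in> borel_measurable borel" and w: "w \<in> borel_measurable borel" and even: "\<And>v. F (- v) = F v"
  shows "(\<integral>\<^sup>+x. \<integral>\<^sup>+y. F (x - y) * w x \<partial>lborel \<partial>lborel) = (\<integral>\<^sup>+v. F v \<partial>lborel) * (\<integral>\<^sup>+y. w y \<partial>lborel)"
proof -
  note [measurable] = F w
  have "(\<integral>\<^sup>+x. \<integral>\<^sup>+y. F (x - y) * w x \<partial>lborel \<partial>lborel) = (\<integral>\<^sup>+y. \<integral>\<^sup>+x. F (x - y) * w x \<partial>lborel \<partial>lborel)"
    by (rule lborel_pair.Fubini'[symmetric]) measurable
  also have "\<dots> = (\<integral>\<^sup>+y. \<integral>\<^sup>+x. F (y - x) * w x \<partial>lborel \<partial>lborel)"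
    using even by (metis (no_types, lifting) minus_diff_eq nn_integral_cong)
  also have "\<dots> = (\<integral>\<^sup>+v. F v \<partial>lborel) * (\<integral>\<^sup>+y. w y \<partial>lborel)"
    by (rule nn_integral_convolution_second[OF F w])
  finally show ?thesis .
qed

section \<open>Energies\<close>

text \<open>
  The integrals under the roots in \<open>Lp_norm\<close> and \<open>gagliardo_seminorm\<close>. For a seminorm of order \<open>\<theta>\<close>
  the exponent is \<open>r = n + \<theta> * p\<close>; the estimates use only \<open>n < r < n + p\<close>.
\<close>
definition lp_energy :: "(real^'n::finite) set \<Rightarrow> real \<Rightarrow> (real^'n \<Rightarrow> real) \<Rightarrow> ennreal"
  where "lp_energy \<Omega> p f = (\<integral>\<^sup>+x. indicator \<Omega> x * ennreal (\<bar>f x\<bar> powr p) \<partial>lborel)"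

definition gagliardo_energy :: "(real^'n::finite) set \<Rightarrow> real \<Rightarrow> real \<Rightarrow> (real^'n \<Rightarrow> real) \<Rightarrow> ennreal"
  where "gagliardo_energy \<Omega> r p f = (\<integral>\<^sup>+x. indicator \<Omega> x *
    (\<integral>\<^sup>+y. indicator \<Omega> y * ennreal (\<bar>f x - f y\<bar> powr p / norm (x - y) powr r) \<partial>lborel) \<partial>lborel)"

lemma powr_add_le:
  fixes a b :: real assumes "p \<ge> 0"
  shows "\<bar>a + b\<bar> powr p \<le> 2 powr p * (\<bar>a\<bar> powr p + \<bar>b\<bar> powr p)"
proof -
  have "\<bar>a + b\<bar> powr p \<le> (2 * max \<bar>a\<bar> \<bar>b\<bar>) powr p" using assms by (intro powr_mono2) auto
  also have "\<dots> = 2 powr p * (max \<bar>a\<bar> \<bar>b\<bar>) powr p" by (simp add: powr_mult)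
  also have "\<dots> \<le> 2 powr p * (\<bar>a\<bar> powr p + \<bar>b\<bar> powr p)" by (intro mult_left_mono) (auto simp: max_def)
  finally show ?thesis .
qed

lemma powr_sum_le:
  fixes a :: "'j \<Rightarrow> real" assumes "p \<ge> 0" "finite J"
  shows "\<bar>\<Sum>j\<in>J. a j\<bar> powr p \<le> (real (card J)) powr p * (\<Sum>j\<in>J. \<bar>a j\<bar> powr p)"
proof (cases "J = {}")
  case False
  define m where "m = Max ((\<lambda>j. \<bar>a j\<bar>) ` J)"
  have le: "\<bar>a j\<bar> \<le> m" if "j \<in> J" for j unfolding m_def using assms(2) that by auto
  have "m \<in> (\<lambda>j. \<bar>a j\<bar>) ` J" unfolding m_def using assms(2) False by (intro Max_in) auto
  then obtain j0 where j0: "j0 \<in> J" "m = \<bar>a j0\<bar>" by auto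
  have "\<bar>\<Sum>j\<in>J. a j\<bar> \<le> (\<Sum>j\<in>J. \<bar>a j\<bar>)" by (rule sum_abs)
  also have "\<dots> \<le> real (card J) * m" using sum_bounded_above[of J "\<lambda>j. \<bar>a j\<bar>" m] le by simp
  finally have "\<bar>\<Sum>j\<in>J. a j\<bar> powr p \<le> (real (card J) * m) powr p" using assms(1) by (intro powr_mono2) auto
  also have "\<dots> = real (card J) powr p * \<bar>a j0\<bar> powr p" by (simp add: powr_mult j0)
  also have "\<bar>a j0\<bar> powr p \<le> (\<Sum>j\<in>J. \<bar>a j\<bar> powr p)"
    using member_le_sum[of j0 J "\<lambda>j. \<bar>a j\<bar> powr p"] j0(1) assms(2) by simp
  finally show ?thesis by (simp add: mult_left_mono)
qed simp

lemma lp_energy_mono_set: "V \<subseteq> \<Omega> \<Longrightarrow> lp_energy V p f \<le> lp_energy \<Omega> p f"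
  unfolding lp_energy_def by (intro nn_integral_mono mult_right_mono) (auto split: split_indicator)

lemma gagliardo_energy_mono_set: "V \<subseteq> \<Omega> \<Longrightarrow> gagliardo_energy V r p f \<le> gagliardo_energy \<Omega> r p f"
  unfolding gagliardo_energy_def
  by (intro nn_integral_mono mult_mono) (auto split: split_indicator intro!: nn_integral_mono)

lemma lp_energy_0: "lp_energy \<Omega> p (\<lambda>x. 0) = 0"
  by (simp add: lp_energy_def)

lemma gagliardo_energy_0: "gagliardo_energy \<Omega> r p (\<lambda>x. 0) = 0"
  by (simp add: gagliardo_energy_def)

lemma lp_energy_add:
  fixes f g :: "real^'n::finite \<Rightarrow> real"
  assumes [measurable]: "f \<in> borel_measurable borel" "g \<in> borel_measurable borel" and p: "p \<ge> 0" and \<Omega>: "open \<Omega>"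
  shows "lp_energy \<Omega> p (\<lambda>x. f x + g x) \<le> ennreal (2 powr p) * (lp_energy \<Omega> p f + lp_energy \<Omega> p g)"
proof -
  have [measurable]: "\<Omega> \<in> sets borel" using \<Omega> by auto
  have "lp_energy \<Omega> p (\<lambda>x. f x + g x)
      \<le> (\<integral>\<^sup>+x. ennreal (2 powr p) * (indicator \<Omega> x * ennreal (\<bar>f x\<bar> powr p) + indicator \<Omega> x * ennreal (\<bar>g x\<bar> powr p)) \<partial>lborel)"
    unfolding lp_energy_def
    using powr_add_le[OF p]
    by (intro nn_integral_mono) (auto simp: ennreal_mult[symmetric] ennreal_plus[symmetric] simp del: ennreal_plus intro!: ennreal_leI split: split_indicator)
  also have "\<dots> = ennreal (2 powr p) * (lp_energy \<Omega> p f + lp_energy \<Omega> p g)"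
    unfolding lp_energy_def by (subst nn_integral_cmult, measurable, subst nn_integral_add) auto
  finally show ?thesis .
qed

lemma gagliardo_energy_add:
  fixes f g :: "real^'n::finite \<Rightarrow> real"
  assumes [measurable]: "f \<in> borel_measurable borel" "g \<in> borel_measurable borel" and p: "p \<ge> 0" and \<Omega>: "open \<Omega>"
  shows "gagliardo_energy \<Omega> r p (\<lambda>x. f x + g x) \<le> ennreal (2 powr p) * (gagliardo_energy \<Omega> r p f + gagliardo_energy \<Omega> r p g)"
proof -
  have [measurable]: "\<Omega> \<in> sets borel" using \<Omega> by auto
  let ?K = "\<lambda>f x y. ennreal (\<bar>f x - f y\<bar> powr p / norm (x - y) powr r)"
  have pt: "?K (\<lambda>x. f x + g x) x y \<le> ennreal (2 powr p) * (?K f x y + ?K g x y)" for x y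
  proof -
    have "\<bar>f x + g x - (f y + g y)\<bar> powr p \<le> 2 powr p * (\<bar>f x - f y\<bar> powr p + \<bar>g x - g y\<bar> powr p)"
      using powr_add_le[OF p, of "f x - f y" "g x - g y"] by (simp add: algebra_simps)
    then have "\<bar>f x + g x - (f y + g y)\<bar> powr p / norm (x - y) powr r
        \<le> 2 powr p * (\<bar>f x - f y\<bar> powr p / norm (x - y) powr r + \<bar>g x - g y\<bar> powr p / norm (x - y) powr r)"
      by (simp add: divide_right_mono add_divide_distrib[symmetric])
    then show ?thesis by (simp add: ennreal_mult[symmetric] ennreal_plus[symmetric] ennreal_leI del: ennreal_plus)
  qed
  have "gagliardo_energy \<Omega> r p (\<lambda>x. f x + g x)
      \<le> (\<integral>\<^sup>+x. indicator \<Omega> x * (\<integral>\<^sup>+y. indicator \<Omega> y * (ennreal (2 powr p) * (?K f x y + ?K g x y)) \<partial>lborel) \<partial>lborel)"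
    unfolding gagliardo_energy_def by (intro nn_integral_mono mult_left_mono pt) auto
  also have "\<dots> = (\<integral>\<^sup>+x. ennreal (2 powr p) * (indicator \<Omega> x * (\<integral>\<^sup>+y. indicator \<Omega> y * ?K f x y \<partial>lborel) +
      indicator \<Omega> x * (\<integral>\<^sup>+y. indicator \<Omega> y * ?K g x y \<partial>lborel)) \<partial>lborel)"
  proof (rule nn_integral_cong)
    fix x :: "real^'n"
    have "(\<integral>\<^sup>+y. indicator \<Omega> y * (ennreal (2 powr p) * (?K f x y + ?K g x y)) \<partial>lborel)
        = (\<integral>\<^sup>+y. ennreal (2 powr p) * (indicator \<Omega> y * ?K f x y + indicator \<Omega> y * ?K g x y) \<partial>lborel)"
      by (intro nn_integral_cong) (simp add: algebra_simps)
    also have "\<dots> = ennreal (2 powr p) * ((\<integral>\<^sup>+y. indicator \<Omega> y * ?K f x y \<partial>lborel) + (\<integral>\<^sup>+y. indicator \<Omega> y * ?K g x y \<partial>lborel))"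
      by (subst nn_integral_cmult, measurable, subst nn_integral_add) auto
    finally show "indicator \<Omega> x * (\<integral>\<^sup>+y. indicator \<Omega> y * (ennreal (2 powr p) * (?K f x y + ?K g x y)) \<partial>lborel) =
      ennreal (2 powr p) * (indicator \<Omega> x * (\<integral>\<^sup>+y. indicator \<Omega> y * ?K f x y \<partial>lborel) +
      indicator \<Omega> x * (\<integral>\<^sup>+y. indicator \<Omega> y * ?K g x y \<partial>lborel))"
      by (simp split: split_indicator)
  qed
  also have "\<dots> = ennreal (2 powr p) * (gagliardo_energy \<Omega> r p f + gagliardo_energy \<Omega> r p g)"
    unfolding gagliardo_energy_def by (subst nn_integral_cmult, measurable, subst nn_integral_add) auto
  finally show ?thesis .
qed

section \<open>Slobodeckij energy of functions with weak first derivatives\<close>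

text \<open>
  Jensen's inequality for the function \<open>\<bar>x\<bar> powr p\<close>. If \<open>A\<close> is the absolute value of the integral,
  Young's inequality for \<open>A powr (p - 1) * \<bar>k t\<bar>\<close> is integrated, and the terms with \<open>A powr p\<close> are
  collected on the left.
\<close>
lemma powr_integral_le:
  fixes k :: "'a \<Rightarrow> real"
  assumes M: "prob_space M" and k: "k \<in> borel_measurable M" and p: "p > 1"
  shows "ennreal (\<bar>LINT t|M. k t\<bar> powr p) \<le> (\<integral>\<^sup>+t. ennreal (\<bar>k t\<bar> powr p) \<partial>M)"
proof (cases "integrable M k \<and> (\<integral>\<^sup>+t. ennreal (\<bar>k t\<bar> powr p) \<partial>M) < \<infinity>")
  case False
  then show ?thesis by (auto simp: not_integrable_integral_eq less_top[symmetric])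
next
  case True
  interpret prob_space M by (rule M)
  let ?A = "\<bar>LINT t|M. k t\<bar>"
  have i: "integrable M k" and ip: "integrable M (\<lambda>t. \<bar>k t\<bar> powr p)"
    using True k by (auto intro!: integrableI_bounded)
  define q where "q = p / (p - 1)"
  have q: "q > 1" "1 / p + 1 / q = 1" using p by (auto simp: q_def field_simps)
  have "?A powr p \<le> (LINT t|M. \<bar>k t\<bar> powr p)"
  proof (cases "?A = 0")
    case False
    have y: "?A powr (p - 1) * \<bar>k t\<bar> \<le> (p - 1) / p * ?A powr p + \<bar>k t\<bar> powr p / p" for t
    proof -
      have "\<bar>k t\<bar> * ?A powr (p - 1) \<le> \<bar>k t\<bar> powr p / p + (?A powr (p - 1)) powr q / q"
        using p q by (intro Youngs_inequality) auto
      moreover have "(?A powr (p - 1)) powr q = ?A powr p" "1 / q = (p - 1) / p"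
        using p by (auto simp: q_def powr_powr)
      ultimately show ?thesis by (simp add: mult.commute divide_inverse)
    qed
    have "?A powr p = ?A powr (p - 1) * ?A" using False by (simp add: powr_diff field_simps)
    also have "\<dots> \<le> ?A powr (p - 1) * (LINT t|M. \<bar>k t\<bar>)" by (intro mult_left_mono integral_abs_bound) auto
    also have "\<dots> = (LINT t|M. ?A powr (p - 1) * \<bar>k t\<bar>)" by simp
    also have "\<dots> \<le> (LINT t|M. (p - 1) / p * ?A powr p + \<bar>k t\<bar> powr p / p)"
      using i ip by (intro integral_mono y) auto
    also have "\<dots> = (p - 1) / p * ?A powr p + (LINT t|M. \<bar>k t\<bar> powr p) / p"
      using ip by (simp add: prob_space)
    finally show ?thesis using p by (simp add: field_simps)
  qed (use p in simp)
  also have "ennreal \<dots> = (\<integral>\<^sup>+t. ennreal (\<bar>k t\<bar> powr p) \<partial>M)"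
    using ip by (intro nn_integral_eq_integral[symmetric]) auto
  finally show ?thesis by (simp add: ennreal_leI)
qed

abbreviation unit_interval :: "real measure"
  where "unit_interval \<equiv> density lborel (\<lambda>t. ennreal (indicator {0..1} t))"

lemma prob_space_unit_interval: "prob_space unit_interval"
  by (rule prob_spaceI) (simp add: emeasure_density nn_integral_cmult_indicator ennreal_indicator)

interpretation ui: pair_sigma_finite "lborel :: (real^'n::finite) measure" unit_interval
proof -
  interpret u: prob_space unit_interval by (rule prob_space_unit_interval)
  show "pair_sigma_finite (lborel :: (real^'n::finite) measure) unit_interval" ..
qed

lemma measurable_pair_unit_interval:
  "measurable ((lborel :: (real^'n::finite) measure) \<Otimes>\<^sub>M unit_interval) N = measurable (borel \<Otimes>\<^sub>M borel) N"
  by (rule measurable_cong_sets) (auto intro!: sets_pair_measure_cong)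

text \<open>
  The fundamental theorem of calculus along the segment from \<open>x\<close> to \<open>x - v\<close>.
\<close>
lemma test_function_difference:
  fixes \<xi> :: "real^'n::finite \<Rightarrow> real"
  assumes \<xi>: "\<xi> \<in> test_functions UNIV"
  shows "\<xi> (x - v) - \<xi> x = - (LINT t|unit_interval. (\<Sum>j\<in>UNIV. v $ j * partial j \<xi> (x - t *\<^sub>R v)))"
proof -
  let ?d = "\<lambda>t. - (\<Sum>j\<in>UNIV. v $ j * partial j \<xi> (x - t *\<^sub>R v))"
  have diff: "\<xi> differentiable (at y)" for y
    using test_functions_smooth[OF \<xi>] smooth_on_differentiable by blast
  have D: "((\<lambda>t. \<xi> (x - t *\<^sub>R v)) has_real_derivative ?d t) (at t)" for t
  proof -
    have 1: "((\<lambda>t. x - t *\<^sub>R v) has_derivative (\<lambda>s. - s *\<^sub>R v)) (at t)" by (auto intro!: derivative_eq_intros)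
    have 2: "(\<xi> has_derivative frechet_derivative \<xi> (at (x - t *\<^sub>R v))) (at (x - t *\<^sub>R v))"
      using diff by (simp add: frechet_derivative_works)
    have "((\<lambda>t. \<xi> (x - t *\<^sub>R v)) has_derivative (\<lambda>s. frechet_derivative \<xi> (at (x - t *\<^sub>R v)) (- s *\<^sub>R v))) (at t)"
      using has_derivative_compose[OF 1 2] .
    moreover have "frechet_derivative \<xi> (at (x - t *\<^sub>R v)) (- s *\<^sub>R v) = ?d t * s" for s
      by (subst has_derivative_eq_partials[OF diff]) (simp add: sum_distrib_left sum_distrib_right sum_negf mult_ac)
    ultimately show ?thesis unfolding has_field_derivative_def by (elim has_derivative_eq_rhs) auto
  qed
  have cont: "isCont ?d t" for t
  proof -
    have "continuous_on UNIV ?d"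
      by (intro continuous_intros continuous_on_compose2[OF test_functions_continuous[OF test_functions_partial[OF \<xi>], of UNIV]]) auto
    then show ?thesis by (simp add: continuous_on_eq_continuous_at)
  qed
  have "(LBINT t. indicator {0..1} t *\<^sub>R ?d t) = \<xi> (x - 1 *\<^sub>R v) - \<xi> (x - 0 *\<^sub>R v)"
    using integral_FTC_Icc_real[of 0 1 "\<lambda>t. \<xi> (x - t *\<^sub>R v)" ?d] D cont by (simp add: mult.commute)
  moreover have "(\<lambda>t. \<Sum>j\<in>UNIV. v $ j * partial j \<xi> (x - t *\<^sub>R v)) \<in> borel_measurable lborel"
    by (intro borel_measurable_sum borel_measurable_times borel_measurable_const
        measurable_compose[OF _ test_functions_measurable[OF test_functions_partial[OF \<xi>]]]) auto
  ultimately show ?thesis by (simp add: integral_density)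
qed

lemma test_functions_translate:
  fixes \<xi> :: "real^'n::finite \<Rightarrow> real"
  assumes "\<xi> \<in> test_functions UNIV"
  shows "(\<lambda>x. \<xi> (x - w)) \<in> test_functions UNIV"
proof -
  have "smooth_on UNIV (\<lambda>x :: real^'n. x - w)"
    by (subst smooth_on_vec) (auto intro!: smooth_on_diff smooth_on_nth smooth_on_const)
  then show ?thesis
    using test_functions_compose[OF assms, of UNIV "\<lambda>x. x - w" "\<lambda>x. x + w"] by (simp add: continuous_intros)
qed

lemma partial_translate:
  fixes \<xi> :: "real^'n::finite \<Rightarrow> real"
  assumes "\<xi> differentiable (at (x - w))"
  shows "partial j (\<lambda>x. \<xi> (x - w)) x = partial j \<xi> (x - w)"
proof -
  have "((\<lambda>x. \<xi> (x - w)) has_derivative (\<lambda>h. frechet_derivative \<xi> (at (x - w)) h)) (at x)"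
    by (rule has_derivative_compose[of "\<lambda>x. x - w" "\<lambda>h. h"])
      (use assms in \<open>auto simp: frechet_derivative_works intro!: derivative_eq_intros\<close>)
  then show ?thesis by (subst partial_eq) (auto simp: partial_def)
qed

lemma integrable_pair_unit_intervalI:
  fixes F :: "real^'n::finite \<Rightarrow> real \<Rightarrow> real"
  assumes F: "case_prod F \<in> borel_measurable (borel \<Otimes>\<^sub>M borel)" and K: "K < \<infinity>"
    and bound: "\<And>t. 0 \<le> t \<Longrightarrow> t \<le> 1 \<Longrightarrow> (\<integral>\<^sup>+x. ennreal \<bar>F x t\<bar> \<partial>lborel) \<le> K"
  shows "integrable (lborel \<Otimes>\<^sub>M unit_interval) (case_prod F)"
proof (rule integrableI_bounded)
  show m: "case_prod F \<in> borel_measurable (lborel \<Otimes>\<^sub>M unit_interval)"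
    unfolding measurable_pair_unit_interval by (rule F)
  have "(\<integral>\<^sup>+z. ennreal (norm (case_prod F z)) \<partial>(lborel \<Otimes>\<^sub>M unit_interval))
      = (\<integral>\<^sup>+t. \<integral>\<^sup>+x. ennreal (norm (case_prod F (x, t))) \<partial>lborel \<partial>unit_interval)"
    by (rule ui.nn_integral_snd[symmetric]) (use m in auto)
  also have "\<dots> \<le> (\<integral>\<^sup>+t. K \<partial>unit_interval)"
  proof (rule nn_integral_mono_AE)
    have "AE t in unit_interval. t \<in> {0..1}" by (subst AE_density) (auto simp: indicator_def)
    then show "AE t in unit_interval. (\<integral>\<^sup>+x. ennreal (norm (case_prod F (x, t))) \<partial>lborel) \<le> K"
      by eventually_elim (use bound in simp)
  qed
  also have "\<dots> = K" using prob_space.emeasure_space_1[OF prob_space_unit_interval] by simp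
  finally show "(\<integral>\<^sup>+z. ennreal (norm (case_prod F z)) \<partial>(lborel \<Otimes>\<^sub>M unit_interval)) < \<infinity>" using K by simp
qed

text \<open>
  The fundamental theorem of calculus for functions with weak first derivatives. Both sides are
  tested with \<open>\<xi>\<close>: a translation and the definition of the weak derivative move translation and
  derivative to \<open>\<xi>\<close>, for which the classical theorem holds, and Fubini's theorem exchanges the
  integrals over \<open>x\<close> and \<open>t\<close>.
\<close>
lemma AE_difference_eq_integral:
  fixes h :: "real^'n::finite \<Rightarrow> real"
  assumes wd: "\<And>j. wd UNIV [j] h (h' j)"
  shows "AE x in lborel. h (v + x) - h x = (LINT t|unit_interval. (\<Sum>j\<in>UNIV. v $ j * h' j (x + t *\<^sub>R v)))"
proof -
  define k where "k x t = (\<Sum>j\<in>UNIV. v $ j * h' j (x + t *\<^sub>R v))" for x t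
  have h: "loc_int UNIV h" and h': "\<And>j. loc_int UNIV (h' j)" using wd by (auto simp: wd_def)
  note [measurable] = loc_int_measurable[OF h] loc_int_measurable[OF h']
  have km [measurable]: "case_prod k \<in> borel_measurable (borel \<Otimes>\<^sub>M borel)" unfolding k_def by measurable
  have main: "integrable lborel (\<lambda>x. (LINT t|unit_interval. k x t) * \<xi> x) \<and> integrable lborel (\<lambda>x. (h (v + x) - h x) * \<xi> x) \<and>
      (LINT x|lborel. (h (v + x) - h x) * \<xi> x) = (LINT x|lborel. (LINT t|unit_interval. k x t) * \<xi> x)"
    if \<xi>: "\<xi> \<in> test_functions UNIV" for \<xi>
  proof -
    note [measurable] = test_functions_measurable[OF \<xi>] test_functions_measurable[OF test_functions_partial[OF \<xi>]]
    obtain C where C: "compact C" "\<And>x. x \<notin> C \<Longrightarrow> \<xi> x = 0" using test_functions_support[OF \<xi>] by blast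
    \<comment> \<open>For \<open>0 \<le> t \<le> 1\<close> the functions \<open>\<xi> (x - t *\<^sub>R v)\<close> of \<open>x\<close> have their supports in \<open>C'\<close>.\<close>
    define C' where "C' = (\<lambda>(x, s). x + s *\<^sub>R v) ` (C \<times> {0..1})"
    have C': "compact C'" unfolding C'_def
      using C(1) by (intro compact_continuous_image compact_Times) (auto intro!: continuous_intros simp: case_prod_beta)
    then have [measurable]: "C' \<in> sets borel" by (rule borel_compact)
    have mem: "x + t *\<^sub>R v \<in> C'" if "x \<in> C" "0 \<le> t" "t \<le> 1" for x t unfolding C'_def using that by force
    have fin: "(\<integral>\<^sup>+x. ennreal (indicator C' x * \<bar>f x\<bar>) \<partial>lborel) < \<infinity>" if "loc_int UNIV f" for f :: "real^'n \<Rightarrow> real"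
      using that C' by (auto simp: loc_int_def integrable_iff_bounded abs_mult)
    obtain B where B: "B > 0" "\<And>x. \<bar>\<xi> x\<bar> \<le> B" using test_functions_bounded[OF \<xi>] by metis
    have diff: "\<xi> differentiable (at y)" for y using test_functions_smooth[OF \<xi>] smooth_on_differentiable by blast
    have tr: "(\<lambda>x. \<xi> (x - t *\<^sub>R v)) \<in> test_functions UNIV" for t by (rule test_functions_translate[OF \<xi>])
    have dtr: "(\<lambda>x. partial j \<xi> (x - t *\<^sub>R v)) \<in> test_functions UNIV" for j t
      by (rule test_functions_translate[OF test_functions_partial[OF \<xi>]])
    have intB: "integrable (lborel \<Otimes>\<^sub>M unit_interval) (case_prod (\<lambda>x t. \<xi> x * k x t))"
    proof (rule integrable_pair_unit_intervalI)
      show "case_prod (\<lambda>x t. \<xi> x * k x t) \<in> borel_measurable (borel \<Otimes>\<^sub>M borel)" by measurable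
      let ?K = "\<Sum>j\<in>UNIV. ennreal (B * \<bar>v $ j\<bar>) * (\<integral>\<^sup>+x. ennreal (indicator C' x * \<bar>h' j x\<bar>) \<partial>lborel)"
      show "?K < \<infinity>" using fin[OF h'] by (auto simp: ennreal_mult_eq_top_iff less_top[symmetric])
      fix t :: real assume t: "0 \<le> t" "t \<le> 1"
      have "ennreal \<bar>\<xi> x * k x t\<bar> \<le> (\<Sum>j\<in>UNIV. ennreal (B * \<bar>v $ j\<bar>) * ennreal (indicator C' (t *\<^sub>R v + x) * \<bar>h' j (t *\<^sub>R v + x)\<bar>))" for x
      proof (cases "x \<in> C")
        case True
        then have "t *\<^sub>R v + x \<in> C'" using mem[OF True t] by (simp add: add.commute)
        moreover have "\<bar>\<xi> x * k x t\<bar> \<le> (\<Sum>j\<in>UNIV. (B * \<bar>v $ j\<bar>) * \<bar>h' j (t *\<^sub>R v + x)\<bar>)"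
        proof -
          have "\<bar>\<xi> x * k x t\<bar> \<le> B * (\<Sum>j\<in>UNIV. \<bar>v $ j * h' j (x + t *\<^sub>R v)\<bar>)"
            unfolding abs_mult[of "\<xi> x"] k_def using B by (intro mult_mono sum_abs) auto
          then show ?thesis by (simp add: sum_distrib_left abs_mult mult.assoc add.commute)
        qed
        ultimately show ?thesis using B(1)
          by (simp add: ennreal_mult[symmetric] ennreal_leI)
      qed (simp add: C(2))
      then have "(\<integral>\<^sup>+x. ennreal \<bar>\<xi> x * k x t\<bar> \<partial>lborel)
          \<le> (\<integral>\<^sup>+x. (\<Sum>j\<in>UNIV. ennreal (B * \<bar>v $ j\<bar>) * ennreal (indicator C' (t *\<^sub>R v + x) * \<bar>h' j (t *\<^sub>R v + x)\<bar>)) \<partial>lborel)"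
        by (intro nn_integral_mono)
      also have "\<dots> = (\<Sum>j\<in>UNIV. ennreal (B * \<bar>v $ j\<bar>) * (\<integral>\<^sup>+x. ennreal (indicator C' (t *\<^sub>R v + x) * \<bar>h' j (t *\<^sub>R v + x)\<bar>) \<partial>lborel))"
        by (subst nn_integral_sum) (auto simp: nn_integral_cmult)
      also have "\<dots> = ?K"
        by (intro sum.cong refl arg_cong2[where f = "(*)"] lborel_nn_integral_translate) measurable
      finally show "(\<integral>\<^sup>+x. ennreal \<bar>\<xi> x * k x t\<bar> \<partial>lborel) \<le> ?K" .
    qed
    define w where "w x t = (\<Sum>j\<in>UNIV. v $ j * partial j \<xi> (x - t *\<^sub>R v))" for x t
    have w0: "w x t = 0" if "x \<notin> C'" "0 \<le> t" "t \<le> 1" for x t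
    proof -
      have "x - t *\<^sub>R v \<notin> C" using mem[of "x - t *\<^sub>R v" t] that by auto
      then have "x - t *\<^sub>R v \<in> - C" by simp
      moreover have "open (- C)" using C(1) by (simp add: compact_imp_closed open_Compl)
      ultimately have "partial j \<xi> (x - t *\<^sub>R v) = 0" for j
        using partial_cong_open[of "- C" "x - t *\<^sub>R v" \<xi> "\<lambda>x. 0" j] diff C(2) by simp
      then show ?thesis by (simp add: w_def)
    qed
    have "\<forall>j. \<exists>B. \<forall>x. \<bar>partial j \<xi> x\<bar> \<le> B" using test_functions_bounded[OF test_functions_partial[OF \<xi>]] by metis
    then obtain b where b: "\<And>j x. \<bar>partial j \<xi> x\<bar> \<le> b j" by metis
    define B' where "B' = (\<Sum>j\<in>UNIV. \<bar>v $ j\<bar> * b j)"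
    have wB: "\<bar>w x t\<bar> \<le> B'" for x t
      unfolding w_def B'_def by (rule order_trans[OF sum_abs sum_mono]) (auto simp: abs_mult intro!: mult_left_mono b)
    have intA: "integrable (lborel \<Otimes>\<^sub>M unit_interval) (case_prod (\<lambda>x t. h x * w x t))"
    proof (rule integrable_pair_unit_intervalI)
      show "case_prod (\<lambda>x t. h x * w x t) \<in> borel_measurable (borel \<Otimes>\<^sub>M borel)" unfolding w_def by measurable
      let ?K = "ennreal B' * (\<integral>\<^sup>+x. ennreal (indicator C' x * \<bar>h x\<bar>) \<partial>lborel)"
      show "?K < \<infinity>" using fin[OF h] by (auto simp: ennreal_mult_eq_top_iff less_top[symmetric])
      fix t :: real assume t: "0 \<le> t" "t \<le> 1"
      have "\<bar>h x * w x t\<bar> \<le> B' * (indicator C' x * \<bar>h x\<bar>)" for x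
        using mult_left_mono[OF wB[of x t], of "\<bar>h x\<bar>"] w0[OF _ t, of x]
        by (cases "x \<in> C'") (simp_all add: abs_mult mult.commute)
      moreover have "B' \<ge> 0" using wB[of 0 0] by linarith
      ultimately have "ennreal \<bar>h x * w x t\<bar> \<le> ennreal B' * ennreal (indicator C' x * \<bar>h x\<bar>)" for x
        by (simp add: ennreal_mult[symmetric] ennreal_leI)
      then have "(\<integral>\<^sup>+x. ennreal \<bar>h x * w x t\<bar> \<partial>lborel) \<le> (\<integral>\<^sup>+x. ennreal B' * ennreal (indicator C' x * \<bar>h x\<bar>) \<partial>lborel)"
        by (intro nn_integral_mono)
      also have "\<dots> = ?K" by (rule nn_integral_cmult) measurable
      finally show "(\<integral>\<^sup>+x. ennreal \<bar>h x * w x t\<bar> \<partial>lborel) \<le> ?K" .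
    qed
    have slice: "(LINT x|lborel. \<xi> x * k x t) = - (LINT x|lborel. h x * w x t)" for t
    proof -
      have ih': "integrable lborel (\<lambda>x. h' j x * \<xi> (x - t *\<^sub>R v))" for j
        by (rule loc_int_mult_test[OF h' tr])
      have i1: "integrable lborel (\<lambda>x. \<xi> x * h' j (x + t *\<^sub>R v))" for j
        using lborel_integrable_translate[OF ih'[of j], of "t *\<^sub>R v"] by (simp add: mult.commute add.commute)
      have e1: "(LINT x|lborel. \<xi> x * h' j (x + t *\<^sub>R v)) = (LINT x|lborel. h' j x * \<xi> (x - t *\<^sub>R v))" for j
        using lborel_integral_translate[of "\<lambda>x. h' j x * \<xi> (x - t *\<^sub>R v)" "t *\<^sub>R v"] ih'[of j] by (simp add: mult.commute add.commute)
      have e2: "(LINT x|lborel. h' j x * \<xi> (x - t *\<^sub>R v)) = - (LINT x|lborel. h x * partial j \<xi> (x - t *\<^sub>R v))" for j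
        using wd[of j] tr[of t] by (auto simp: wd_def partials_Cons partial_translate[OF diff, abs_def])
      have i2: "integrable lborel (\<lambda>x. h x * partial j \<xi> (x - t *\<^sub>R v))" for j
        by (rule loc_int_mult_test[OF h dtr])
      have "(LINT x|lborel. \<xi> x * k x t) = (LINT x|lborel. (\<Sum>j\<in>UNIV. v $ j * (\<xi> x * h' j (x + t *\<^sub>R v))))"
        by (simp add: k_def sum_distrib_left mult_ac)
      also have "\<dots> = (\<Sum>j\<in>UNIV. v $ j * (LINT x|lborel. \<xi> x * h' j (x + t *\<^sub>R v)))"
        using i1 by (subst Bochner_Integration.integral_sum) auto
      also have "\<dots> = - (\<Sum>j\<in>UNIV. v $ j * (LINT x|lborel. h x * partial j \<xi> (x - t *\<^sub>R v)))"
        by (simp add: e1 e2 sum_negf)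
      also have "(\<Sum>j\<in>UNIV. v $ j * (LINT x|lborel. h x * partial j \<xi> (x - t *\<^sub>R v))) = (LINT x|lborel. (\<Sum>j\<in>UNIV. v $ j * (h x * partial j \<xi> (x - t *\<^sub>R v))))"
        using i2 by (subst Bochner_Integration.integral_sum) auto
      also have "\<dots> = (LINT x|lborel. h x * w x t)"
        by (simp add: w_def sum_distrib_left mult_ac)
      finally show ?thesis .
    qed
    have ihv: "integrable lborel (\<lambda>x. h x * \<xi> (x - v))" using loc_int_mult_test[OF h tr[of 1]] by simp
    have ih: "integrable lborel (\<lambda>x. h x * \<xi> x)" by (rule loc_int_mult_test[OF h \<xi>])
    have ihv': "integrable lborel (\<lambda>x. h (v + x) * \<xi> x)" using lborel_integrable_translate[OF ihv, of v] by simp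
    have ehv': "(LINT x|lborel. h (v + x) * \<xi> x) = (LINT x|lborel. h x * \<xi> (x - v))"
      using lborel_integral_translate[of "\<lambda>x. h x * \<xi> (x - v)" v] ihv by simp
    have "(LINT x|lborel. (LINT t|unit_interval. k x t) * \<xi> x) = (LINT x|lborel. (LINT t|unit_interval. \<xi> x * k x t))"
      by (simp add: mult.commute)
    also have "\<dots> = (LINT t|unit_interval. (LINT x|lborel. \<xi> x * k x t))"
      by (rule ui.Fubini_integral[OF intB, symmetric])
    also have "\<dots> = - (LINT t|unit_interval. (LINT x|lborel. h x * w x t))" by (simp add: slice)
    also have "(LINT t|unit_interval. (LINT x|lborel. h x * w x t)) = (LINT x|lborel. (LINT t|unit_interval. h x * w x t))"
      by (rule ui.Fubini_integral[OF intA])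
    also have "\<dots> = (LINT x|lborel. - (h x * (\<xi> (x - v) - \<xi> x)))"
      by (simp add: test_function_difference[OF \<xi>] w_def)
    also have "- \<dots> = (LINT x|lborel. h x * \<xi> (x - v)) - (LINT x|lborel. h x * \<xi> x)"
      using ihv ih by (simp add: right_diff_distrib)
    also have "\<dots> = (LINT x|lborel. (h (v + x) - h x) * \<xi> x)"
      using ihv' ih by (simp add: left_diff_distrib ehv')
    finally have "(LINT x|lborel. (LINT t|unit_interval. k x t) * \<xi> x) = (LINT x|lborel. (h (v + x) - h x) * \<xi> x)" .
    moreover have "integrable lborel (\<lambda>x. (LINT t|unit_interval. k x t) * \<xi> x)"
      using ui.integrable_fst[OF intB] by (simp add: mult.commute)
    moreover have "integrable lborel (\<lambda>x. (h (v + x) - h x) * \<xi> x)" using ihv' ih by (simp add: left_diff_distrib)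
    ultimately show ?thesis by simp
  qed
  have qm: "(\<lambda>x. LINT t|unit_interval. k x t) \<in> borel_measurable borel"
  proof -
    have "case_prod k \<in> borel_measurable (lborel \<Otimes>\<^sub>M unit_interval)" unfolding measurable_pair_unit_interval by (rule km)
    from ui.M2.borel_measurable_lebesgue_integral[OF this] show ?thesis by simp
  qed
  have "AE x in lborel. x \<in> UNIV \<longrightarrow> h (v + x) - h x = (LINT t|unit_interval. k x t)"
  proof (rule AE_eq_if_test_integrals_eq[OF open_UNIV])
    show "loc_int UNIV (\<lambda>x. h (v + x) - h x)" by (rule loc_intI_test) (use main in auto)
    show "loc_int UNIV (\<lambda>x. LINT t|unit_interval. k x t)" by (rule loc_intI_test[OF qm]) (use main in auto)
  qed (use main in blast)
  then show ?thesis by (simp add: k_def)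
qed

text \<open>
  By Jensen's inequality the \<open>p\<close>-th power of the difference is at most an average over \<open>t\<close> of
  \<open>p\<close>-th powers of the directional derivative at \<open>x + t *\<^sub>R v\<close>; for each \<open>t\<close> the integral over \<open>x\<close>
  is translation invariant.
\<close>
lemma translation_energy_le:
  fixes h :: "real^'n::finite \<Rightarrow> real"
  assumes wd: "\<And>j. wd UNIV [j] h (h' j)" and p: "p > 1"
  shows "(\<integral>\<^sup>+x. ennreal (\<bar>h (v + x) - h x\<bar> powr p) \<partial>lborel)
    \<le> ennreal (real CARD('n) powr p * norm v powr p) * (\<Sum>j\<in>UNIV. lp_energy UNIV p (h' j))"
proof -
  define k where "k x t = (\<Sum>j\<in>UNIV. v $ j * h' j (x + t *\<^sub>R v))" for x t
  have h': "\<And>j. loc_int UNIV (h' j)" using wd by (auto simp: wd_def)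
  note [measurable] = loc_int_measurable[OF h']
  have km [measurable]: "case_prod k \<in> borel_measurable (borel \<Otimes>\<^sub>M borel)" unfolding k_def by measurable
  have "(\<integral>\<^sup>+x. ennreal (\<bar>h (v + x) - h x\<bar> powr p) \<partial>lborel) = (\<integral>\<^sup>+x. ennreal (\<bar>LINT t|unit_interval. k x t\<bar> powr p) \<partial>lborel)"
  proof (rule nn_integral_cong_AE)
    show "AE x in lborel. ennreal (\<bar>h (v + x) - h x\<bar> powr p) = ennreal (\<bar>LINT t|unit_interval. k x t\<bar> powr p)"
      using AE_difference_eq_integral[OF wd, of v] by eventually_elim (simp add: k_def)
  qed
  also have "\<dots> \<le> (\<integral>\<^sup>+x. \<integral>\<^sup>+t. ennreal (\<bar>k x t\<bar> powr p) \<partial>unit_interval \<partial>lborel)"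
    by (intro nn_integral_mono powr_integral_le prob_space_unit_interval p) measurable
  also have "\<dots> = (\<integral>\<^sup>+t. \<integral>\<^sup>+x. ennreal (\<bar>k x t\<bar> powr p) \<partial>lborel \<partial>unit_interval)"
    by (rule ui.Fubini'[symmetric]) (unfold measurable_pair_unit_interval, measurable)
  also have "\<dots> \<le> (\<integral>\<^sup>+t. ennreal (real CARD('n) powr p * norm v powr p) * (\<Sum>j\<in>UNIV. lp_energy UNIV p (h' j)) \<partial>unit_interval)"
  proof (rule nn_integral_mono)
    fix t
    have "(\<integral>\<^sup>+x. ennreal (\<bar>k x t\<bar> powr p) \<partial>lborel) = (\<integral>\<^sup>+x. ennreal (\<bar>\<Sum>j\<in>UNIV. v $ j * h' j (t *\<^sub>R v + x)\<bar> powr p) \<partial>lborel)"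
      by (simp add: k_def add.commute)
    also have "\<dots> = (\<integral>\<^sup>+x. ennreal (\<bar>\<Sum>j\<in>UNIV. v $ j * h' j x\<bar> powr p) \<partial>lborel)"
      by (rule lborel_nn_integral_translate) measurable
    also have "\<dots> \<le> (\<integral>\<^sup>+x. ennreal (real CARD('n) powr p * norm v powr p) * (\<Sum>j\<in>UNIV. ennreal (\<bar>h' j x\<bar> powr p)) \<partial>lborel)"
    proof (rule nn_integral_mono)
      fix x
      have "\<bar>\<Sum>j\<in>UNIV. v $ j * h' j x\<bar> powr p \<le> real CARD('n) powr p * (\<Sum>j\<in>UNIV. \<bar>v $ j * h' j x\<bar> powr p)"
        using powr_sum_le[of p "UNIV :: 'n set" "\<lambda>j. v $ j * h' j x"] p by simp
      also have "\<dots> \<le> real CARD('n) powr p * (\<Sum>j\<in>UNIV. norm v powr p * \<bar>h' j x\<bar> powr p)"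
      proof (intro mult_left_mono sum_mono)
        fix j
        have "\<bar>v $ j\<bar> powr p \<le> norm v powr p" using p component_le_norm_cart[of v j] by (intro powr_mono2) auto
        then show "\<bar>v $ j * h' j x\<bar> powr p \<le> norm v powr p * \<bar>h' j x\<bar> powr p"
          by (simp add: abs_mult powr_mult mult_right_mono)
      qed simp
      finally show "ennreal (\<bar>\<Sum>j\<in>UNIV. v $ j * h' j x\<bar> powr p)
          \<le> ennreal (real CARD('n) powr p * norm v powr p) * (\<Sum>j\<in>UNIV. ennreal (\<bar>h' j x\<bar> powr p))"
        by (simp add: ennreal_mult[symmetric] sum_distrib_left[symmetric] mult.assoc sum_nonneg ennreal_leI)
    qed
    also have "\<dots> = ennreal (real CARD('n) powr p * norm v powr p) * (\<Sum>j\<in>UNIV. lp_energy UNIV p (h' j))"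
      unfolding lp_energy_def by (subst nn_integral_cmult, measurable, subst nn_integral_sum) auto
    finally show "(\<integral>\<^sup>+x. ennreal (\<bar>k x t\<bar> powr p) \<partial>lborel) \<le> ennreal (real CARD('n) powr p * norm v powr p) * (\<Sum>j\<in>UNIV. lp_energy UNIV p (h' j))" .
  qed
  also have "\<dots> = ennreal (real CARD('n) powr p * norm v powr p) * (\<Sum>j\<in>UNIV. lp_energy UNIV p (h' j))"
    using prob_space.emeasure_space_1[OF prob_space_unit_interval] by simp
  finally show ?thesis .
qed

lemma nn_integral2_add:
  fixes F G :: "real^'n::finite \<Rightarrow> real^'n \<Rightarrow> ennreal"
  assumes [measurable]: "case_prod F \<in> borel_measurable (borel \<Otimes>\<^sub>M borel)" "case_prod G \<in> borel_measurable (borel \<Otimes>\<^sub>M borel)"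
  shows "(\<integral>\<^sup>+x. \<integral>\<^sup>+y. F x y + G x y \<partial>lborel \<partial>lborel) = (\<integral>\<^sup>+x. \<integral>\<^sup>+y. F x y \<partial>lborel \<partial>lborel) + (\<integral>\<^sup>+x. \<integral>\<^sup>+y. G x y \<partial>lborel \<partial>lborel)"
proof -
  have "(\<integral>\<^sup>+x. \<integral>\<^sup>+y. F x y + G x y \<partial>lborel \<partial>lborel) = (\<integral>\<^sup>+x. (\<integral>\<^sup>+y. F x y \<partial>lborel) + (\<integral>\<^sup>+y. G x y \<partial>lborel) \<partial>lborel)"
    by (intro nn_integral_cong nn_integral_add) measurable
  also have "\<dots> = (\<integral>\<^sup>+x. \<integral>\<^sup>+y. F x y \<partial>lborel \<partial>lborel) + (\<integral>\<^sup>+x. \<integral>\<^sup>+y. G x y \<partial>lborel \<partial>lborel)"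
    by (rule nn_integral_add) measurable
  finally show ?thesis .
qed

lemma nn_integral2_cmult:
  fixes F :: "real^'n::finite \<Rightarrow> real^'n \<Rightarrow> ennreal"
  assumes [measurable]: "case_prod F \<in> borel_measurable (borel \<Otimes>\<^sub>M borel)"
  shows "(\<integral>\<^sup>+x. \<integral>\<^sup>+y. c * F x y \<partial>lborel \<partial>lborel) = c * (\<integral>\<^sup>+x. \<integral>\<^sup>+y. F x y \<partial>lborel \<partial>lborel)"
proof -
  have "(\<integral>\<^sup>+x. \<integral>\<^sup>+y. c * F x y \<partial>lborel \<partial>lborel) = (\<integral>\<^sup>+x. c * (\<integral>\<^sup>+y. F x y \<partial>lborel) \<partial>lborel)"
    by (intro nn_integral_cong nn_integral_cmult) measurable
  also have "\<dots> = c * (\<integral>\<^sup>+x. \<integral>\<^sup>+y. F x y \<partial>lborel \<partial>lborel)"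
    by (rule nn_integral_cmult) measurable
  finally show ?thesis .
qed

text \<open>
  Double integrals over pairs of points at distance less than \<open>\<delta>\<close>, respectively at least \<open>\<delta>\<close>, are
  convolutions with these kernels.
\<close>
definition near_kernel :: "real \<Rightarrow> real \<Rightarrow> real^'n::finite \<Rightarrow> ennreal"
  where "near_kernel \<delta> s v = ennreal (indicator (ball 0 \<delta>) v * norm v powr s)"

definition far_kernel :: "real \<Rightarrow> real \<Rightarrow> real^'n::finite \<Rightarrow> ennreal"
  where "far_kernel \<delta> s v = ennreal (indicator (- ball 0 \<delta>) v * norm v powr (- s))"

lemma measurable_near_kernel [measurable]: "near_kernel \<delta> s \<in> borel_measurable borel"
proof -
  have [measurable]: "ball (0::real^'a) \<delta> \<in> sets borel" by simp
  show ?thesis unfolding near_kernel_def[abs_def] by measurable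
qed

lemma measurable_far_kernel [measurable]: "far_kernel \<delta> s \<in> borel_measurable borel"
proof -
  have [measurable]: "- ball (0::real^'a) \<delta> \<in> sets borel" by (simp add: borel_closed closed_Compl)
  show ?thesis unfolding far_kernel_def[abs_def] by measurable
qed

lemma far_kernel_minus: "far_kernel \<delta> s (- v) = far_kernel \<delta> s v"
  by (simp add: far_kernel_def indicator_def)

lemma lp_energy_UNIV: "lp_energy UNIV p f = (\<integral>\<^sup>+x. ennreal (\<bar>f x\<bar> powr p) \<partial>lborel)"
  by (simp add: lp_energy_def)

lemma gagliardo_energy_UNIV:
  "gagliardo_energy UNIV r p f = (\<integral>\<^sup>+x. \<integral>\<^sup>+y. ennreal (\<bar>f x - f y\<bar> powr p / norm (x - y) powr r) \<partial>lborel \<partial>lborel)"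
  by (simp add: gagliardo_energy_def)

lemma far_kernel_energy:
  fixes h :: "real^'n::finite \<Rightarrow> real"
  assumes [measurable]: "h \<in> borel_measurable borel"
  shows "(\<integral>\<^sup>+x. \<integral>\<^sup>+y. far_kernel \<delta> r (x - y) * ennreal (\<bar>h x\<bar> powr p) + far_kernel \<delta> r (x - y) * ennreal (\<bar>h y\<bar> powr p) \<partial>lborel \<partial>lborel)
    = 2 * (\<integral>\<^sup>+v. far_kernel \<delta> r (v :: real^'n) \<partial>lborel) * lp_energy UNIV p h"
proof -
  have "(\<integral>\<^sup>+x. \<integral>\<^sup>+y. far_kernel \<delta> r (x - y) * ennreal (\<bar>h x\<bar> powr p) + far_kernel \<delta> r (x - y) * ennreal (\<bar>h y\<bar> powr p) \<partial>lborel \<partial>lborel)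
     = (\<integral>\<^sup>+x. \<integral>\<^sup>+y. far_kernel \<delta> r (x - y) * ennreal (\<bar>h x\<bar> powr p) \<partial>lborel \<partial>lborel) +
       (\<integral>\<^sup>+x. \<integral>\<^sup>+y. far_kernel \<delta> r (x - y) * ennreal (\<bar>h y\<bar> powr p) \<partial>lborel \<partial>lborel)"
    by (rule nn_integral2_add) measurable
  also have "(\<integral>\<^sup>+x. \<integral>\<^sup>+y. far_kernel \<delta> r (x - y) * ennreal (\<bar>h x\<bar> powr p) \<partial>lborel \<partial>lborel)
     = (\<integral>\<^sup>+v. far_kernel \<delta> r (v :: real^'n) \<partial>lborel) * lp_energy UNIV p h"
    unfolding lp_energy_UNIV by (rule nn_integral_convolution_first) (measurable, rule far_kernel_minus)
  also have "(\<integral>\<^sup>+x. \<integral>\<^sup>+y. far_kernel \<delta> r (x - y) * ennreal (\<bar>h y\<bar> powr p) \<partial>lborel \<partial>lborel)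
     = (\<integral>\<^sup>+v. far_kernel \<delta> r (v :: real^'n) \<partial>lborel) * lp_energy UNIV p h"
    unfolding lp_energy_UNIV by (rule nn_integral_convolution_second) measurable
  finally show ?thesis by (simp add: mult_2 distrib_right)
qed

text \<open>
  For distant points the two terms of the difference are estimated separately; each contributes
  the integral of the far kernel times an \<open>L\<^sup>p\<close> energy.
\<close>
lemma far_kernel_bound:
  fixes x y :: "real^'n::finite" and a b :: real
  assumes "norm (x - y) \<ge> \<delta>" "p \<ge> 0"
  shows "ennreal (\<bar>a - b\<bar> powr p / norm (x - y) powr r)
    \<le> ennreal (2 powr p) * (far_kernel \<delta> r (x - y) * ennreal (\<bar>a\<bar> powr p) + far_kernel \<delta> r (x - y) * ennreal (\<bar>b\<bar> powr p))"
proof -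
  have "\<bar>a - b\<bar> powr p \<le> 2 powr p * (\<bar>a\<bar> powr p + \<bar>b\<bar> powr p)"
    using powr_add_le[OF assms(2), of a "- b"] by simp
  then have "\<bar>a - b\<bar> powr p / norm (x - y) powr r \<le> 2 powr p * (\<bar>a\<bar> powr p + \<bar>b\<bar> powr p) / norm (x - y) powr r"
    by (rule divide_right_mono) simp
  also have "\<dots> = 2 powr p * (norm (x - y) powr (- r) * \<bar>a\<bar> powr p + norm (x - y) powr (- r) * \<bar>b\<bar> powr p)"
    by (simp add: powr_minus_divide distrib_left add_divide_distrib)
  finally show ?thesis using assms(1)
    by (simp add: far_kernel_def ennreal_mult[symmetric] ennreal_plus[symmetric] ennreal_leI del: ennreal_plus)
qed

lemma nn_integral_near_kernel_finite:
  "real CARD('n) + s > 0 \<Longrightarrow> \<delta> > 0 \<Longrightarrow> (\<integral>\<^sup>+v. near_kernel \<delta> s (v :: real^'n::finite) \<partial>lborel) < \<infinity>"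
  unfolding near_kernel_def by (rule nn_integral_norm_powr_near)

lemma nn_integral_far_kernel_finite:
  "s > real CARD('n) \<Longrightarrow> \<delta> > 0 \<Longrightarrow> (\<integral>\<^sup>+v. far_kernel \<delta> s (v :: real^'n::finite) \<partial>lborel) < \<infinity>"
  unfolding far_kernel_def by (rule nn_integral_norm_powr_far)

lemma ennreal_bound_exists:
  fixes I :: ennreal assumes "I < \<infinity>"
  obtains C where "C > 0" "I \<le> ennreal C"
proof
  show "max 1 (enn2real I) > 0" by simp
  have "I = ennreal (enn2real I)" using assms by simp
  also have "\<dots> \<le> ennreal (max 1 (enn2real I))" by (intro ennreal_leI) simp
  finally show "I \<le> ennreal (max 1 (enn2real I))" .
qed

lemma near_kernel_bound:
  assumes "real CARD('n) + s > 0" "\<delta> > 0"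
  shows "\<exists>C>0. (\<integral>\<^sup>+v. near_kernel \<delta> s (v :: real^'n::finite) \<partial>lborel) \<le> ennreal C"
  using ennreal_bound_exists[OF nn_integral_near_kernel_finite[OF assms]] by blast

lemma far_kernel_bound_integral:
  assumes "s > real CARD('n)" "\<delta> > 0"
  shows "\<exists>C>0. (\<integral>\<^sup>+v. far_kernel \<delta> s (v :: real^'n::finite) \<partial>lborel) \<le> ennreal C"
  using ennreal_bound_exists[OF nn_integral_far_kernel_finite[OF assms]] by blast

text \<open>
  For pairs at distance at least \<open>1\<close> the values of \<open>h\<close> are estimated separately. For pairs
  \<open>y + v\<close>, \<open>y\<close> with \<open>norm v < 1\<close> the integral over \<open>y\<close> is at most a multiple of \<open>norm v powr p\<close> by
  \<open>translation_energy_le\<close>, and \<open>norm v powr (p - r)\<close> is integrable near \<open>0\<close> because \<open>r < n + p\<close>.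
\<close>
lemma gagliardo_energy_le_weak_gradient:
  fixes p r :: real
  assumes p: "p > 1" and r: "real CARD('n::finite) < r" "r < real CARD('n) + p"
  obtains C where "C > 0" "\<And>(h :: real^'n \<Rightarrow> real) h'. (\<And>j. wd UNIV [j] h (h' j)) \<Longrightarrow>
    gagliardo_energy UNIV r p h \<le> ennreal C * (lp_energy UNIV p h + (\<Sum>j\<in>UNIV. lp_energy UNIV p (h' j)))"
proof -
  obtain C1 where C1: "C1 > 0" "(\<integral>\<^sup>+v. near_kernel 1 (p - r) (v :: real^'n) \<partial>lborel) \<le> ennreal C1"
    using near_kernel_bound[of "p - r" 1, where 'n = 'n] r by auto
  obtain C2 where C2: "C2 > 0" "(\<integral>\<^sup>+v. far_kernel 1 r (v :: real^'n) \<partial>lborel) \<le> ennreal C2"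
    using far_kernel_bound_integral[of r 1, where 'n = 'n] r by auto
  define C where "C = real CARD('n) powr p * C1 + 2 powr p * (2 * C2)"
  show thesis
  proof (rule that)
    show "C > 0" unfolding C_def using C1(1) C2(1) by (intro add_pos_pos mult_pos_pos) auto
    fix h :: "real^'n \<Rightarrow> real" and h' assume wd: "\<And>j. wd UNIV [j] h (h' j)"
    have hm [measurable]: "h \<in> borel_measurable borel" using wd loc_int_measurable by (auto simp: wd_def)
    let ?D = "\<Sum>j\<in>UNIV. lp_energy UNIV p (h' j)"
    let ?near = "\<lambda>x y. near_kernel 1 (- r) (x - y) * ennreal (\<bar>h x - h y\<bar> powr p)"
    let ?far = "\<lambda>x y. far_kernel 1 r (x - y) * ennreal (\<bar>h x\<bar> powr p) + far_kernel 1 r (x - y) * ennreal (\<bar>h y\<bar> powr p)"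
    have "gagliardo_energy UNIV r p h \<le> (\<integral>\<^sup>+x. \<integral>\<^sup>+y. ?near x y + ennreal (2 powr p) * ?far x y \<partial>lborel \<partial>lborel)"
      unfolding gagliardo_energy_UNIV
    proof (intro nn_integral_mono)
      fix x y
      show "ennreal (\<bar>h x - h y\<bar> powr p / norm (x - y) powr r) \<le> ?near x y + ennreal (2 powr p) * ?far x y"
      proof (cases "norm (x - y) \<ge> 1")
        case True
        have "ennreal (\<bar>h x - h y\<bar> powr p / norm (x - y) powr r) \<le> ennreal (2 powr p) * ?far x y"
          using far_kernel_bound[OF True, of p "h x" "h y" r] p by simp
        then show ?thesis by (rule order_trans) simp
      next
        case False
        then have "ennreal (\<bar>h x - h y\<bar> powr p / norm (x - y) powr r) = ?near x y"
          by (simp add: near_kernel_def ennreal_mult[symmetric] powr_minus_divide)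
        then show ?thesis by simp
      qed
    qed
    also have "\<dots> = (\<integral>\<^sup>+x. \<integral>\<^sup>+y. ?near x y \<partial>lborel \<partial>lborel) + (\<integral>\<^sup>+x. \<integral>\<^sup>+y. ennreal (2 powr p) * ?far x y \<partial>lborel \<partial>lborel)"
      by (rule nn_integral2_add) measurable
    also have "(\<integral>\<^sup>+x. \<integral>\<^sup>+y. ennreal (2 powr p) * ?far x y \<partial>lborel \<partial>lborel) = ennreal (2 powr p) * (\<integral>\<^sup>+x. \<integral>\<^sup>+y. ?far x y \<partial>lborel \<partial>lborel)"
      by (rule nn_integral2_cmult) measurable
    also have "(\<integral>\<^sup>+x. \<integral>\<^sup>+y. ?far x y \<partial>lborel \<partial>lborel) = 2 * (\<integral>\<^sup>+v. far_kernel 1 r (v :: real^'n) \<partial>lborel) * lp_energy UNIV p h"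
      by (rule far_kernel_energy[OF hm])
    also have "(\<integral>\<^sup>+x. \<integral>\<^sup>+y. ?near x y \<partial>lborel \<partial>lborel) \<le> ennreal (real CARD('n) powr p * C1) * ?D"
    proof -
      have "(\<integral>\<^sup>+x. \<integral>\<^sup>+y. ?near x y \<partial>lborel \<partial>lborel) = (\<integral>\<^sup>+y. \<integral>\<^sup>+x. ?near x y \<partial>lborel \<partial>lborel)"
        by (rule lborel_pair.Fubini'[symmetric]) measurable
      also have "\<dots> = (\<integral>\<^sup>+y. \<integral>\<^sup>+v. near_kernel 1 (- r) v * ennreal (\<bar>h (y + v) - h y\<bar> powr p) \<partial>lborel \<partial>lborel)"
      proof (rule nn_integral_cong)
        fix y
        have "(\<lambda>x. ?near x y) \<in> borel_measurable borel" by measurable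
        from lborel_nn_integral_translate[OF this, of y]
        show "(\<integral>\<^sup>+x. ?near x y \<partial>lborel) = (\<integral>\<^sup>+v. near_kernel 1 (- r) v * ennreal (\<bar>h (y + v) - h y\<bar> powr p) \<partial>lborel)"
          by simp
      qed
      also have "\<dots> = (\<integral>\<^sup>+v. \<integral>\<^sup>+y. near_kernel 1 (- r) v * ennreal (\<bar>h (y + v) - h y\<bar> powr p) \<partial>lborel \<partial>lborel)"
        by (rule lborel_pair.Fubini'[symmetric]) measurable
      also have "\<dots> = (\<integral>\<^sup>+v. near_kernel 1 (- r) v * (\<integral>\<^sup>+y. ennreal (\<bar>h (v + y) - h y\<bar> powr p) \<partial>lborel) \<partial>lborel)"
        by (simp add: nn_integral_cmult add.commute)
      also have "\<dots> \<le> (\<integral>\<^sup>+v. near_kernel 1 (p - r) (v :: real^'n) * (ennreal (real CARD('n) powr p) * ?D) \<partial>lborel)"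
      proof (rule nn_integral_mono)
        fix v :: "real^'n"
        have "near_kernel 1 (- r) v * (\<integral>\<^sup>+y. ennreal (\<bar>h (v + y) - h y\<bar> powr p) \<partial>lborel)
            \<le> near_kernel 1 (- r) v * (ennreal (real CARD('n) powr p * norm v powr p) * ?D)"
          by (intro mult_left_mono translation_energy_le wd p) simp
        also have "\<dots> = near_kernel 1 (p - r) v * (ennreal (real CARD('n) powr p) * ?D)"
        proof -
          have "near_kernel 1 (- r) v * ennreal (norm v powr p) = near_kernel 1 (p - r) v"
            by (simp add: near_kernel_def ennreal_mult[symmetric] powr_add[symmetric] mult.assoc)
          moreover have "near_kernel 1 (- r) v * (ennreal (real CARD('n) powr p * norm v powr p) * ?D)
              = near_kernel 1 (- r) v * ennreal (norm v powr p) * (ennreal (real CARD('n) powr p) * ?D)"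
            by (simp add: ennreal_mult mult_ac)
          ultimately show ?thesis by simp
        qed
        finally show "near_kernel 1 (- r) v * (\<integral>\<^sup>+y. ennreal (\<bar>h (v + y) - h y\<bar> powr p) \<partial>lborel)
          \<le> near_kernel 1 (p - r) v * (ennreal (real CARD('n) powr p) * ?D)" .
      qed
      also have "\<dots> = (\<integral>\<^sup>+v. near_kernel 1 (p - r) (v :: real^'n) \<partial>lborel) * (ennreal (real CARD('n) powr p) * ?D)"
        by (rule nn_integral_multc) measurable
      also have "\<dots> \<le> ennreal C1 * (ennreal (real CARD('n) powr p) * ?D)"
        by (intro mult_right_mono C1) simp
      also have "\<dots> = ennreal (real CARD('n) powr p * C1) * ?D"
        using C1(1) by (simp add: ennreal_mult mult_ac)
      finally show ?thesis .
    qed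
    also have "ennreal (2 powr p) * (2 * (\<integral>\<^sup>+v. far_kernel 1 r (v :: real^'n) \<partial>lborel) * lp_energy UNIV p h)
        \<le> ennreal (2 powr p) * (2 * ennreal C2 * lp_energy UNIV p h)"
      by (intro mult_left_mono mult_right_mono C2) auto
    also have "\<dots> = ennreal (2 powr p * (2 * C2)) * lp_energy UNIV p h"
      using C2(1) by (simp add: ennreal_mult mult.assoc)
    also have "ennreal (real CARD('n) powr p * C1) * ?D + ennreal (2 powr p * (2 * C2)) * lp_energy UNIV p h
        \<le> ennreal C * ?D + ennreal C * lp_energy UNIV p h"
      using C1(1) C2(1) by (intro add_mono mult_right_mono ennreal_leI) (auto simp: C_def)
    finally show "gagliardo_energy UNIV r p h \<le> ennreal C * (lp_energy UNIV p h + ?D)"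
      by (simp add: distrib_left add.commute add_mono)
  qed
qed

section \<open>Energy of a pullback\<close>

lemma compact_neighbourhood:
  fixes K :: "(real^'n::finite) set"
  assumes K: "compact K" and V: "open V" "K \<subseteq> V"
  obtains \<delta> K' where "\<delta> > 0" "compact K'" "K' \<subseteq> V" "\<And>x. x \<in> K \<Longrightarrow> cball x \<delta> \<subseteq> K'"
proof -
  obtain \<delta> where \<delta>: "\<delta> > 0" "(\<Union>x\<in>K. cball x \<delta>) \<subseteq> V"
    using compact_subset_open_imp_cball_epsilon_subset[OF K V] by metis
  have eq: "(\<Union>x\<in>K. cball x \<delta>) = {x + y | x y. x \<in> K \<and> y \<in> cball 0 \<delta>}"
  proof safe
    fix x z assume "x \<in> K" "z \<in> cball x \<delta>"
    then show "\<exists>x' y. z = x' + y \<and> x' \<in> K \<and> y \<in> cball 0 \<delta>"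
      by (intro exI[of _ x] exI[of _ "z - x"]) (auto simp: dist_norm norm_minus_commute)
  next
    fix x y :: "real^'n" assume "x \<in> K" "y \<in> cball 0 \<delta>"
    then show "x + y \<in> (\<Union>x\<in>K. cball x \<delta>)" by (intro UN_I[of x]) (auto simp: dist_norm)
  qed
  have "compact (\<Union>x\<in>K. cball x \<delta>)" unfolding eq by (rule compact_sums[OF K compact_cball])
  with \<delta> that show thesis by blast
qed

text \<open>
  A smooth function need not be Lipschitz on a compact set that is not convex; the estimate holds
  for points joined by a segment in the set, with the same constant for all of them.
\<close>
lemma smooth_on_lipschitz_segment:
  fixes f :: "real^'n::finite \<Rightarrow> 'b::real_normed_vector"
  assumes f: "smooth_on V f" and K: "compact K" "K \<subseteq> V"
  obtains L where "L > 0" "\<And>x y. closed_segment x y \<subseteq> K \<Longrightarrow> norm (f x - f y) \<le> L * norm (x - y)"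
proof -
  have "compact ((\<lambda>x. \<Sum>j\<in>UNIV. norm (partial j f x)) ` K)"
    using K by (intro compact_continuous_image continuous_intros continuous_on_subset[OF smooth_on_continuous_on[OF smooth_on_partial[OF f]]])
  then obtain L where L: "L > 0" "\<And>x. x \<in> K \<Longrightarrow> \<bar>\<Sum>j\<in>UNIV. norm (partial j f x)\<bar> \<le> L"
    using compact_imp_bounded bounded_pos[of "(\<lambda>x. \<Sum>j\<in>UNIV. norm (partial j f x)) ` K"] by auto
  show thesis
  proof (rule that[OF L(1)])
    fix x y assume xy: "closed_segment x y \<subseteq> K"
    show "norm (f x - f y) \<le> L * norm (x - y)"
    proof (rule differentiable_bound)
      show "convex (closed_segment x y)" by (rule convex_closed_segment)
      fix z assume z: "z \<in> closed_segment x y"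
      then have d: "f differentiable (at z)" using f K(2) xy smooth_on_differentiable by blast
      then show "(f has_derivative frechet_derivative f (at z)) (at z within closed_segment x y)"
        by (simp add: frechet_derivative_works has_derivative_at_withinI)
      show "onorm (frechet_derivative f (at z)) \<le> L"
      proof (rule onorm_le)
        fix v
        have "norm (frechet_derivative f (at z) v) \<le> (\<Sum>j\<in>UNIV. norm ((v $ j) *\<^sub>R partial j f z))"
          unfolding has_derivative_eq_partials[OF d] by (rule norm_sum)
        also have "\<dots> \<le> (\<Sum>j\<in>UNIV. norm v * norm (partial j f z))"
          by (intro sum_mono) (simp add: mult_right_mono component_le_norm_cart)
        also have "\<dots> = (\<Sum>j\<in>UNIV. norm (partial j f z)) * norm v" by (simp add: sum_distrib_left mult.commute)
        also have "\<dots> \<le> L * norm v" using L(2)[of z] z xy by (intro mult_right_mono) auto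
        finally show "norm (frechet_derivative f (at z) v) \<le> L * norm v" .
      qed
    qed auto
  qed
qed

context smooth_diffeo
begin

text \<open>
  The Jacobian has a positive minimum on \<open>K\<close>.
\<close>
lemma nn_integral_pullback_compact:
  assumes K: "compact K" "K \<subseteq> V"
  shows "\<exists>C>0. \<forall>F\<in>borel_measurable borel.
    (\<integral>\<^sup>+y. indicator K y * F (\<tau> y) \<partial>lborel) \<le> ennreal C * (\<integral>\<^sup>+z. indicator V' z * F z \<partial>lborel)"
proof -
  have "\<exists>c>0. \<forall>y\<in>K. c \<le> jac \<tau> y"
  proof (cases "K = {}")
    case False
    obtain x0 where "x0 \<in> K" "\<forall>y\<in>K. jac \<tau> x0 \<le> jac \<tau> y"
      using continuous_attains_inf[OF K(1) False continuous_on_subset[OF smooth_on_continuous_on[OF smooth_on_jac] K(2)]] by blast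
    then show ?thesis using jac_pos K(2) by (intro exI[of _ "jac \<tau> x0"]) auto
  qed (auto intro: exI[of _ 1])
  then obtain c where c: "c > 0" "\<And>y. y \<in> K \<Longrightarrow> c \<le> jac \<tau> y" by blast
  show ?thesis
  proof (intro exI[of _ "1 / c"] conjI ballI)
    show "1 / c > 0" using c by simp
    fix F :: "real^'n \<Rightarrow> ennreal" assume F: "F \<in> borel_measurable borel"
    note [measurable] = F measurable_\<tau> measurable_jac
    have "(\<integral>\<^sup>+y. indicator K y * F (\<tau> y) \<partial>lborel)
        \<le> (\<integral>\<^sup>+y. ennreal (1 / c) * (ennreal (indicator V y * jac \<tau> y) * F (if y \<in> V then \<tau> y else 0)) \<partial>lborel)"
    proof (rule nn_integral_mono)
      fix y
      show "indicator K y * F (\<tau> y) \<le> ennreal (1 / c) * (ennreal (indicator V y * jac \<tau> y) * F (if y \<in> V then \<tau> y else 0))"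
      proof (cases "y \<in> K")
        case True
        have "1 \<le> ennreal (1 / c * jac \<tau> y)"
          using c(1) c(2)[OF True] by (intro ennreal_ge_1[THEN iffD2]) (simp add: field_simps)
        then have "1 * F (\<tau> y) \<le> ennreal (1 / c * jac \<tau> y) * F (\<tau> y)" by (rule mult_right_mono) simp
        then show ?thesis using True K(2) c(1) by (auto simp: ennreal_mult[symmetric] mult.assoc[symmetric] jac_def)
      qed simp
    qed
    also have "\<dots> = ennreal (1 / c) * (\<integral>\<^sup>+y. ennreal (indicator V y * jac \<tau> y) * F (if y \<in> V then \<tau> y else 0) \<partial>lborel)"
      by (rule nn_integral_cmult) measurable
    also have "(\<integral>\<^sup>+y. ennreal (indicator V y * jac \<tau> y) * F (if y \<in> V then \<tau> y else 0) \<partial>lborel)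
        = (\<integral>\<^sup>+y. ennreal (indicator V y * jac \<tau> y) * F (\<tau> y) \<partial>lborel)"
      by (intro nn_integral_cong) (simp split: split_indicator)
    also have "\<dots> = (\<integral>\<^sup>+z. indicator V' z * F z \<partial>lborel)" by (rule nn_integral_change_of_variables[OF F])
    finally show "(\<integral>\<^sup>+y. indicator K y * F (\<tau> y) \<partial>lborel) \<le> ennreal (1 / c) * (\<integral>\<^sup>+z. indicator V' z * F z \<partial>lborel)" .
  qed
qed

lemma lp_energy_pullback:
  assumes a: "a \<in> test_functions V" and p: "p > 0"
  shows "\<exists>C>0. \<forall>g\<in>borel_measurable borel.
    lp_energy UNIV p (\<lambda>y. a y * g (\<tau> y)) \<le> ennreal C * lp_energy V' p g"
proof -
  obtain B where B: "B > 0" "\<And>x. \<bar>a x\<bar> \<le> B" using test_functions_bounded[OF a] by metis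
  obtain K where K: "compact K" "K \<subseteq> V" "\<And>x. x \<notin> K \<Longrightarrow> a x = 0" using test_functions_support[OF a] by blast
  obtain C where C: "C > 0" "\<And>F. F \<in> borel_measurable borel \<Longrightarrow>
    (\<integral>\<^sup>+y. indicator K y * F (\<tau> y) \<partial>lborel) \<le> ennreal C * (\<integral>\<^sup>+z. indicator V' z * F z \<partial>lborel)"
    using nn_integral_pullback_compact[OF K(1,2)] by blast
  show ?thesis
  proof (intro exI[of _ "B powr p * C"] conjI ballI)
    show "B powr p * C > 0" using B C by simp
    fix g :: "real^'n \<Rightarrow> real" assume g [measurable]: "g \<in> borel_measurable borel"
    note [measurable] = measurable_\<tau>
    have [measurable]: "K \<in> sets borel" by (rule borel_compact[OF K(1)])
    have "lp_energy UNIV p (\<lambda>y. a y * g (\<tau> y))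
        \<le> (\<integral>\<^sup>+y. ennreal (B powr p) * (indicator K y * ennreal (\<bar>g (if y \<in> V then \<tau> y else 0)\<bar> powr p)) \<partial>lborel)"
      unfolding lp_energy_UNIV
    proof (rule nn_integral_mono)
      fix y
      show "ennreal (\<bar>a y * g (\<tau> y)\<bar> powr p) \<le> ennreal (B powr p) * (indicator K y * ennreal (\<bar>g (if y \<in> V then \<tau> y else 0)\<bar> powr p))"
      proof (cases "y \<in> K")
        case True
        have "\<bar>a y\<bar> powr p \<le> B powr p" using B p by (intro powr_mono2) auto
        then have "\<bar>a y * g (\<tau> y)\<bar> powr p \<le> B powr p * \<bar>g (\<tau> y)\<bar> powr p"
          by (simp add: abs_mult powr_mult mult_right_mono)
        then show ?thesis using True K(2) by (auto simp: ennreal_mult[symmetric] ennreal_leI)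
      qed (use K(3) p in simp)
    qed
    also have "\<dots> = ennreal (B powr p) * (\<integral>\<^sup>+y. indicator K y * ennreal (\<bar>g (if y \<in> V then \<tau> y else 0)\<bar> powr p) \<partial>lborel)"
      by (rule nn_integral_cmult) measurable
    also have "(\<integral>\<^sup>+y. indicator K y * ennreal (\<bar>g (if y \<in> V then \<tau> y else 0)\<bar> powr p) \<partial>lborel)
        = (\<integral>\<^sup>+y. indicator K y * ennreal (\<bar>g (\<tau> y)\<bar> powr p) \<partial>lborel)"
      using K(2) by (intro nn_integral_cong) (auto split: split_indicator)
    also have "ennreal (B powr p) * \<dots> \<le> ennreal (B powr p) * (ennreal C * lp_energy V' p g)"
      unfolding lp_energy_def by (intro mult_left_mono C(2)) auto
    finally show "lp_energy UNIV p (\<lambda>y. a y * g (\<tau> y)) \<le> ennreal (B powr p * C) * lp_energy V' p g"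
      using C(1) by (simp add: ennreal_mult mult.assoc)
  qed
qed

text \<open>
  Let \<open>K\<close> be the support of \<open>a\<close> and \<open>K'\<close> a compact neighbourhood of it in \<open>V\<close> that contains the
  balls of radius \<open>\<delta>\<close> around the points of \<open>K\<close>. If \<open>x\<close> and \<open>y\<close> have distance at least \<open>\<delta>\<close>, the two
  values of the function are estimated separately. Otherwise the integrand vanishes or the segment
  from \<open>x\<close> to \<open>y\<close> lies in \<open>K'\<close>, and the difference is
  \<open>a x * (g (\<tau> x) - g (\<tau> y)) + (a x - a y) * g (\<tau> y)\<close>. In the first summand \<open>1 / norm (x - y)\<close> is
  at most a constant times \<open>1 / norm (\<tau> x - \<tau> y)\<close>, so that a change of both variables yields the
  energy of \<open>g\<close>. In the second summand the factor \<open>norm (x - y) powr p\<close> leaves an integrable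
  kernel, and the double integral is a convolution.
\<close>
lemma gagliardo_energy_pullback:
  fixes p r :: real
  assumes a: "a \<in> test_functions V" and p: "p > 1" and r: "real CARD('n) < r" "r < real CARD('n) + p"
  shows "\<exists>C>0. \<forall>g\<in>borel_measurable borel.
    gagliardo_energy UNIV r p (\<lambda>y. a y * g (\<tau> y)) \<le> ennreal C * (gagliardo_energy V' r p g + lp_energy V' p g)"
proof -
  have p0: "p > 0" using p by simp
  obtain B where B: "B > 0" "\<And>x. \<bar>a x\<bar> \<le> B" using test_functions_bounded[OF a] by metis
  obtain K where K: "compact K" "K \<subseteq> V" "\<And>x. x \<notin> K \<Longrightarrow> a x = 0" using test_functions_support[OF a] by blast
  obtain \<delta> K' where K': "\<delta> > 0" "compact K'" "K' \<subseteq> V" "\<And>x. x \<in> K \<Longrightarrow> cball x \<delta> \<subseteq> K'"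
    using compact_neighbourhood[OF K(1) open_V K(2)] by metis
  obtain L where L: "L > 0" "\<And>x y. closed_segment x y \<subseteq> K' \<Longrightarrow> norm (\<tau> x - \<tau> y) \<le> L * norm (x - y)"
    using smooth_on_lipschitz_segment[OF smooth_\<tau> K'(2,3)] by metis
  obtain La where La: "La > 0" "\<And>x y. closed_segment x y \<subseteq> K' \<Longrightarrow> norm (a x - a y) \<le> La * norm (x - y)"
    using smooth_on_lipschitz_segment[OF test_functions_smooth[OF a] K'(2)] by auto
  obtain C0 where C0: "C0 > 0" "\<And>F. F \<in> borel_measurable borel \<Longrightarrow>
    (\<integral>\<^sup>+y. indicator K' y * F (\<tau> y) \<partial>lborel) \<le> ennreal C0 * (\<integral>\<^sup>+z. indicator V' z * F z \<partial>lborel)"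
    using nn_integral_pullback_compact[OF K'(2,3)] by blast
  obtain CE where CE: "CE > 0" "\<And>g. g \<in> borel_measurable borel \<Longrightarrow>
    lp_energy UNIV p (\<lambda>y. a y * g (\<tau> y)) \<le> ennreal CE * lp_energy V' p g"
    using lp_energy_pullback[OF a p0] by blast
  obtain CN where CN: "CN > 0" "(\<integral>\<^sup>+v. near_kernel \<delta> (p - r) (v :: real^'n) \<partial>lborel) \<le> ennreal CN"
    using near_kernel_bound[of "p - r" \<delta>, where 'n = 'n] r K'(1) by auto
  obtain CF where CF: "CF > 0" "(\<integral>\<^sup>+v. far_kernel \<delta> r (v :: real^'n) \<partial>lborel) \<le> ennreal CF"
    using far_kernel_bound_integral[of r \<delta>, where 'n = 'n] r K'(1) by auto
  define c1 where "c1 = 2 powr p * (B powr p * L powr r)"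
  define c2 where "c2 = 2 powr p * La powr p"
  have c: "c1 \<ge> 0" "c2 \<ge> 0" by (auto simp: c1_def c2_def)
  define T where "T y = (if y \<in> V then \<tau> y else 0)" for y
  have T [measurable]: "T \<in> borel_measurable borel" unfolding T_def[abs_def] by (rule measurable_\<tau>)
  have KK: "K \<subseteq> K'" using K'(1,4) by force
  have [measurable]: "K' \<in> sets borel" by (rule borel_compact[OF K'(2)])
  define C where "C = c1 * C0 * C0 + (c2 * CN * C0 + 2 powr p * (2 * CF * CE))"
  show ?thesis
  proof (intro exI[of _ C] conjI ballI)
    show "C > 0" unfolding C_def
      by (intro add_nonneg_pos add_nonneg_nonneg mult_nonneg_nonneg) (use C0(1) CN(1) CF(1) CE(1) c in auto)
    fix g :: "real^'n \<Rightarrow> real" assume g [measurable]: "g \<in> borel_measurable borel"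
    define h where "h y = a y * g (\<tau> y)" for y
    have hm [measurable]: "h \<in> borel_measurable borel" unfolding h_def[abs_def]
      by (rule measurable_pullback[OF test_functions_measurable[OF a] test_functions_zero[OF a] g])
    let ?\<Phi> = "\<lambda>x y. ennreal (\<bar>g x - g y\<bar> powr p / norm (x - y) powr r)"
    \<comment> \<open>The integrand is bounded by \<open>?A\<close>, which carries the difference of \<open>g \<circ> \<tau>\<close>, by \<open>?N\<close>, which
      carries that of \<open>a\<close>, and by \<open>?F\<close> for distant points. The Borel map \<open>T\<close> replaces \<open>\<tau>\<close>
      for the sake of measurability.\<close>
    let ?w = "\<lambda>y. indicator K' y * ennreal (\<bar>g (T y)\<bar> powr p)"
    let ?A = "\<lambda>x y. indicator K' x * (indicator K' y * ?\<Phi> (T x) (T y))"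
    let ?N = "\<lambda>x y. near_kernel \<delta> (p - r) (x - y) * ?w y"
    let ?F = "\<lambda>x y. far_kernel \<delta> r (x - y) * ennreal (\<bar>h x\<bar> powr p) + far_kernel \<delta> r (x - y) * ennreal (\<bar>h y\<bar> powr p)"
    have pt: "ennreal (\<bar>h x - h y\<bar> powr p / norm (x - y) powr r)
        \<le> ennreal c1 * ?A x y + (ennreal c2 * ?N x y + ennreal (2 powr p) * ?F x y)" for x y
    proof (cases "norm (x - y) \<ge> \<delta>")
      case True
      have "ennreal (\<bar>h x - h y\<bar> powr p / norm (x - y) powr r) \<le> ennreal (2 powr p) * ?F x y"
        using far_kernel_bound[OF True, of p "h x" "h y" r] p by simp
      then show ?thesis by (rule order_trans) (simp add: add_increasing)
    next
      case False
      show ?thesis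
      proof (cases "x = y \<or> (x \<notin> K \<and> y \<notin> K)")
        case True
        then show ?thesis using p by (auto simp: h_def K(3))
      next
        case False
        have xy: "norm (x - y) > 0" using False by simp
        obtain z where z: "z \<in> K" "x \<in> cball z \<delta>" "y \<in> cball z \<delta>"
          using False \<open>\<not> norm (x - y) \<ge> \<delta>\<close> K'(1) by (force simp: dist_norm norm_minus_commute)
        then have seg: "closed_segment x y \<subseteq> K'"
          using K'(4)[OF z(1)] closed_segment_subset[OF z(2,3) convex_cball] by blast
        then have xK: "x \<in> K'" and yK: "y \<in> K'" by auto
        then have Tx: "T x = \<tau> x" and Ty: "T y = \<tau> y" and xV: "x \<in> V" and yV: "y \<in> V" using K'(3) by (auto simp: T_def)
        have ne: "\<tau> x \<noteq> \<tau> y" using False \<sigma>\<tau>[OF xV] \<sigma>\<tau>[OF yV] by metis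
        have "h x - h y = a x * (g (\<tau> x) - g (\<tau> y)) + (a x - a y) * g (\<tau> y)"
          by (simp add: h_def algebra_simps)
        then have "\<bar>h x - h y\<bar> powr p \<le> 2 powr p * (\<bar>a x * (g (\<tau> x) - g (\<tau> y))\<bar> powr p + \<bar>(a x - a y) * g (\<tau> y)\<bar> powr p)"
          using powr_add_le[of p] p by simp
        also have "\<dots> \<le> 2 powr p * (B powr p * \<bar>g (\<tau> x) - g (\<tau> y)\<bar> powr p + La powr p * norm (x - y) powr p * \<bar>g (\<tau> y)\<bar> powr p)"
        proof (intro mult_left_mono add_mono)
          show "\<bar>a x * (g (\<tau> x) - g (\<tau> y))\<bar> powr p \<le> B powr p * \<bar>g (\<tau> x) - g (\<tau> y)\<bar> powr p"
            unfolding abs_mult powr_mult using B p by (intro mult_right_mono powr_mono2) auto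
          have "\<bar>a x - a y\<bar> powr p \<le> (La * norm (x - y)) powr p"
            using La(2)[OF seg] p by (intro powr_mono2) auto
          then show "\<bar>(a x - a y) * g (\<tau> y)\<bar> powr p \<le> La powr p * norm (x - y) powr p * \<bar>g (\<tau> y)\<bar> powr p"
            unfolding abs_mult powr_mult by (intro mult_right_mono) auto
        qed simp
        finally have 1: "\<bar>h x - h y\<bar> powr p / norm (x - y) powr r
            \<le> 2 powr p * (B powr p * \<bar>g (\<tau> x) - g (\<tau> y)\<bar> powr p + La powr p * norm (x - y) powr p * \<bar>g (\<tau> y)\<bar> powr p) / norm (x - y) powr r"
          by (rule divide_right_mono) simp
        have "norm (\<tau> x - \<tau> y) powr r \<le> (L * norm (x - y)) powr r"
          using L(2)[OF seg] r by (intro powr_mono2) auto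
        then have "1 / norm (x - y) powr r \<le> L powr r / norm (\<tau> x - \<tau> y) powr r"
          using xy ne by (simp add: powr_mult field_simps)
        then have 2: "\<bar>g (\<tau> x) - g (\<tau> y)\<bar> powr p / norm (x - y) powr r \<le> L powr r * (\<bar>g (\<tau> x) - g (\<tau> y)\<bar> powr p / norm (\<tau> x - \<tau> y) powr r)"
          using mult_left_mono[of "1 / norm (x - y) powr r" "L powr r / norm (\<tau> x - \<tau> y) powr r" "\<bar>g (\<tau> x) - g (\<tau> y)\<bar> powr p"]
          by (simp add: mult.commute)
        have "2 powr p * (B powr p * \<bar>g (\<tau> x) - g (\<tau> y)\<bar> powr p + La powr p * norm (x - y) powr p * \<bar>g (\<tau> y)\<bar> powr p) / norm (x - y) powr r
           = 2 powr p * B powr p * (\<bar>g (\<tau> x) - g (\<tau> y)\<bar> powr p / norm (x - y) powr r) + c2 * (norm (x - y) powr (p - r) * \<bar>g (\<tau> y)\<bar> powr p)"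
          by (simp add: c2_def powr_diff add_divide_distrib distrib_left mult_ac)
        also have "\<dots> \<le> 2 powr p * B powr p * (L powr r * (\<bar>g (\<tau> x) - g (\<tau> y)\<bar> powr p / norm (\<tau> x - \<tau> y) powr r)) + c2 * (norm (x - y) powr (p - r) * \<bar>g (\<tau> y)\<bar> powr p)"
          by (intro add_mono mult_left_mono 2) (auto simp: c)
        also have "\<dots> = c1 * (\<bar>g (\<tau> x) - g (\<tau> y)\<bar> powr p / norm (\<tau> x - \<tau> y) powr r) + c2 * (norm (x - y) powr (p - r) * \<bar>g (\<tau> y)\<bar> powr p)"
          by (simp add: c1_def mult_ac)
        finally have 3: "\<bar>h x - h y\<bar> powr p / norm (x - y) powr r
            \<le> c1 * (\<bar>g (\<tau> x) - g (\<tau> y)\<bar> powr p / norm (\<tau> x - \<tau> y) powr r) + c2 * (norm (x - y) powr (p - r) * \<bar>g (\<tau> y)\<bar> powr p)"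
          using 1 by linarith
        have "ennreal (\<bar>h x - h y\<bar> powr p / norm (x - y) powr r) \<le> ennreal c1 * ?A x y + ennreal c2 * ?N x y"
        proof -
          have e: "ennreal (c1 * X + c2 * (n * Z)) = ennreal c1 * ennreal X + ennreal c2 * (ennreal n * ennreal Z)"
            if "X \<ge> 0" "n \<ge> 0" "Z \<ge> 0" for X n Z using c that by (simp add: ennreal_mult ennreal_plus)
          have "?A x y = ennreal (\<bar>g (\<tau> x) - g (\<tau> y)\<bar> powr p / norm (\<tau> x - \<tau> y) powr r)"
            using xK yK Tx Ty by simp
          moreover have "?N x y = ennreal (norm (x - y) powr (p - r)) * ennreal (\<bar>g (\<tau> y)\<bar> powr p)"
            using yK Ty \<open>\<not> norm (x - y) \<ge> \<delta>\<close> by (simp add: near_kernel_def)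
          moreover note ennreal_leI[OF 3]
          ultimately show ?thesis by (subst (asm) e) auto
        qed
        also have "\<dots> \<le> ennreal c1 * ?A x y + (ennreal c2 * ?N x y + ennreal (2 powr p) * ?F x y)"
          by (intro add_mono order_refl) simp
        finally show ?thesis .
      qed
    qed
    have "gagliardo_energy UNIV r p h \<le> (\<integral>\<^sup>+x. \<integral>\<^sup>+y. ennreal c1 * ?A x y + (ennreal c2 * ?N x y + ennreal (2 powr p) * ?F x y) \<partial>lborel \<partial>lborel)"
      unfolding gagliardo_energy_UNIV by (intro nn_integral_mono pt)
    also have "\<dots> = (\<integral>\<^sup>+x. \<integral>\<^sup>+y. ennreal c1 * ?A x y \<partial>lborel \<partial>lborel) + (\<integral>\<^sup>+x. \<integral>\<^sup>+y. ennreal c2 * ?N x y + ennreal (2 powr p) * ?F x y \<partial>lborel \<partial>lborel)"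
      by (rule nn_integral2_add) measurable
    also have "(\<integral>\<^sup>+x. \<integral>\<^sup>+y. ennreal c2 * ?N x y + ennreal (2 powr p) * ?F x y \<partial>lborel \<partial>lborel)
        = (\<integral>\<^sup>+x. \<integral>\<^sup>+y. ennreal c2 * ?N x y \<partial>lborel \<partial>lborel) + (\<integral>\<^sup>+x. \<integral>\<^sup>+y. ennreal (2 powr p) * ?F x y \<partial>lborel \<partial>lborel)"
      by (rule nn_integral2_add) measurable
    also have "(\<integral>\<^sup>+x. \<integral>\<^sup>+y. ennreal c1 * ?A x y \<partial>lborel \<partial>lborel) = ennreal c1 * (\<integral>\<^sup>+x. \<integral>\<^sup>+y. ?A x y \<partial>lborel \<partial>lborel)"
      by (rule nn_integral2_cmult) measurable
    also have "(\<integral>\<^sup>+x. \<integral>\<^sup>+y. ennreal c2 * ?N x y \<partial>lborel \<partial>lborel) = ennreal c2 * (\<integral>\<^sup>+x. \<integral>\<^sup>+y. ?N x y \<partial>lborel \<partial>lborel)"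
      by (rule nn_integral2_cmult) measurable
    also have "(\<integral>\<^sup>+x. \<integral>\<^sup>+y. ennreal (2 powr p) * ?F x y \<partial>lborel \<partial>lborel) = ennreal (2 powr p) * (\<integral>\<^sup>+x. \<integral>\<^sup>+y. ?F x y \<partial>lborel \<partial>lborel)"
      by (rule nn_integral2_cmult) measurable
    finally have main: "gagliardo_energy UNIV r p h \<le> ennreal c1 * (\<integral>\<^sup>+x. \<integral>\<^sup>+y. ?A x y \<partial>lborel \<partial>lborel) +
      (ennreal c2 * (\<integral>\<^sup>+x. \<integral>\<^sup>+y. ?N x y \<partial>lborel \<partial>lborel) + ennreal (2 powr p) * (\<integral>\<^sup>+x. \<integral>\<^sup>+y. ?F x y \<partial>lborel \<partial>lborel))" .
    have kernel_slice [measurable]: "?\<Phi> x \<in> borel_measurable borel" for x by measurable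
    have V'm [measurable]: "V' \<in> sets borel" using open_V' by simp
    have TK: "indicator K' y * G (T y) = indicator K' y * G (\<tau> y)" for G :: "real^'n \<Rightarrow> ennreal" and y
      using K'(3) by (auto simp: T_def split: split_indicator)
    have A: "(\<integral>\<^sup>+x. \<integral>\<^sup>+y. ?A x y \<partial>lborel \<partial>lborel) \<le> ennreal (C0 * C0) * gagliardo_energy V' r p g"
    proof -
      let ?\<Psi> = "\<lambda>x. \<integral>\<^sup>+z. indicator V' z * ?\<Phi> x z \<partial>lborel"
      have "(\<integral>\<^sup>+x. \<integral>\<^sup>+y. ?A x y \<partial>lborel \<partial>lborel) \<le> (\<integral>\<^sup>+x. ennreal C0 * (indicator K' x * ?\<Psi> (T x)) \<partial>lborel)"
      proof (rule nn_integral_mono)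
        fix x
        have "(\<integral>\<^sup>+y. ?A x y \<partial>lborel) = indicator K' x * (\<integral>\<^sup>+y. indicator K' y * ?\<Phi> (T x) (T y) \<partial>lborel)"
          by (rule nn_integral_cmult) measurable
        also have "\<dots> \<le> indicator K' x * (ennreal C0 * ?\<Psi> (T x))"
        proof (rule mult_left_mono)
          have "(\<integral>\<^sup>+y. indicator K' y * ?\<Phi> (T x) (T y) \<partial>lborel) = (\<integral>\<^sup>+y. indicator K' y * ?\<Phi> (T x) (\<tau> y) \<partial>lborel)"
            by (intro nn_integral_cong TK)
          also have "\<dots> \<le> ennreal C0 * ?\<Psi> (T x)" by (rule C0(2)[OF kernel_slice])
          finally show "(\<integral>\<^sup>+y. indicator K' y * ?\<Phi> (T x) (T y) \<partial>lborel) \<le> ennreal C0 * ?\<Psi> (T x)" .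
        qed simp
        finally show "(\<integral>\<^sup>+y. ?A x y \<partial>lborel) \<le> ennreal C0 * (indicator K' x * ?\<Psi> (T x))" by (simp add: mult_ac)
      qed
      also have "\<dots> = ennreal C0 * (\<integral>\<^sup>+x. indicator K' x * ?\<Psi> (T x) \<partial>lborel)"
        by (rule nn_integral_cmult) measurable
      also have "\<dots> \<le> ennreal C0 * (ennreal C0 * (\<integral>\<^sup>+x. indicator V' x * ?\<Psi> x \<partial>lborel))"
      proof (rule mult_left_mono)
        have "(\<integral>\<^sup>+x. indicator K' x * ?\<Psi> (T x) \<partial>lborel) = (\<integral>\<^sup>+x. indicator K' x * ?\<Psi> (\<tau> x) \<partial>lborel)"
          by (intro nn_integral_cong TK)
        also have "\<dots> \<le> ennreal C0 * (\<integral>\<^sup>+x. indicator V' x * ?\<Psi> x \<partial>lborel)" by (rule C0(2)) measurable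
        finally show "(\<integral>\<^sup>+x. indicator K' x * ?\<Psi> (T x) \<partial>lborel) \<le> ennreal C0 * (\<integral>\<^sup>+x. indicator V' x * ?\<Psi> x \<partial>lborel)" .
      qed simp
      finally show ?thesis unfolding gagliardo_energy_def using C0(1) by (simp add: ennreal_mult mult.assoc)
    qed
    have N: "(\<integral>\<^sup>+x. \<integral>\<^sup>+y. ?N x y \<partial>lborel \<partial>lborel) \<le> ennreal (CN * C0) * lp_energy V' p g"
    proof -
      have "(\<integral>\<^sup>+x. \<integral>\<^sup>+y. ?N x y \<partial>lborel \<partial>lborel) = (\<integral>\<^sup>+v. near_kernel \<delta> (p - r) (v :: real^'n) \<partial>lborel) * (\<integral>\<^sup>+y. ?w y \<partial>lborel)"
        by (rule nn_integral_convolution_second) measurable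
      also have "\<dots> \<le> ennreal CN * (ennreal C0 * lp_energy V' p g)"
      proof (rule mult_mono[OF CN(2)])
        have "(\<integral>\<^sup>+y. ?w y \<partial>lborel) = (\<integral>\<^sup>+y. indicator K' y * ennreal (\<bar>g (\<tau> y)\<bar> powr p) \<partial>lborel)"
          by (intro nn_integral_cong TK)
        also have "\<dots> \<le> ennreal C0 * lp_energy V' p g" unfolding lp_energy_def by (rule C0(2)) measurable
        finally show "(\<integral>\<^sup>+y. ?w y \<partial>lborel) \<le> ennreal C0 * lp_energy V' p g" .
      qed auto
      finally show ?thesis using CN(1) C0(1) by (simp add: ennreal_mult mult.assoc)
    qed
    have F: "(\<integral>\<^sup>+x. \<integral>\<^sup>+y. ?F x y \<partial>lborel \<partial>lborel) \<le> ennreal (2 * CF * CE) * lp_energy V' p g"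
    proof -
      have "(\<integral>\<^sup>+x. \<integral>\<^sup>+y. ?F x y \<partial>lborel \<partial>lborel) = 2 * (\<integral>\<^sup>+v. far_kernel \<delta> r (v :: real^'n) \<partial>lborel) * lp_energy UNIV p h"
        by (rule far_kernel_energy[OF hm])
      also have "\<dots> \<le> 2 * ennreal CF * (ennreal CE * lp_energy V' p g)"
        unfolding h_def[abs_def] by (intro mult_mono CF CE(2) g order_refl) auto
      finally show ?thesis using CF(1) CE(1) by (simp add: ennreal_mult mult.assoc)
    qed
    let ?X = "gagliardo_energy V' r p g" and ?Y = "lp_energy V' p g"
    have "gagliardo_energy UNIV r p h \<le> ennreal c1 * (ennreal (C0 * C0) * ?X) + (ennreal c2 * (ennreal (CN * C0) * ?Y) + ennreal (2 powr p) * (ennreal (2 * CF * CE) * ?Y))"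
      by (rule order_trans[OF main]) (intro add_mono mult_left_mono A N F; simp)
    also have "\<dots> = ennreal (c1 * C0 * C0) * ?X + ennreal (c2 * CN * C0 + 2 powr p * (2 * CF * CE)) * ?Y"
      using C0(1) CN(1) CF(1) CE(1) c by (simp add: ennreal_mult ennreal_plus distrib_right mult.assoc)
    also have "\<dots> \<le> ennreal C * ?X + ennreal C * ?Y"
      using C0(1) CN(1) CF(1) CE(1) c by (intro add_mono mult_right_mono ennreal_leI) (auto simp: C_def)
    finally show "gagliardo_energy UNIV r p (\<lambda>y. a y * g (\<tau> y)) \<le> ennreal C * (?X + ?Y)"
      by (simp add: distrib_left h_def[abs_def])
  qed
qed

end

section \<open>Sobolev norms of pullbacks\<close>

lemma finite_lists_le: "finite {L :: 'n::finite list. length L \<le> m}"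
  using finite_lists_length_le[of "UNIV :: 'n set" m] by simp

lemma finite_lists_eq: "finite {L :: 'n::finite list. length L = m}"
  by (rule finite_subset[OF _ finite_lists_le[of m]]) auto

context smooth_diffeo
begin

lemma pullback_operator_measurable:
  assumes "pullback_operator V \<tau> m H" and "\<And>L. length L \<le> m \<Longrightarrow> G L \<in> borel_measurable borel"
  shows "H G \<in> borel_measurable borel"
  using assms(1)
proof induction
  case (monomial a L)
  then show ?case
    by (intro measurable_pullback test_functions_measurable[OF monomial(1)] test_functions_zero[OF monomial(1)] assms(2))
qed auto

text \<open>
  The constants are found by induction on the operator, before \<open>G\<close> is given.
\<close>
lemma lp_energy_pullback_operator:
  assumes "pullback_operator V \<tau> m H" and p: "p > 0"
  shows "\<exists>C>0. \<forall>G. (\<forall>L. length L \<le> m \<longrightarrow> G L \<in> borel_measurable borel) \<longrightarrow>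
    lp_energy UNIV p (H G) \<le> ennreal C * (\<Sum>L | length L \<le> m. lp_energy V' p (G L))"
  using assms(1)
proof induction
  case zero
  show ?case by (intro exI[of _ 1]) (simp add: lp_energy_0)
next
  case (monomial a L)
  obtain C where C: "C > 0" "\<And>g. g \<in> borel_measurable borel \<Longrightarrow> lp_energy UNIV p (\<lambda>y. a y * g (\<tau> y)) \<le> ennreal C * lp_energy V' p g"
    using lp_energy_pullback[OF monomial(1) p] by blast
  show ?case
  proof (intro exI[of _ C] conjI allI impI C(1))
    fix G :: "'n list \<Rightarrow> real^'n \<Rightarrow> real" assume G: "\<forall>L. length L \<le> m \<longrightarrow> G L \<in> borel_measurable borel"
    have "lp_energy V' p (G L) \<le> (\<Sum>L | length L \<le> m. lp_energy V' p (G L))"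
      using monomial(2) by (intro member_le_sum) (auto simp: finite_lists_le)
    then show "lp_energy UNIV p (\<lambda>y. a y * G L (\<tau> y)) \<le> ennreal C * (\<Sum>L | length L \<le> m. lp_energy V' p (G L))"
      using C(2)[of "G L"] G monomial(2) by (meson mult_left_mono order_trans zero_le)
  qed
next
  case (add H H')
  obtain C where C: "C > 0" "\<And>G. (\<forall>L. length L \<le> m \<longrightarrow> G L \<in> borel_measurable borel) \<Longrightarrow>
    lp_energy UNIV p (H G) \<le> ennreal C * (\<Sum>L | length L \<le> m. lp_energy V' p (G L))" using add.IH(1) by blast
  obtain C' where C': "C' > 0" "\<And>G. (\<forall>L. length L \<le> m \<longrightarrow> G L \<in> borel_measurable borel) \<Longrightarrow>
    lp_energy UNIV p (H' G) \<le> ennreal C' * (\<Sum>L | length L \<le> m. lp_energy V' p (G L))" using add.IH(2) by blast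
  show ?case
  proof (intro exI[of _ "2 powr p * (C + C')"] conjI allI impI)
    show "2 powr p * (C + C') > 0" using C C' by simp
    fix G :: "'n list \<Rightarrow> real^'n \<Rightarrow> real" assume G: "\<forall>L. length L \<le> m \<longrightarrow> G L \<in> borel_measurable borel"
    let ?S = "\<Sum>L | length L \<le> m. lp_energy V' p (G L)"
    have "lp_energy UNIV p (\<lambda>y. H G y + H' G y) \<le> ennreal (2 powr p) * (lp_energy UNIV p (H G) + lp_energy UNIV p (H' G))"
      using pullback_operator_measurable[OF add.hyps(1), of G] pullback_operator_measurable[OF add.hyps(2), of G] G p
      by (intro lp_energy_add) auto
    also have "\<dots> \<le> ennreal (2 powr p) * (ennreal C * ?S + ennreal C' * ?S)"
      by (intro mult_left_mono add_mono C(2) C'(2) G) simp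
    also have "\<dots> = ennreal (2 powr p * (C + C')) * ?S"
      using C(1) C'(1) by (simp add: ennreal_mult ennreal_plus distrib_right mult.assoc)
    finally show "lp_energy UNIV p (\<lambda>y. H G y + H' G y) \<le> ennreal (2 powr p * (C + C')) * ?S" .
  qed
qed

lemma wd_measurable: "wd \<Omega> L f g \<Longrightarrow> g \<in> borel_measurable borel"
  by (auto simp: wd_def dest: loc_int_measurable)

text \<open>
  A term with a derivative of order \<open>m\<close> is a case of \<open>gagliardo_energy_pullback\<close>. A term with a
  derivative of lower order can be differentiated weakly once more, within the derivatives of
  order at most \<open>m\<close>, and \<open>gagliardo_energy_le_weak_gradient\<close> applies.
\<close>
lemma gagliardo_energy_pullback_operator:
  assumes "pullback_operator V \<tau> m H" and p: "p > 1" and r: "real CARD('n) < r" "r < real CARD('n) + p"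
  shows "\<exists>C>0. \<forall>f G. (\<forall>L. length L \<le> m \<longrightarrow> wd V' L f (G L)) \<longrightarrow>
    gagliardo_energy UNIV r p (H G) \<le> ennreal C * ((\<Sum>L | length L \<le> m. lp_energy V' p (G L)) + (\<Sum>L | length L = m. gagliardo_energy V' r p (G L)))"
  using assms(1)
proof induction
  case zero
  show ?case by (intro exI[of _ 1]) (simp add: gagliardo_energy_0)
next
  case (monomial a L)
  have p0: "p > 0" using p by simp
  let ?S = "\<lambda>G. \<Sum>L | length L \<le> m. lp_energy V' p (G L)"
  let ?T = "\<lambda>G. \<Sum>L | length L = m. gagliardo_energy V' r p (G L)"
  show ?case
  proof (cases "length L = m")
    case True
    obtain C where C: "C > 0" "\<And>g. g \<in> borel_measurable borel \<Longrightarrow>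
      gagliardo_energy UNIV r p (\<lambda>y. a y * g (\<tau> y)) \<le> ennreal C * (gagliardo_energy V' r p g + lp_energy V' p g)"
      using gagliardo_energy_pullback[OF monomial(1) p r] by blast
    show ?thesis
    proof (intro exI[of _ C] conjI allI impI C(1))
      fix f G assume G: "\<forall>L. length L \<le> m \<longrightarrow> wd V' L f (G L)"
      have 1: "lp_energy V' p (G L) \<le> ?S G"
        using monomial(2) by (intro member_le_sum) (auto simp: finite_lists_le)
      have 2: "gagliardo_energy V' r p (G L) \<le> ?T G"
        using True finite_lists_eq[of m] by (intro member_le_sum) auto
      have "gagliardo_energy UNIV r p (\<lambda>y. a y * G L (\<tau> y)) \<le> ennreal C * (gagliardo_energy V' r p (G L) + lp_energy V' p (G L))"
        using G monomial(2) by (intro C(2)) (blast intro: wd_measurable)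
      also have "\<dots> \<le> ennreal C * (?S G + ?T G)"
        using add_mono[OF 1 2] by (intro mult_left_mono) (auto simp: add.commute)
      finally show "gagliardo_energy UNIV r p (\<lambda>y. a y * G L (\<tau> y)) \<le> ennreal C * (?S G + ?T G)" .
    qed
  next
    case False
    then have L: "Suc (length L) \<le> m" using monomial(2) by simp
    let ?H = "\<lambda>G y. a y * G L (\<tau> y)"
    have op: "pullback_operator V \<tau> (length L) ?H" by (rule pullback_operator.monomial[OF monomial(1)]) simp
    have "\<forall>i. \<exists>H'. pullback_operator V \<tau> (Suc (length L)) H' \<and>
      (\<forall>f G. (\<forall>M. length M \<le> Suc (length L) \<longrightarrow> wd V' M f (G M)) \<longrightarrow> wd UNIV [i] (?H G) (H' G))"
      using pullback_operator_partial[OF op] by blast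
    then obtain H' where H': "\<And>i. pullback_operator V \<tau> (Suc (length L)) (H' i)"
      "\<And>i f G. (\<forall>M. length M \<le> Suc (length L) \<longrightarrow> wd V' M f (G M)) \<Longrightarrow> wd UNIV [i] (?H G) (H' i G)" by metis
    obtain C0 where C0: "C0 > 0" "\<And>g. g \<in> borel_measurable borel \<Longrightarrow> lp_energy UNIV p (\<lambda>y. a y * g (\<tau> y)) \<le> ennreal C0 * lp_energy V' p g"
      using lp_energy_pullback[OF monomial(1) p0] by blast
    have "\<forall>i. \<exists>C>0. \<forall>G. (\<forall>M. length M \<le> Suc (length L) \<longrightarrow> G M \<in> borel_measurable borel) \<longrightarrow>
      lp_energy UNIV p (H' i G) \<le> ennreal C * (\<Sum>M | length M \<le> Suc (length L). lp_energy V' p (G M))"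
      using lp_energy_pullback_operator[OF H'(1) p0] by blast
    then obtain C1 where C1: "\<And>i. C1 i > 0" "\<And>i G. (\<forall>M. length M \<le> Suc (length L) \<longrightarrow> G M \<in> borel_measurable borel) \<Longrightarrow>
      lp_energy UNIV p (H' i G) \<le> ennreal (C1 i) * (\<Sum>M | length M \<le> Suc (length L). lp_energy V' p (G M))" by metis
    obtain C2 where C2: "C2 > 0" "\<And>(h :: real^'n \<Rightarrow> real) h'. (\<And>j. wd UNIV [j] h (h' j)) \<Longrightarrow>
      gagliardo_energy UNIV r p h \<le> ennreal C2 * (lp_energy UNIV p h + (\<Sum>j\<in>UNIV. lp_energy UNIV p (h' j)))"
      using gagliardo_energy_le_weak_gradient[OF p r] by metis
    let ?C = "C2 * (C0 + (\<Sum>i\<in>UNIV. C1 i))"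
    show ?thesis
    proof (intro exI[of _ ?C] conjI allI impI)
      show "?C > 0" using C2(1) C0(1) C1(1) by (intro mult_pos_pos add_pos_nonneg sum_nonneg) (auto simp: less_imp_le)
      fix f G assume G: "\<forall>L. length L \<le> m \<longrightarrow> wd V' L f (G L)"
      have GL: "G L \<in> borel_measurable borel" using G monomial(2) wd_measurable by blast
      have sub: "(\<Sum>M | length M \<le> Suc (length L). lp_energy V' p (G M)) \<le> ?S G"
        using L by (intro sum_mono2 finite_lists_le) auto
      have e0: "lp_energy UNIV p (?H G) \<le> ennreal C0 * ?S G"
      proof -
        have "lp_energy V' p (G L) \<le> ?S G"
          using monomial(2) by (intro member_le_sum) (auto simp: finite_lists_le)
        then show ?thesis using C0(2)[OF GL] by (meson mult_left_mono order_trans zero_le)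
      qed
      have e1: "lp_energy UNIV p (H' i G) \<le> ennreal (C1 i) * ?S G" for i
      proof -
        have "\<forall>M. length M \<le> Suc (length L) \<longrightarrow> G M \<in> borel_measurable borel"
          using G L wd_measurable by (meson order_trans)
        from C1(2)[OF this, of i] sub show ?thesis by (meson mult_left_mono order_trans zero_le)
      qed
      have "wd UNIV [i] (?H G) (H' i G)" for i
      proof (rule H'(2))
        show "\<forall>M. length M \<le> Suc (length L) \<longrightarrow> wd V' M f (G M)" using G L by auto
      qed
      then have "gagliardo_energy UNIV r p (?H G) \<le> ennreal C2 * (lp_energy UNIV p (?H G) + (\<Sum>i\<in>UNIV. lp_energy UNIV p (H' i G)))"
        by (rule C2(2))
      also have "\<dots> \<le> ennreal C2 * (ennreal C0 * ?S G + (\<Sum>i\<in>UNIV. ennreal (C1 i) * ?S G))"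
        by (intro mult_left_mono add_mono sum_mono e0 e1) simp
      also have "\<dots> = ennreal ?C * ?S G"
        using C2(1) C0(1) C1(1) by (simp add: sum_distrib_right[symmetric] distrib_right[symmetric] ennreal_plus[symmetric] ennreal_mult[symmetric]
          mult.assoc[symmetric] less_imp_le sum_nonneg del: ennreal_plus)
      also have "\<dots> \<le> ennreal ?C * (?S G + ?T G)" by (intro mult_left_mono) auto
      finally show "gagliardo_energy UNIV r p (?H G) \<le> ennreal ?C * (?S G + ?T G)" .
    qed
  qed
next
  case (add H H')
  let ?S = "\<lambda>G. (\<Sum>L | length L \<le> m. lp_energy V' p (G L)) + (\<Sum>L | length L = m. gagliardo_energy V' r p (G L))"
  obtain C where C: "C > 0" "\<And>f G. (\<forall>L. length L \<le> m \<longrightarrow> wd V' L f (G L)) \<Longrightarrow>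
    gagliardo_energy UNIV r p (H G) \<le> ennreal C * ?S G" using add.IH(1) by blast
  obtain C' where C': "C' > 0" "\<And>f G. (\<forall>L. length L \<le> m \<longrightarrow> wd V' L f (G L)) \<Longrightarrow>
    gagliardo_energy UNIV r p (H' G) \<le> ennreal C' * ?S G" using add.IH(2) by blast
  show ?case
  proof (intro exI[of _ "2 powr p * (C + C')"] conjI allI impI)
    show "2 powr p * (C + C') > 0" using C C' by simp
    fix f G assume G: "\<forall>L. length L \<le> m \<longrightarrow> wd V' L f (G L)"
    then have Gm: "G L \<in> borel_measurable borel" if "length L \<le> m" for L using that wd_measurable by blast
    have "gagliardo_energy UNIV r p (\<lambda>y. H G y + H' G y) \<le> ennreal (2 powr p) * (gagliardo_energy UNIV r p (H G) + gagliardo_energy UNIV r p (H' G))"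
      using pullback_operator_measurable[OF add.hyps(1) Gm] pullback_operator_measurable[OF add.hyps(2) Gm] p
      by (intro gagliardo_energy_add) auto
    also have "\<dots> \<le> ennreal (2 powr p) * (ennreal C * ?S G + ennreal C' * ?S G)"
      by (intro mult_left_mono add_mono C(2)[OF G] C'(2)[OF G]) simp
    also have "\<dots> = ennreal (2 powr p * (C + C')) * ?S G"
      using C(1) C'(1) by (simp add: ennreal_mult ennreal_plus distrib_right mult.assoc)
    finally show "gagliardo_energy UNIV r p (\<lambda>y. H G y + H' G y) \<le> ennreal (2 powr p * (C + C')) * ?S G" .
  qed
qed

end

lemma ennreal_root_mono: "p > 0 \<Longrightarrow> I \<le> J \<Longrightarrow> ennreal_root p I \<le> ennreal_root p J"
  unfolding ennreal_root_def
  by (auto simp: top_unique less_top[symmetric] intro!: ennreal_leI powr_mono2 enn2real_mono)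

lemma ennreal_root_cmult:
  assumes "C > 0" shows "ennreal_root p (ennreal C * I) = ennreal (C powr (1 / p)) * ennreal_root p I"
  using assms by (auto simp: ennreal_root_def ennreal_mult_eq_top_iff ennreal_mult_top enn2real_mult powr_mult ennreal_mult)

text \<open>
  With \<open>x = a powr (1 / p)\<close> and \<open>y = b powr (1 / p)\<close> the claim is
  \<open>x powr p + y powr p \<le> (x + y) powr p\<close>, where \<open>z powr p \<le> z * (x + y) powr (p - 1)\<close> for each of
  the two summands \<open>z\<close>.
\<close>
lemma powr_root_add_le:
  fixes a b :: real assumes "a \<ge> 0" "b \<ge> 0" "p \<ge> 1"
  shows "(a + b) powr (1 / p) \<le> a powr (1 / p) + b powr (1 / p)"
proof -
  define x y where "x = a powr (1 / p)" and "y = b powr (1 / p)"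
  have xy: "x \<ge> 0" "y \<ge> 0" by (auto simp: x_def y_def)
  have a: "a = x powr p" and b: "b = y powr p" using assms by (auto simp: x_def y_def powr_powr)
  have "z powr p \<le> z * (x + y) powr (p - 1)" if "0 \<le> z" "z \<le> x + y" for z
  proof (cases "z = 0")
    case False
    have "z powr p = z * z powr (p - 1)" using that False by (simp add: powr_diff)
    also have "\<dots> \<le> z * (x + y) powr (p - 1)" using that assms(3) by (intro mult_left_mono powr_mono2) auto
    finally show ?thesis .
  qed simp
  from this[of x] this[of y] xy have "a + b \<le> (x + y) * (x + y) powr (p - 1)"
    unfolding a b by (simp add: distrib_right)
  also have "\<dots> = (x + y) powr p"
    using xy by (cases "x + y = 0") (auto simp: powr_diff)
  finally have "(a + b) powr (1 / p) \<le> ((x + y) powr p) powr (1 / p)" using assms by (intro powr_mono2) auto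
  also have "\<dots> = x + y" using assms(3) xy by (simp add: powr_powr)
  finally show ?thesis by (simp add: x_def y_def)
qed

lemma ennreal_root_add: "p \<ge> 1 \<Longrightarrow> ennreal_root p (I + J) \<le> ennreal_root p I + ennreal_root p J"
  using powr_root_add_le[of "enn2real I" "enn2real J" p]
  by (auto simp: ennreal_root_def enn2real_plus less_top[symmetric] ennreal_plus[symmetric] simp del: ennreal_plus intro!: ennreal_leI)

lemma ennreal_root_sum:
  assumes "p \<ge> 1" "finite J"
  shows "ennreal_root p (\<Sum>j\<in>J. I j) \<le> (\<Sum>j\<in>J. ennreal_root p (I j))"
  using assms(2)
proof (induction J rule: finite_induct)
  case (insert j J)
  then show ?case
    using order_trans[OF ennreal_root_add[OF assms(1), of "I j" "\<Sum>j\<in>J. I j"] add_left_mono[OF insert.IH]] by simp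
qed (use assms(1) in \<open>simp add: ennreal_root_def\<close>)

lemma Lp_norm_energy: "open \<Omega> \<Longrightarrow> Lp_norm \<Omega> p f = ennreal_root p (lp_energy \<Omega> p f)"
  by (simp add: Lp_norm_borel lp_energy_def)

lemma gagliardo_seminorm_energy:
  fixes f :: "real^'n::finite \<Rightarrow> real"
  assumes "open \<Omega>" "f \<in> borel_measurable borel"
  shows "gagliardo_seminorm \<Omega> \<theta> p f = ennreal_root p (gagliardo_energy \<Omega> (real CARD('n) + \<theta> * p) p f)"
  using assms by (simp add: gagliardo_borel gagliardo_energy_def)

text \<open>
  Finiteness of the norm provides all weak derivatives, and \<open>f\<close> and these derivatives may be
  replaced by Borel functions. The derivative of order \<open>0\<close> is taken to be \<open>f0\<close> itself.
\<close>
lemma weak_derivatives_borel: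
  fixes f :: "real^'n::finite \<Rightarrow> real"
  assumes \<Omega>: "open \<Omega>" and fin: "sobolev_fun_norm \<Omega> s p f < \<infinity>" and k: "k = nat \<lfloor>s\<rfloor>"
  shows "\<exists>f0 G. loc_int \<Omega> f0 \<and> (AE x in lebesgue. x \<in> \<Omega> \<longrightarrow> f x = f0 x) \<and>
    (\<forall>\<nu>. mi_order \<nu> \<le> k \<longrightarrow> G \<nu> \<in> borel_measurable borel) \<and>
    (\<forall>\<nu> is. mi_order \<nu> \<le> k \<longrightarrow> count_list is = \<nu> \<longrightarrow> wd \<Omega> is f0 (G \<nu>)) \<and> G (\<lambda>_. 0) = f0"
proof -
  have "\<forall>\<nu>. \<exists>g. mi_order \<nu> \<le> k \<longrightarrow> is_weak_deriv \<Omega> \<nu> f g"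
    using sobolev_fun_norm_finite_weak_deriv[OF fin] by (auto simp: k)
  then obtain g where g: "\<And>\<nu>. mi_order \<nu> \<le> k \<Longrightarrow> is_weak_deriv \<Omega> \<nu> f (g \<nu>)" by metis
  have lf: "locally_integrable \<Omega> f" using g[of "\<lambda>_. 0"] by (simp add: is_weak_deriv_def mi_order_def)
  obtain f0 where f0: "loc_int \<Omega> f0" "AE x in lebesgue. x \<in> \<Omega> \<longrightarrow> f x = f0 x"
    using borel_representative[OF \<Omega> lf] by blast
  have "\<forall>\<nu>. \<exists>g0. mi_order \<nu> \<le> k \<longrightarrow> loc_int \<Omega> g0 \<and> (AE x in lebesgue. x \<in> \<Omega> \<longrightarrow> g \<nu> x = g0 x)"
    using borel_representative[OF \<Omega>] g by (auto simp: is_weak_deriv_def)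
  then obtain g0 where g0: "\<And>\<nu>. mi_order \<nu> \<le> k \<Longrightarrow> loc_int \<Omega> (g0 \<nu>)"
    "\<And>\<nu>. mi_order \<nu> \<le> k \<Longrightarrow> AE x in lebesgue. x \<in> \<Omega> \<longrightarrow> g \<nu> x = g0 \<nu> x" by metis
  define G where "G \<nu> = (if \<nu> = (\<lambda>_. 0) then f0 else g0 \<nu>)" for \<nu>
  have gm: "g0 \<nu> \<in> borel_measurable borel" if "mi_order \<nu> \<le> k" for \<nu>
    using g0(1)[OF that] by (rule loc_int_measurable)
  have "wd \<Omega> is f0 (G \<nu>)" if "mi_order \<nu> \<le> k" "count_list is = \<nu>" for \<nu> "is"
  proof (cases "\<nu> = (\<lambda>_. 0)")
    case True
    then have "mi_order (count_list is) = 0" using that(2) by (simp add: mi_order_def)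
    then have "is = []" by (simp add: mi_order_count_list)
    with True show ?thesis using wd_Nil[OF f0(1)] by (simp add: G_def)
  next
    case False
    then show ?thesis
      using is_weak_deriv_cong_AE[OF \<Omega> f0(2) g0(2)[OF that(1)] g[OF that(1)]]
        is_weak_deriv_iff_wd[OF \<Omega> loc_int_measurable[OF f0(1)] gm[OF that(1)], of "is"] that(2) by (simp add: G_def)
  qed
  moreover have "G \<nu> \<in> borel_measurable borel" if "mi_order \<nu> \<le> k" for \<nu>
    using gm[OF that] loc_int_measurable[OF f0(1)] by (simp add: G_def)
  moreover have "G (\<lambda>_. 0) = f0" by (simp add: G_def)
  ultimately show ?thesis using f0 by blast
qed

lemma sobolev_fun_norm_wd:
  fixes f :: "real^'n::finite \<Rightarrow> real"
  assumes \<Omega>: "open \<Omega>" and k: "k = nat \<lfloor>s\<rfloor>" and f: "f \<in> borel_measurable borel"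
    and G: "\<And>\<nu>. mi_order \<nu> \<le> k \<Longrightarrow> G \<nu> \<in> borel_measurable borel"
    and wd: "\<And>\<nu> is. mi_order \<nu> \<le> k \<Longrightarrow> count_list is = \<nu> \<Longrightarrow> wd \<Omega> is f (G \<nu>)"
  shows "sobolev_fun_norm \<Omega> s p f = (\<Sum>\<nu> | mi_order \<nu> \<le> k. ennreal_root p (lp_energy \<Omega> p (G \<nu>))) +
    (if frac s = 0 then 0 else (\<Sum>\<nu> | mi_order \<nu> = k. ennreal_root p (gagliardo_energy \<Omega> (real CARD('n) + frac s * p) p (G \<nu>))))"
proof -
  have w: "is_weak_deriv \<Omega> \<nu> f (G \<nu>)" if \<nu>: "mi_order \<nu> \<le> k" for \<nu>
  proof -
    obtain "is" where "is": "count_list is = \<nu>" by (rule multi_index_list_exists)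
    then show ?thesis using is_weak_deriv_iff_wd[OF \<Omega> f G[OF \<nu>], of "is"] wd[OF \<nu> "is"] by simp
  qed
  have "(\<Sum>\<nu> | mi_order \<nu> = k. gagliardo_seminorm \<Omega> (frac s) p (G \<nu>)) =
      (\<Sum>\<nu> | mi_order \<nu> = k. ennreal_root p (gagliardo_energy \<Omega> (real CARD('n) + frac s * p) p (G \<nu>)))"
    by (intro sum.cong refl gagliardo_seminorm_energy[OF \<Omega>] G) auto
  then show ?thesis
    using sobolev_fun_norm_eq[OF \<Omega> k refl w, of p] unfolding Lp_norm_energy[OF \<Omega>] by (simp only: refl)
qed

lemma sum_le_card_mult:
  fixes f :: "'j \<Rightarrow> ennreal"
  assumes "\<And>j. j \<in> J \<Longrightarrow> f j \<le> N" shows "(\<Sum>j\<in>J. f j) \<le> ennreal (real (card J)) * N"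
  using sum_bounded_above[of J f N] assms by (simp add: ennreal_of_nat_eq_real_of_nat)

text \<open>
  Finitely many bounds with different constants are added. The constants are fixed before the
  object \<open>g\<close> to which they apply.
\<close>
lemma uniform_constant:
  fixes A :: "'j \<Rightarrow> 'g \<Rightarrow> ennreal" and N :: "'g \<Rightarrow> ennreal"
  assumes "finite J" "\<And>j. j \<in> J \<Longrightarrow> \<exists>C>0. \<forall>g. P g \<longrightarrow> A j g \<le> ennreal C * N g"
  shows "\<exists>C>0. \<forall>g. P g \<longrightarrow> (\<Sum>j\<in>J. A j g) \<le> ennreal C * N g"
proof -
  obtain C where C: "\<And>j. j \<in> J \<Longrightarrow> C j > 0" "\<And>j g. j \<in> J \<Longrightarrow> P g \<Longrightarrow> A j g \<le> ennreal (C j) * N g"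
    using assms(2) by metis
  show ?thesis
  proof (intro exI[of _ "1 + (\<Sum>j\<in>J. C j)"] conjI allI impI)
    have nn: "(\<Sum>j\<in>J. C j) \<ge> 0" using C(1) by (intro sum_nonneg) (auto simp: less_imp_le)
    then show "1 + (\<Sum>j\<in>J. C j) > 0" by simp
    fix g assume "P g"
    then have "(\<Sum>j\<in>J. A j g) \<le> (\<Sum>j\<in>J. ennreal (C j) * N g)" by (intro sum_mono C(2))
    also have "\<dots> = ennreal (\<Sum>j\<in>J. C j) * N g"
      using C(1) by (simp add: sum_distrib_right[symmetric] sum_ennreal less_imp_le)
    also have "\<dots> \<le> ennreal (1 + (\<Sum>j\<in>J. C j)) * N g" using nn by (intro mult_right_mono ennreal_leI) auto
    finally show "(\<Sum>j\<in>J. A j g) \<le> ennreal (1 + (\<Sum>j\<in>J. C j)) * N g" .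
  qed
qed

context smooth_diffeo
begin

text \<open>
  The image of a null set under the differentiable map \<open>\<sigma>\<close> is a null set. For arbitrary, not
  necessarily measurable, functions this replaces the change of variables.
\<close>
lemma AE_pullback_eq:
  fixes f g :: "real^'n \<Rightarrow> real"
  assumes a: "a \<in> test_functions V" and ae: "AE x in lebesgue. x \<in> V' \<longrightarrow> f x = g x"
  shows "AE y in lebesgue. a y * f (\<tau> y) = a y * g (\<tau> y)"
proof -
  define N where "N = {x \<in> V'. f x \<noteq> g x}"
  have "N \<in> null_sets lebesgue"
    using ae by (subst (asm) completion.AE_iff_null_sets) (simp add: N_def)
  then have "negligible N" by (simp add: negligible_iff_null_sets)
  moreover have "\<sigma> differentiable_on N"
    using smooth_on_differentiable[OF smooth_\<sigma>] by (auto simp: differentiable_on_def N_def intro: differentiable_at_withinI)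
  ultimately have "negligible (\<sigma> ` N)" by (intro negligible_differentiable_image_negligible) auto
  moreover have "{y. a y * f (\<tau> y) \<noteq> a y * g (\<tau> y)} \<subseteq> \<sigma> ` N"
  proof
    fix y assume y: "y \<in> {y. a y * f (\<tau> y) \<noteq> a y * g (\<tau> y)}"
    then have "a y \<noteq> 0" by auto
    then have "y \<in> V" using test_functions_zero[OF a] by blast
    then have "\<tau> y \<in> N" "y = \<sigma> (\<tau> y)" using y \<tau>_mem \<sigma>\<tau> by (auto simp: N_def)
    then show "y \<in> \<sigma> ` N" by blast
  qed
  ultimately have "negligible {y. a y * f (\<tau> y) \<noteq> a y * g (\<tau> y)}" by (rule negligible_subset)
  then show ?thesis
    by (subst completion.AE_iff_null_sets) (simp add: negligible_iff_null_sets)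
qed

text \<open>
  The energy estimates for the operators of \<open>pullback_weak_derivatives\<close> are added up and \<open>p\<close>-th
  roots are taken. Both are done for pairs \<open>(f, G)\<close> of a Borel function and its weak derivatives
  along lists. For the transition to \<open>sobolev_fun_norm\<close> all derivatives of \<open>f\<close> are replaced by
  Borel representatives; each multi-index is the count of finitely many lists, which contributes
  the factor \<open>m\<close>.
\<close>
theorem sobolev_fun_norm_pullback:
  assumes \<Omega>: "open \<Omega>" "V \<subseteq> \<Omega>" and \<Omega>': "open \<Omega>'" "V' \<subseteq> \<Omega>'" and a: "a \<in> test_functions V"
    and p: "p > 1" and s: "s \<ge> 0"
  shows "\<exists>C>0. \<forall>f. sobolev_fun_norm \<Omega> s p (\<lambda>y. a y * f (\<tau> y)) \<le> ennreal C * sobolev_fun_norm \<Omega>' s p f"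
proof -
  define k where "k = nat \<lfloor>s\<rfloor>"
  define \<theta> where "\<theta> = frac s"
  define r where "r = real CARD('n) + \<theta> * p"
  have p0: "p > 0" "p \<ge> 1" using p by auto
  have \<theta>: "0 \<le> \<theta>" "\<theta> < 1" by (auto simp: \<theta>_def frac_lt_1)
  have r: "real CARD('n) < r" "r < real CARD('n) + p" if "\<theta> \<noteq> 0" using that \<theta> p by (auto simp: r_def)
  obtain Li :: "('n \<Rightarrow> nat) \<Rightarrow> 'n list" where Li: "\<And>\<nu>. count_list (Li \<nu>) = \<nu>" using multi_index_list_exists by metis
  have len: "length (Li \<nu>) = mi_order \<nu>" for \<nu> using mi_order_count_list[of "Li \<nu>"] by (simp add: Li)
  have "\<forall>\<nu>. \<exists>H. pullback_operator V \<tau> (mi_order \<nu>) H \<and>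
    (\<forall>f G. (\<forall>L. length L \<le> mi_order \<nu> \<longrightarrow> wd V' L f (G L)) \<longrightarrow> G [] = f \<longrightarrow> wd UNIV (Li \<nu>) (\<lambda>y. a y * f (\<tau> y)) (H G))"
    using pullback_weak_derivatives[OF a, of "Li _"] unfolding len by blast
  from choice[OF this] obtain H where Hall: "\<forall>\<nu>. pullback_operator V \<tau> (mi_order \<nu>) (H \<nu>) \<and>
    (\<forall>f G. (\<forall>L. length L \<le> mi_order \<nu> \<longrightarrow> wd V' L f (G L)) \<longrightarrow> G [] = f \<longrightarrow> wd UNIV (Li \<nu>) (\<lambda>y. a y * f (\<tau> y)) (H \<nu> G))" ..
  have H: "pullback_operator V \<tau> (mi_order \<nu>) (H \<nu>)"
    "(\<forall>L. length L \<le> mi_order \<nu> \<longrightarrow> wd V' L f (G L)) \<Longrightarrow> G [] = f \<Longrightarrow> wd UNIV (Li \<nu>) (\<lambda>y. a y * f (\<tau> y)) (H \<nu> G)" for \<nu> f G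
    using Hall by blast+
  \<comment> \<open>\<open>P (f, G)\<close>: \<open>G\<close> is the family of weak derivatives of \<open>f\<close> up to order \<open>k\<close>, along lists. Then
    \<open>N (f, G)\<close> is, up to repetitions of summands, the norm of \<open>f\<close>.\<close>
  define P where "P = (\<lambda>(f, G). (\<forall>L. length L \<le> k \<longrightarrow> wd \<Omega>' L f (G L)))"
  define N where "N = (\<lambda>(f :: real^'n \<Rightarrow> real, G :: 'n list \<Rightarrow> real^'n \<Rightarrow> real). (\<Sum>L | length L \<le> k. Lp_norm \<Omega>' p (G L)) +
    (if \<theta> = 0 then 0 else (\<Sum>L | length L = k. gagliardo_seminorm \<Omega>' \<theta> p (G L))))"
  have wdV: "wd V' L f (G L)" if "P (f, G)" "length L \<le> k" for f G L
    using that \<Omega>'(2) by (auto simp: P_def intro: wd_mono)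
  have GM: "G L \<in> borel_measurable borel" if "P (f, G)" "length L \<le> k" for f G L
    using wdV[OF that] by (rule wd_measurable)
  have lp: "\<exists>C>0. \<forall>g. P g \<longrightarrow> Lp_norm \<Omega> p (H \<nu> (snd g)) \<le> ennreal C * N g" if \<nu>: "mi_order \<nu> \<le> k" for \<nu>
  proof -
    obtain C where C: "C > 0" "\<And>G. (\<forall>L. length L \<le> mi_order \<nu> \<longrightarrow> G L \<in> borel_measurable borel) \<Longrightarrow>
      lp_energy UNIV p (H \<nu> G) \<le> ennreal C * (\<Sum>L | length L \<le> mi_order \<nu>. lp_energy V' p (G L))"
      using lp_energy_pullback_operator[OF H(1) p0(1)] by blast
    have "Lp_norm \<Omega> p (H \<nu> G) \<le> ennreal (C powr (1 / p)) * N (f, G)" if PG: "P (f, G)" for f G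
    proof -
      have m: "\<forall>L. length L \<le> mi_order \<nu> \<longrightarrow> G L \<in> borel_measurable borel" using GM[OF PG] \<nu> by auto
      have "lp_energy \<Omega> p (H \<nu> G) \<le> lp_energy UNIV p (H \<nu> G)" by (rule lp_energy_mono_set) simp
      also have "\<dots> \<le> ennreal C * (\<Sum>L | length L \<le> mi_order \<nu>. lp_energy V' p (G L))" by (rule C(2)[OF m])
      also have "\<dots> \<le> ennreal C * (\<Sum>L | length L \<le> k. lp_energy \<Omega>' p (G L))"
        using \<nu> by (intro mult_left_mono order_trans[OF sum_mono2[OF finite_lists_le] sum_mono] lp_energy_mono_set \<Omega>'(2)) auto
      finally have "Lp_norm \<Omega> p (H \<nu> G) \<le> ennreal_root p (ennreal C * (\<Sum>L | length L \<le> k. lp_energy \<Omega>' p (G L)))"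
        unfolding Lp_norm_energy[OF \<Omega>(1)] by (rule ennreal_root_mono[OF p0(1)])
      also have "\<dots> \<le> ennreal (C powr (1 / p)) * (\<Sum>L | length L \<le> k. Lp_norm \<Omega>' p (G L))"
        unfolding ennreal_root_cmult[OF C(1)] Lp_norm_energy[OF \<Omega>'(1)]
        by (intro mult_left_mono ennreal_root_sum p0 finite_lists_le) auto
      also have "\<dots> \<le> ennreal (C powr (1 / p)) * N (f, G)"
        unfolding N_def by (intro mult_left_mono) auto
      finally show ?thesis .
    qed
    then show ?thesis using C(1) by (intro exI[of _ "C powr (1 / p)"]) auto
  qed
  have gag: "\<exists>C>0. \<forall>g. P g \<longrightarrow> gagliardo_seminorm \<Omega> \<theta> p (H \<nu> (snd g)) \<le> ennreal C * N g"
    if \<nu>: "mi_order \<nu> = k" and t: "\<theta> \<noteq> 0" for \<nu>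
  proof -
    obtain C where C: "C > 0" "\<And>f G. (\<forall>L. length L \<le> mi_order \<nu> \<longrightarrow> wd V' L f (G L)) \<Longrightarrow>
      gagliardo_energy UNIV r p (H \<nu> G) \<le> ennreal C * ((\<Sum>L | length L \<le> mi_order \<nu>. lp_energy V' p (G L)) +
        (\<Sum>L | length L = mi_order \<nu>. gagliardo_energy V' r p (G L)))"
      using gagliardo_energy_pullback_operator[OF H(1) p r[OF t]] by blast
    have "gagliardo_seminorm \<Omega> \<theta> p (H \<nu> G) \<le> ennreal (C powr (1 / p)) * N (f, G)" if PG: "P (f, G)" for f G
    proof -
      have m: "\<forall>L. length L \<le> mi_order \<nu> \<longrightarrow> wd V' L f (G L)" using wdV[OF PG] \<nu> by auto
      have hm: "H \<nu> G \<in> borel_measurable borel"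
        using GM[OF PG] \<nu> by (intro pullback_operator_measurable[OF H(1)]) auto
      have "gagliardo_energy \<Omega> r p (H \<nu> G) \<le> gagliardo_energy UNIV r p (H \<nu> G)" by (rule gagliardo_energy_mono_set) simp
      also have "\<dots> \<le> ennreal C * ((\<Sum>L | length L \<le> k. lp_energy V' p (G L)) + (\<Sum>L | length L = k. gagliardo_energy V' r p (G L)))"
        using C(2)[OF m] by (simp add: \<nu>)
      also have "\<dots> \<le> ennreal C * ((\<Sum>L | length L \<le> k. lp_energy \<Omega>' p (G L)) + (\<Sum>L | length L = k. gagliardo_energy \<Omega>' r p (G L)))"
        by (intro mult_left_mono add_mono sum_mono lp_energy_mono_set gagliardo_energy_mono_set \<Omega>'(2)) auto
      finally have "gagliardo_seminorm \<Omega> \<theta> p (H \<nu> G) \<le> ennreal_root p (ennreal C *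
          ((\<Sum>L | length L \<le> k. lp_energy \<Omega>' p (G L)) + (\<Sum>L | length L = k. gagliardo_energy \<Omega>' r p (G L))))"
        unfolding gagliardo_seminorm_energy[OF \<Omega>(1) hm] r_def[symmetric] by (rule ennreal_root_mono[OF p0(1)])
      also have "\<dots> \<le> ennreal (C powr (1 / p)) *
          ((\<Sum>L | length L \<le> k. ennreal_root p (lp_energy \<Omega>' p (G L))) + (\<Sum>L | length L = k. ennreal_root p (gagliardo_energy \<Omega>' r p (G L))))"
        unfolding ennreal_root_cmult[OF C(1)]
        by (intro mult_left_mono order_trans[OF ennreal_root_add[OF p0(2)] add_mono] ennreal_root_sum p0 finite_lists_le finite_lists_eq) auto
      also have "(\<Sum>L | length L = k. ennreal_root p (gagliardo_energy \<Omega>' r p (G L))) = (\<Sum>L | length L = k. gagliardo_seminorm \<Omega>' \<theta> p (G L))"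
        by (intro sum.cong refl) (simp add: gagliardo_seminorm_energy[OF \<Omega>'(1) GM[OF PG]] r_def)
      also have "ennreal (C powr (1 / p)) * ((\<Sum>L | length L \<le> k. ennreal_root p (lp_energy \<Omega>' p (G L))) + (\<Sum>L | length L = k. gagliardo_seminorm \<Omega>' \<theta> p (G L)))
          = ennreal (C powr (1 / p)) * N (f, G)"
        using t by (simp add: N_def Lp_norm_energy[OF \<Omega>'(1)])
      finally show ?thesis .
    qed
    then show ?thesis using C(1) by (intro exI[of _ "C powr (1 / p)"]) auto
  qed
  obtain C1 where C1: "C1 > 0" "\<And>g. P g \<Longrightarrow> (\<Sum>\<nu> | mi_order \<nu> \<le> k. Lp_norm \<Omega> p (H \<nu> (snd g))) \<le> ennreal C1 * N g"
  proof -
    have "\<exists>C>0. \<forall>g. P g \<longrightarrow> (\<Sum>\<nu> | mi_order \<nu> \<le> k. Lp_norm \<Omega> p (H \<nu> (snd g))) \<le> ennreal C * N g"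
      by (rule uniform_constant[OF finite_mi_order_le lp]) simp
    then show thesis using that by blast
  qed
  have fk: "finite {\<nu> :: 'n \<Rightarrow> nat. mi_order \<nu> = k}" by (rule finite_subset[OF _ finite_mi_order_le[of k]]) auto
  have "\<exists>C2>0. \<forall>g. P g \<longrightarrow> (if \<theta> = 0 then 0 else \<Sum>\<nu> | mi_order \<nu> = k. gagliardo_seminorm \<Omega> \<theta> p (H \<nu> (snd g))) \<le> ennreal C2 * N g"
  proof (cases "\<theta> = 0")
    case False
    have "\<exists>C>0. \<forall>g. P g \<longrightarrow> (\<Sum>\<nu> | mi_order \<nu> = k. gagliardo_seminorm \<Omega> \<theta> p (H \<nu> (snd g))) \<le> ennreal C * N g"
      by (rule uniform_constant[OF fk gag[OF _ False]]) simp
    with False show ?thesis by simp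
  qed (auto intro: exI[of _ 1])
  then obtain C2 where C2: "C2 > 0" "\<And>g. P g \<Longrightarrow> (if \<theta> = 0 then 0 else \<Sum>\<nu> | mi_order \<nu> = k. gagliardo_seminorm \<Omega> \<theta> p (H \<nu> (snd g))) \<le> ennreal C2 * N g"
    by blast
  define m where "m = real (card {L :: 'n list. length L \<le> k}) + real (card {L :: 'n list. length L = k})"
  define C where "C = (C1 + C2) * (m + 1)"
  show ?thesis
  proof (intro exI[of _ C] conjI allI)
    show "C > 0" using C1(1) C2(1) by (auto simp: C_def m_def)
    fix f :: "real^'n \<Rightarrow> real"
    let ?N = "sobolev_fun_norm \<Omega>' s p f"
    show "sobolev_fun_norm \<Omega> s p (\<lambda>y. a y * f (\<tau> y)) \<le> ennreal C * ?N"
    proof (cases "?N < \<infinity>")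
      case False
      then show ?thesis using \<open>C > 0\<close> by (simp add: less_top[symmetric] ennreal_mult_top)
    next
      case True
      obtain f0 D where f0: "loc_int \<Omega>' f0" "AE x in lebesgue. x \<in> \<Omega>' \<longrightarrow> f x = f0 x"
        and D: "\<And>\<nu>. mi_order \<nu> \<le> k \<Longrightarrow> D \<nu> \<in> borel_measurable borel"
          "\<And>\<nu> is. mi_order \<nu> \<le> k \<Longrightarrow> count_list is = \<nu> \<Longrightarrow> wd \<Omega>' is f0 (D \<nu>)" "D (\<lambda>_. 0) = f0"
        using weak_derivatives_borel[OF \<Omega>'(1) True k_def] by blast
      define G where "G L = D (count_list L)" for L
      have "count_list ([] :: 'n list) = (\<lambda>_. 0)" by (intro ext) simp
      then have G0: "G [] = f0" by (simp add: G_def D(3))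
      have PG: "P (f0, G)" by (auto simp: P_def G_def mi_order_count_list intro!: D(2))
      have normf: "?N = (\<Sum>\<nu> | mi_order \<nu> \<le> k. Lp_norm \<Omega>' p (D \<nu>)) +
          (if \<theta> = 0 then 0 else (\<Sum>\<nu> | mi_order \<nu> = k. gagliardo_seminorm \<Omega>' \<theta> p (D \<nu>)))"
      proof -
        have "is_weak_deriv \<Omega>' \<nu> f0 (D \<nu>)" if "mi_order \<nu> \<le> k" for \<nu>
          using is_weak_deriv_iff_wd[OF \<Omega>'(1) loc_int_measurable[OF f0(1)] D(1)[OF that], of "Li \<nu>"] D(2)[OF that Li] by (simp add: Li)
        from sobolev_fun_norm_eq[OF \<Omega>'(1) k_def \<theta>_def this] show ?thesis
          unfolding sobolev_fun_norm_cong_AE[OF \<Omega>'(1) f0(2)] by blast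
      qed
      have "Lp_norm \<Omega>' p (G L) \<le> ?N" if "length L \<le> k" for L
      proof -
        have "Lp_norm \<Omega>' p (G L) \<le> (\<Sum>\<nu> | mi_order \<nu> \<le> k. Lp_norm \<Omega>' p (D \<nu>))"
          unfolding G_def using that by (intro member_le_sum) (auto simp: finite_mi_order_le mi_order_count_list)
        also have "\<dots> \<le> ?N" unfolding normf by simp
        finally show ?thesis .
      qed
      moreover have "gagliardo_seminorm \<Omega>' \<theta> p (G L) \<le> ?N" if "length L = k" "\<theta> \<noteq> 0" for L
      proof -
        have "gagliardo_seminorm \<Omega>' \<theta> p (G L) \<le> (\<Sum>\<nu> | mi_order \<nu> = k. gagliardo_seminorm \<Omega>' \<theta> p (D \<nu>))"
          unfolding G_def using that by (intro member_le_sum) (auto simp: fk mi_order_count_list)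
        also have "\<dots> \<le> ?N" unfolding normf using that by simp
        finally show ?thesis .
      qed
      ultimately have "N (f0, G) \<le> ennreal (real (card {L :: 'n list. length L \<le> k})) * ?N +
          ennreal (real (card {L :: 'n list. length L = k})) * ?N"
        unfolding N_def prod.case by (intro add_mono sum_le_card_mult) (auto intro: sum_le_card_mult)
      also have "\<dots> = ennreal m * ?N" by (simp add: m_def ennreal_plus distrib_right)
      finally have Nle: "N (f0, G) \<le> ennreal m * ?N" .
      have "is_weak_deriv \<Omega> \<nu> (\<lambda>y. a y * f0 (\<tau> y)) (H \<nu> G)" if \<nu>: "mi_order \<nu> \<le> k" for \<nu>
      proof -
        have w: "wd UNIV (Li \<nu>) (\<lambda>y. a y * f0 (\<tau> y)) (H \<nu> G)"
          by (rule H(2)) (use wdV[OF PG] \<nu> G0 in auto)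
        then have m: "(\<lambda>y. a y * f0 (\<tau> y)) \<in> borel_measurable borel" "H \<nu> G \<in> borel_measurable borel"
          by (auto simp: wd_def loc_int_measurable)
        have "wd \<Omega> (Li \<nu>) (\<lambda>y. a y * f0 (\<tau> y)) (H \<nu> G)" using w by (rule wd_mono) simp
        then show ?thesis using is_weak_deriv_iff_wd[OF \<Omega>(1) m, of "Li \<nu>"] by (simp add: Li)
      qed
      from sobolev_fun_norm_eq[OF \<Omega>(1) k_def \<theta>_def this]
      have "sobolev_fun_norm \<Omega> s p (\<lambda>y. a y * f0 (\<tau> y)) \<le> ennreal C1 * N (f0, G) + ennreal C2 * N (f0, G)"
        using add_mono[OF C1(2)[OF PG] C2(2)[OF PG]] unfolding snd_conv by (simp only:)
      also have "\<dots> = ennreal (C1 + C2) * N (f0, G)"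
        using C1(1) C2(1) by (simp add: ennreal_plus distrib_right)
      also have "\<dots> \<le> ennreal (C1 + C2) * (ennreal m * ?N)" by (intro mult_left_mono Nle) simp
      also have "\<dots> \<le> ennreal C * ?N"
      proof -
        have "ennreal (C1 + C2) * (ennreal m * ?N) = ennreal ((C1 + C2) * m) * ?N"
          using C1(1) C2(1) by (simp add: ennreal_mult m_def mult.assoc del: ennreal_plus)
        also have "\<dots> \<le> ennreal C * ?N"
          using C1(1) C2(1) unfolding C_def by (intro mult_right_mono ennreal_leI) auto
        finally show ?thesis .
      qed
      finally have "sobolev_fun_norm \<Omega> s p (\<lambda>y. a y * f0 (\<tau> y)) \<le> ennreal C * ?N" .
      moreover have ae: "AE y in lebesgue. y \<in> \<Omega> \<longrightarrow> a y * f (\<tau> y) = a y * f0 (\<tau> y)"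
      proof -
        have "AE x in lebesgue. x \<in> V' \<longrightarrow> f x = f0 x" using f0(2) by eventually_elim (use \<Omega>'(2) in auto)
        from AE_pullback_eq[OF a this] show ?thesis by eventually_elim simp
      qed
      moreover have "sobolev_fun_norm \<Omega> s p (\<lambda>y. a y * f (\<tau> y)) = sobolev_fun_norm \<Omega> s p (\<lambda>y. a y * f0 (\<tau> y))"
        by (rule sobolev_fun_norm_cong_AE[OF \<Omega>(1) ae])
      ultimately show ?thesis by simp
    qed
  qed
qed

end

section \<open>Bounds for distributions\<close>

lemma lp_energy_cmult:
  fixes f :: "real^'n::finite \<Rightarrow> real"
  assumes [measurable]: "f \<in> borel_measurable borel" and \<Omega>: "open \<Omega>" and c: "c > 0"
  shows "lp_energy \<Omega> p (\<lambda>x. c * f x) = ennreal (c powr p) * lp_energy \<Omega> p f"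
proof -
  have [measurable]: "\<Omega> \<in> sets borel" using \<Omega> by auto
  have "lp_energy \<Omega> p (\<lambda>x. c * f x) = (\<integral>\<^sup>+x. ennreal (c powr p) * (indicator \<Omega> x * ennreal (\<bar>f x\<bar> powr p)) \<partial>lborel)"
    unfolding lp_energy_def using c
    by (intro nn_integral_cong) (simp add: abs_mult powr_mult ennreal_mult mult_ac)
  also have "\<dots> = ennreal (c powr p) * lp_energy \<Omega> p f"
    unfolding lp_energy_def by (rule nn_integral_cmult) measurable
  finally show ?thesis .
qed

lemma gagliardo_energy_cmult:
  fixes f :: "real^'n::finite \<Rightarrow> real"
  assumes [measurable]: "f \<in> borel_measurable borel" and \<Omega>: "open \<Omega>" and c: "c > 0"
  shows "gagliardo_energy \<Omega> r p (\<lambda>x. c * f x) = ennreal (c powr p) * gagliardo_energy \<Omega> r p f"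
proof -
  have [measurable]: "\<Omega> \<in> sets borel" using \<Omega> by auto
  let ?K = "\<lambda>x y. ennreal (\<bar>f x - f y\<bar> powr p / norm (x - y) powr r)"
  have k: "ennreal (\<bar>c * f x - c * f y\<bar> powr p / norm (x - y) powr r) = ennreal (c powr p) * ?K x y" for x y
  proof -
    have "\<bar>c * f x - c * f y\<bar> = c * \<bar>f x - f y\<bar>" using c by (simp add: right_diff_distrib[symmetric] abs_mult)
    then show ?thesis using c by (simp add: powr_mult ennreal_mult[symmetric])
  qed
  have "gagliardo_energy \<Omega> r p (\<lambda>x. c * f x) = (\<integral>\<^sup>+x. ennreal (c powr p) * (indicator \<Omega> x * (\<integral>\<^sup>+y. indicator \<Omega> y * ?K x y \<partial>lborel)) \<partial>lborel)"
    unfolding gagliardo_energy_def k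
  proof (rule nn_integral_cong)
    fix x :: "real^'n"
    have "(\<integral>\<^sup>+y. indicator \<Omega> y * (ennreal (c powr p) * ?K x y) \<partial>lborel) = (\<integral>\<^sup>+y. ennreal (c powr p) * (indicator \<Omega> y * ?K x y) \<partial>lborel)"
      by (simp add: mult_ac)
    also have "\<dots> = ennreal (c powr p) * (\<integral>\<^sup>+y. indicator \<Omega> y * ?K x y \<partial>lborel)"
      by (rule nn_integral_cmult) measurable
    finally show "indicator \<Omega> x * (\<integral>\<^sup>+y. indicator \<Omega> y * (ennreal (c powr p) * ?K x y) \<partial>lborel)
      = ennreal (c powr p) * (indicator \<Omega> x * (\<integral>\<^sup>+y. indicator \<Omega> y * ?K x y \<partial>lborel))"
      by (simp add: mult_ac)
  qed
  also have "\<dots> = ennreal (c powr p) * gagliardo_energy \<Omega> r p f"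
    unfolding gagliardo_energy_def by (rule nn_integral_cmult) measurable
  finally show ?thesis .
qed

lemma wd_cmult:
  assumes "wd \<Omega> is f g" shows "wd \<Omega> is (\<lambda>x. c * f x) (\<lambda>x. c * g x)"
proof -
  have l: "loc_int \<Omega> (\<lambda>x. c * h x)" if "loc_int \<Omega> h" for h :: "real^'a \<Rightarrow> real"
    using that by (intro loc_int_mult_continuous) auto
  show ?thesis using assms by (auto simp: wd_def mult.assoc intro: l)
qed

lemma sobolev_fun_norm_cmult:
  fixes f :: "real^'n::finite \<Rightarrow> real"
  assumes \<Omega>: "open \<Omega>" and c: "c > 0" and p: "p > 1"
  shows "sobolev_fun_norm \<Omega> s p (\<lambda>x. c * f x) \<le> ennreal c * sobolev_fun_norm \<Omega> s p f"
proof (cases "sobolev_fun_norm \<Omega> s p f < \<infinity>")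
  case False
  then show ?thesis using c by (simp add: less_top[symmetric] ennreal_mult_top)
next
  case True
  define k where "k = nat \<lfloor>s\<rfloor>"
  obtain f0 G where f0: "loc_int \<Omega> f0" "AE x in lebesgue. x \<in> \<Omega> \<longrightarrow> f x = f0 x"
    and G: "\<And>\<nu>. mi_order \<nu> \<le> k \<Longrightarrow> G \<nu> \<in> borel_measurable borel"
      "\<And>\<nu> is. mi_order \<nu> \<le> k \<Longrightarrow> count_list is = \<nu> \<Longrightarrow> wd \<Omega> is f0 (G \<nu>)"
    using weak_derivatives_borel[OF \<Omega> True k_def] by blast
  have cf: "AE x in lebesgue. x \<in> \<Omega> \<longrightarrow> c * f x = c * f0 x" using f0(2) by eventually_elim simp
  have "(c powr p) powr (1 / p) = c" using p c by (simp add: powr_powr)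
  then have root: "ennreal_root p (ennreal (c powr p) * I) = ennreal c * ennreal_root p I" for I
    using ennreal_root_cmult[of "c powr p" p I] c by simp
  have "sobolev_fun_norm \<Omega> s p (\<lambda>x. c * f0 x) = (\<Sum>\<nu> | mi_order \<nu> \<le> k. ennreal_root p (lp_energy \<Omega> p (\<lambda>x. c * G \<nu> x))) +
    (if frac s = 0 then 0 else (\<Sum>\<nu> | mi_order \<nu> = k. ennreal_root p (gagliardo_energy \<Omega> (real CARD('n) + frac s * p) p (\<lambda>x. c * G \<nu> x))))"
    using G loc_int_measurable[OF f0(1)] by (intro sobolev_fun_norm_wd[OF \<Omega> k_def] wd_cmult) auto
  also have "(\<Sum>\<nu> | mi_order \<nu> \<le> k. ennreal_root p (lp_energy \<Omega> p (\<lambda>x. c * G \<nu> x))) = ennreal c * (\<Sum>\<nu> | mi_order \<nu> \<le> k. ennreal_root p (lp_energy \<Omega> p (G \<nu>)))"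
    unfolding sum_distrib_left root[symmetric] by (intro sum.cong refl arg_cong[where f = "ennreal_root p"] lp_energy_cmult \<Omega> c G) auto
  also have "(\<Sum>\<nu> | mi_order \<nu> = k. ennreal_root p (gagliardo_energy \<Omega> (real CARD('n) + frac s * p) p (\<lambda>x. c * G \<nu> x)))
      = ennreal c * (\<Sum>\<nu> | mi_order \<nu> = k. ennreal_root p (gagliardo_energy \<Omega> (real CARD('n) + frac s * p) p (G \<nu>)))"
    unfolding sum_distrib_left root[symmetric] by (intro sum.cong refl arg_cong[where f = "ennreal_root p"] gagliardo_energy_cmult \<Omega> c G) auto
  also have "ennreal c * (\<Sum>\<nu> | mi_order \<nu> \<le> k. ennreal_root p (lp_energy \<Omega> p (G \<nu>))) + (if frac s = 0 then 0 else
      ennreal c * (\<Sum>\<nu> | mi_order \<nu> = k. ennreal_root p (gagliardo_energy \<Omega> (real CARD('n) + frac s * p) p (G \<nu>)))) = ennreal c * sobolev_fun_norm \<Omega> s p f0"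
    using sobolev_fun_norm_wd[OF \<Omega> k_def loc_int_measurable[OF f0(1)], of G p] G by (simp add: distrib_left)
  finally show ?thesis
    unfolding sobolev_fun_norm_cong_AE[OF \<Omega> f0(2)] sobolev_fun_norm_cong_AE[OF \<Omega> cf] by simp
qed

text \<open>
  The constant \<open>2\<close> instead of \<open>1\<close> spares Minkowski's inequality for the double integrals.
\<close>
lemma sobolev_fun_norm_add:
  fixes f g :: "real^'n::finite \<Rightarrow> real"
  assumes \<Omega>: "open \<Omega>" and p: "p > 1"
  shows "sobolev_fun_norm \<Omega> s p (\<lambda>x. f x + g x) \<le> 2 * (sobolev_fun_norm \<Omega> s p f + sobolev_fun_norm \<Omega> s p g)"
proof (cases "sobolev_fun_norm \<Omega> s p f < \<infinity> \<and> sobolev_fun_norm \<Omega> s p g < \<infinity>")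
  case False
  then show ?thesis by (auto simp: less_top[symmetric] ennreal_mult_top)
next
  case True
  define k where "k = nat \<lfloor>s\<rfloor>"
  let ?r = "real CARD('n) + frac s * p"
  obtain f0 F where f0: "loc_int \<Omega> f0" "AE x in lebesgue. x \<in> \<Omega> \<longrightarrow> f x = f0 x"
    and F: "\<And>\<nu>. mi_order \<nu> \<le> k \<Longrightarrow> F \<nu> \<in> borel_measurable borel"
      "\<And>\<nu> is. mi_order \<nu> \<le> k \<Longrightarrow> count_list is = \<nu> \<Longrightarrow> wd \<Omega> is f0 (F \<nu>)"
    using weak_derivatives_borel[OF \<Omega> conjunct1[OF True] k_def] by blast
  obtain g0 G where g0: "loc_int \<Omega> g0" "AE x in lebesgue. x \<in> \<Omega> \<longrightarrow> g x = g0 x"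
    and G: "\<And>\<nu>. mi_order \<nu> \<le> k \<Longrightarrow> G \<nu> \<in> borel_measurable borel"
      "\<And>\<nu> is. mi_order \<nu> \<le> k \<Longrightarrow> count_list is = \<nu> \<Longrightarrow> wd \<Omega> is g0 (G \<nu>)"
    using weak_derivatives_borel[OF \<Omega> conjunct2[OF True] k_def] by blast
  have ae: "AE x in lebesgue. x \<in> \<Omega> \<longrightarrow> f x + g x = f0 x + g0 x" using f0(2) g0(2) by eventually_elim simp
  have "(2 powr p) powr (1 / p) = 2" using p by (simp add: powr_powr)
  then have root: "ennreal_root p (ennreal (2 powr p) * (I + J)) \<le> 2 * (ennreal_root p I + ennreal_root p J)" for I J
    using ennreal_root_cmult[of "2 powr p" p "I + J"] mult_left_mono[OF ennreal_root_add[of p I J], of 2] p by simp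
  have l: "ennreal_root p (lp_energy \<Omega> p (\<lambda>x. F \<nu> x + G \<nu> x)) \<le> 2 * (ennreal_root p (lp_energy \<Omega> p (F \<nu>)) + ennreal_root p (lp_energy \<Omega> p (G \<nu>)))"
    if "mi_order \<nu> \<le> k" for \<nu>
    using p by (intro order_trans[OF ennreal_root_mono[OF _ lp_energy_add[OF F(1)[OF that] G(1)[OF that] _ \<Omega>]] root]) auto
  have m: "ennreal_root p (gagliardo_energy \<Omega> ?r p (\<lambda>x. F \<nu> x + G \<nu> x)) \<le> 2 * (ennreal_root p (gagliardo_energy \<Omega> ?r p (F \<nu>)) + ennreal_root p (gagliardo_energy \<Omega> ?r p (G \<nu>)))"
    if "mi_order \<nu> \<le> k" for \<nu>
    using p by (intro order_trans[OF ennreal_root_mono[OF _ gagliardo_energy_add[OF F(1)[OF that] G(1)[OF that] _ \<Omega>]] root]) auto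
  have "sobolev_fun_norm \<Omega> s p (\<lambda>x. f0 x + g0 x) = (\<Sum>\<nu> | mi_order \<nu> \<le> k. ennreal_root p (lp_energy \<Omega> p (\<lambda>x. F \<nu> x + G \<nu> x))) +
    (if frac s = 0 then 0 else (\<Sum>\<nu> | mi_order \<nu> = k. ennreal_root p (gagliardo_energy \<Omega> ?r p (\<lambda>x. F \<nu> x + G \<nu> x))))"
    using F G loc_int_measurable[OF f0(1)] loc_int_measurable[OF g0(1)] by (intro sobolev_fun_norm_wd[OF \<Omega> k_def] wd_add) auto
  also have "\<dots> \<le> (\<Sum>\<nu> | mi_order \<nu> \<le> k. 2 * (ennreal_root p (lp_energy \<Omega> p (F \<nu>)) + ennreal_root p (lp_energy \<Omega> p (G \<nu>)))) +
    (if frac s = 0 then 0 else (\<Sum>\<nu> | mi_order \<nu> = k. 2 * (ennreal_root p (gagliardo_energy \<Omega> ?r p (F \<nu>)) + ennreal_root p (gagliardo_energy \<Omega> ?r p (G \<nu>)))))"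
  proof (rule add_mono)
    show "(\<Sum>\<nu> | mi_order \<nu> \<le> k. ennreal_root p (lp_energy \<Omega> p (\<lambda>x. F \<nu> x + G \<nu> x)))
      \<le> (\<Sum>\<nu> | mi_order \<nu> \<le> k. 2 * (ennreal_root p (lp_energy \<Omega> p (F \<nu>)) + ennreal_root p (lp_energy \<Omega> p (G \<nu>))))"
      by (intro sum_mono l) simp
    show "(if frac s = 0 then 0 else (\<Sum>\<nu> | mi_order \<nu> = k. ennreal_root p (gagliardo_energy \<Omega> ?r p (\<lambda>x. F \<nu> x + G \<nu> x))))
      \<le> (if frac s = 0 then 0 else (\<Sum>\<nu> | mi_order \<nu> = k. 2 * (ennreal_root p (gagliardo_energy \<Omega> ?r p (F \<nu>)) + ennreal_root p (gagliardo_energy \<Omega> ?r p (G \<nu>)))))"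
    proof (cases "frac s = 0")
      case False
      then show ?thesis unfolding if_not_P[OF False] by (intro sum_mono m) simp
    qed simp
  qed
  also have "\<dots> = 2 * (sobolev_fun_norm \<Omega> s p f0 + sobolev_fun_norm \<Omega> s p g0)"
    using sobolev_fun_norm_wd[OF \<Omega> k_def loc_int_measurable[OF f0(1)], of F p] F
      sobolev_fun_norm_wd[OF \<Omega> k_def loc_int_measurable[OF g0(1)], of G p] G
    by (simp add: sum_distrib_left[symmetric] sum.distrib distrib_left add_ac)
  finally show ?thesis
    unfolding sobolev_fun_norm_cong_AE[OF \<Omega> f0(2)] sobolev_fun_norm_cong_AE[OF \<Omega> g0(2)] sobolev_fun_norm_cong_AE[OF \<Omega> ae] .
qed

lemma sobolev_fun_norm_0:
  assumes "open (\<Omega> :: (real^'n::finite) set)" shows "sobolev_fun_norm \<Omega> s p (\<lambda>x. 0) = 0"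
proof -
  have "ennreal_root p 0 = 0" by (simp add: ennreal_root_def)
  then show ?thesis
    using sobolev_fun_norm_wd[OF assms refl, of "\<lambda>x. 0" s "\<lambda>_ _. 0" p] by (simp add: wd_0 lp_energy_0 gagliardo_energy_0)
qed

lemma sobolev_fun_norm_sum:
  fixes \<Omega> :: "(real^'n::finite) set"
  assumes \<Omega>: "open \<Omega>" and p: "p > 1" and "finite I"
  shows "\<exists>C>0. \<forall>h. sobolev_fun_norm \<Omega> s p (\<lambda>x. \<Sum>i\<in>I. h i x) \<le> ennreal C * (\<Sum>i\<in>I. sobolev_fun_norm \<Omega> s p (h i))"
  using assms(3)
proof (induction I rule: finite_induct)
  case empty
  then show ?case by (intro exI[of _ 1]) (simp add: sobolev_fun_norm_0[OF \<Omega>])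
next
  case (insert j I)
  then obtain C where C: "C > 0" "\<And>h. sobolev_fun_norm \<Omega> s p (\<lambda>x. \<Sum>i\<in>I. h i x) \<le> ennreal C * (\<Sum>i\<in>I. sobolev_fun_norm \<Omega> s p (h i))" by blast
  show ?case
  proof (intro exI[of _ "2 * (1 + C)"] conjI allI)
    show "2 * (1 + C) > 0" using C(1) by simp
    fix h :: "'a \<Rightarrow> real^'n \<Rightarrow> real"
    let ?a = "sobolev_fun_norm \<Omega> s p (h j)" and ?b = "\<Sum>i\<in>I. sobolev_fun_norm \<Omega> s p (h i)"
    have "sobolev_fun_norm \<Omega> s p (\<lambda>x. h j x + (\<Sum>i\<in>I. h i x)) \<le> 2 * (?a + ennreal C * ?b)"
      by (rule order_trans[OF sobolev_fun_norm_add[OF \<Omega> p]]) (intro mult_left_mono add_mono order_refl C(2), simp)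
    also have "\<dots> \<le> 2 * (ennreal (1 + C) * ?a + ennreal (1 + C) * ?b)"
    proof (intro mult_left_mono add_mono)
      have "ennreal 1 * ?a \<le> ennreal (1 + C) * ?a" using C(1) by (intro mult_right_mono ennreal_leI) auto
      then show "?a \<le> ennreal (1 + C) * ?a" by simp
      show "ennreal C * ?b \<le> ennreal (1 + C) * ?b" by (intro mult_right_mono ennreal_leI) auto
    qed simp
    also have "\<dots> = ennreal (2 * (1 + C)) * (?a + ?b)"
    proof -
      have "ennreal (2 * (1 + C)) = 2 * ennreal (1 + C)" using ennreal_mult[of 2 "1 + C"] C(1) by (simp only:) simp
      then show ?thesis by (simp only: distrib_left mult.assoc)
    qed
    finally show "sobolev_fun_norm \<Omega> s p (\<lambda>x. \<Sum>i\<in>insert j I. h i x) \<le> ennreal (2 * (1 + C)) * (\<Sum>i\<in>insert j I. sobolev_fun_norm \<Omega> s p (h i))"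
      using insert by simp
  qed
qed

context smooth_diffeo
begin

lemma test_functions_pullback:
  assumes a: "a \<in> test_functions V" and \<xi>: "\<xi> \<in> test_functions \<Omega>'"
  shows "(\<lambda>y. a y * \<xi> (\<tau> y)) \<in> test_functions V"
proof (rule test_functions_mult_smooth[OF a open_V])
  show "smooth_on V (\<lambda>y. \<xi> (\<tau> y))"
    using test_functions_smooth[OF \<xi>] by (intro smooth_on_compose[OF open_V open_UNIV _ _ smooth_\<tau>]) auto
qed

text \<open>
  Approximating test functions are pulled back along with \<open>f\<close>.
\<close>
lemma sobolev_zero_pullback:
  assumes \<Omega>: "open \<Omega>" "V \<subseteq> \<Omega>" and \<Omega>': "open \<Omega>'" "V' \<subseteq> \<Omega>'" and a: "a \<in> test_functions V"
    and p: "p > 1" and s: "s \<ge> 0" and f: "f \<in> sobolev_zero \<Omega>' s p"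
  shows "(\<lambda>y. a y * f (\<tau> y)) \<in> sobolev_zero \<Omega> s p"
proof -
  obtain C where C: "C > 0" "\<And>f. sobolev_fun_norm \<Omega> s p (\<lambda>y. a y * f (\<tau> y)) \<le> ennreal C * sobolev_fun_norm \<Omega>' s p f"
    using sobolev_fun_norm_pullback[OF \<Omega> \<Omega>' a p s] by blast
  show ?thesis
    unfolding sobolev_zero_def
  proof (intro CollectI conjI allI impI)
    show "sobolev_fun_norm \<Omega> s p (\<lambda>y. a y * f (\<tau> y)) < \<infinity>"
      using C(2)[of f] f by (auto simp: sobolev_zero_def ennreal_mult_less_top intro: le_less_trans)
    fix \<epsilon> :: real assume "\<epsilon> > 0"
    then have "\<epsilon> / C > 0" using C(1) by simp
    then obtain \<xi> where \<xi>: "\<xi> \<in> test_functions \<Omega>'" "sobolev_fun_norm \<Omega>' s p (\<lambda>x. f x - \<xi> x) < ennreal (\<epsilon> / C)"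
      using f by (auto simp: sobolev_zero_def)
    show "\<exists>\<eta>\<in>test_functions \<Omega>. sobolev_fun_norm \<Omega> s p (\<lambda>x. a x * f (\<tau> x) - \<eta> x) < ennreal \<epsilon>"
    proof (rule bexI[of _ "\<lambda>y. a y * \<xi> (\<tau> y)"])
      show "(\<lambda>y. a y * \<xi> (\<tau> y)) \<in> test_functions \<Omega>"
        by (rule test_functions_mono[OF test_functions_pullback[OF a \<xi>(1)] \<Omega>(2)])
      have "sobolev_fun_norm \<Omega> s p (\<lambda>x. a x * f (\<tau> x) - a x * \<xi> (\<tau> x)) \<le> ennreal C * sobolev_fun_norm \<Omega>' s p (\<lambda>x. f x - \<xi> x)"
        using C(2)[of "\<lambda>x. f x - \<xi> x"] by (simp add: right_diff_distrib)
      also have "\<dots> < ennreal C * ennreal (\<epsilon> / C)"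
        using C(1) \<xi>(2) by (intro ennreal_mult_strict_left_mono) auto
      also have "\<dots> = ennreal \<epsilon>" using C(1) \<open>\<epsilon> > 0\<close> by (simp add: ennreal_mult[symmetric])
      finally show "sobolev_fun_norm \<Omega> s p (\<lambda>x. a x * f (\<tau> x) - a x * \<xi> (\<tau> x)) < ennreal \<epsilon>" .
    qed
  qed
qed

text \<open>
  The supremum in the dual norm ranges over functions of norm at most \<open>1\<close>; the pullback of \<open>f\<close> is
  divided by the constant \<open>C\<close> of \<open>sobolev_fun_norm_pullback\<close> to become one of them.
\<close>
lemma dual_norm_pullback:
  assumes \<Omega>: "open \<Omega>" "V \<subseteq> \<Omega>" and \<Omega>': "open \<Omega>'" "V' \<subseteq> \<Omega>'" and a: "a \<in> test_functions V"
    and p: "p > 1" and s: "s \<ge> 0"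
  shows "\<exists>C>0. \<forall>F f. linear_functional_on (sobolev_zero \<Omega> s p) F \<longrightarrow> f \<in> sobolev_zero \<Omega>' s p \<longrightarrow> sobolev_fun_norm \<Omega>' s p f \<le> 1 \<longrightarrow>
    ennreal \<bar>F (\<lambda>y. a y * f (\<tau> y))\<bar> \<le> ennreal C * sobolev_dual_norm \<Omega> s p F"
proof -
  obtain C where C: "C > 0" "\<And>f. sobolev_fun_norm \<Omega> s p (\<lambda>y. a y * f (\<tau> y)) \<le> ennreal C * sobolev_fun_norm \<Omega>' s p f"
    using sobolev_fun_norm_pullback[OF \<Omega> \<Omega>' a p s] by blast
  show ?thesis
  proof (intro exI[of _ C] conjI allI impI C(1))
    fix F f assume F: "linear_functional_on (sobolev_zero \<Omega> s p) F" and f: "f \<in> sobolev_zero \<Omega>' s p" "sobolev_fun_norm \<Omega>' s p f \<le> 1"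
    define g where "g = (\<lambda>y. a y * f (\<tau> y))"
    have g: "g \<in> sobolev_zero \<Omega> s p" unfolding g_def by (rule sobolev_zero_pullback[OF \<Omega> \<Omega>' a p s f(1)])
    \<comment> \<open>\<open>h\<close> has norm at most \<open>1\<close>; it is itself a pullback, which shows that it lies in the space.\<close>
    define h where "h = (\<lambda>y. (1 / C * a y) * f (\<tau> y))"
    have hg: "h = (\<lambda>y. 1 / C * g y)" by (simp add: h_def g_def mult.assoc)
    have h0: "h \<in> sobolev_zero \<Omega> s p" unfolding h_def
      by (rule sobolev_zero_pullback[OF \<Omega> \<Omega>' test_functions_cmult[OF a] p s f(1)])
    have "sobolev_fun_norm \<Omega> s p h \<le> ennreal (1 / C) * sobolev_fun_norm \<Omega> s p g"
      unfolding hg using C(1) by (intro sobolev_fun_norm_cmult \<Omega> p) simp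
    also have "\<dots> \<le> ennreal (1 / C) * (ennreal C * 1)"
      unfolding g_def by (intro mult_left_mono order_trans[OF C(2)] f(2)) auto
    also have "\<dots> = 1" using C(1) by (simp add: ennreal_mult[symmetric])
    finally have "ennreal \<bar>F h\<bar> \<le> sobolev_dual_norm \<Omega> s p F"
      unfolding sobolev_dual_norm_def using h0 by (intro SUP_upper) auto
    moreover have "F h = 1 / C * F g" unfolding hg using F g unfolding linear_functional_on_def by blast
    ultimately have "ennreal C * ennreal (1 / C * \<bar>F g\<bar>) \<le> ennreal C * sobolev_dual_norm \<Omega> s p F"
      using C(1) by (intro mult_left_mono) (auto simp: abs_mult)
    then show "ennreal \<bar>F (\<lambda>y. a y * f (\<tau> y))\<bar> \<le> ennreal C * sobolev_dual_norm \<Omega> s p F"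
      using C(1) by (simp add: ennreal_mult[symmetric] g_def)
  qed
qed

text \<open>
  The adjoint of the pullback \<open>\<xi> \<mapsto> a \<cdot> (\<xi> \<circ> \<tau>)\<close> is the pullback along the inverse map with the
  factor \<open>push a\<close>; in the iterated transport the two Jacobians cancel.
\<close>
lemma integral_pullback_test:
  assumes a: "a \<in> test_functions V" and g: "loc_int V g" and \<xi>: "\<xi> \<in> test_functions \<Omega>'"
  shows "(LINT y|lborel. g y * (a y * \<xi> (\<tau> y))) = (LINT z|lborel. (push a z * g (\<sigma> z)) * \<xi> z)"
proof -
  interpret inv: smooth_diffeo V' V \<sigma> \<tau> by (rule inverse_diffeo)
  have "(\<lambda>z. push a z * \<xi> z) \<in> test_functions V'"
    by (rule test_functions_mult[OF push_test[OF a] test_functions_smooth[OF \<xi>]])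
  note pb = inv.pullback_integral(2)[OF this g]
  have e: "inv.push (\<lambda>z. push a z * \<xi> z) y = a y * \<xi> (\<tau> y)" for y
  proof (cases "y \<in> V")
    case True
    have "inv.push (\<lambda>z. push a z * \<xi> z) y = a y * \<xi> (\<tau> y) * (jac \<sigma> (\<tau> y) * jac \<tau> y)"
      using True by (simp add: inv.push_def push_def \<tau>_mem \<sigma>\<tau> mult_ac)
    then show ?thesis by (simp add: jac_inverse[OF True])
  qed (simp add: inv.push_def test_functions_zero[OF a])
  have "(LINT z|lborel. (push a z * g (\<sigma> z)) * \<xi> z) = (LINT y|lborel. g y * inv.push (\<lambda>z. push a z * \<xi> z) y)"
    using pb by (simp add: mult_ac)
  then show ?thesis unfolding e by simp
qed

end

text \<open>
  Reduces an inequality between norms that are infima to one between their members.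
\<close>
lemma le_mult_sum_Inf:
  fixes X :: "'i \<Rightarrow> ennreal set"
  assumes I: "finite I" and C: "C > 0"
    and le: "\<And>x. (\<And>i. i \<in> I \<Longrightarrow> x i \<in> X i) \<Longrightarrow> L \<le> ennreal C * (\<Sum>i\<in>I. x i)"
  shows "L \<le> ennreal C * (\<Sum>i\<in>I. Inf (X i))"
proof (rule ennreal_le_epsilon)
  fix e :: real assume fin: "ennreal C * (\<Sum>i\<in>I. Inf (X i)) < top" and e: "0 < e"
  \<comment> \<open>The summand \<open>1\<close> covers the case of an empty index set.\<close>
  define \<delta> where "\<delta> = e / (C * (real (card I) + 1))"
  have \<delta>: "\<delta> > 0" using e C by (auto simp: \<delta>_def)
  have "\<exists>x\<in>X i. x < Inf (X i) + ennreal \<delta>" if i: "i \<in> I" for i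
  proof -
    have "(\<Sum>i\<in>I. Inf (X i)) \<noteq> top" 
    proof
      assume "(\<Sum>i\<in>I. Inf (X i)) = top"
      with fin C show False by (simp add: ennreal_mult_top)
    qed
    moreover have "Inf (X i) \<le> (\<Sum>i\<in>I. Inf (X i))" using member_le_sum[OF i, of "\<lambda>i. Inf (X i)"] I by simp
    ultimately have "Inf (X i) < top" by (meson le_less_trans less_top)
    then have "Inf (X i) \<noteq> top" by (simp only: less_top)
    then have "Inf (X i) < Inf (X i) + ennreal \<delta>" using \<delta> by (cases "Inf (X i)") (auto simp: ennreal_plus[symmetric] ennreal_less_iff simp del: ennreal_plus)
    then show ?thesis by (simp add: Inf_less_iff)
  qed
  then obtain x where x: "\<And>i. i \<in> I \<Longrightarrow> x i \<in> X i" "\<And>i. i \<in> I \<Longrightarrow> x i < Inf (X i) + ennreal \<delta>" by metis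
  have "L \<le> ennreal C * (\<Sum>i\<in>I. x i)" by (rule le[OF x(1)])
  also have "\<dots> \<le> ennreal C * (\<Sum>i\<in>I. Inf (X i) + ennreal \<delta>)"
    by (intro mult_left_mono sum_mono less_imp_le[OF x(2)]) auto
  also have "\<dots> = ennreal C * (\<Sum>i\<in>I. Inf (X i)) + ennreal (C * (real (card I) * \<delta>))"
    using C \<delta> by (simp add: sum.distrib distrib_left ennreal_mult ennreal_of_nat_eq_real_of_nat)
  also have "\<dots> \<le> ennreal C * (\<Sum>i\<in>I. Inf (X i)) + ennreal e"
  proof (intro add_left_mono ennreal_leI)
    have "C * (real (card I) * \<delta>) \<le> C * ((real (card I) + 1) * \<delta>)" using C \<delta> by (intro mult_left_mono mult_right_mono) auto
    also have "\<dots> = e" using C by (simp add: \<delta>_def)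
    finally show "C * (real (card I) * \<delta>) \<le> e" .
  qed
  finally show "L \<le> ennreal C * (\<Sum>i\<in>I. Inf (X i)) + ennreal e" .
qed

text \<open>
  If \<open>e \<ge> 0\<close> and \<open>S i\<close> is given by a function \<open>g i\<close>, then \<open>T\<close> is given by the sum of the adjoint
  pullbacks \<open>Q i\<close> of \<open>g i\<close>. If \<open>e < 0\<close> and \<open>S i\<close> extends to a functional \<open>F i\<close>, then \<open>T\<close> extends
  to the sum of the functionals \<open>f \<mapsto> F i (a i \<cdot> (f \<circ> \<tau> i))\<close>. In both cases the norm of the
  representing object is bounded by \<open>sobolev_fun_norm_pullback\<close>.
\<close>
theorem sobolev_norm_sum_pullback:
  fixes \<Omega> :: "(real^'n::finite) set" and \<Omega>' :: "'i \<Rightarrow> (real^'n) set"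
  assumes I: "finite I" and q: "q > 1" and \<Omega>: "open \<Omega>"
    and \<Omega>': "\<And>i. i \<in> I \<Longrightarrow> open (\<Omega>' i)"
    and diffeo: "\<And>i. i \<in> I \<Longrightarrow> smooth_diffeo (V i) (V' i) (\<tau> i) (\<sigma> i)"
    and V: "\<And>i. i \<in> I \<Longrightarrow> V i \<subseteq> \<Omega>' i" and V': "\<And>i. i \<in> I \<Longrightarrow> V' i \<subseteq> \<Omega>"
    and a: "\<And>i. i \<in> I \<Longrightarrow> a i \<in> test_functions (V i)"
  shows "\<exists>C>0. \<forall>T S. (\<forall>\<xi>\<in>test_functions \<Omega>. T \<xi> = (\<Sum>i\<in>I. S i (\<lambda>y. a i y * \<xi> (\<tau> i y)))) \<longrightarrow>
    sobolev_norm \<Omega> e q T \<le> ennreal C * (\<Sum>i\<in>I. sobolev_norm (\<Omega>' i) e q (S i))"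
proof (cases "e \<ge> 0")
  case True
  have ex: "\<exists>C>0. \<forall>f. sobolev_fun_norm \<Omega> e q (\<lambda>z. smooth_diffeo.push (V' i) (\<sigma> i) (a i) z * f (\<sigma> i z)) \<le> ennreal C * sobolev_fun_norm (\<Omega>' i) e q f"
    if i: "i \<in> I" for i
  proof -
    interpret smooth_diffeo "V i" "V' i" "\<tau> i" "\<sigma> i" by (rule diffeo[OF i])
    show ?thesis
      by (rule smooth_diffeo.sobolev_fun_norm_pullback[OF inverse_diffeo \<Omega> V'[OF i] \<Omega>'[OF i] V[OF i] push_test[OF a[OF i]] q True])
  qed
  from bchoice[OF ballI[OF ex]] obtain C1 where C1all: "\<forall>i\<in>I. 0 < C1 i \<and> (\<forall>f. sobolev_fun_norm \<Omega> e q
      (\<lambda>z. smooth_diffeo.push (V' i) (\<sigma> i) (a i) z * f (\<sigma> i z)) \<le> ennreal (C1 i) * sobolev_fun_norm (\<Omega>' i) e q f)" ..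
  have C1: "C1 i > 0" "sobolev_fun_norm \<Omega> e q (\<lambda>z. smooth_diffeo.push (V' i) (\<sigma> i) (a i) z * f (\<sigma> i z))
      \<le> ennreal (C1 i) * sobolev_fun_norm (\<Omega>' i) e q f" if "i \<in> I" for i f
    using bspec[OF C1all that] by simp_all
  obtain C0 where C0: "C0 > 0" "\<And>h :: 'i \<Rightarrow> real^'n \<Rightarrow> real. sobolev_fun_norm \<Omega> e q (\<lambda>x. \<Sum>i\<in>I. h i x) \<le> ennreal C0 * (\<Sum>i\<in>I. sobolev_fun_norm \<Omega> e q (h i))"
    using sobolev_fun_norm_sum[OF \<Omega> q I, of e] by blast
  define C where "C = C0 * (1 + (\<Sum>i\<in>I. C1 i))"
  have S0: "(\<Sum>i\<in>I. C1 i) \<ge> 0" using C1(1) by (intro sum_nonneg) (auto simp: less_imp_le)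
  show ?thesis
  proof (intro exI[of _ C] conjI allI impI)
    show C: "C > 0" unfolding C_def using C0(1) S0 by (intro mult_pos_pos) auto
    fix T and S :: "'i \<Rightarrow> (real^'n \<Rightarrow> real) \<Rightarrow> real"
    assume T: "\<forall>\<xi>\<in>test_functions \<Omega>. T \<xi> = (\<Sum>i\<in>I. S i (\<lambda>y. a i y * \<xi> (\<tau> i y)))"
    let ?X = "\<lambda>i. {sobolev_fun_norm (\<Omega>' i) e q f | f. locally_integrable (\<Omega>' i) f \<and>
            (\<forall>\<xi>\<in>test_functions (\<Omega>' i). S i \<xi> = (LINT x|lebesgue_on (\<Omega>' i). f x * \<xi> x))}"
    have "sobolev_norm \<Omega> e q T \<le> ennreal C * (\<Sum>i\<in>I. Inf (?X i))"
    proof (rule le_mult_sum_Inf[OF I C])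
      fix x assume x: "\<And>i. i \<in> I \<Longrightarrow> x i \<in> ?X i"
      then have "\<forall>i\<in>I. \<exists>f. x i = sobolev_fun_norm (\<Omega>' i) e q f \<and> locally_integrable (\<Omega>' i) f \<and>
            (\<forall>\<xi>\<in>test_functions (\<Omega>' i). S i \<xi> = (LINT x|lebesgue_on (\<Omega>' i). f x * \<xi> x))" by blast
      from bchoice[OF this] obtain f where f: "\<And>i. i \<in> I \<Longrightarrow> x i = sobolev_fun_norm (\<Omega>' i) e q (f i)"
        "\<And>i. i \<in> I \<Longrightarrow> locally_integrable (\<Omega>' i) (f i)"
        "\<And>i \<xi>. i \<in> I \<Longrightarrow> \<xi> \<in> test_functions (\<Omega>' i) \<Longrightarrow> S i \<xi> = (LINT x|lebesgue_on (\<Omega>' i). f i x * \<xi> x)" by blast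
      have "\<forall>i\<in>I. \<exists>g. loc_int (\<Omega>' i) g \<and> (AE x in lebesgue. x \<in> \<Omega>' i \<longrightarrow> f i x = g x)"
        using borel_representative[OF \<Omega>' f(2)] by blast
      from bchoice[OF this] obtain g where g: "\<And>i. i \<in> I \<Longrightarrow> loc_int (\<Omega>' i) (g i)"
        "\<And>i. i \<in> I \<Longrightarrow> AE x in lebesgue. x \<in> \<Omega>' i \<longrightarrow> f i x = g i x" by blast
      define Q where "Q i z = smooth_diffeo.push (V' i) (\<sigma> i) (a i) z * g i (\<sigma> i z)" for i z
      have Ql: "loc_int UNIV (Q i)" and QS: "\<xi> \<in> test_functions \<Omega> \<Longrightarrow> S i (\<lambda>y. a i y * \<xi> (\<tau> i y)) = (LINT z|lborel. Q i z * \<xi> z)"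
        if i: "i \<in> I" for i \<xi>
      proof -
        interpret smooth_diffeo "V i" "V' i" "\<tau> i" "\<sigma> i" by (rule diffeo[OF i])
        have gl: "loc_int (V i) (g i)" by (rule loc_int_mono[OF g(1)[OF i] V[OF i]])
        show "loc_int UNIV (Q i)" unfolding Q_def[abs_def]
          by (rule smooth_diffeo.loc_int_pullback[OF inverse_diffeo push_test[OF a[OF i]] gl])
        assume \<xi>: "\<xi> \<in> test_functions \<Omega>"
        have t: "(\<lambda>y. a i y * \<xi> (\<tau> i y)) \<in> test_functions (\<Omega>' i)"
          by (rule test_functions_mono[OF test_functions_pullback[OF a[OF i] \<xi>] V[OF i]])
        have "S i (\<lambda>y. a i y * \<xi> (\<tau> i y)) = (LINT y|lborel. g i y * (a i y * \<xi> (\<tau> i y)))"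
          using f(3)[OF i t] integral_lebesgue_on_cong_AE[OF \<Omega>'[OF i] g(2)[OF i] f(2)[OF i] test_functions_measurable[OF t]]
            integral_lebesgue_on_borel[OF \<Omega>'[OF i] loc_int_measurable[OF g(1)[OF i]] t] by simp
        also have "\<dots> = (LINT z|lborel. Q i z * \<xi> z)"
          unfolding Q_def by (rule integral_pullback_test[OF a[OF i] gl \<xi>])
        finally show "S i (\<lambda>y. a i y * \<xi> (\<tau> i y)) = (LINT z|lborel. Q i z * \<xi> z)" .
      qed
      define F where "F z = (\<Sum>i\<in>I. Q i z)" for z
      have Fl: "loc_int UNIV F" unfolding F_def[abs_def] by (intro loc_int_sum I Ql)
      have TF: "T \<xi> = (LINT x|lebesgue_on \<Omega>. F x * \<xi> x)" if \<xi>: "\<xi> \<in> test_functions \<Omega>" for \<xi>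
      proof -
        have int: "integrable lborel (\<lambda>z. Q i z * \<xi> z)" if "i \<in> I" for i
          by (rule loc_int_mult_test[OF loc_int_mono[OF Ql[OF that]] \<xi>]) simp
        have "T \<xi> = (\<Sum>i\<in>I. LINT z|lborel. Q i z * \<xi> z)" using T \<xi> QS by simp
        also have "\<dots> = (LINT z|lborel. F z * \<xi> z)"
          using int by (subst Bochner_Integration.integral_sum[symmetric]) (auto simp: F_def sum_distrib_right)
        also have "\<dots> = (LINT x|lebesgue_on \<Omega>. F x * \<xi> x)"
          by (rule integral_lebesgue_on_borel[OF \<Omega> loc_int_measurable[OF Fl] \<xi>, symmetric])
        finally show ?thesis .
      qed
      have "locally_integrable \<Omega> F"
        using loc_int_mono[OF Fl, of \<Omega>] by (simp add: loc_int_iff[OF loc_int_measurable[OF Fl]])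
      then have "sobolev_norm \<Omega> e q T \<le> sobolev_fun_norm \<Omega> e q F"
        unfolding sobolev_norm_def using True TF by (auto intro!: Inf_lower)
      also have "\<dots> \<le> ennreal C0 * (\<Sum>i\<in>I. sobolev_fun_norm \<Omega> e q (Q i))" unfolding F_def[abs_def] by (rule C0(2))
      also have "\<dots> \<le> ennreal C0 * (\<Sum>i\<in>I. ennreal (1 + (\<Sum>i\<in>I. C1 i)) * x i)"
      proof (intro mult_left_mono sum_mono)
        fix i assume i: "i \<in> I"
        have "sobolev_fun_norm \<Omega> e q (Q i) \<le> ennreal (C1 i) * sobolev_fun_norm (\<Omega>' i) e q (g i)"
          unfolding Q_def[abs_def] by (rule C1(2)[OF i])
        also have "sobolev_fun_norm (\<Omega>' i) e q (g i) = x i"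
          unfolding f(1)[OF i] by (rule sobolev_fun_norm_cong_AE[OF \<Omega>'[OF i] g(2)[OF i], symmetric])
        also have "ennreal (C1 i) * x i \<le> ennreal (1 + (\<Sum>i\<in>I. C1 i)) * x i"
          using member_le_sum[OF i, of C1] C1(1) I by (intro mult_right_mono ennreal_leI) (auto simp: less_imp_le add_increasing)
        finally show "sobolev_fun_norm \<Omega> e q (Q i) \<le> ennreal (1 + (\<Sum>i\<in>I. C1 i)) * x i" .
      qed simp
      also have "\<dots> = ennreal C * (\<Sum>i\<in>I. x i)"
        using C0(1) S0 by (simp add: C_def sum_distrib_left[symmetric] ennreal_mult mult.assoc del: ennreal_plus)
      finally show "sobolev_norm \<Omega> e q T \<le> ennreal C * (\<Sum>i\<in>I. x i)" .
    qed
    then show "sobolev_norm \<Omega> e q T \<le> ennreal C * (\<Sum>i\<in>I. sobolev_norm (\<Omega>' i) e q (S i))"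
      unfolding sobolev_norm_def[of "\<Omega>' _"] using True by simp
  qed
next
  case False
  define s where "s = - e"
  define p where "p = q / (q - 1)"
  have s: "s \<ge> 0" using False by (simp add: s_def)
  have p: "p > 1" using q by (simp add: p_def field_simps)
  let ?P = "\<lambda>i f y. a i y * f (\<tau> i y)"
  have ex: "\<exists>C>0. \<forall>F f. linear_functional_on (sobolev_zero (\<Omega>' i) s p) F \<longrightarrow> f \<in> sobolev_zero \<Omega> s p \<longrightarrow> sobolev_fun_norm \<Omega> s p f \<le> 1 \<longrightarrow>
      ennreal \<bar>F (?P i f)\<bar> \<le> ennreal C * sobolev_dual_norm (\<Omega>' i) s p F" if i: "i \<in> I" for i
    by (rule smooth_diffeo.dual_norm_pullback[OF diffeo[OF i] \<Omega>'[OF i] V[OF i] \<Omega> V'[OF i] a[OF i] p s])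
  from bchoice[OF ballI[OF ex]] obtain C1 where C1all: "\<forall>i\<in>I. 0 < C1 i \<and> (\<forall>F f. linear_functional_on (sobolev_zero (\<Omega>' i) s p) F \<longrightarrow>
      f \<in> sobolev_zero \<Omega> s p \<longrightarrow> sobolev_fun_norm \<Omega> s p f \<le> 1 \<longrightarrow>
      ennreal \<bar>F (?P i f)\<bar> \<le> ennreal (C1 i) * sobolev_dual_norm (\<Omega>' i) s p F)" ..
  have C1: "C1 i > 0" "linear_functional_on (sobolev_zero (\<Omega>' i) s p) F \<Longrightarrow> f \<in> sobolev_zero \<Omega> s p \<Longrightarrow> sobolev_fun_norm \<Omega> s p f \<le> 1 \<Longrightarrow>
      ennreal \<bar>F (?P i f)\<bar> \<le> ennreal (C1 i) * sobolev_dual_norm (\<Omega>' i) s p F" if "i \<in> I" for i F f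
    using bspec[OF C1all that] by simp_all
  define C where "C = 1 + (\<Sum>i\<in>I. C1 i)"
  have S0: "(\<Sum>i\<in>I. C1 i) \<ge> 0" using C1(1) by (intro sum_nonneg) (auto simp: less_imp_le)
  show ?thesis
  proof (intro exI[of _ C] conjI allI impI)
    show C: "C > 0" unfolding C_def using S0 by simp
    fix T and S :: "'i \<Rightarrow> (real^'n \<Rightarrow> real) \<Rightarrow> real"
    assume T: "\<forall>\<xi>\<in>test_functions \<Omega>. T \<xi> = (\<Sum>i\<in>I. S i (?P i \<xi>))"
    let ?X = "\<lambda>i. {sobolev_dual_norm (\<Omega>' i) s p F | F. linear_functional_on (sobolev_zero (\<Omega>' i) s p) F \<and>
            (\<forall>\<xi>\<in>test_functions (\<Omega>' i). F \<xi> = S i \<xi>)}"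
    have "sobolev_norm \<Omega> e q T \<le> ennreal C * (\<Sum>i\<in>I. Inf (?X i))"
    proof (rule le_mult_sum_Inf[OF I C])
      fix x assume x: "\<And>i. i \<in> I \<Longrightarrow> x i \<in> ?X i"
      then have "\<forall>i\<in>I. \<exists>F. x i = sobolev_dual_norm (\<Omega>' i) s p F \<and> linear_functional_on (sobolev_zero (\<Omega>' i) s p) F \<and>
            (\<forall>\<xi>\<in>test_functions (\<Omega>' i). F \<xi> = S i \<xi>)" by blast
      from bchoice[OF this] obtain F where F: "\<And>i. i \<in> I \<Longrightarrow> x i = sobolev_dual_norm (\<Omega>' i) s p (F i)"
        "\<And>i. i \<in> I \<Longrightarrow> linear_functional_on (sobolev_zero (\<Omega>' i) s p) (F i)"
        "\<And>i \<xi>. i \<in> I \<Longrightarrow> \<xi> \<in> test_functions (\<Omega>' i) \<Longrightarrow> F i \<xi> = S i \<xi>" by blast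
      define G where "G f = (\<Sum>i\<in>I. F i (?P i f))" for f
      have Pz: "?P i f \<in> sobolev_zero (\<Omega>' i) s p" if "i \<in> I" "f \<in> sobolev_zero \<Omega> s p" for i f
        by (rule smooth_diffeo.sobolev_zero_pullback[OF diffeo \<Omega>' V \<Omega> V' a p s]) (use that in auto)
      have "linear_functional_on (sobolev_zero \<Omega> s p) G"
        unfolding linear_functional_on_def
      proof (intro conjI ballI allI)
        fix f g assume fg: "f \<in> sobolev_zero \<Omega> s p" "g \<in> sobolev_zero \<Omega> s p"
        have "F i (?P i (\<lambda>x. f x + g x)) = F i (?P i f) + F i (?P i g)" if i: "i \<in> I" for i
          using F(2)[OF i] Pz[OF i fg(1)] Pz[OF i fg(2)] by (simp add: linear_functional_on_def distrib_left)
        then show "G (\<lambda>x. f x + g x) = G f + G g" by (simp add: G_def sum.distrib)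
      next
        fix b f assume f: "f \<in> sobolev_zero \<Omega> s p"
        have "F i (?P i (\<lambda>x. b * f x)) = b * F i (?P i f)" if i: "i \<in> I" for i
          using F(2)[OF i] Pz[OF i f] by (simp add: linear_functional_on_def mult.left_commute)
        then show "G (\<lambda>x. b * f x) = b * G f" by (simp add: G_def sum_distrib_left)
      qed
      moreover have "G \<xi> = T \<xi>" if \<xi>: "\<xi> \<in> test_functions \<Omega>" for \<xi>
      proof -
        have "F i (?P i \<xi>) = S i (?P i \<xi>)" if i: "i \<in> I" for i
          by (rule F(3)[OF i test_functions_mono[OF smooth_diffeo.test_functions_pullback[OF diffeo[OF i] a[OF i] \<xi>] V[OF i]]])
        then show ?thesis using T \<xi> by (simp add: G_def)
      qed
      ultimately have "sobolev_norm \<Omega> e q T \<le> sobolev_dual_norm \<Omega> s p G"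
        unfolding sobolev_norm_def using False by (auto simp: s_def[symmetric] p_def[symmetric] intro!: Inf_lower)
      also have "\<dots> \<le> ennreal C * (\<Sum>i\<in>I. x i)"
        unfolding sobolev_dual_norm_def[of \<Omega>]
      proof (rule SUP_least)
        fix f assume "f \<in> {f \<in> sobolev_zero \<Omega> s p. sobolev_fun_norm \<Omega> s p f \<le> 1}"
        then have f: "f \<in> sobolev_zero \<Omega> s p" "sobolev_fun_norm \<Omega> s p f \<le> 1" by auto
        have "ennreal \<bar>G f\<bar> \<le> ennreal (\<Sum>i\<in>I. \<bar>F i (?P i f)\<bar>)" unfolding G_def by (intro ennreal_leI sum_abs)
        also have "\<dots> = (\<Sum>i\<in>I. ennreal \<bar>F i (?P i f)\<bar>)" by (rule sum_ennreal[symmetric]) simp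
        also have "\<dots> \<le> (\<Sum>i\<in>I. ennreal C * x i)"
        proof (rule sum_mono)
          fix i assume i: "i \<in> I"
          have "ennreal \<bar>F i (?P i f)\<bar> \<le> ennreal (C1 i) * x i"
            unfolding F(1)[OF i] by (rule C1(2)[OF i F(2)[OF i] f])
          also have "\<dots> \<le> ennreal C * x i"
            using member_le_sum[OF i, of C1] C1(1) I by (intro mult_right_mono ennreal_leI) (auto simp: C_def less_imp_le add_increasing)
          finally show "ennreal \<bar>F i (?P i f)\<bar> \<le> ennreal C * x i" .
        qed
        finally show "ennreal \<bar>G f\<bar> \<le> ennreal C * (\<Sum>i\<in>I. x i)" by (simp add: sum_distrib_left)
      qed
      finally show "sobolev_norm \<Omega> e q T \<le> ennreal C * (\<Sum>i\<in>I. x i)" .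
    qed
    then show "sobolev_norm \<Omega> e q T \<le> ennreal C * (\<Sum>i\<in>I. sobolev_norm (\<Omega>' i) e q (S i))"
      unfolding sobolev_norm_def[of "\<Omega>' _"] using False by (simp add: s_def[symmetric] p_def[symmetric])
  qed
qed

section \<open>Charts, densities and localization\<close>

lemma jac_compose:
  fixes \<tau> \<rho> f :: "real^'n::finite \<Rightarrow> real^'n"
  assumes \<tau>: "\<tau> differentiable (at y)" and \<rho>: "\<rho> differentiable (at (\<tau> y))"
    and U: "open U" "y \<in> U" and f: "\<And>z. z \<in> U \<Longrightarrow> f z = \<rho> (\<tau> z)"
  shows "jac f y = jac \<tau> y * jac \<rho> (\<tau> y)"
proof -
  have d\<tau>: "(\<tau> has_derivative frechet_derivative \<tau> (at y)) (at y)"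
    and d\<rho>: "(\<rho> has_derivative frechet_derivative \<rho> (at (\<tau> y))) (at (\<tau> y))"
    using \<tau> \<rho> by (simp_all add: frechet_derivative_works)
  have "((\<lambda>z. \<rho> (\<tau> z)) has_derivative (\<lambda>h. frechet_derivative \<rho> (at (\<tau> y)) (frechet_derivative \<tau> (at y) h))) (at y)"
    by (rule has_derivative_compose[OF d\<tau> d\<rho>])
  then have "(f has_derivative (\<lambda>h. frechet_derivative \<rho> (at (\<tau> y)) (frechet_derivative \<tau> (at y) h))) (at y)"
    by (rule has_derivative_transform_within_open[OF _ U]) (simp add: f)
  then have "frechet_derivative f (at y) = frechet_derivative \<rho> (at (\<tau> y)) \<circ> frechet_derivative \<tau> (at y)"
    by (simp add: frechet_derivative_at[symmetric] o_def)
  then show ?thesis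
    using has_derivative_linear[OF d\<tau>] has_derivative_linear[OF d\<rho>]
    by (simp add: jac_def matrix_compose det_mul abs_mult)
qed

context
  fixes M :: "'m topology" and A :: "('m, 'n::finite) chart set"
  assumes manifold: "smooth_manifold M A"
begin

lemma chart: "c \<in> A \<Longrightarrow> is_chart M c"
  using manifold by (simp add: smooth_manifold_def)

lemma chart_open: "c \<in> A \<Longrightarrow> openin M (fst c)"
  using chart by (simp add: is_chart_def)

lemma chart_subset: "c \<in> A \<Longrightarrow> fst c \<subseteq> topspace M"
  using chart_open openin_subset by blast

lemma chart_image_open: "c \<in> A \<Longrightarrow> open (chart_image c)"
  using chart by (simp add: is_chart_def)

lemma chart_homeo: "c \<in> A \<Longrightarrow> homeomorphic_map (subtopology M (fst c)) (top_of_set (chart_image c)) (snd c)"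
  using chart by (simp add: is_chart_def)

lemma chart_topspace: "c \<in> A \<Longrightarrow> topspace (subtopology M (fst c)) = fst c"
  using chart_subset[of c] by (auto simp: topspace_subtopology)

lemma chart_inj: "c \<in> A \<Longrightarrow> inj_on (snd c) (fst c)"
  using homeomorphic_imp_injective_map[OF chart_homeo] chart_topspace by fastforce

lemma chart_inv_left: "c \<in> A \<Longrightarrow> x \<in> fst c \<Longrightarrow> chart_inv c (snd c x) = x"
  unfolding chart_inv_def by (rule inv_into_f_f[OF chart_inj])

lemma chart_inv_mem: "y \<in> chart_image c \<Longrightarrow> chart_inv c y \<in> fst c"
  and chart_inv_right: "y \<in> chart_image c \<Longrightarrow> snd c (chart_inv c y) = y"
  unfolding chart_inv_def chart_image_def by (auto intro: inv_into_into f_inv_into_f)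

lemma chart_open_image:
  assumes c: "c \<in> A" and U: "openin M U" "U \<subseteq> fst c"
  shows "open (snd c ` U)"
proof -
  have "openin (subtopology M (fst c)) U" using U by (auto simp: openin_subtopology)
  then have "openin (top_of_set (chart_image c)) (snd c ` U)"
    using homeomorphic_imp_open_map[OF chart_homeo[OF c]] by (auto simp: open_map_def)
  then show ?thesis using chart_image_open[OF c] openin_open_trans by blast
qed

lemma continuous_map_chart_inv:
  assumes c: "c \<in> A" shows "continuous_map (top_of_set (chart_image c)) M (chart_inv c)"
proof -
  obtain g where g: "homeomorphic_maps (subtopology M (fst c)) (top_of_set (chart_image c)) (snd c) g"
    using chart_homeo[OF c] by (auto simp: homeomorphic_map_maps)
  then have gc: "continuous_map (top_of_set (chart_image c)) (subtopology M (fst c)) g"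
    and gi: "\<And>y. y \<in> chart_image c \<Longrightarrow> snd c (g y) = y" by (auto simp: homeomorphic_maps_def)
  have gm: "g y \<in> fst c" if "y \<in> chart_image c" for y
    using continuous_map_image_subset_topspace[OF gc] that chart_topspace[OF c] by auto
  have "continuous_map (top_of_set (chart_image c)) M g"
    using gc by (simp add: continuous_map_in_subtopology)
  then show ?thesis
  proof (rule continuous_map_eq)
    fix y assume "y \<in> topspace (top_of_set (chart_image c))"
    then have y: "y \<in> chart_image c" by simp
    show "g y = chart_inv c y" using chart_inv_left[OF c gm[OF y]] gi[OF y] by simp
  qed
qed

lemma compactin_chart_inv:
  assumes c: "c \<in> A" and C: "compact C" "C \<subseteq> chart_image c"
  shows "compactin M (chart_inv c ` C)"
proof (rule image_compactin[OF _ continuous_map_chart_inv[OF c]])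
  show "compactin (top_of_set (chart_image c)) C" using C by (simp add: compactin_subtopology)
qed

lemma compact_chart_image:
  assumes c: "c \<in> A" and K: "compactin M K" "K \<subseteq> fst c"
  shows "compact (snd c ` K)"
proof -
  have "compactin (subtopology M (fst c)) K" using K by (simp add: compactin_subtopology)
  then have "compactin (top_of_set (chart_image c)) (snd c ` K)"
    by (rule image_compactin[OF _ homeomorphic_imp_continuous_map[OF chart_homeo[OF c]]])
  then show ?thesis by (simp add: compactin_subtopology)
qed

lemma overlap_diffeo:
  assumes c: "c \<in> A" and d: "d \<in> A"
  shows "smooth_diffeo (snd c ` (fst c \<inter> fst d)) (snd d ` (fst c \<inter> fst d)) (transition c d) (transition d c)"
proof
  show "open (snd c ` (fst c \<inter> fst d))" "open (snd d ` (fst c \<inter> fst d))"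
    using chart_open[OF c] chart_open[OF d] by (auto intro!: chart_open_image c d openin_Int)
  show "transition c d ` snd c ` (fst c \<inter> fst d) = snd d ` (fst c \<inter> fst d)"
    using chart_inv_left[OF c] by (force simp: transition_def image_iff)
  show "transition d c ` snd d ` (fst c \<inter> fst d) = snd c ` (fst c \<inter> fst d)"
    using chart_inv_left[OF d] by (force simp: transition_def image_iff)
  show "transition d c (transition c d y) = y" if "y \<in> snd c ` (fst c \<inter> fst d)" for y
    using that chart_inv_left[OF c] chart_inv_left[OF d] by (auto simp: transition_def)
  show "transition c d (transition d c y) = y" if "y \<in> snd d ` (fst c \<inter> fst d)" for y
    using that chart_inv_left[OF c] chart_inv_left[OF d] by (auto simp: transition_def)
  have "smoothly_compatible c d" using manifold c d by (simp add: smooth_manifold_def)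
  then show "smooth_on (snd c ` (fst c \<inter> fst d)) (transition c d)" "smooth_on (snd d ` (fst c \<inter> fst d)) (transition d c)"
    by (auto simp: smoothly_compatible_def)
qed

lemma jacobian_factor_jac: "jacobian_factor c d x = jac (transition c d) (snd c x)"
  by (simp add: jacobian_factor_def jac_def)

text \<open>
  The transition map from \<open>c\<close> to \<open>e\<close> is, near the point, the composition of those from \<open>c\<close> to \<open>d\<close>
  and from \<open>d\<close> to \<open>e\<close>.
\<close>
lemma jacobian_factor_cocycle:
  assumes c: "c \<in> A" and d: "d \<in> A" and e: "e \<in> A" and x: "x \<in> fst c \<inter> fst d \<inter> fst e"
  shows "jacobian_factor c e x = jacobian_factor c d x * jacobian_factor d e x"
proof -
  let ?U = "snd c ` (fst c \<inter> fst d \<inter> fst e)"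
  have tx: "transition c d (snd c x) = snd d x" using chart_inv_left[OF c] x by (simp add: transition_def)
  have "jac (transition c e) (snd c x) = jac (transition c d) (snd c x) * jac (transition d e) (transition c d (snd c x))"
  proof (rule jac_compose)
    show "transition c d differentiable at (snd c x)"
      using x by (intro smooth_on_differentiable[OF smooth_diffeo.smooth_\<tau>[OF overlap_diffeo[OF c d]]]) auto
    show "transition d e differentiable at (transition c d (snd c x))"
      unfolding tx using x by (intro smooth_on_differentiable[OF smooth_diffeo.smooth_\<tau>[OF overlap_diffeo[OF d e]]]) auto
    show "open ?U" using chart_open[OF c] chart_open[OF d] chart_open[OF e] by (intro chart_open_image c openin_Int) auto
    show "snd c x \<in> ?U" using x by auto
    show "transition c e z = transition d e (transition c d z)" if "z \<in> ?U" for z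
      using that chart_inv_left[OF c] chart_inv_left[OF d] by (auto simp: transition_def)
  qed
  then show ?thesis unfolding jacobian_factor_jac tx .
qed

text \<open>
  In a chart \<open>c'\<close> the coefficient is \<open>(\<xi> \<circ> transition) \<cdot> jac\<close> on the overlap with \<open>c\<close>. A point off
  the overlap may lie in its closure; but the support of \<open>\<xi>\<close> corresponds to a compact subset of
  the manifold, which is closed because the manifold is Hausdorff, so the coefficient vanishes
  near such a point.
\<close>
lemma coord_density_smooth:
  assumes c: "c \<in> A" and \<xi>: "\<xi> \<in> test_functions (chart_image c)"
  shows "coord_density A c \<xi> \<in> smooth_densities A"
  unfolding smooth_densities_def
proof (intro CollectI conjI allI ballI)
  fix x
  show "(\<lambda>c'. coord_density A c \<xi> (x, c')) \<in> density_fibre A x"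
    unfolding density_fibre_def
  proof (intro CollectI conjI allI ballI impI)
    fix c' d assume c': "c' \<in> A" and d: "d \<in> A" and x: "x \<in> fst c' \<inter> fst d"
    show "coord_density A c \<xi> (x, c') = jacobian_factor c' d x * coord_density A c \<xi> (x, d)"
      using jacobian_factor_cocycle[OF c' d c, of x] x c' d by (auto simp: coord_density_def)
  qed (auto simp: coord_density_def)
next
  fix c' assume c': "c' \<in> A"
  interpret smooth_diffeo "snd c' ` (fst c' \<inter> fst c)" "snd c ` (fst c' \<inter> fst c)" "transition c' c" "transition c c'"
    by (rule overlap_diffeo[OF c' c])
  let ?g = "\<lambda>y. coord_density A c \<xi> (chart_inv c' y, c')"
  obtain C where C: "compact C" "C \<subseteq> chart_image c" "\<And>x. x \<notin> C \<Longrightarrow> \<xi> x = 0" using test_functions_support[OF \<xi>] by blast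
  have "closedin M (chart_inv c ` C)"
    using compactin_imp_closedin[OF _ compactin_chart_inv[OF c C(1,2)]] manifold by (simp add: smooth_manifold_def)
  then have op: "open (snd c' ` (fst c' - chart_inv c ` C))"
    by (intro chart_open_image c' openin_diff chart_open) auto
  show "smooth_on (chart_image c') ?g"
  proof (rule smooth_on_local)
    fix y assume y: "y \<in> chart_image c'"
    let ?x = "chart_inv c' y"
    have xc': "?x \<in> fst c'" and yx: "snd c' ?x = y" using chart_inv_mem[OF y] chart_inv_right[OF y] by auto
    show "\<exists>T. y \<in> T \<and> smooth_on T ?g"
    proof (cases "?x \<in> fst c")
      case True
      have "smooth_on (snd c' ` (fst c' \<inter> fst c)) (\<lambda>y. \<xi> (transition c' c y) * jac (transition c' c) y)"
        using test_functions_smooth[OF \<xi>]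
        by (intro smooth_on_mult open_V smooth_on_compose[OF open_V open_UNIV _ _ smooth_\<tau>] smooth_on_jac) auto
      then have "smooth_on (snd c' ` (fst c' \<inter> fst c)) ?g"
        by (rule smooth_on_cong_open[OF open_V])
          (use c' chart_inv_left[OF c'] in \<open>auto simp: coord_density_def jacobian_factor_jac transition_def\<close>)
      moreover have "y \<in> snd c' ` (fst c' \<inter> fst c)" by (rule image_eqI[where x = "?x"]) (simp_all add: True xc' yx)
      ultimately show ?thesis by (intro exI conjI)
    next
      case False
      have "?g z = 0" if z: "z \<in> snd c' ` (fst c' - chart_inv c ` C)" for z
      proof -
        obtain w where w: "w \<in> fst c'" "w \<notin> chart_inv c ` C" "z = snd c' w" using z by blast
        have "\<xi> (snd c w) = 0" if "w \<in> fst c"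
        proof (rule C(3))
          show "snd c w \<notin> C" using w(2) chart_inv_left[OF c that] by force
        qed
        then show ?thesis using w chart_inv_left[OF c' w(1)] by (auto simp: coord_density_def)
      qed
      then have "smooth_on (snd c' ` (fst c' - chart_inv c ` C)) ?g"
        by (intro smooth_on_cong_open[OF op smooth_on_const[of _ 0]]) simp
      moreover have "y \<in> snd c' ` (fst c' - chart_inv c ` C)"
      proof -
        have "?x \<notin> chart_inv c ` C"
        proof
          assume "?x \<in> chart_inv c ` C"
          then obtain w where w: "w \<in> C" "?x = chart_inv c w" by (rule imageE) 
          then show False using chart_inv_mem[OF subsetD[OF C(2) w(1)]] False by simp
        qed
        then show ?thesis by (intro image_eqI[where x = "?x"]) (simp_all add: xc' yx)
      qed
      ultimately show ?thesis by (intro exI conjI)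
    qed
  qed
qed

lemma density_vanishes: "\<eta> \<in> smooth_densities A \<Longrightarrow> c \<notin> A \<or> x \<notin> fst c \<Longrightarrow> \<eta> (x, c) = 0"
  unfolding smooth_densities_def density_fibre_def by blast

lemma density_change:
  "\<eta> \<in> smooth_densities A \<Longrightarrow> c \<in> A \<Longrightarrow> d \<in> A \<Longrightarrow> x \<in> fst c \<inter> fst d \<Longrightarrow> \<eta> (x, c) = jacobian_factor c d x * \<eta> (x, d)"
  unfolding smooth_densities_def density_fibre_def by blast

lemma scale_density_smooth:
  assumes \<psi>: "smooth_function A \<psi>" and \<eta>: "\<eta> \<in> smooth_densities A"
  shows "scale_density \<psi> \<eta> \<in> smooth_densities A"
proof -
  have "smooth_on (chart_image c) (\<lambda>y. \<psi> (chart_inv c y) * \<eta> (chart_inv c y, c))" if c: "c \<in> A" for c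
    using \<psi> \<eta> c by (intro smooth_on_mult chart_image_open) (auto simp: smooth_function_def smooth_densities_def)
  moreover have "(\<lambda>c. \<psi> x * \<eta> (x, c)) \<in> density_fibre A x" for x
    unfolding density_fibre_def
  proof (intro CollectI conjI allI ballI impI)
    show "\<psi> x * \<eta> (x, c) = 0" if "c \<notin> A \<or> x \<notin> fst c" for c using density_vanishes[OF \<eta> that] by simp
    fix c d assume c: "c \<in> A" and d: "d \<in> A" and x: "x \<in> fst c \<inter> fst d"
    show "\<psi> x * \<eta> (x, c) = jacobian_factor c d x * (\<psi> x * \<eta> (x, d))"
      unfolding density_change[OF \<eta> c d x] by (rule mult.left_commute)
  qed
  ultimately show ?thesis by (simp add: smooth_densities_def scale_density_def)
qed

lemma density_zero_off: "\<eta> \<in> smooth_densities A \<Longrightarrow> x \<notin> topspace M \<Longrightarrow> \<eta> (x, c) = 0"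
  by (rule density_vanishes) (use chart_subset[of c] in auto)

lemma augmented_atlas_chart: "augmented_atlas M A \<Lambda> \<Longrightarrow> (c, \<psi>) \<in> set \<Lambda> \<Longrightarrow> c \<in> A"
  unfolding augmented_atlas_def by (drule conjunct1, drule imageI[where f = fst], simp only: fst_conv, erule (1) subsetD)

lemma augmented_atlas_smooth: "augmented_atlas M A \<Lambda> \<Longrightarrow> (c, \<psi>) \<in> set \<Lambda> \<Longrightarrow> smooth_function A \<psi>"
  by (auto simp: augmented_atlas_def)

lemma augmented_atlas_support:
  "augmented_atlas M A \<Lambda> \<Longrightarrow> (c, \<psi>) \<in> set \<Lambda> \<Longrightarrow> M closure_of {x \<in> topspace M. \<psi> x \<noteq> 0} \<subseteq> fst c"
  by (auto simp: augmented_atlas_def)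

lemma add_density_smooth:
  assumes f: "f \<in> smooth_densities A" and g: "g \<in> smooth_densities A"
  shows "(\<lambda>z. f z + g z) \<in> smooth_densities A"
proof -
  have "smooth_on (chart_image c) (\<lambda>y. f (chart_inv c y, c) + g (chart_inv c y, c))" if c: "c \<in> A" for c
    using f g c by (intro smooth_on_add chart_image_open) (auto simp: smooth_densities_def)
  moreover have "(\<lambda>c. f (x, c) + g (x, c)) \<in> density_fibre A x" for x
    unfolding density_fibre_def
  proof (intro CollectI conjI allI ballI impI)
    show "f (x, c) + g (x, c) = 0" if "c \<notin> A \<or> x \<notin> fst c" for c
      using density_vanishes[OF f that] density_vanishes[OF g that] by simp
    fix c d assume c: "c \<in> A" and d: "d \<in> A" and x: "x \<in> fst c \<inter> fst d"
    show "f (x, c) + g (x, c) = jacobian_factor c d x * (f (x, d) + g (x, d))"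
      unfolding density_change[OF f c d x] density_change[OF g c d x] by (rule distrib_left[symmetric])
  qed
  ultimately show ?thesis by (simp add: smooth_densities_def)
qed

text \<open>
  The partition of unity is applied to the density that is tested with; \<open>u\<close> is additive.
\<close>
lemma distribution_partition:
  assumes \<Upsilon>: "augmented_atlas M A \<Upsilon>" and u: "u \<in> distributions A" and \<eta>: "\<eta> \<in> smooth_densities A"
  shows "u \<eta> = (\<Sum>(d, \<rho>)\<leftarrow>\<Upsilon>. u (scale_density \<rho> \<eta>))"
proof -
  have lin: "linear_functional_on (smooth_densities A) u" using u by (simp add: distributions_def)
  have smooth: "scale_density \<rho> \<eta> \<in> smooth_densities A" if "(d, \<rho>) \<in> set \<Upsilon>" for d \<rho>
    using scale_density_smooth[OF augmented_atlas_smooth[OF \<Upsilon> that] \<eta>] .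
  have "u (\<lambda>z. 0 * \<eta> z) = 0 * u \<eta>"
    using bspec[OF spec[OF conjunct2[OF lin[unfolded linear_functional_on_def]], of 0] \<eta>] .
  then have u0: "u (\<lambda>z. 0) = 0" by simp
  have zero: "(\<lambda>z. 0) \<in> smooth_densities A"
    by (auto simp: smooth_densities_def density_fibre_def smooth_on_const)
  have "(\<lambda>z. \<Sum>(d, \<rho>)\<leftarrow>xs. scale_density \<rho> \<eta> z) \<in> smooth_densities A \<and>
     u (\<lambda>z. \<Sum>(d, \<rho>)\<leftarrow>xs. scale_density \<rho> \<eta> z) = (\<Sum>(d, \<rho>)\<leftarrow>xs. u (scale_density \<rho> \<eta>))" if "set xs \<subseteq> set \<Upsilon>" for xs
    using that
  proof (induction xs)
    case Nil
    then show ?case using zero u0 by simp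
  next
    case (Cons p xs)
    obtain d \<rho> where p: "p = (d, \<rho>)" by (cases p)
    let ?f = "scale_density \<rho> \<eta>" and ?g = "\<lambda>z. \<Sum>(d, \<rho>)\<leftarrow>xs. scale_density \<rho> \<eta> z"
    have f: "?f \<in> smooth_densities A" using smooth[of d \<rho>] Cons.prems p by auto
    have g: "?g \<in> smooth_densities A" "u ?g = (\<Sum>(d, \<rho>)\<leftarrow>xs. u (scale_density \<rho> \<eta>))" using Cons by auto
    have "(\<lambda>z. ?f z + ?g z) \<in> smooth_densities A"
      by (rule add_density_smooth[OF f g(1)])
    moreover have "u (\<lambda>z. ?f z + ?g z) = u ?f + u ?g"
      using bspec[OF bspec[OF conjunct1[OF lin[unfolded linear_functional_on_def]] f] g(1)] .
    ultimately show ?case using g(2) by (simp add: p)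
  qed
  from this[of \<Upsilon>] have "u (\<lambda>z. \<Sum>(d, \<rho>)\<leftarrow>\<Upsilon>. scale_density \<rho> \<eta> z) = (\<Sum>(d, \<rho>)\<leftarrow>\<Upsilon>. u (scale_density \<rho> \<eta>))" by simp
  moreover have "(\<lambda>z. \<Sum>(d, \<rho>)\<leftarrow>\<Upsilon>. scale_density \<rho> \<eta> z) = \<eta>"
  proof
    fix z :: "'m \<times> ('m, 'n) chart"
    obtain x c where z: "z = (x, c)" by (cases z)
    have "(\<Sum>(d, \<rho>)\<leftarrow>\<Upsilon>. scale_density \<rho> \<eta> z) = (\<Sum>(d, \<rho>)\<leftarrow>\<Upsilon>. \<rho> x) * \<eta> (x, c)"
      by (simp add: z scale_density_def sum_list_mult_const[symmetric] split_def)
    also have "\<dots> = \<eta> (x, c)"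
    proof (cases "x \<in> topspace M")
      case True
      then show ?thesis using \<Upsilon> by (simp add: augmented_atlas_def)
    qed (simp add: density_zero_off[OF \<eta>])
    finally show "(\<Sum>(d, \<rho>)\<leftarrow>\<Upsilon>. scale_density \<rho> \<eta> z) = \<eta> z" by (simp add: z)
  qed
  ultimately show ?thesis by simp
qed

text \<open>
  On the support of \<open>\<rho>\<close> and \<open>\<psi>\<close> the density that is \<open>\<xi>\<close> in the chart \<open>c\<close> has the coefficient
  \<open>(\<xi> \<circ> transition d c) \<cdot> jac\<close> in the chart \<open>d\<close>. So \<open>a\<close> should be \<open>\<psi> \<cdot> jac\<close>, which need not have
  compact support in the image of the overlap: the support of \<open>\<psi>\<close> may leave \<open>d\<close>. A bump function
  \<open>b\<close> that equals \<open>1\<close> on the support of \<open>\<rho>\<close>, which is compact since the manifold is, cuts it off;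
  this changes nothing after multiplication with \<open>\<rho>\<close>.
\<close>
lemma localized_coord_density:
  assumes compact: "compact_space M"
    and \<Lambda>: "augmented_atlas M A \<Lambda>" "(c, \<psi>) \<in> set \<Lambda>" and \<Upsilon>: "augmented_atlas M A \<Upsilon>" "(d, \<rho>) \<in> set \<Upsilon>"
  shows "\<exists>a\<in>test_functions (snd d ` (fst d \<inter> fst c)). \<forall>\<xi>.
    scale_density \<rho> (scale_density \<psi> (coord_density A c \<xi>)) = scale_density \<rho> (coord_density A d (\<lambda>y. a y * \<xi> (transition d c y)))"
proof -
  have c: "c \<in> A" by (rule augmented_atlas_chart[OF \<Lambda>])
  have d: "d \<in> A" by (rule augmented_atlas_chart[OF \<Upsilon>])
  let ?V = "snd d ` (fst d \<inter> fst c)"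
  interpret smooth_diffeo ?V "snd c ` (fst d \<inter> fst c)" "transition d c" "transition c d"
    by (rule overlap_diffeo[OF d c])
  let ?S\<rho> = "M closure_of {x \<in> topspace M. \<rho> x \<noteq> 0}" and ?S\<psi> = "M closure_of {x \<in> topspace M. \<psi> x \<noteq> 0}"
  have S: "?S\<rho> \<subseteq> fst d" "?S\<psi> \<subseteq> fst c"
    using augmented_atlas_support[OF \<Upsilon>] augmented_atlas_support[OF \<Lambda>] by auto
  have mem: "x \<in> M closure_of {x \<in> topspace M. f x \<noteq> 0}" if "x \<in> topspace M" "f x \<noteq> (0 :: real)" for x f
    using that closure_of_subset[of "{x \<in> topspace M. f x \<noteq> 0}" M] by auto
  have cpt: "compactin M ?S\<rho>" using compact by (intro closedin_compact_space) auto
  have K: "compact (snd d ` ?S\<rho>)" "snd d ` ?S\<rho> \<subseteq> chart_image d"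
    using compact_chart_image[OF d cpt S(1)] S(1) by (auto simp: chart_image_def)
  obtain b where b: "b \<in> test_functions (chart_image d)" "\<And>y. y \<in> snd d ` ?S\<rho> \<Longrightarrow> b y = 1"
    using bump_function_exists[OF K(1) chart_image_open[OF d] K(2)] by metis
  define \<alpha> where "\<alpha> y = b y * \<psi> (chart_inv d y)" for y
  have \<alpha>: "\<alpha> \<in> test_functions (chart_image d)" unfolding \<alpha>_def[abs_def]
    using augmented_atlas_smooth[OF \<Lambda>] d by (intro test_functions_mult_smooth b chart_image_open) (auto simp: smooth_function_def)
  obtain C where C: "compact C" "C \<subseteq> chart_image d" "\<And>y. y \<notin> C \<Longrightarrow> b y = 0" using test_functions_support[OF b(1)] by blast
  \<comment> \<open>The support of \<open>\<alpha>\<close> lies in the intersection of the compact support of \<open>b\<close> with the closed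
    support of \<open>\<psi>\<close>.\<close>
  have \<alpha>V: "\<alpha> \<in> test_functions ?V"
  proof (rule test_functionsI[OF open_UNIV test_functions_smooth[OF \<alpha>]])
    let ?K = "chart_inv d ` C \<inter> ?S\<psi>"
    have "compactin M ?K" by (intro compact_Int_closedin compactin_chart_inv d C) auto
    moreover have "chart_inv d ` C \<subseteq> fst d" using C(2) chart_inv_mem by blast
    ultimately show "compact (snd d ` ?K)" by (intro compact_chart_image d) auto
    show "snd d ` ?K \<subseteq> ?V" using \<open>chart_inv d ` C \<subseteq> fst d\<close> S(2) by auto
    show "\<alpha> y = 0" if y: "y \<notin> snd d ` ?K" for y
    proof (rule ccontr)
      assume "\<alpha> y \<noteq> 0"
      then have "y \<in> C" "\<psi> (chart_inv d y) \<noteq> 0" using C(3) by (auto simp: \<alpha>_def)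
      then have "chart_inv d y \<in> ?K" using C(2) chart_inv_mem[of y d] chart_subset[OF d] by (auto intro!: mem)
      then show False using y \<open>y \<in> C\<close> C(2) chart_inv_right[of y d] by force
    qed
  qed simp
  define a where "a y = \<alpha> y * jac (transition d c) y" for y
  have a: "a \<in> test_functions ?V" unfolding a_def[abs_def] by (rule test_functions_mult_smooth[OF \<alpha>V open_V smooth_on_jac])
  show ?thesis
  proof (rule bexI[OF _ a], intro allI ext)
    fix \<xi> and z :: "'m \<times> ('m, 'n) chart"
    obtain x c' where z: "z = (x, c')" by (cases z)
    show "scale_density \<rho> (scale_density \<psi> (coord_density A c \<xi>)) z = scale_density \<rho> (coord_density A d (\<lambda>y. a y * \<xi> (transition d c y))) z"
    proof (cases "x \<in> topspace M \<and> \<rho> x \<noteq> 0 \<and> c' \<in> A \<and> x \<in> fst c'")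
      case False
      then show ?thesis using chart_subset[OF c] chart_subset[OF d] by (auto simp: z scale_density_def coord_density_def)
    next
      case True
      then have x\<rho>: "x \<in> ?S\<rho>" by (intro mem) auto
      then have xd: "x \<in> fst d" using S(1) by blast
      show ?thesis
      proof (cases "x \<in> fst c")
        case xc: True
        have "a (snd d x) = \<psi> x * jacobian_factor d c x"
          using b(2)[of "snd d x"] x\<rho> chart_inv_left[OF d xd] by (simp add: a_def \<alpha>_def jacobian_factor_jac)
        moreover have "transition d c (snd d x) = snd c x" using chart_inv_left[OF d xd] by (simp add: transition_def)
        moreover have "jacobian_factor c' c x = jacobian_factor c' d x * jacobian_factor d c x"
          using True xd xc by (intro jacobian_factor_cocycle d c) auto
        ultimately show ?thesis using True xd xc by (simp add: z scale_density_def coord_density_def mult_ac)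
      next
        case False
        have "snd d x \<notin> ?V" using chart_inj[OF d] xd False by (auto simp: inj_on_def)
        then have "a (snd d x) = 0" by (rule test_functions_zero[OF a])
        then show ?thesis using False by (simp add: z scale_density_def coord_density_def)
      qed
    qed
  qed
qed

text \<open>
  The distributions \<open>\<rho>u\<close> are indexed by the positions in \<open>\<Upsilon>\<close>, since charts and functions may be
  repeated in the list.
\<close>
lemma local_rep_bound:
  assumes compact: "compact_space M" and q: "1 < q"
    and \<Lambda>: "augmented_atlas M A \<Lambda>" "(c, \<psi>) \<in> set \<Lambda>" and \<Upsilon>: "augmented_atlas M A \<Upsilon>"
  shows "\<exists>C>0. \<forall>u\<in>distributions A.
    sobolev_norm (chart_image c) e q (local_rep A c (mult_distr A \<psi> u)) \<le> ennreal C * msobolev_norm A \<Upsilon> e q u"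
proof -
  have c: "c \<in> A" by (rule augmented_atlas_chart[OF \<Lambda>])
  let ?I = "{..<length \<Upsilon>}"
  define D where "D i = fst (\<Upsilon> ! i)" for i
  define R where "R i = snd (\<Upsilon> ! i)" for i
  have DR: "(D i, R i) \<in> set \<Upsilon>" if "i \<in> ?I" for i using that by (simp add: D_def R_def)
  have D: "D i \<in> A" if "i \<in> ?I" for i by (rule augmented_atlas_chart[OF \<Upsilon> DR[OF that]])
  let ?V = "\<lambda>i. snd (D i) ` (fst (D i) \<inter> fst c)" and ?V' = "\<lambda>i. snd c ` (fst (D i) \<inter> fst c)"
  have "\<forall>i\<in>?I. \<exists>a. a \<in> test_functions (?V i) \<and> (\<forall>\<xi>. scale_density (R i) (scale_density \<psi> (coord_density A c \<xi>)) =
      scale_density (R i) (coord_density A (D i) (\<lambda>y. a y * \<xi> (transition (D i) c y))))"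
    using localized_coord_density[OF compact \<Lambda> \<Upsilon> DR] by blast
  from bchoice[OF this] obtain a where a: "\<And>i. i \<in> ?I \<Longrightarrow> a i \<in> test_functions (?V i)"
    "\<And>i \<xi>. i \<in> ?I \<Longrightarrow> scale_density (R i) (scale_density \<psi> (coord_density A c \<xi>)) =
      scale_density (R i) (coord_density A (D i) (\<lambda>y. a i y * \<xi> (transition (D i) c y)))" by blast
  have V: "?V i \<subseteq> chart_image (D i)" "?V' i \<subseteq> chart_image c" for i by (auto simp: chart_image_def)
  obtain C where C: "C > 0" "\<And>T S. (\<forall>\<xi>\<in>test_functions (chart_image c). T \<xi> = (\<Sum>i\<in>?I. S i (\<lambda>y. a i y * \<xi> (transition (D i) c y)))) \<Longrightarrow>
      sobolev_norm (chart_image c) e q T \<le> ennreal C * (\<Sum>i\<in>?I. sobolev_norm (chart_image (D i)) e q (S i))"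
    using sobolev_norm_sum_pullback[of ?I q "chart_image c" "\<lambda>i. chart_image (D i)" ?V ?V' "\<lambda>i. transition (D i) c" "\<lambda>i. transition c (D i)" a e]
      q chart_image_open[OF c] chart_image_open[OF D] overlap_diffeo[OF D c] V a(1) by auto
  show ?thesis
  proof (intro exI[of _ C] conjI ballI C(1))
    fix u assume u: "u \<in> distributions A"
    let ?S = "\<lambda>i. local_rep A (D i) (mult_distr A (R i) u)"
    have "local_rep A c (mult_distr A \<psi> u) \<xi> = (\<Sum>i\<in>?I. ?S i (\<lambda>y. a i y * \<xi> (transition (D i) c y)))"
      if \<xi>: "\<xi> \<in> test_functions (chart_image c)" for \<xi>
    proof -
      let ?\<eta> = "scale_density \<psi> (coord_density A c \<xi>)"
      have \<eta>: "?\<eta> \<in> smooth_densities A"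
        by (rule scale_density_smooth[OF augmented_atlas_smooth[OF \<Lambda>] coord_density_smooth[OF c \<xi>]])
      have "local_rep A c (mult_distr A \<psi> u) \<xi> = u ?\<eta>"
        using coord_density_smooth[OF c \<xi>] by (simp add: local_rep_def mult_distr_def)
      also have "\<dots> = (\<Sum>(d, \<rho>)\<leftarrow>\<Upsilon>. u (scale_density \<rho> ?\<eta>))" by (rule distribution_partition[OF \<Upsilon> u \<eta>])
      also have "\<dots> = (\<Sum>i\<in>?I. u (scale_density (R i) ?\<eta>))"
        by (simp add: sum_list_sum_nth R_def case_prod_beta atLeast0LessThan)
      also have "\<dots> = (\<Sum>i\<in>?I. ?S i (\<lambda>y. a i y * \<xi> (transition (D i) c y)))"
      proof (rule sum.cong[OF refl])
        fix i assume i: "i \<in> ?I"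
        have "(\<lambda>y. a i y * \<xi> (transition (D i) c y)) \<in> test_functions (chart_image (D i))"
          by (rule test_functions_mono[OF smooth_diffeo.test_functions_pullback[OF overlap_diffeo[OF D[OF i] c] a(1)[OF i] \<xi>] V(1)])
        then have "coord_density A (D i) (\<lambda>y. a i y * \<xi> (transition (D i) c y)) \<in> smooth_densities A"
          by (rule coord_density_smooth[OF D[OF i]])
        then show "u (scale_density (R i) ?\<eta>) = ?S i (\<lambda>y. a i y * \<xi> (transition (D i) c y))"
          using a(2)[OF i, of \<xi>] by (simp add: local_rep_def mult_distr_def)
      qed
      finally show ?thesis .
    qed
    then have "sobolev_norm (chart_image c) e q (local_rep A c (mult_distr A \<psi> u)) \<le> ennreal C * (\<Sum>i\<in>?I. sobolev_norm (chart_image (D i)) e q (?S i))"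
      by (intro C(2)) blast
    also have "(\<Sum>i\<in>?I. sobolev_norm (chart_image (D i)) e q (?S i)) = msobolev_norm A \<Upsilon> e q u"
      by (simp add: msobolev_norm_def sum_list_sum_nth D_def R_def case_prod_beta atLeast0LessThan)
    finally show "sobolev_norm (chart_image c) e q (local_rep A c (mult_distr A \<psi> u)) \<le> ennreal C * msobolev_norm A \<Upsilon> e q u" .
  qed
qed

text \<open>
  With the value \<open>\<infinity>\<close> allowed on the right, this contains the inclusion of the spaces as well as,
  with the atlases exchanged, the equivalence of the norms.
\<close>
theorem msobolev_norm_bound:
  assumes compact: "compact_space M" and q: "1 < q"
    and \<Lambda>: "augmented_atlas M A \<Lambda>" and \<Upsilon>: "augmented_atlas M A \<Upsilon>"
  shows "\<exists>C>0. \<forall>u\<in>distributions A. msobolev_norm A \<Lambda> e q u \<le> ennreal C * msobolev_norm A \<Upsilon> e q u"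
proof -
  let ?N = "\<lambda>i u. sobolev_norm (chart_image (fst (\<Lambda> ! i))) e q (local_rep A (fst (\<Lambda> ! i)) (mult_distr A (snd (\<Lambda> ! i)) u))"
  have "\<exists>C>0. \<forall>u. u \<in> distributions A \<longrightarrow> (\<Sum>i\<in>{..<length \<Lambda>}. ?N i u) \<le> ennreal C * msobolev_norm A \<Upsilon> e q u"
  proof (rule uniform_constant)
    fix i assume "i \<in> {..<length \<Lambda>}"
    then have "(fst (\<Lambda> ! i), snd (\<Lambda> ! i)) \<in> set \<Lambda>" by simp
    from local_rep_bound[OF compact q \<Lambda> this \<Upsilon>, of e]
    show "\<exists>C>0. \<forall>u. u \<in> distributions A \<longrightarrow> ?N i u \<le> ennreal C * msobolev_norm A \<Upsilon> e q u" by blast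
  qed simp
  moreover have "msobolev_norm A \<Lambda> e q u = (\<Sum>i\<in>{..<length \<Lambda>}. ?N i u)" for u
    by (simp add: msobolev_norm_def sum_list_sum_nth case_prod_beta atLeast0LessThan)
  ultimately show ?thesis by (simp only: Ball_def)
qed

end

theorem theorem9p5:
  fixes M :: "'m topology"
    and A :: "('m, 'n::finite) chart set"
    and \<Lambda> \<Upsilon> :: "('m, 'n) aug_atlas"
    and e q :: real
  assumes "smooth_manifold M A" and "compact_space M"
    and "1 < q"
    and "augmented_atlas M A \<Lambda>" and "augmented_atlas M A \<Upsilon>"
  shows
    "(\<not> (e \<notin> \<int> \<and> e < -1) \<longrightarrow>
       (\<exists>C1>0. \<exists>C2>0. \<forall>W.
          vector_subspace W (msobolev_space A \<Upsilon> e q) \<and> W \<subseteq> regular_distributions M A \<longrightarrow>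
          vector_subspace W (msobolev_space A \<Lambda> e q) \<and>
          (\<forall>u\<in>W. msobolev_norm A \<Lambda> e q u \<le> ennreal C1 * msobolev_norm A \<Upsilon> e q u \<and>
                 msobolev_norm A \<Upsilon> e q u \<le> ennreal C2 * msobolev_norm A \<Lambda> e q u))) \<and>
     (e \<notin> \<int> \<and> e < -1 \<and> GL_compatible \<Lambda> \<Upsilon> \<longrightarrow>
       (\<exists>C1>0. \<exists>C2>0. \<forall>W.
          vector_subspace W (msobolev_space A \<Upsilon> e q) \<and> W \<subseteq> regular_distributions M A \<longrightarrow>
          vector_subspace W (msobolev_space A \<Lambda> e q) \<and>
          (\<forall>u\<in>W. msobolev_norm A \<Lambda> e q u \<le> ennreal C1 * msobolev_norm A \<Upsilon> e q u \<and>
                 msobolev_norm A \<Upsilon> e q u \<le> ennreal C2 * msobolev_norm A \<Lambda> e q u)))"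
proof -
  obtain C1 where C1: "C1 > 0" "\<And>u. u \<in> distributions A \<Longrightarrow> msobolev_norm A \<Lambda> e q u \<le> ennreal C1 * msobolev_norm A \<Upsilon> e q u"
    using msobolev_norm_bound[OF assms(1-5), of e] by blast
  obtain C2 where C2: "C2 > 0" "\<And>u. u \<in> distributions A \<Longrightarrow> msobolev_norm A \<Upsilon> e q u \<le> ennreal C2 * msobolev_norm A \<Lambda> e q u"
    using msobolev_norm_bound[OF assms(1-3,5,4), of e] by blast
  have sub: "msobolev_space A \<Upsilon> e q \<subseteq> msobolev_space A \<Lambda> e q"
  proof
    fix u assume "u \<in> msobolev_space A \<Upsilon> e q"
    then have u: "u \<in> distributions A" "msobolev_norm A \<Upsilon> e q u < \<infinity>" by (auto simp: msobolev_space_def)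
    have "ennreal C1 * msobolev_norm A \<Upsilon> e q u < \<infinity>" using u(2) by (simp add: ennreal_mult_less_top)
    with C1(2)[OF u(1)] u(1) show "u \<in> msobolev_space A \<Lambda> e q" by (auto simp: msobolev_space_def intro: le_less_trans)
  qed
  have "vector_subspace W (msobolev_space A \<Lambda> e q) \<and>
      (\<forall>u\<in>W. msobolev_norm A \<Lambda> e q u \<le> ennreal C1 * msobolev_norm A \<Upsilon> e q u \<and>
             msobolev_norm A \<Upsilon> e q u \<le> ennreal C2 * msobolev_norm A \<Lambda> e q u)"
    if W: "vector_subspace W (msobolev_space A \<Upsilon> e q)" for W
  proof (intro conjI ballI)
    show "vector_subspace W (msobolev_space A \<Lambda> e q)" using W sub by (auto simp: vector_subspace_def)
    fix u assume "u \<in> W"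
    then have "u \<in> distributions A" using W by (auto simp: vector_subspace_def msobolev_space_def)
    then show "msobolev_norm A \<Lambda> e q u \<le> ennreal C1 * msobolev_norm A \<Upsilon> e q u"
      "msobolev_norm A \<Upsilon> e q u \<le> ennreal C2 * msobolev_norm A \<Lambda> e q u" by (rule C1(2), rule C2(2))
  qed
  then show ?thesis using C1(1) C2(1) by blast
qed

end
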